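(* Let $\mathbb{K}\in\{\mathbb{R},\mathbb{C}\}$, let $\mathcal{H}$ be an arbitrary Hopf algebra over $\mathbb{K}$ and let $B$ be a commutative weakly complete algebra over $\mathbb{K}$. Then the following holds: (a) The topological group $G(\mathcal{H},B)$ of $B$-valued characters of $\mathcal{H}$ is a projective limit of finite-dimensional Lie groups (a pro-Lie group). (b) The pro-Lie algebra $\mathcal{L}(G(\mathcal{H},B))$ of the pro-Lie group $G(\mathcal{H},B)$ is the Lie algebra of infinitesimal characters $\mathfrak{g}(\mathcal{H},B)$.
   Context: Algebras are unital associative $\mathbb{K}$-algebras. A weakly complete algebra is a topological $\mathbb{K}$-algebra (with jointly continuous multiplication) whose underlying topological vector space is isomorphic to $\mathbb{K}^I$ (product topology) for some set $I$. Write $\Delta_{\mathcal{H}}$ and $\epsilon_{\mathcal{H}}$ for the coproduct and counit of $\mathcal{H}$, and $m_B$ for the multiplication of $B$. The space $\mathrm{Hom}_{\mathbb{K}}(\mathcal{H},B)$ of all $\mathbb{K}$-linear maps carries the topology of pointwise convergence and the convolution product $\phi\star\psi=m_B\circ(\phi\otimes\psi)\circ\Delta_{\mathcal{H}}$, with unit $x\mapsto\epsilon_{\mathcal{H}}(x)1_B$. The character group $G(\mathcal{H},B)$ is the set of unital algebra homomorphisms $\mathcal{H}\to B$; it is a topological group under $\star$ with the topology of pointwise convergence. The Lie algebra of infinitesimal characters is $\mathfrak{g}(\mathcal{H},B)=\{\phi\in\mathrm{Hom}_{\mathbb{K}}(\mathcal{H},B):\phi(ab)=\epsilon_{\mathcal{H}}(a)\phi(b)+\epsilon_{\mathcal{H}}(b)\phi(a)\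 \forall a,b\in\mathcal{H}\}$ with bracket $[\phi,\psi]=\phi\star\psi-\psi\star\phi$ and the topology of pointwise convergence. A topological group is a pro-Lie group if it is the projective limit (in the category of topological groups) of a directed system of finite-dimensional real Lie groups; equivalently, if it is topologically isomorphic to a closed subgroup of a product of finite-dimensional real Lie groups. For a pro-Lie group $G$, the pro-Lie algebra $\mathcal{L}(G)$ is the space of all continuous one-parameter subgroups $\mathbb{R}\to G$ with the compact-open topology. It is a projective limit of finite-dimensional Lie algebras and thereby carries a natural structure of a locally convex topological Lie algebra over $\mathbb{R}$. *)

theory Defs
  imports "HOL-Analysis.Analysis" "HOL-Algebra.Product_Groups" "HOL-Library.Poly_Mapping"
begin

section \<open>The ground field\<close>

class real_or_complex = real_normed_field +
  assumes real_or_complex: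
    "(\<exists>f :: 'a \<Rightarrow> real. bij f \<and> (\<forall>x y. f (x + y) = f x + f y \<and> f (x * y) = f x * f y)
        \<and> (\<forall>x. norm (f x) = norm x)) \<or>
     (\<exists>f :: 'a \<Rightarrow> complex. bij f \<and> (\<forall>x y. f (x + y) = f x + f y \<and> f (x * y) = f x * f y)
        \<and> (\<forall>x. norm (f x) = norm x))"

instance real :: real_or_complex
  by standard (rule disjI1, rule exI[of _ "\<lambda>x. x"], simp add: bij_def inj_on_def)

instance complex :: real_or_complex
  by standard (rule disjI2, rule exI[of _ "\<lambda>x. x"], simp add: bij_def inj_on_def)


section \<open>Algebras and tensor products\<close>

text \<open>The sort \<open>{ring, monoid_mult}\<close> describes unital rings in which \<open>0 = 1\<close> is allowed
  (unlike in \<open>ring_1\<close>); in particular the zero algebra is an algebra.\<close>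

locale unital_algebra = vector_space smul
  for smul :: "'k::field \<Rightarrow> 'a::{ring,monoid_mult} \<Rightarrow> 'a" +
  assumes smul_mult_left: "smul c (x * y) = smul c x * y"
    and smul_mult_right: "smul c (x * y) = x * smul c y"

text \<open>\<open>'x \<Rightarrow>\<^sub>0 'k\<close> is the free vector space on the set of all elements of \<open>'x\<close>,
  with basis vectors \<open>free_basis x\<close>. A map \<open>f\<close> from the basis
  into a vector space extends linearly to \<open>free_lift smul f\<close>.\<close>

definition free_scale :: "'k::field \<Rightarrow> ('x \<Rightarrow>\<^sub>0 'k) \<Rightarrow> ('x \<Rightarrow>\<^sub>0 'k)" where
  "free_scale c p = Poly_Mapping.map (\<lambda>a. c * a) p"

definition free_basis :: "'x \<Rightarrow> ('x \<Rightarrow>\<^sub>0 'k::field)" where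
  "free_basis x = Poly_Mapping.single x 1"

definition free_lift ::
  "('k::field \<Rightarrow> 'v::ab_group_add \<Rightarrow> 'v) \<Rightarrow> ('x \<Rightarrow> 'v) \<Rightarrow> ('x \<Rightarrow>\<^sub>0 'k) \<Rightarrow> 'v" where
  "free_lift smul f p = (\<Sum>x\<in>Poly_Mapping.keys p. smul (Poly_Mapping.lookup p x) (f x))"

text \<open>The tensor products \<open>V \<otimes> V\<close> and \<open>V \<otimes> V \<otimes> V\<close> are the quotients of the free vector spaces on
  pairs and triples by the subspaces spanned by the multilinearity relations. Their elements are
  represented by elements of these free spaces, and \<open>tensor2_eq\<close>, \<open>tensor3_eq\<close> are equality
  in the quotient.\<close>

definition tensor2_relations ::
  "('k::field \<Rightarrow> 'v::ab_group_add \<Rightarrow> 'v) \<Rightarrow> ('v \<times> 'v \<Rightarrow>\<^sub>0 'k) set" where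
  "tensor2_relations smul =
     {free_basis (a + a', b) - free_basis (a, b) - free_basis (a', b) | a a' b. True} \<union>
     {free_basis (a, b + b') - free_basis (a, b) - free_basis (a, b') | a b b'. True} \<union>
     {free_basis (smul c a, b) - free_scale c (free_basis (a, b)) | c a b. True} \<union>
     {free_basis (a, smul c b) - free_scale c (free_basis (a, b)) | c a b. True}"

definition tensor2_eq ::
  "('k::field \<Rightarrow> 'v::ab_group_add \<Rightarrow> 'v) \<Rightarrow> ('v \<times> 'v \<Rightarrow>\<^sub>0 'k) \<Rightarrow> ('v \<times> 'v \<Rightarrow>\<^sub>0 'k) \<Rightarrow> bool" where
  "tensor2_eq smul p q \<longleftrightarrow> p - q \<in> module.span free_scale (tensor2_relations smul)"

definition tensor3_relations ::
  "('k::field \<Rightarrow> 'v::ab_group_add \<Rightarrow> 'v) \<Rightarrow> ('v \<times> 'v \<times> 'v \<Rightarrow>\<^sub>0 'k) set" where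
  "tensor3_relations smul =
     {free_basis (a + a', b, d) - free_basis (a, b, d) - free_basis (a', b, d) | a a' b d. True} \<union>
     {free_basis (a, b + b', d) - free_basis (a, b, d) - free_basis (a, b', d) | a b b' d. True} \<union>
     {free_basis (a, b, d + d') - free_basis (a, b, d) - free_basis (a, b, d') | a b d d'. True} \<union>
     {free_basis (smul c a, b, d) - free_scale c (free_basis (a, b, d)) | c a b d. True} \<union>
     {free_basis (a, smul c b, d) - free_scale c (free_basis (a, b, d)) | c a b d. True} \<union>
     {free_basis (a, b, smul c d) - free_scale c (free_basis (a, b, d)) | c a b d. True}"

definition tensor3_eq ::
  "('k::field \<Rightarrow> 'v::ab_group_add \<Rightarrow> 'v) \<Rightarrow> ('v \<times> 'v \<times> 'v \<Rightarrow>\<^sub>0 'k) \<Rightarrow> ('v \<times> 'v \<times> 'v \<Rightarrow>\<^sub>0 'k) \<Rightarrow> bool"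
  where
  "tensor3_eq smul p q \<longleftrightarrow> p - q \<in> module.span free_scale (tensor3_relations smul)"

definition tensor2_mult ::
  "('a::{ring,monoid_mult} \<times> 'a \<Rightarrow>\<^sub>0 'k::field) \<Rightarrow> ('a \<times> 'a \<Rightarrow>\<^sub>0 'k) \<Rightarrow> ('a \<times> 'a \<Rightarrow>\<^sub>0 'k)" where
  "tensor2_mult p q =
     free_lift free_scale
       (\<lambda>(a, b). free_lift free_scale (\<lambda>(c, d). free_basis (a * c, b * d)) q) p"


section \<open>Hopf algebras\<close>

text \<open>\<open>\<Delta> x\<close> is a representative in the free vector space on pairs of the coproduct
  of \<open>x\<close>; so \<open>\<Delta>\<close> amounts to a map from \<open>H\<close> to \<open>H \<otimes> H\<close> and its axioms are stated modulo
  \<open>tensor2_eq\<close> and \<open>tensor3_eq\<close>. In the counit and antipode axioms no quotient is visible since the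
  values lie in \<open>H\<close>, and \<open>free_lift\<close> of a bilinear map does not depend on the representative.\<close>

locale hopf_algebra = unital_algebra smul
  for smul :: "'k::field \<Rightarrow> 'h::{ring,monoid_mult} \<Rightarrow> 'h" +
  fixes \<Delta> :: "'h \<Rightarrow> ('h \<times> 'h \<Rightarrow>\<^sub>0 'k)"
    and \<epsilon> :: "'h \<Rightarrow> 'k"
    and S :: "'h \<Rightarrow> 'h"
  assumes coproduct_add: "tensor2_eq smul (\<Delta> (x + y)) (\<Delta> x + \<Delta> y)"
    and coproduct_scale: "tensor2_eq smul (\<Delta> (smul c x)) (free_scale c (\<Delta> x))"
    and coproduct_mult: "tensor2_eq smul (\<Delta> (x * y)) (tensor2_mult (\<Delta> x) (\<Delta> y))"
    and coproduct_one: "tensor2_eq smul (\<Delta> 1) (free_basis (1, 1))"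
    and coassociative: "tensor3_eq smul
      (free_lift free_scale
        (\<lambda>(a, b). free_lift free_scale (\<lambda>(a1, a2). free_basis (a1, a2, b)) (\<Delta> a)) (\<Delta> x))
      (free_lift free_scale
        (\<lambda>(a, b). free_lift free_scale (\<lambda>(b1, b2). free_basis (a, b1, b2)) (\<Delta> b)) (\<Delta> x))"
    and counit_linear: "Vector_Spaces.linear smul (*) \<epsilon>"
    and counit_mult: "\<epsilon> (x * y) = \<epsilon> x * \<epsilon> y"
    and counit_one: "\<epsilon> 1 = 1"
    and counit_left: "free_lift smul (\<lambda>(a, b). smul (\<epsilon> a) b) (\<Delta> x) = x"
    and counit_right: "free_lift smul (\<lambda>(a, b). smul (\<epsilon> b) a) (\<Delta> x) = x"
    and antipode_linear: "Vector_Spaces.linear smul smul S"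
    and antipode_left: "free_lift smul (\<lambda>(a, b). S a * b) (\<Delta> x) = smul (\<epsilon> x) 1"
    and antipode_right: "free_lift smul (\<lambda>(a, b). a * S b) (\<Delta> x) = smul (\<epsilon> x) 1"


section \<open>Weakly complete algebras\<close>

locale weakly_complete_algebra = unital_algebra smul
  for smul :: "'k::real_or_complex \<Rightarrow> 'b::{ring,monoid_mult,topological_space} \<Rightarrow> 'b" +
  fixes I :: "'x set"
  assumes continuous_mult: "continuous_on UNIV (\<lambda>(x :: 'b, y). x * y)"
    and iso_power: "\<exists>f :: 'b \<Rightarrow> 'x \<Rightarrow> 'k.
      homeomorphic_map euclidean (product_topology (\<lambda>_. euclidean) I) f \<and>
      (\<forall>x y. \<forall>i\<in>I. f (x + y) i = f x i + f y i) \<and>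
      (\<forall>c x. \<forall>i\<in>I. f (smul c x) i = c * f x i)"


section \<open>Topological groups and Lie groups\<close>

record 'a top_group = "'a monoid" +
  gtop :: "'a topology"

locale topological_group = group G for G :: "('a, 'm) top_group_scheme" (structure) +
  assumes topspace_gtop: "topspace (gtop G) = carrier G"
    and continuous_mult:
      "continuous_map (prod_topology (gtop G) (gtop G)) (gtop G) (\<lambda>(x, y). x \<otimes>\<^bsub>G\<^esub> y)"
    and continuous_inv: "continuous_map (gtop G) (gtop G) (\<lambda>x. inv\<^bsub>G\<^esub> x)"

text \<open>\<open>Ck_on n k U f\<close>: all iterated partial derivatives of order at most \<open>k\<close> of \<open>f\<close> exist and are
  continuous on \<open>U\<close>. It is only used for sets \<open>U\<close> that are open in \<open>Euclidean_space n\<close>.\<close>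

primrec Ck_on :: "nat \<Rightarrow> nat \<Rightarrow> (nat \<Rightarrow> real) set \<Rightarrow> ((nat \<Rightarrow> real) \<Rightarrow> real) \<Rightarrow> bool" where
  "Ck_on n 0 U f \<longleftrightarrow> continuous_on U f"
| "Ck_on n (Suc k) U f \<longleftrightarrow> continuous_on U f \<and>
     (\<forall>i<n. \<exists>f'. (\<forall>x\<in>U. ((\<lambda>t. f (x(i := t))) has_real_derivative f' x) (at (x i))) \<and>
        Ck_on n k U f')"

definition smooth_map_on ::
  "nat \<Rightarrow> nat \<Rightarrow> (nat \<Rightarrow> real) set \<Rightarrow> ((nat \<Rightarrow> real) \<Rightarrow> (nat \<Rightarrow> real)) \<Rightarrow> bool" where
  "smooth_map_on n m U f \<longleftrightarrow> (\<forall>j<m. \<forall>k. Ck_on n k U (\<lambda>x. f x j))"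

text \<open>The two components of a point of \<open>Euclidean_space (2 * n)\<close>.\<close>

definition left_half :: "nat \<Rightarrow> (nat \<Rightarrow> real) \<Rightarrow> (nat \<Rightarrow> real)" where
  "left_half n z = (\<lambda>i. if i < n then z i else 0)"

definition right_half :: "nat \<Rightarrow> (nat \<Rightarrow> real) \<Rightarrow> (nat \<Rightarrow> real)" where
  "right_half n z = (\<lambda>i. if i < n then z (n + i) else 0)"

record 'a lie_group = "'a top_group" +
  ldim :: nat
  atlas :: "('a set \<times> ('a \<Rightarrow> nat \<Rightarrow> real)) set"

locale finite_dim_lie_group = topological_group G
  for G :: "('a, 'm) lie_group_scheme" (structure) +
  assumes Hausdorff: "Hausdorff_space (gtop G)"
    and chart_domain: "(U, f) \<in> atlas G \<Longrightarrow> openin (gtop G) U"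
    and chart_range: "(U, f) \<in> atlas G \<Longrightarrow> openin (Euclidean_space (ldim G)) (f ` U)"
    and chart_homeomorphic: "(U, f) \<in> atlas G \<Longrightarrow>
      homeomorphic_map (subtopology (gtop G) U)
        (subtopology (Euclidean_space (ldim G)) (f ` U)) f"
    and charts_cover: "(\<Union>(U, f)\<in>atlas G. U) = carrier G"
    and chart_transition: "(U, f) \<in> atlas G \<Longrightarrow> (V, g) \<in> atlas G \<Longrightarrow>
      smooth_map_on (ldim G) (ldim G) (f ` (U \<inter> V)) (\<lambda>x. g (inv_into U f x))"
    and smooth_mult: "(U, f) \<in> atlas G \<Longrightarrow> (V, g) \<in> atlas G \<Longrightarrow> (W, h) \<in> atlas G \<Longrightarrow>
      smooth_map_on (2 * ldim G) (ldim G)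
        {z \<in> topspace (Euclidean_space (2 * ldim G)).
           left_half (ldim G) z \<in> f ` U \<and> right_half (ldim G) z \<in> g ` V \<and>
           inv_into U f (left_half (ldim G) z) \<otimes>\<^bsub>G\<^esub> inv_into V g (right_half (ldim G) z) \<in> W}
        (\<lambda>z. h (inv_into U f (left_half (ldim G) z) \<otimes>\<^bsub>G\<^esub> inv_into V g (right_half (ldim G) z)))"
    and smooth_inv: "(U, f) \<in> atlas G \<Longrightarrow> (V, g) \<in> atlas G \<Longrightarrow>
      smooth_map_on (ldim G) (ldim G)
        {x \<in> f ` U. inv\<^bsub>G\<^esub> (inv_into U f x) \<in> V} (\<lambda>x. g (inv\<^bsub>G\<^esub> (inv_into U f x)))"


section \<open>One-parameter subgroups\<close>

definition one_param_subgroups :: "('a, 'm) top_group_scheme \<Rightarrow> (real \<Rightarrow> 'a) set" where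
  "one_param_subgroups G =
     {X. continuous_map euclideanreal (gtop G) X \<and> (\<forall>s t. X (s + t) = X s \<otimes>\<^bsub>G\<^esub> X t)}"

definition compact_open_topology :: "('a, 'm) top_group_scheme \<Rightarrow> (real \<Rightarrow> 'a) topology" where
  "compact_open_topology G = topology_generated_by
     {{X \<in> one_param_subgroups G. X ` K \<subseteq> U} | K U. compact K \<and> openin (gtop G) U}"

text \<open>The continuous one-parameter subgroups of a Lie group \<open>G\<close> correspond bijectively to the tangent
  space at the identity via \<open>X \<mapsto> X'(0)\<close>. The Lie algebra structure of the tangent space is
  transported along this bijection; the bracket of \<open>X'(0)\<close> and \<open>Y'(0)\<close> is the derivative at
  \<open>s = 0\<close> of \<open>Ad (X s) (Y'(0))\<close>. Tangent vectors at the identity are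
  expressed in a chart around it (the choice of chart being immaterial).\<close>

definition has_velocity ::
  "nat \<Rightarrow> ('a \<Rightarrow> nat \<Rightarrow> real) \<Rightarrow> (real \<Rightarrow> 'a) \<Rightarrow> (nat \<Rightarrow> real) \<Rightarrow> bool" where
  "has_velocity n f X v \<longleftrightarrow> (\<forall>i<n. ((\<lambda>t. f (X t) i) has_real_derivative v i) (at 0))"

definition is_lie_sum ::
  "('a, 'm) lie_group_scheme \<Rightarrow> (real \<Rightarrow> 'a) \<Rightarrow> (real \<Rightarrow> 'a) \<Rightarrow> (real \<Rightarrow> 'a) \<Rightarrow> bool" where
  "is_lie_sum G X Y Z \<longleftrightarrow> Z \<in> one_param_subgroups G \<and>
     (\<exists>(U, f)\<in>atlas G. \<one>\<^bsub>G\<^esub> \<in> U \<and>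
       (\<exists>v w. has_velocity (ldim G) f X v \<and> has_velocity (ldim G) f Y w \<and>
          has_velocity (ldim G) f Z (\<lambda>i. v i + w i)))"

definition is_lie_bracket ::
  "('a, 'm) lie_group_scheme \<Rightarrow> (real \<Rightarrow> 'a) \<Rightarrow> (real \<Rightarrow> 'a) \<Rightarrow> (real \<Rightarrow> 'a) \<Rightarrow> bool" where
  "is_lie_bracket G X Y Z \<longleftrightarrow> Z \<in> one_param_subgroups G \<and>
     (\<exists>(U, f)\<in>atlas G. \<one>\<^bsub>G\<^esub> \<in> U \<and>
       (\<exists>(a :: real \<Rightarrow> nat \<Rightarrow> real) z.
          (\<forall>s. has_velocity (ldim G) f (\<lambda>t. X s \<otimes>\<^bsub>G\<^esub> Y t \<otimes>\<^bsub>G\<^esub> inv\<^bsub>G\<^esub> (X s)) (a s)) \<and>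
          (\<forall>i<ldim G. ((\<lambda>s. a s i) has_real_derivative z i) (at 0)) \<and>
          has_velocity (ldim G) f Z z))"


section \<open>Projective limits of Lie groups\<close>

record ('i, 'a) lie_system =
  indices :: "'i set"
  below :: "'i \<Rightarrow> 'i \<Rightarrow> bool"
  stage :: "'i \<Rightarrow> 'a lie_group"
  bond :: "'i \<Rightarrow> 'i \<Rightarrow> 'a \<Rightarrow> 'a"

text \<open>\<open>bond L i j\<close> is the bonding map from \<open>stage L j\<close> to \<open>stage L i\<close> for \<open>below L i j\<close>.\<close>

locale directed_lie_system =
  fixes L :: "('i, 'a) lie_system"
  assumes indices_nonempty: "indices L \<noteq> {}"
    and below_refl: "i \<in> indices L \<Longrightarrow> below L i i"
    and below_trans: "\<lbrakk>i \<in> indices L; j \<in> indices L; k \<in> indices L; below L i j; below L j k\<rbrakk>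
      \<Longrightarrow> below L i k"
    and directed: "\<lbrakk>i \<in> indices L; j \<in> indices L\<rbrakk>
      \<Longrightarrow> \<exists>k\<in>indices L. below L i k \<and> below L j k"
    and stage_lie: "i \<in> indices L \<Longrightarrow> finite_dim_lie_group (stage L i)"
    and bond_hom: "\<lbrakk>i \<in> indices L; j \<in> indices L; below L i j\<rbrakk>
      \<Longrightarrow> bond L i j \<in> hom (stage L j) (stage L i)"
    and bond_continuous: "\<lbrakk>i \<in> indices L; j \<in> indices L; below L i j\<rbrakk>
      \<Longrightarrow> continuous_map (gtop (stage L j)) (gtop (stage L i)) (bond L i j)"
    and bond_id: "\<lbrakk>i \<in> indices L; x \<in> carrier (stage L i)\<rbrakk> \<Longrightarrow> bond L i i x = x"
    and bond_comp: "\<lbrakk>i \<in> indices L; j \<in> indices L; k \<in> indices L; below L i j; below L j k;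
      x \<in> carrier (stage L k)\<rbrakk> \<Longrightarrow> bond L i j (bond L j k x) = bond L i k x"

definition limit_carrier :: "('i, 'a) lie_system \<Rightarrow> ('i \<Rightarrow> 'a) set" where
  "limit_carrier L = {x \<in> carrier (product_group (indices L) (stage L)).
     \<forall>i\<in>indices L. \<forall>j\<in>indices L. below L i j \<longrightarrow> bond L i j (x j) = x i}"

definition limit_group :: "('i, 'a) lie_system \<Rightarrow> ('i \<Rightarrow> 'a) top_group" where
  "limit_group L =
     \<lparr>carrier = limit_carrier L,
      monoid.mult = monoid.mult (product_group (indices L) (stage L)),
      one = one (product_group (indices L) (stage L)),
      gtop = subtopology (product_topology (\<lambda>i. gtop (stage L i)) (indices L)) (limit_carrier L)\<rparr>"

text \<open>\<open>p\<close> exhibits the topological group \<open>G\<close> as the projective limit of the directed system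
  \<open>L\<close> of Lie groups; the limit projection to the stage \<open>i\<close> is \<open>\<lambda>x. p x i\<close>. A group admitting such
  \<open>L\<close> and \<open>p\<close> is a pro-Lie group. Since types cannot be quantified, an existence claim for \<open>L\<close> has
  to name types for the indices and for the elements of the stages; whatever the choice, the claim
  implies that \<open>G\<close> is a pro-Lie group.\<close>

definition is_pro_lie_limit ::
  "('i, 'a) lie_system \<Rightarrow> ('g, 'm) top_group_scheme \<Rightarrow> ('g \<Rightarrow> 'i \<Rightarrow> 'a) \<Rightarrow> bool" where
  "is_pro_lie_limit L G p \<longleftrightarrow> directed_lie_system L \<and> topological_group G \<and>
     p \<in> iso G (limit_group L) \<and> homeomorphic_map (gtop G) (gtop (limit_group L)) p"

text \<open>The Lie algebra structure on the one-parameter subgroups of a projective limit is that of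
  the projective limit of the Lie algebras of the stages. It depends only on the topological
  group \<open>G\<close>, although it is expressed here through a presentation of \<open>G\<close> as a limit.\<close>

definition is_pro_lie_sum ::
  "('i, 'a) lie_system \<Rightarrow> ('g, 'm) top_group_scheme \<Rightarrow> ('g \<Rightarrow> 'i \<Rightarrow> 'a) \<Rightarrow>
    (real \<Rightarrow> 'g) \<Rightarrow> (real \<Rightarrow> 'g) \<Rightarrow> (real \<Rightarrow> 'g) \<Rightarrow> bool" where
  "is_pro_lie_sum L G p X Y Z \<longleftrightarrow> Z \<in> one_param_subgroups G \<and>
     (\<forall>i\<in>indices L. is_lie_sum (stage L i) (\<lambda>t. p (X t) i) (\<lambda>t. p (Y t) i) (\<lambda>t. p (Z t) i))"

definition is_pro_lie_bracket ::
  "('i, 'a) lie_system \<Rightarrow> ('g, 'm) top_group_scheme \<Rightarrow> ('g \<Rightarrow> 'i \<Rightarrow> 'a) \<Rightarrow>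
    (real \<Rightarrow> 'g) \<Rightarrow> (real \<Rightarrow> 'g) \<Rightarrow> (real \<Rightarrow> 'g) \<Rightarrow> bool" where
  "is_pro_lie_bracket L G p X Y Z \<longleftrightarrow> Z \<in> one_param_subgroups G \<and>
     (\<forall>i\<in>indices L. is_lie_bracket (stage L i) (\<lambda>t. p (X t) i) (\<lambda>t. p (Y t) i) (\<lambda>t. p (Z t) i))"

record 'v top_lie_algebra = "'v partial_object" +
  vtop :: "'v topology"
  vadd :: "'v \<Rightarrow> 'v \<Rightarrow> 'v"
  vscale :: "real \<Rightarrow> 'v \<Rightarrow> 'v"
  vbracket :: "'v \<Rightarrow> 'v \<Rightarrow> 'v"

text \<open>\<open>\<Phi>\<close> is an isomorphism of real topological Lie algebras from \<open>A\<close> onto the pro-Lie algebra of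
  the projective limit \<open>G\<close>. The scalar multiplication of the latter is \<open>(r X)(t) = X (r t)\<close>.\<close>

definition is_iso_onto_pro_lie_algebra ::
  "'v top_lie_algebra \<Rightarrow> ('i, 'a) lie_system \<Rightarrow> ('g, 'm) top_group_scheme \<Rightarrow>
    ('g \<Rightarrow> 'i \<Rightarrow> 'a) \<Rightarrow> ('v \<Rightarrow> real \<Rightarrow> 'g) \<Rightarrow> bool" where
  "is_iso_onto_pro_lie_algebra A L G p \<Phi> \<longleftrightarrow>
     bij_betw \<Phi> (carrier A) (one_param_subgroups G) \<and>
     homeomorphic_map (vtop A) (compact_open_topology G) \<Phi> \<and>
     (\<forall>x\<in>carrier A. \<forall>y\<in>carrier A. vadd A x y \<in> carrier A \<and>
        is_pro_lie_sum L G p (\<Phi> x) (\<Phi> y) (\<Phi> (vadd A x y))) \<and>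
     (\<forall>r. \<forall>x\<in>carrier A. vscale A r x \<in> carrier A \<and>
        \<Phi> (vscale A r x) = (\<lambda>t. \<Phi> x (r * t))) \<and>
     (\<forall>x\<in>carrier A. \<forall>y\<in>carrier A. vbracket A x y \<in> carrier A \<and>
        is_pro_lie_bracket L G p (\<Phi> x) (\<Phi> y) (\<Phi> (vbracket A x y)))"


section \<open>Characters and infinitesimal characters\<close>

definition convolution ::
  "('h \<Rightarrow> ('h \<times> 'h \<Rightarrow>\<^sub>0 'k)) \<Rightarrow> ('k::field \<Rightarrow> 'b::{ring,monoid_mult} \<Rightarrow> 'b) \<Rightarrow>
    ('h \<Rightarrow> 'b) \<Rightarrow> ('h \<Rightarrow> 'b) \<Rightarrow> ('h \<Rightarrow> 'b)" where
  "convolution \<Delta> scaleB \<phi> \<psi> = (\<lambda>x. free_lift scaleB (\<lambda>(a, b). \<phi> a * \<psi> b) (\<Delta> x))"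

definition characters ::
  "('k::field \<Rightarrow> 'h::{ring,monoid_mult} \<Rightarrow> 'h) \<Rightarrow> ('k \<Rightarrow> 'b::{ring,monoid_mult} \<Rightarrow> 'b) \<Rightarrow>
    ('h \<Rightarrow> 'b) set" where
  "characters scaleH scaleB =
     {\<phi>. Vector_Spaces.linear scaleH scaleB \<phi> \<and> \<phi> 1 = 1 \<and> (\<forall>a b. \<phi> (a * b) = \<phi> a * \<phi> b)}"

text \<open>The topology of the type \<open>'h \<Rightarrow> 'b\<close> is that of pointwise convergence.\<close>

definition character_group ::
  "('k::field \<Rightarrow> 'h::{ring,monoid_mult} \<Rightarrow> 'h) \<Rightarrow> ('h \<Rightarrow> ('h \<times> 'h \<Rightarrow>\<^sub>0 'k)) \<Rightarrow> ('h \<Rightarrow> 'k) \<Rightarrow>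
    ('k \<Rightarrow> 'b::{ring,monoid_mult,topological_space} \<Rightarrow> 'b) \<Rightarrow> ('h \<Rightarrow> 'b) top_group" where
  "character_group scaleH \<Delta> \<epsilon> scaleB =
     \<lparr>carrier = characters scaleH scaleB,
      monoid.mult = convolution \<Delta> scaleB,
      one = (\<lambda>x. scaleB (\<epsilon> x) 1),
      gtop = subtopology euclidean (characters scaleH scaleB)\<rparr>"

definition infinitesimal_characters ::
  "('k::field \<Rightarrow> 'h::{ring,monoid_mult} \<Rightarrow> 'h) \<Rightarrow> ('h \<Rightarrow> 'k) \<Rightarrow>
    ('k \<Rightarrow> 'b::{ring,monoid_mult} \<Rightarrow> 'b) \<Rightarrow> ('h \<Rightarrow> 'b) set" where
  "infinitesimal_characters scaleH \<epsilon> scaleB =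
     {\<phi>. Vector_Spaces.linear scaleH scaleB \<phi> \<and>
        (\<forall>a b. \<phi> (a * b) = scaleB (\<epsilon> a) (\<phi> b) + scaleB (\<epsilon> b) (\<phi> a))}"

definition infinitesimal_lie_algebra ::
  "('k::real_or_complex \<Rightarrow> 'h::{ring,monoid_mult} \<Rightarrow> 'h) \<Rightarrow> ('h \<Rightarrow> ('h \<times> 'h \<Rightarrow>\<^sub>0 'k)) \<Rightarrow>
    ('h \<Rightarrow> 'k) \<Rightarrow> ('k \<Rightarrow> 'b::{ring,monoid_mult,topological_space} \<Rightarrow> 'b) \<Rightarrow>
    ('h \<Rightarrow> 'b) top_lie_algebra" where
  "infinitesimal_lie_algebra scaleH \<Delta> \<epsilon> scaleB =
     \<lparr>carrier = infinitesimal_characters scaleH \<epsilon> scaleB,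
      vtop = subtopology euclidean (infinitesimal_characters scaleH \<epsilon> scaleB),
      vadd = (\<lambda>\<phi> \<psi> x. \<phi> x + \<psi> x),
      vscale = (\<lambda>r \<phi> x. scaleB (of_real r) (\<phi> x)),
      vbracket = (\<lambda>\<phi> \<psi> x. convolution \<Delta> scaleB \<phi> \<psi> x - convolution \<Delta> scaleB \<psi> \<phi> x)\<rparr>"

end

theory Submission
  imports Defs "HOL-Library.Function_Algebras"
begin

text \<open>Every element of \<open>H\<close> lies in the span of a matrix coalgebra, i.e. of a matrix \<open>a\<close> over \<open>H\<close> with
  \<open>\<Delta> a\<^sub>i\<^sub>j = \<Sum>\<^sub>k a\<^sub>i\<^sub>k \<otimes> a\<^sub>k\<^sub>j\<close>, and every continuous functional on \<open>B\<close> is a linear combination of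
  entries of a continuous real matrix representation \<open>\<beta>\<close> of \<open>B\<close>. A pair of these yields the matrix
  \<open>R \<phi> = (\<beta> (\<phi> a\<^sub>i\<^sub>j))\<close>, which turns convolution of linear maps into multiplication of matrices. The \<open>R\<close>
  determine \<open>\<phi>\<close> and its topology, and \<open>Hom(H, B)\<close> is complete with respect to them. The closure of
  the image of the character group among the invertible matrices is a Lie group, by Cartan's theorem
  on closed subgroups, and the character group is the projective limit of these Lie groups.
  Its one-parameter subgroups are \<open>t \<mapsto> exp (t \<phi>)\<close> with \<open>\<phi>\<close> linear; such a curve consists of
  characters iff \<open>\<phi>\<close> is an infinitesimal character.\<close>

text \<open>The statement fixes the types of indices and stages in advance. Hence the stages, matrix
  groups of unbounded size, are all cut out of one Banach algebra and encoded as real sequences, and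
  an index is a pair of subsets of \<open>'h\<close> and \<open>'b\<close>. Scalars are resolved
  into real coordinates, so that real and complex scalars both lead to real matrix groups. Whether
  the image of the characters at a single stage is closed is never decided; its closure may contain
  matrices that come only from linear maps. In the limit this does no harm: being a character is a
  family of polynomial conditions, each visible at one stage, so a linear map that lies in the
  closure at every stage is a character. Completeness of \<open>Hom(H, B)\<close> enters three
  times: for the points of the limit, for the exponential series and for the generator of a
  one-parameter subgroup. Each time the answer is found at every stage separately and then
  assembled. Identities in \<open>H \<otimes> H\<close> are tested on matrix coefficients, where
  they become identities between finite sums; multiplicativity becomes an equation between matrices
  indexed by a Kronecker product.\<close>

section \<open>Calculus in Banach algebras\<close>

\<comment> \<open>Homogeneous polynomials of degree \<open>n\<close> in a noncommutative algebra, with a bound for the sum of the norms of the coefficients.\<close>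
inductive hpoly :: "nat \<Rightarrow> real \<Rightarrow> ('a::real_normed_algebra_1 \<Rightarrow> 'a) \<Rightarrow> bool" where
  zero: "hpoly n 0 (\<lambda>_. 0)"
| const: "norm c \<le> w \<Longrightarrow> hpoly 0 w (\<lambda>_. c)"
| ident: "hpoly 1 1 (\<lambda>x. x)"
| add: "hpoly n v p \<Longrightarrow> hpoly n w q \<Longrightarrow> hpoly n (v + w) (\<lambda>x. p x + q x)"
| mult: "hpoly m v p \<Longrightarrow> hpoly n w q \<Longrightarrow> hpoly (m + n) (v * w) (\<lambda>x. p x * q x)"

lemma hpoly_bound: "hpoly n w p \<Longrightarrow> 0 \<le> w \<and> norm (p x) \<le> w * norm x ^ n"
proof (induction rule: hpoly.induct)
  case (const c w)
  then show ?case using norm_ge_zero[of c] by (auto intro: order.trans[OF norm_ge_zero])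
next
  case (add n v p w q)
  then show ?case using norm_triangle_ineq[of "p x" "q x"] by (simp add: distrib_right)
next
  case (mult m v p n w q)
  have "norm (p x * q x) \<le> norm (p x) * norm (q x)" by (rule norm_mult_ineq)
  also have "\<dots> \<le> (v * norm x ^ m) * (w * norm x ^ n)"
    using mult.IH by (intro mult_mono) auto
  finally show ?case using mult.IH by (simp add: power_add mult_ac)
qed auto

lemma hpoly_weight_0: "hpoly n 0 p \<Longrightarrow> p = (\<lambda>_. 0)"
  using hpoly_bound[of n 0 p] by auto

text \<open>The product rule keeps the order of the factors, so a directional derivative is again a
  homogeneous polynomial. The weight \<open>w\<close> turns into \<open>n * w\<close>, exactly as
  the coefficient of a scalar monomial does; majorants of series can therefore be differentiated
  along with the series.\<close>

lemma hpoly_has_derivative: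
  "hpoly n w p \<Longrightarrow>
    \<exists>p'. (\<forall>x. (p has_derivative p' x) (at x)) \<and> (\<forall>v. hpoly (n - 1) (n * w * norm v) (\<lambda>x. p' x v))"
proof (induction rule: hpoly.induct)
  case (zero n)
  show ?case by (rule exI[of _ "\<lambda>_ _. 0"]) (auto intro: hpoly.zero)
next
  case (const c w)
  show ?case by (rule exI[of _ "\<lambda>_ _. 0"]) (auto intro: hpoly.zero)
next
  case ident
  show ?case by (rule exI[of _ "\<lambda>_ v. v"]) (auto intro: hpoly.const)
next
  case (add n v p w q)
  then obtain p' q' where "\<forall>x. (p has_derivative p' x) (at x)" "\<forall>x. (q has_derivative q' x) (at x)"
    and h: "\<forall>u. hpoly (n - 1) (n * v * norm u) (\<lambda>x. p' x u)"
      "\<forall>u. hpoly (n - 1) (n * w * norm u) (\<lambda>x. q' x u)" by blast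
  moreover have "hpoly (n - 1) (n * (v + w) * norm u) (\<lambda>x. p' x u + q' x u)" for u
    using hpoly.add[OF h(1)[rule_format, of u] h(2)[rule_format, of u]] by (simp add: algebra_simps)
  ultimately show ?case
    by (intro exI[of _ "\<lambda>x u. p' x u + q' x u"]) (auto intro: has_derivative_add)
next
  case (mult m v p n w q)
  then obtain p' q' where d: "\<forall>x. (p has_derivative p' x) (at x)" "\<forall>x. (q has_derivative q' x) (at x)"
    and h: "\<forall>u. hpoly (m - 1) (m * v * norm u) (\<lambda>x. p' x u)"
      "\<forall>u. hpoly (n - 1) (n * w * norm u) (\<lambda>x. q' x u)" by blast
  have "hpoly (m + n - 1) (real (m + n) * (v * w) * norm u) (\<lambda>x. p x * q' x u + p' x u * q x)" for u
  proof -
    have 1: "hpoly (m + n - 1) (v * (n * w * norm u)) (\<lambda>x. p x * q' x u)"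
    \<comment> \<open>Natural subtraction truncates: for \<open>n = 0\<close> the degree
      \<open>m + (n - 1)\<close> differs from \<open>m + n - 1\<close> unless \<open>m = 0\<close>.
      In this case the weight is \<open>0\<close>, and \<open>hpoly_weight_0\<close> makes the term
      vanish.\<close>
    proof (cases "n = 0")
      case True
      then have "hpoly (n - 1) 0 (\<lambda>x. q' x u)" using h(2)[rule_format, of u] by simp
      from hpoly_weight_0[OF this] have "(\<lambda>x. q' x u) = (\<lambda>_. 0)" .
      then have "q' x u = 0" for x by meson
      then show ?thesis using True by (simp add: hpoly.zero)
    next
      case False
      then show ?thesis using hpoly.mult[OF mult.hyps(1) h(2)[rule_format, of u]] by simp
    qed
    have 2: "hpoly (m + n - 1) ((m * v * norm u) * w) (\<lambda>x. p' x u * q x)"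
    proof (cases "m = 0")
      case True
      then have "hpoly (m - 1) 0 (\<lambda>x. p' x u)" using h(1)[rule_format, of u] by simp
      from hpoly_weight_0[OF this] have "(\<lambda>x. p' x u) = (\<lambda>_. 0)" .
      then have "p' x u = 0" for x by meson
      then show ?thesis using True by (simp add: hpoly.zero)
    next
      case False
      then show ?thesis using hpoly.mult[OF h(1)[rule_format, of u] mult.hyps(2)] by simp
    qed
    show ?thesis using hpoly.add[OF 1 2] by (simp add: algebra_simps)
  qed
  with d show ?case
    by (intro exI[of _ "\<lambda>x u. p x * q' x u + p' x u * q x"]) (auto intro: has_derivative_mult)
qed

lemma hpoly_power: "hpoly n 1 (\<lambda>x. x ^ n)"
proof (induction n)
  case 0
  then show ?case using hpoly.const[of 1 1] by simp
next
  case (Suc n)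
  then show ?case using hpoly.mult[OF hpoly.ident Suc] by simp
qed

lemma hpoly_scaleR_power: "hpoly n \<bar>c\<bar> (\<lambda>x. c *\<^sub>R x ^ n)"
proof -
  have "hpoly (0 + n) (\<bar>c\<bar> * 1) (\<lambda>x. (c *\<^sub>R 1) * x ^ n)"
    by (rule hpoly.mult[OF hpoly.const hpoly_power]) simp
  then show ?thesis by simp
qed

\<comment> \<open>Power series with noncommuting coefficients; this class is closed under directional derivatives.\<close>
definition pser :: "real \<Rightarrow> ('a::{real_normed_algebra_1,banach} \<Rightarrow> 'a) \<Rightarrow> bool" where
  "pser R f \<longleftrightarrow> (\<exists>p w. (\<forall>n. hpoly n (w n) (p n)) \<and>
     (\<forall>r. 0 \<le> r \<longrightarrow> r < R \<longrightarrow> summable (\<lambda>n. w n * r ^ n)) \<and>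
     (\<forall>x. norm x < R \<longrightarrow> f x = (suminf (\<lambda>n. p n x))))"

context
  fixes f :: "'a::{real_normed_algebra_1,banach} \<Rightarrow> 'a" and p :: "nat \<Rightarrow> 'a \<Rightarrow> 'a" and p' :: "nat \<Rightarrow> 'a \<Rightarrow> 'a \<Rightarrow> 'a"
    and w :: "nat \<Rightarrow> real" and R :: real
  assumes hp: "\<And>n. hpoly n (w n) (p n)"
    and sw: "\<And>r. 0 \<le> r \<Longrightarrow> r < R \<Longrightarrow> summable (\<lambda>n. w n * r ^ n)"
    and fp: "\<And>x. norm x < R \<Longrightarrow> f x = (suminf (\<lambda>n. p n x))"
    and dp: "\<And>n x. (p n has_derivative p' n x) (at x)"
    and hp': "\<And>n v. hpoly (n - 1) (n * w n * norm v) (\<lambda>x. p' n x v)"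
begin

text \<open>The weights give a scalar majorant that converges for all radii below \<open>R\<close>.
  The derived weights are the coefficients of its derivative, which converges there as well, so
  termwise differentiation is justified and stays within the class.\<close>

lemma hpoly_series_has_derivative:
  shows "\<And>x v. norm x < R \<Longrightarrow> summable (\<lambda>n. p' n x v)"
    and "\<And>x. norm x < R \<Longrightarrow> (f has_derivative (\<lambda>v. suminf (\<lambda>n. p' n x v))) (at x)"
    and "\<And>v. pser R (\<lambda>x. suminf (\<lambda>n. p' n x v))"
proof -
  have w0: "w n \<ge> 0" for n using hpoly_bound[OF hp] by blast
  have bounds: "norm (p' n x v) \<le> n * w n * norm v * norm x ^ (n - 1)" for n x v
    using hpoly_bound[OF hp'] by blast
  define M where "M s n = real n * w n * s ^ (n - 1)" for s n
  have M0: "M s n \<ge> 0" if "s \<ge> 0" for s n using that w0 by (simp add: M_def)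
  have sd: "summable (\<lambda>n. diffs w n * s ^ n)" if "0 \<le> s" "s < R" for s
  proof (rule termdiff_converges[of s R w])
    show "norm s < R" using that by simp
    fix x :: real assume x: "norm x < R"
    have "summable (\<lambda>n. w n * \<bar>x\<bar> ^ n)" by (rule sw) (use x in auto)
    then show "summable (\<lambda>n. w n * x ^ n)"
      by (rule summable_comparison_test') (use w0 in \<open>auto simp: abs_mult power_abs\<close>)
  qed
  have sM: "summable (M s)" if "0 \<le> s" "s < R" for s
  proof -
    have "summable (\<lambda>n. M s (Suc n))" using sd[OF that] by (simp add: M_def diffs_def)
    then show ?thesis by (simp only: summable_Suc_iff)
  qed
  define f' where "f' x v = (suminf (\<lambda>n. p' n x v))" for x v
  have sp': "summable (\<lambda>n. p' n x v)" if "norm x < R" for x v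
  proof (rule summable_comparison_test')
    show "summable (\<lambda>n. M (norm x) n * norm v)" by (rule summable_mult2[OF sM]) (use that in auto)
    show "norm (p' n x v) \<le> M (norm x) n * norm v" for n using bounds[of n x v] by (simp add: M_def mult_ac)
  qed
  have der: "(f has_derivative f' x) (at x)" if x: "norm x < R" for x
  proof -
    \<comment> \<open>On the smaller ball of radius \<open>s\<close> the single series
      \<open>M s\<close> dominates all derived series, which makes their tails uniformly
      small.\<close>
    obtain s where s: "norm x < s" "s < R" using x dense by blast
    then have s0: "s \<ge> 0" using norm_ge_zero[of x] by linarith
    define S where "S = ball (0::'a) s"
    have oS: "open S" and xS: "x \<in> S" using s by (auto simp: S_def)
    have "\<exists>g. \<forall>x\<in>S. (\<lambda>n. p n x) sums (g x) \<and> (g has_derivative f' x) (at x within S)"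
    proof (rule has_derivative_series)
      show "convex S" by (simp add: S_def)
      show "(p n has_derivative p' n y) (at y within S)" for n y
        by (rule has_derivative_at_withinI[OF dp])
      show "x \<in> S" by fact
      have "summable (\<lambda>n. p n x)"
      proof (rule summable_comparison_test')
        show "summable (\<lambda>n. w n * norm x ^ n)" by (rule sw) (use x in auto)
        show "norm (p n x) \<le> w n * norm x ^ n" for n using hpoly_bound[OF hp] by blast
      qed
      then show "(\<lambda>n. p n x) sums (suminf (\<lambda>n. p n x))" by (rule summable_sums)
      fix e :: real assume e: "e > 0"
      obtain N where N: "\<And>n. n \<ge> N \<Longrightarrow> norm (suminf (\<lambda>i. M s (i + n))) < e"
        using suminf_exist_split[OF e sM[OF s0 s(2)]] by blast
      show "\<forall>\<^sub>F n in sequentially. \<forall>y\<in>S. \<forall>h. norm ((\<Sum>i<n. p' i y h) - f' y h) \<le> e * norm h"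
        unfolding eventually_sequentially
      proof (intro exI allI impI ballI)
        fix n and y h :: 'a assume n: "N \<le> n" and "y \<in> S"
        then have y: "norm y < s" "norm y < R" using s by (auto simp: S_def)
        have sMn: "summable (\<lambda>i. M s (i + n) * norm h)"
          by (rule summable_mult2, subst summable_iff_shift, rule sM[OF s0 s(2)])
        have b: "norm (p' i y h) \<le> M s i * norm h" for i
        proof -
          have "norm (p' i y h) \<le> i * w i * norm h * norm y ^ (i - 1)" by (rule bounds)
          also have "\<dots> \<le> i * w i * norm h * s ^ (i - 1)"
            using y(1) w0[of i] by (intro mult_left_mono power_mono) auto
          finally show ?thesis by (simp add: M_def mult_ac)
        qed
        have "f' y h - (\<Sum>i<n. p' i y h) = (suminf (\<lambda>i. p' (i + n) y h))"
          using suminf_split_initial_segment[OF sp'[OF y(2), of h], of n] by (simp add: f'_def)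
        then have "norm ((\<Sum>i<n. p' i y h) - f' y h) = norm (suminf (\<lambda>i. p' (i + n) y h))"
          by (metis norm_minus_commute)
        also have "\<dots> \<le> (suminf (\<lambda>i. M s (i + n) * norm h))"
          by (rule norm_suminf_le[OF b sMn])
        also have "\<dots> = (suminf (\<lambda>i. M s (i + n))) * norm h"
          by (rule suminf_mult2[symmetric], subst summable_iff_shift, rule sM[OF s0 s(2)])
        also have "\<dots> \<le> e * norm h"
          using N[OF n] by (intro mult_right_mono) auto
        finally show "norm ((\<Sum>i<n. p' i y h) - f' y h) \<le> e * norm h" .
      qed
    qed
    then obtain g where g: "\<And>y. y \<in> S \<Longrightarrow> (\<lambda>n. p n y) sums (g y)"
      "\<And>y. y \<in> S \<Longrightarrow> (g has_derivative f' y) (at y within S)" by blast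
    have "(g has_derivative f' x) (at x)" using g(2)[OF xS] unfolding at_within_open[OF xS oS] .
    then show ?thesis
    proof (rule has_derivative_transform_within_open[OF _ oS xS])
      fix y assume y: "y \<in> S"
      then have "norm y < R" using s by (auto simp: S_def)
      then show "g y = f y" using fp g(1)[OF y] by (simp add: sums_unique)
    qed
  qed
  have "pser R (\<lambda>x. f' x v)" for v
    unfolding pser_def
  proof (intro exI conjI allI impI)
    \<comment> \<open>The derivative of the term of degree \<open>0\<close> vanishes; shifting by
      \<open>Suc\<close> restores the rule that the \<open>n\<close>-th term has degree
      \<open>n\<close>.\<close>
    show "hpoly n (real (Suc n) * w (Suc n) * norm v) (\<lambda>x. p' (Suc n) x v)" for n
      using hp'[of "Suc n" v] by simp
    show "summable (\<lambda>n. real (Suc n) * w (Suc n) * norm v * r ^ n)" if "0 \<le> r" "r < R" for r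
      using summable_mult[OF sd[OF that], of "norm v"] by (simp add: diffs_def mult_ac)
    show "f' x v = (suminf (\<lambda>n. p' (Suc n) x v))" if "norm x < R" for x
    proof -
      have "p' 0 x v = 0" using bounds[of 0 x v] by simp
      then show ?thesis using suminf_split_head[OF sp'[OF that, of v]] by (simp add: f'_def)
    qed
  qed
  with der sp' show "\<And>x v. norm x < R \<Longrightarrow> summable (\<lambda>n. p' n x v)"
    "\<And>x. norm x < R \<Longrightarrow> (f has_derivative (\<lambda>v. suminf (\<lambda>n. p' n x v))) (at x)"
    "\<And>v. pser R (\<lambda>x. suminf (\<lambda>n. p' n x v))"
    unfolding f'_def by blast+
qed

end

lemma pser_has_derivative:
  assumes "pser R f"
  shows "\<exists>f'. (\<forall>x. norm x < R \<longrightarrow> (f has_derivative f' x) (at x)) \<and> (\<forall>v. pser R (\<lambda>x. f' x v))"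
proof -
  obtain p w where hp: "\<And>n. hpoly n (w n) (p n)"
    and sw: "\<And>r. 0 \<le> r \<Longrightarrow> r < R \<Longrightarrow> summable (\<lambda>n. w n * r ^ n)"
    and fp: "\<And>x. norm x < R \<Longrightarrow> f x = (suminf (\<lambda>n. p n x))"
    using assms unfolding pser_def by blast
  obtain p' where dp: "\<And>n x. (p n has_derivative p' n x) (at x)"
    and hp': "\<And>n v. hpoly (n - 1) (n * w n * norm v) (\<lambda>x. p' n x v)"
    using hpoly_has_derivative[OF hp] by metis
  show ?thesis
    using hpoly_series_has_derivative(2,3)[OF hp sw fp dp hp']
    by (intro exI[of _ "\<lambda>x v. suminf (\<lambda>n. p' n x v)"]) auto
qed

lemma pser_power_series:
  fixes a :: "nat \<Rightarrow> real"
  assumes "\<And>r. 0 \<le> r \<Longrightarrow> r < R \<Longrightarrow> summable (\<lambda>n. \<bar>a n\<bar> * r ^ n)"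
  shows "pser R (\<lambda>x. suminf (\<lambda>n. a n *\<^sub>R x ^ n))"
  unfolding pser_def
  by (rule exI[of _ "\<lambda>n x. a n *\<^sub>R x ^ n"], rule exI[of _ "\<lambda>n. \<bar>a n\<bar>"])
     (use assms in \<open>auto intro: hpoly_scaleR_power\<close>)

lemma pser_exp: "pser R exp"
proof -
  have "pser R (\<lambda>x::'a. suminf (\<lambda>n. inverse (fact n) *\<^sub>R x ^ n))"
  proof (rule pser_power_series)
    fix r :: real
    show "summable (\<lambda>n. \<bar>inverse (fact n) :: real\<bar> * r ^ n)"
      using summable_exp_generic[of r] by (simp add: abs_inverse)
  qed
  then show ?thesis by (simp add: exp_def[abs_def])
qed

section \<open>Iterated partial derivatives of vector-valued maps\<close>

text \<open>Follows \<open>Ck_on\<close>, but for values in a normed space: the group laws can be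
  differentiated as products in the algebra, and real coordinates are taken only at the very
  end.\<close>

primrec Ckv :: "nat \<Rightarrow> nat \<Rightarrow> (nat \<Rightarrow> real) set \<Rightarrow> ((nat \<Rightarrow> real) \<Rightarrow> 'e::real_normed_vector) \<Rightarrow> bool"
  where
  "Ckv n 0 U u \<longleftrightarrow> continuous_on U u"
| "Ckv n (Suc k) U u \<longleftrightarrow> continuous_on U u \<and>
     (\<forall>i<n. \<exists>u'. (\<forall>x\<in>U. ((\<lambda>t. u (x(i := t))) has_vector_derivative u' x) (at (x i))) \<and>
        Ckv n k U u')"

lemma Ckv_imp_continuous_on: "Ckv n k U u \<Longrightarrow> continuous_on U u"
  by (cases k) auto

lemma Ckv_SucD: "Ckv n (Suc k) U u \<Longrightarrow> Ckv n k U u"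
proof (induction k arbitrary: u)
  case (Suc k)
  then show ?case by (metis Ckv.simps(2))
qed simp

lemma Ckv_const: "Ckv n k U (\<lambda>_. c)"
proof (induction k arbitrary: c)
  case (Suc k)
  show ?case using Suc[of 0] by (auto intro!: exI[of _ "\<lambda>_. 0"])
qed simp

lemma Ckv_coord: "Ckv n k U (\<lambda>x. x j)"
proof (cases k)
  case 0
  then show ?thesis by (simp add: continuous_on_subset[OF continuous_on_product_coordinates])
next
  case (Suc k')
  have "\<exists>u'. (\<forall>x\<in>U. ((\<lambda>t. (x(i := t)) j) has_vector_derivative u' x) (at (x i))) \<and> Ckv n k' U u'" for i
  proof (rule exI[of _ "\<lambda>_. if i = j then 1 else 0"], intro conjI ballI Ckv_const)
    show "((\<lambda>t. (x(i := t)) j) has_vector_derivative (if i = j then 1 else 0)) (at (x i))" for x :: "nat \<Rightarrow> real"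
      by (cases "i = j") (auto simp: has_vector_derivative_def)
  qed
  then show ?thesis using Suc
    by (simp add: continuous_on_subset[OF continuous_on_product_coordinates])
qed

lemma Ckv_add: "Ckv n k U u \<Longrightarrow> Ckv n k U v \<Longrightarrow> Ckv n k U (\<lambda>x. u x + v x)"
proof (induction k arbitrary: u v)
  case 0
  then show ?case by (auto intro: continuous_on_add)
next
  case (Suc k)
  have "\<exists>f'. (\<forall>x\<in>U. ((\<lambda>t. u (x(i := t)) + v (x(i := t))) has_vector_derivative f' x) (at (x i))) \<and> Ckv n k U f'"
    if i: "i < n" for i
  proof -
    obtain u' v' where d: "\<forall>x\<in>U. ((\<lambda>t. u (x(i := t))) has_vector_derivative u' x) (at (x i))"
      "\<forall>x\<in>U. ((\<lambda>t. v (x(i := t))) has_vector_derivative v' x) (at (x i))"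
      and c: "Ckv n k U u'" "Ckv n k U v'" using Suc.prems i by (metis Ckv.simps(2))
    show ?thesis
      by (rule exI[of _ "\<lambda>x. u' x + v' x"])
         (use d Suc.IH[OF c] in \<open>auto intro: has_vector_derivative_add\<close>)
  qed
  then show ?case using Suc.prems by (auto intro: continuous_on_add)
qed

lemma Ckv_sum: "(\<And>j. j \<in> J \<Longrightarrow> Ckv n k U (u j)) \<Longrightarrow> Ckv n k U (\<lambda>x. \<Sum>j\<in>J. u j x)"
  by (induction J rule: infinite_finite_induct) (auto intro: Ckv_const Ckv_add)

lemma Ckv_bilinear:
  assumes bl: "bounded_bilinear pr"
  shows "Ckv n k U u \<Longrightarrow> Ckv n k U v \<Longrightarrow> Ckv n k U (\<lambda>x. pr (u x) (v x))"
proof (induction k arbitrary: u v)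
  case 0
  then show ?case by (auto intro: bounded_bilinear.continuous_on[OF bl])
next
  case (Suc k)
  have "\<exists>f'. (\<forall>x\<in>U. ((\<lambda>t. pr (u (x(i := t))) (v (x(i := t)))) has_vector_derivative f' x) (at (x i))) \<and> Ckv n k U f'"
    if i: "i < n" for i
  proof -
    obtain u' v' where d: "\<forall>x\<in>U. ((\<lambda>t. u (x(i := t))) has_vector_derivative u' x) (at (x i))"
      "\<forall>x\<in>U. ((\<lambda>t. v (x(i := t))) has_vector_derivative v' x) (at (x i))"
      and c: "Ckv n k U u'" "Ckv n k U v'" using Suc.prems i by (metis Ckv.simps(2))
    have "((\<lambda>t. pr (u (x(i := t))) (v (x(i := t)))) has_vector_derivative
        (pr (u x) (v' x) + pr (u' x) (v x))) (at (x i))" if "x \<in> U" for x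
      using bounded_bilinear.has_vector_derivative[OF bl d(1)[rule_format, OF that] d(2)[rule_format, OF that]]
      by simp
    moreover have "Ckv n k U (\<lambda>x. pr (u x) (v' x) + pr (u' x) (v x))"
      by (intro Ckv_add Suc.IH c Ckv_SucD[OF Suc.prems(1)] Ckv_SucD[OF Suc.prems(2)])
    ultimately show ?thesis by (intro exI[of _ "\<lambda>x. pr (u x) (v' x) + pr (u' x) (v x)"]) auto
  qed
  then show ?case using Suc.prems by (auto intro: bounded_bilinear.continuous_on[OF bl])
qed

lemmas Ckv_mult = Ckv_bilinear[OF bounded_bilinear_mult]
lemmas Ckv_scaleR = Ckv_bilinear[OF bounded_bilinear_scaleR]

lemma Ckv_bounded_linear:
  assumes bl: "bounded_linear f"
  shows "Ckv n k U u \<Longrightarrow> Ckv n k U (\<lambda>x. f (u x))"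
proof (induction k arbitrary: u)
  case 0
  then show ?case by (auto intro: bounded_linear.continuous_on[OF bl])
next
  case (Suc k)
  have "\<exists>f'. (\<forall>x\<in>U. ((\<lambda>t. f (u (x(i := t)))) has_vector_derivative f' x) (at (x i))) \<and> Ckv n k U f'"
    if i: "i < n" for i
  proof -
    obtain u' where d: "\<forall>x\<in>U. ((\<lambda>t. u (x(i := t))) has_vector_derivative u' x) (at (x i))"
      and c: "Ckv n k U u'" using Suc.prems i by (metis Ckv.simps(2))
    show ?thesis by (rule exI[of _ "\<lambda>x. f (u' x)"])
      (use d Suc.IH[OF c] in \<open>auto intro: bounded_linear.has_vector_derivative[OF bl]\<close>)
  qed
  then show ?case using Suc.prems by (auto intro: bounded_linear.continuous_on[OF bl])
qed

text \<open>The argument of \<open>f\<close> is a combination of fixed vectors \<open>b j\<close>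
  with scalar coefficient functions. The chain rule then evaluates the derivative of
  \<open>f\<close> only in the constant directions \<open>b j\<close>, where it is again a
  \<open>pser\<close>, so the induction over \<open>k\<close> closes for arbitrary
  \<open>f\<close>.\<close>

lemma Ckv_pser:
  fixes f :: "'a::{real_normed_algebra_1,banach} \<Rightarrow> 'a"
  assumes "finite J"
    and R: "\<And>x. x \<in> U \<Longrightarrow> norm (\<Sum>j\<in>J. y j x *\<^sub>R b j) < R"
  shows "pser R f \<Longrightarrow> (\<And>j. j \<in> J \<Longrightarrow> Ckv n k U (y j)) \<Longrightarrow> Ckv n k U (\<lambda>x. f (\<Sum>j\<in>J. y j x *\<^sub>R b j))"
proof (induction k arbitrary: f)
  have cont: "continuous_on U (\<lambda>x. f (\<Sum>j\<in>J. y j x *\<^sub>R b j))"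
    if ps: "pser R f" and y: "\<And>j. j \<in> J \<Longrightarrow> continuous_on U (y j)" for f :: "'a \<Rightarrow> 'a"
  proof -
    obtain f' where f': "\<And>x. norm x < R \<Longrightarrow> (f has_derivative f' x) (at x)"
      using pser_has_derivative[OF ps] by blast
    have "continuous_on (ball 0 R) f"
    proof (intro continuous_at_imp_continuous_on ballI)
      fix x :: 'a assume "x \<in> ball 0 R"
      then have "norm x < R" by simp
      from has_derivative_continuous[OF f'[OF this]] show "isCont f x" .
    qed
    moreover have "continuous_on U (\<lambda>x. \<Sum>j\<in>J. y j x *\<^sub>R b j)"
      by (intro continuous_intros y)
    ultimately show ?thesis by (rule continuous_on_compose2) (use R in auto)
  qed
  {
    case 0
    then show ?case using cont by simp
  next
    case (Suc k)
    obtain f' where f': "\<And>x. norm x < R \<Longrightarrow> (f has_derivative f' x) (at x)"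
      and pf': "\<And>v. pser R (\<lambda>x. f' x v)"
      using pser_has_derivative[OF Suc.prems(1)] by blast
    let ?u = "\<lambda>x. \<Sum>j\<in>J. y j x *\<^sub>R b j"
    have "\<exists>g'. (\<forall>x\<in>U. ((\<lambda>t. f (?u (x(i := t)))) has_vector_derivative g' x) (at (x i))) \<and> Ckv n k U g'"
      if i: "i < n" for i
    proof -
      have "\<forall>j\<in>J. \<exists>y'. (\<forall>x\<in>U. ((\<lambda>t. y j (x(i := t))) has_vector_derivative y' x) (at (x i))) \<and> Ckv n k U y'"
        using Suc.prems(2) i by (metis Ckv.simps(2))
      then obtain y' where d: "\<And>j x. j \<in> J \<Longrightarrow> x \<in> U \<Longrightarrow> ((\<lambda>t. y j (x(i := t))) has_vector_derivative y' j x) (at (x i))"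
        and c: "\<And>j. j \<in> J \<Longrightarrow> Ckv n k U (y' j)" by metis
      have "((\<lambda>t. f (?u (x(i := t)))) has_vector_derivative (\<Sum>j\<in>J. y' j x *\<^sub>R f' (?u x) (b j))) (at (x i))"
        if x: "x \<in> U" for x
      proof -
        have "((\<lambda>t. ?u (x(i := t))) has_vector_derivative (\<Sum>j\<in>J. y' j x *\<^sub>R b j)) (at (x i))"
          by (intro has_vector_derivative_sum bounded_linear.has_vector_derivative[OF bounded_linear_scaleR_left] d x)
        moreover have fd: "(f has_derivative f' (?u (x(i := x i)))) (at (?u (x(i := x i))))"
          using f'[OF R[OF x]] by simp
        ultimately have "((\<lambda>t. f (?u (x(i := t)))) has_derivative
            (\<lambda>h. f' (?u (x(i := x i))) (h *\<^sub>R (\<Sum>j\<in>J. y' j x *\<^sub>R b j)))) (at (x i))"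
          unfolding has_vector_derivative_def by (rule has_derivative_compose)
        moreover have l: "linear (f' (?u x))" using f'[OF R[OF x]] by (rule has_derivative_linear)
        ultimately show ?thesis
          by (simp add: has_vector_derivative_def linear_scale linear_sum o_def)
      qed
      moreover have "Ckv n k U (\<lambda>x. \<Sum>j\<in>J. y' j x *\<^sub>R f' (?u x) (b j))"
      proof (rule Ckv_sum, rule Ckv_scaleR)
        fix j assume "j \<in> J"
        then show "Ckv n k U (y' j)" by (rule c)
        show "Ckv n k U (\<lambda>x. f' (?u x) (b j))"
          by (rule Suc.IH[OF pf' Ckv_SucD]) (rule Suc.prems(2))
      qed
      ultimately show ?thesis by (intro exI[of _ "\<lambda>x. \<Sum>j\<in>J. y' j x *\<^sub>R f' (?u x) (b j)"]) auto
    qed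
    moreover have "continuous_on U (\<lambda>x. f (?u x))"
      by (rule cont[OF Suc.prems(1) Ckv_imp_continuous_on[OF Suc.prems(2)]])
    ultimately show ?case by simp
  }
qed

section \<open>Metric estimates for the exponential\<close>

lemma norm_power_diff_le:
  fixes a b :: "'a::real_normed_algebra_1"
  assumes "norm a \<le> r" "norm b \<le> r"
  shows "norm (a ^ Suc n - b ^ Suc n) \<le> real (Suc n) * r ^ n * norm (a - b)"
proof (induction n)
  case (Suc n)
  have r: "r \<ge> 0" using assms(1) norm_ge_zero[of a] by linarith
  have "a ^ Suc (Suc n) - b ^ Suc (Suc n) = a * (a ^ Suc n - b ^ Suc n) + (a - b) * b ^ Suc n"
    by (simp add: algebra_simps)
  also have "norm \<dots> \<le> norm a * norm (a ^ Suc n - b ^ Suc n) + norm (a - b) * norm (b ^ Suc n)"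
    by (intro order.trans[OF norm_triangle_ineq] add_mono norm_mult_ineq)
  also have "\<dots> \<le> r * (real (Suc n) * r ^ n * norm (a - b)) + norm (a - b) * r ^ Suc n"
  proof (intro add_mono mult_mono assms Suc mult_left_mono)
    show "norm (b ^ Suc n) \<le> r ^ Suc n"
      by (rule order.trans[OF norm_power_ineq power_mono]) (use assms in auto)
  qed (use r in auto)
  also have "\<dots> = real (Suc (Suc n)) * r ^ Suc n * norm (a - b)" by (simp add: algebra_simps)
  finally show ?case .
qed simp

text \<open>The terms of degree at least two contribute at most
  \<open>(exp r - 1) * norm (a - b)\<close>, and
  \<open>exp r - 1 \<le> r + r\<^sup>2 \<le> 2 * r\<close>. So \<open>exp\<close> differs from the
  identity by a map with Lipschitz constant \<open>2 * r\<close>.\<close>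

lemma exp_near_identity:
  fixes a b :: "'a::{real_normed_algebra_1,banach}"
  assumes ar: "norm a \<le> r" "norm b \<le> r" and r: "r \<le> 1"
  shows "norm (exp a - exp b - (a - b)) \<le> 2 * r * norm (a - b)"
proof -
  have r0: "0 \<le> r" using ar(1) norm_ge_zero[of a] by linarith
  define f where "f n = a ^ n /\<^sub>R fact n - b ^ n /\<^sub>R fact n" for n
  have f: "f sums (exp a - exp b)"
    unfolding f_def by (intro sums_diff exp_converges)
  have "f 0 = 0" "f 1 = a - b" by (auto simp: f_def)
  then have "(\<lambda>n. f (n + 2)) sums (exp a - exp b - (a - b))"
    using sums_split_initial_segment[OF f, of 2] by (simp add: numeral_2_eq_2)
  then have eq: "exp a - exp b - (a - b) = (suminf (\<lambda>n. f (n + 2)))" by (rule sums_unique)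
  have E: "(\<lambda>n. r ^ n /\<^sub>R fact n) sums exp r" by (rule exp_converges)
  have E1: "(\<lambda>n. r ^ Suc n /\<^sub>R fact (Suc n)) sums (exp r - 1)"
    using sums_split_initial_segment[OF E, of 1] by simp
  have "exp r \<le> 1 + r + r\<^sup>2" by (rule exp_bound) (use r0 r in auto)
  then have e: "exp r - 1 \<le> 2 * r" using mult_left_mono[OF r r0] by (simp add: power2_eq_square)
  have b: "norm (f (n + 2)) \<le> (r ^ Suc n /\<^sub>R fact (Suc n)) * norm (a - b)" for n
  proof -
    have "f (n + 2) = (a ^ Suc (Suc n) - b ^ Suc (Suc n)) /\<^sub>R fact (Suc (Suc n))"
      by (simp add: f_def scaleR_diff_right)
    then have "norm (f (n + 2)) = norm (a ^ Suc (Suc n) - b ^ Suc (Suc n)) / fact (Suc (Suc n))"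
      by (simp add: divide_inverse mult.commute)
    also have "\<dots> \<le> (real (Suc (Suc n)) * r ^ Suc n * norm (a - b)) / fact (Suc (Suc n))"
      by (intro divide_right_mono norm_power_diff_le ar) auto
    also have "\<dots> = (real (Suc (Suc n)) / fact (Suc (Suc n))) * r ^ Suc n * norm (a - b)" by simp
    also have "real (Suc (Suc n)) / fact (Suc (Suc n)) = (1 / fact (Suc n) :: real)"
      by (simp only: fact_Suc[of "Suc n"] of_nat_mult of_nat_fact) (simp del: of_nat_Suc fact_Suc)
    finally show ?thesis by (simp add: field_simps del: fact_Suc power_Suc)
  qed
  have "norm (suminf (\<lambda>n. f (n + 2))) \<le> (suminf (\<lambda>n. (r ^ Suc n /\<^sub>R fact (Suc n)) * norm (a - b)))"
    by (rule norm_suminf_le[OF b]) (rule summable_mult2[OF sums_summable[OF E1]])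
  also have "\<dots> = (exp r - 1) * norm (a - b)"
    by (rule sums_unique[symmetric]) (rule sums_mult2[OF E1])
  also have "\<dots> \<le> 2 * r * norm (a - b)" by (intro mult_right_mono e) auto
  finally show ?thesis by (simp only: eq)
qed

text \<open>For \<open>r = 1/4\<close> the Lipschitz constant of the perturbation is
  \<open>1/2\<close>, which leaves half of \<open>norm (a - b)\<close>. This is the origin of the
  radius \<open>1/4\<close> on which \<open>exp\<close> is inverted below.\<close>

lemma exp_lower_Lipschitz:
  fixes a b :: "'a::{real_normed_algebra_1,banach}"
  assumes "norm a \<le> 1/4" "norm b \<le> 1/4"
  shows "norm (a - b) \<le> 2 * norm (exp a - exp b)"
  using exp_near_identity[OF assms] norm_triangle_ineq2[of "a - b" "exp a - exp b"]
  by (simp add: norm_minus_commute)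

lemma norm_exp_minus_one_le:
  fixes a :: "'a::{real_normed_algebra_1,banach}"
  assumes "norm a \<le> r" "r \<le> 1"
  shows "norm (exp a - 1) \<le> 3 * norm a"
proof -
  have "norm (exp a - exp 0 - (a - 0)) \<le> 2 * norm a * norm (a - 0)"
    by (rule exp_near_identity) (use assms in auto)
  also have "\<dots> \<le> 2 * norm a" using assms by (simp add: mult_left_le)
  finally show ?thesis using norm_triangle_sub[of "exp a - 1" a] by simp
qed

lemma exp_inject_small:
  fixes a b :: "'a::{real_normed_algebra_1,banach}"
  assumes "norm a \<le> 1/4" "norm b \<le> 1/4" "exp a = exp b"
  shows "a = b"
  using exp_lower_Lipschitz[OF assms(1,2)] assms(3) by simp

text \<open>On the line through \<open>x\<close> in a direction commuting with \<open>x\<close> the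
  exponential factors as \<open>exp x * exp (t *\<^sub>R v)\<close>, whose derivative at
  \<open>0\<close> is known.\<close>

lemma exp_has_derivative_commuting:
  fixes x v :: "'a::{real_normed_algebra_1,banach}"
  assumes d: "(exp has_derivative D) (at x)" and c: "x * v = v * x"
  shows "D v = exp x * v"
proof -
  have "((\<lambda>t. x + t *\<^sub>R v) has_vector_derivative v) (at 0)"
    by (auto intro!: derivative_eq_intros simp: has_vector_derivative_def)
  moreover have "(exp has_derivative D) (at (x + 0 *\<^sub>R v))" using d by simp
  ultimately have "((\<lambda>t. exp (x + t *\<^sub>R v)) has_derivative (\<lambda>h. D (h *\<^sub>R v))) (at 0)"
    unfolding has_vector_derivative_def by (rule has_derivative_compose)
  then have 1: "((\<lambda>t. exp (x + t *\<^sub>R v)) has_vector_derivative D v) (at 0)"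
    by (simp add: has_vector_derivative_def linear_scale[OF has_derivative_linear[OF d]])
  have "((\<lambda>t. exp x * exp (t *\<^sub>R v)) has_vector_derivative exp x * (exp (0 *\<^sub>R v) * v)) (at 0)"
    by (rule bounded_linear.has_vector_derivative[OF bounded_linear_mult_right exp_scaleR_has_vector_derivative_right])
  moreover have "exp (x + t *\<^sub>R v) = exp x * exp (t *\<^sub>R v)" for t
    by (rule exp_add_commuting) (simp add: c)
  ultimately have "((\<lambda>t. exp (x + t *\<^sub>R v)) has_vector_derivative exp x * v) (at 0)" by simp
  from vector_derivative_unique_at[OF 1 this] show ?thesis .
qed

lemma exp_differentiable:
  fixes x :: "'a::{real_normed_algebra_1,banach}"
  obtains D where "(exp has_derivative D) (at x)" "linear D"
proof -
  obtain f' where "\<And>y::'a. norm y < norm x + 1 \<Longrightarrow> (exp has_derivative f' y) (at y)"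
    using pser_has_derivative[OF pser_exp] by blast
  then have "(exp has_derivative f' x) (at x)" by simp
  with that has_derivative_linear show ?thesis by blast
qed

lemma continuous_on_exp_algebra [continuous_intros]:
  fixes f :: "'x::topological_space \<Rightarrow> 'a::{real_normed_algebra_1,banach}"
  assumes "continuous_on S f"
  shows "continuous_on S (\<lambda>x. exp (f x))"
proof -
  have "isCont exp y" for y :: 'a by (metis exp_differentiable has_derivative_continuous)
  then have "continuous_on UNIV (exp :: 'a \<Rightarrow> 'a)" by (simp add: continuous_at_imp_continuous_on)
  from continuous_on_compose2[OF this assms] show ?thesis by simp
qed

lemma exp_conj:
  fixes u v x :: "'a::{real_normed_algebra_1,banach}"
  assumes "v * u = 1" "u * v = 1"
  shows "exp (u * x * v) = u * exp x * v"
proof -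
  have "(u * x * v) ^ n = u * x ^ n * v" for n
  proof (induction n)
    case (Suc n)
    have "(u * x * v) * (u * x ^ n * v) = u * x * (v * u) * x ^ n * v" by (simp only: mult.assoc)
    then show ?case using Suc assms by (simp add: mult.assoc)
  qed (use assms in simp)
  then have "(u * x * v) ^ n /\<^sub>R fact n = u * (x ^ n /\<^sub>R fact n) * v" for n by simp
  moreover have "(\<lambda>n. u * (x ^ n /\<^sub>R fact n) * v) sums (u * exp x * v)"
    by (intro sums_mult sums_mult2 exp_converges)
  ultimately have "(\<lambda>n. (u * x * v) ^ n /\<^sub>R fact n) sums (u * exp x * v)" by simp
  then show ?thesis using exp_converges sums_unique2 by blast
qed

section \<open>The logarithm series\<close>

definition ln1p_coeff :: "nat \<Rightarrow> real" where
  "ln1p_coeff n = (if n = 0 then 0 else - ((- 1) ^ n) / real n)"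

definition lnb :: "'a::{real_normed_algebra_1,banach} \<Rightarrow> 'a" where
  "lnb y = (suminf (\<lambda>n. ln1p_coeff n *\<^sub>R (y - 1) ^ n))"

lemma ln1p_coeff_zero_power: "ln1p_coeff n *\<^sub>R (0::'a::real_normed_algebra_1) ^ n = 0"
  by (cases n) (auto simp: ln1p_coeff_def)

lemma ln1p_coeff_le: "\<bar>ln1p_coeff n\<bar> \<le> 1"
  by (simp add: ln1p_coeff_def abs_div power_abs field_simps)

lemma ln1p_coeff_power_le: "\<bar>ln1p_coeff n\<bar> * r ^ n \<le> r ^ n" if "0 \<le> r" for r :: real
  using mult_right_mono[OF ln1p_coeff_le, of "r ^ n" n] that by simp

lemma ln1p_summable_abs: "0 \<le> r \<Longrightarrow> r < 1 \<Longrightarrow> summable (\<lambda>n. \<bar>ln1p_coeff n\<bar> * r ^ n)"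
  by (rule summable_comparison_test'[of "\<lambda>n. r ^ n"])
     (auto intro: summable_geometric ln1p_coeff_power_le simp: abs_mult)

lemma pser_ln1p: "pser 1 (\<lambda>z. lnb (1 + z))"
  unfolding lnb_def add_diff_cancel_left' by (rule pser_power_series) (rule ln1p_summable_abs)

lemma ln1p_summable:
  fixes z :: "'a::{real_normed_algebra_1,banach}"
  assumes "norm z < 1"
  shows "summable (\<lambda>n. ln1p_coeff n *\<^sub>R z ^ n)"
proof (rule summable_comparison_test')
  show "summable (\<lambda>n. \<bar>ln1p_coeff n\<bar> * norm z ^ n)" using assms by (intro ln1p_summable_abs) auto
  show "norm (ln1p_coeff n *\<^sub>R z ^ n) \<le> \<bar>ln1p_coeff n\<bar> * norm z ^ n" for n
    by (auto intro: mult_left_mono norm_power_ineq)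
qed

text \<open>With radius \<open>1/8\<close> the geometric majorant \<open>s / (1 - s)\<close> is
  \<open>1/7\<close>, which stays below the radius \<open>1/4\<close> on which \<open>exp\<close> is
  injective.\<close>

lemma norm_lnb_less:
  fixes y :: "'a::{real_normed_algebra_1,banach}"
  assumes "norm (y - 1) \<le> 1/8"
  shows "norm (lnb y) < 1/4"
proof -
  define s :: real where "s = 1/8"
  have s: "0 \<le> s" "s < 1" "norm (y - 1) \<le> s" using assms by (auto simp: s_def)
  have "norm (lnb y) \<le> (suminf (\<lambda>n. if n = 0 then 0 else s ^ n))"
    unfolding lnb_def
  proof (rule norm_suminf_le)
    fix n
    have "norm (ln1p_coeff n *\<^sub>R (y - 1) ^ n) \<le> \<bar>ln1p_coeff n\<bar> * s ^ n"
      by (auto intro!: mult_left_mono order.trans[OF norm_power_ineq] power_mono s)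
    also have "\<dots> \<le> (if n = 0 then 0 else s ^ n)"
      using ln1p_coeff_power_le[OF s(1), of n] by (cases "n = 0") (auto simp: ln1p_coeff_def)
    finally show "norm (ln1p_coeff n *\<^sub>R (y - 1) ^ n) \<le> (if n = 0 then 0 else s ^ n)" .
    show "summable (\<lambda>n. if n = 0 then 0 else s ^ n)"
      by (rule summable_comparison_test'[of "\<lambda>n. s ^ n"]) (use s in \<open>auto intro: summable_geometric\<close>)
  qed
  also have "\<dots> = s / (1 - s)"
  proof -
    have "(\<lambda>n. s * s ^ n) sums (s * (1 / (1 - s)))"
      by (intro sums_mult geometric_sums) (use s in auto)
    then have "(\<lambda>n. if Suc n = 0 then 0 else s ^ Suc n) sums (s / (1 - s))" by simp
    from sums_Suc[OF this] show ?thesis by (simp add: sums_iff)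
  qed
  also have "\<dots> < 1/4" by (simp add: s_def)
  finally show ?thesis .
qed

lemma suminf_commute:
  fixes f :: "nat \<Rightarrow> 'a::{real_normed_algebra_1,banach}"
  assumes "summable f" "\<And>n. f n * z = z * f n"
  shows "suminf f * z = z * suminf f"
  using suminf_mult2[OF assms(1), of z] suminf_mult[OF assms(1), of z] assms(2) by simp

text \<open>The composition of the two series is never expanded. Along the segment from
  \<open>1\<close> to \<open>y\<close> the logarithm \<open>g\<close> satisfies
  \<open>(1 + t *\<^sub>R z) * g' t = z\<close>; consequently
  \<open>exp (- g t) * (1 + t *\<^sub>R z)\<close> has derivative zero and keeps its initial value
  \<open>1\<close>.\<close>

lemma exp_lnb:
  fixes y :: "'a::{real_normed_algebra_1,banach}"
  assumes "norm (y - 1) < 1"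
  shows "exp (lnb y) = y"
proof -
  define z where "z = y - 1"
  have z: "norm z < 1" using assms by (simp add: z_def)
  let ?L = "\<lambda>x::'a. suminf (\<lambda>n. ln1p_coeff n *\<^sub>R x ^ n)"
  have tz: "norm (t *\<^sub>R z) < 1" if "t \<in> {0..1}" for t
    using that z by (auto intro: le_less_trans[OF mult_left_le_one_le])
  have psL: "pser 1 ?L" by (rule pser_power_series) (rule ln1p_summable_abs)
  define g where "g t = ?L (t *\<^sub>R z)" for t
  have sg: "summable (\<lambda>n. ln1p_coeff n *\<^sub>R (t *\<^sub>R z) ^ n)" if "t \<in> {0..1}" for t
    using ln1p_summable[OF tz[OF that]] .
  \<comment> \<open>Termwise differentiation of the series along the line through \<open>z\<close>, where everything commutes.\<close>
  have "\<exists>g'. (g has_vector_derivative g') (at t) \<and> (1 + t *\<^sub>R z) * g' = z \<and> (\<forall>x. x * z = z * x \<longrightarrow> x * g' = g' * x)"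
    if t: "t \<in> {0..1}" for t
  proof -
    \<comment> \<open>Terms of the geometric series for \<open>z\<close> divided by
      \<open>1 + t *\<^sub>R z\<close>. Telescoping multiplies its sum by
      \<open>1 + t *\<^sub>R z\<close> without inverting anything.\<close>
    define d where "d n = (- 1) ^ n *\<^sub>R (t ^ n *\<^sub>R z ^ Suc n)" for n
    have nd: "norm (d n) \<le> norm (t *\<^sub>R z) ^ n * norm z" for n
    proof -
      have "norm (d n) = \<bar>t\<bar> ^ n * norm (z ^ n * z)" by (simp add: d_def power_abs power_commutes abs_mult)
      also have "\<dots> \<le> \<bar>t\<bar> ^ n * (norm z ^ n * norm z)"
        by (intro mult_left_mono order.trans[OF norm_mult_ineq] mult_right_mono norm_power_ineq) auto
      finally show ?thesis by (simp add: power_mult_distrib mult_ac)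
    qed
    have sgeo: "summable (\<lambda>n. norm (t *\<^sub>R z) ^ n * norm z)"
      by (rule summable_mult2, rule summable_geometric) (use tz[OF t] in simp)
    have sd: "summable d" by (rule summable_comparison_test'[OF sgeo nd])
    have d0: "d \<longlonglongrightarrow> 0" by (rule summable_LIMSEQ_zero[OF sd])
    have "(\<lambda>n. d n - d (Suc n)) sums (d 0 - 0)" by (rule telescope_sums'[OF d0])
    moreover have "d n - d (Suc n) = (1 + t *\<^sub>R z) * d n" for n
      by (simp add: d_def algebra_simps)
    ultimately have "(\<lambda>n. (1 + t *\<^sub>R z) * d n) sums z" by (simp add: d_def)
    then have dz: "(1 + t *\<^sub>R z) * suminf d = z"
      using suminf_mult[OF sd] by (metis sums_unique)
    have cd: "x * suminf d = suminf d * x" if x: "x * z = z * x" for x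
    proof -
      have "x * z ^ k = z ^ k * x" for k
        by (rule power_commuting_commutes[symmetric]) (simp add: x)
      then have "d n * x = x * d n" for n by (simp add: d_def del: power_Suc)
      from suminf_commute[OF sd this] show ?thesis by simp
    qed
    have "(g has_vector_derivative suminf d) (at t)"
    proof -
      define p where "p n x = ln1p_coeff n *\<^sub>R x ^ n" for n and x :: 'a
      have hp: "hpoly n \<bar>ln1p_coeff n\<bar> (p n)" for n unfolding p_def by (rule hpoly_scaleR_power)
      obtain p' where dp: "\<And>n x. (p n has_derivative p' n x) (at x)"
        and hp': "\<And>n v. hpoly (n - 1) (n * \<bar>ln1p_coeff n\<bar> * norm v) (\<lambda>x. p' n x v)"
        using hpoly_has_derivative[OF hp] by metis
      have lin: "((\<lambda>t. t *\<^sub>R z) has_derivative (\<lambda>h. h *\<^sub>R z)) (at t)"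
        by (auto intro!: derivative_eq_intros)
      \<comment> \<open>The derivatives \<open>p'\<close> were only obtained as existing;
        differentiating along the line identifies their value in the direction
        \<open>z\<close>.\<close>
      have pp: "p' n (t *\<^sub>R z) z = (real n * t ^ (n - 1) * ln1p_coeff n) *\<^sub>R z ^ n" for n
      proof -
        have "((\<lambda>t. p n (t *\<^sub>R z)) has_derivative (\<lambda>h. p' n (t *\<^sub>R z) (h *\<^sub>R z))) (at t)"
          by (rule has_derivative_compose[OF lin dp])
        then have "((\<lambda>t. p n (t *\<^sub>R z)) has_vector_derivative p' n (t *\<^sub>R z) z) (at t)"
          by (simp add: has_vector_derivative_def linear_scale[OF has_derivative_linear[OF dp]])
        moreover have "p n (t *\<^sub>R z) = (ln1p_coeff n * t ^ n) *\<^sub>R z ^ n" for t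
          by (simp add: p_def scaleR_power)
        moreover have "((\<lambda>t. (ln1p_coeff n * t ^ n) *\<^sub>R z ^ n) has_vector_derivative
            (real n * t ^ (n - 1) * ln1p_coeff n) *\<^sub>R z ^ n) (at t)"
          unfolding has_vector_derivative_def by (auto intro!: derivative_eq_intros simp: mult_ac)
        ultimately show ?thesis using vector_derivative_unique_at by fastforce
      qed
      note ser = hpoly_series_has_derivative[of "\<lambda>n. \<bar>ln1p_coeff n\<bar>" p 1 ?L p', OF hp ln1p_summable_abs _ dp hp']
      have f': "(?L has_derivative (\<lambda>v. suminf (\<lambda>n. p' n (t *\<^sub>R z) v))) (at (t *\<^sub>R z))"
        by (rule ser(2)) (use tz[OF t] in \<open>auto simp: p_def\<close>)
      have "p' (Suc n) (t *\<^sub>R z) z = d n" for n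
        by (simp add: pp d_def ln1p_coeff_def)
      then have fd: "(suminf (\<lambda>n. p' n (t *\<^sub>R z) z)) = suminf d"
        using suminf_split_head[OF ser(1)[OF _ _ _ tz[OF t], of z]] pp[of 0] by (simp add: p_def)
      from has_derivative_compose[OF lin f'] have "(g has_derivative (\<lambda>h. (suminf (\<lambda>n. p' n (t *\<^sub>R z) (h *\<^sub>R z))))) (at t)"
        by (simp add: g_def[abs_def])
      moreover have "(suminf (\<lambda>n. p' n (t *\<^sub>R z) (h *\<^sub>R z))) = h *\<^sub>R (suminf (\<lambda>n. p' n (t *\<^sub>R z) z))" for h
        using linear_scale[OF has_derivative_linear[OF f']] by simp
      ultimately show ?thesis by (simp add: has_vector_derivative_def fd)
    qed
    with dz cd show ?thesis by blast
  qed
  then obtain g' where g': "\<And>t. t \<in> {0..1} \<Longrightarrow> (g has_vector_derivative g' t) (at t)"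
    and zg': "\<And>t. t \<in> {0..1} \<Longrightarrow> (1 + t *\<^sub>R z) * g' t = z"
    and cg': "\<And>t x. t \<in> {0..1} \<Longrightarrow> x * z = z * x \<Longrightarrow> x * g' t = g' t * x" by metis
  have gz: "g t * z = z * g t" if "t \<in> {0..1}" for t
    unfolding g_def by (rule suminf_commute[OF sg[OF that]]) (simp add: power_commutes)
  define h where "h t = exp (- g t) * (1 + t *\<^sub>R z)" for t
  have "(h has_vector_derivative 0) (at t within {0..1})" if t: "t \<in> {0..1}" for t
  proof -
    obtain D where D: "(exp has_derivative D) (at (- g t))" "linear D" by (rule exp_differentiable)
    have gg: "g t * g' t = g' t * g t" using cg'[OF t gz[OF t]] .
    have "((\<lambda>t. - g t) has_vector_derivative - g' t) (at t)"
      by (rule has_vector_derivative_minus[OF g'[OF t]])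
    then have "((\<lambda>t. exp (- g t)) has_derivative (\<lambda>h. D (h *\<^sub>R (- g' t)))) (at t)"
      unfolding has_vector_derivative_def using D(1) by (rule has_derivative_compose)
    \<comment> \<open>This formula for the derivative of \<open>exp\<close> needs the direction to
      commute with the point, which is why commutation with \<open>g' t\<close> was carried
      along.\<close>
    moreover have "D (- g' t) = exp (- g t) * (- g' t)"
      by (rule exp_has_derivative_commuting[OF D(1)]) (simp add: gg)
    ultimately have "((\<lambda>t. exp (- g t)) has_vector_derivative exp (- g t) * (- g' t)) (at t)"
      by (simp add: has_vector_derivative_def linear_scale[OF D(2)] linear_neg[OF D(2)])
    moreover have "((\<lambda>t. 1 + t *\<^sub>R z) has_vector_derivative z) (at t)"
      by (auto intro!: derivative_eq_intros simp: has_vector_derivative_def)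
    ultimately have "(h has_vector_derivative
        (exp (- g t) * z + exp (- g t) * (- g' t) * (1 + t *\<^sub>R z))) (at t)"
      unfolding h_def by (rule has_vector_derivative_mult)
    moreover have "g' t * (1 + t *\<^sub>R z) = z"
      using zg'[OF t] cg'[OF t, of z] by (simp add: distrib_left distrib_right)
    ultimately show ?thesis
      by (simp add: mult.assoc has_vector_derivative_at_within)
  qed
  then obtain c where "\<And>t. t \<in> {0..1} \<Longrightarrow> h t = c"
    using has_vector_derivative_zero_constant[of "{0..1::real}" h] by auto
  then have "h 1 = h 0" by simp
  moreover have "h 0 = 1"
  proof -
    have "g 0 = 0" by (simp add: g_def ln1p_coeff_zero_power)
    then show ?thesis by (simp add: h_def)
  qed
  ultimately have "exp (- g 1) * (1 + z) = 1" by (simp add: h_def)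
  then have "exp (g 1) * (exp (- g 1) * (1 + z)) = exp (g 1)" by simp
  then have "1 + z = exp (g 1)" by (simp add: mult.assoc[symmetric] exp_minus_inverse)
  then show ?thesis by (simp add: g_def lnb_def z_def)
qed

text \<open>Both sides have norm at most \<open>1/4\<close> and the same exponential.\<close>

lemma lnb_exp:
  fixes a :: "'a::{real_normed_algebra_1,banach}"
  assumes "norm a \<le> 1/4" "norm (exp a - 1) \<le> 1/8"
  shows "lnb (exp a) = a"
  using exp_inject_small[OF less_imp_le[OF norm_lnb_less[OF assms(2)]] assms(1)] exp_lnb[of "exp a"] assms(2) by simp

text \<open>Differentiate \<open>exp (lnb y) = y\<close> at \<open>1\<close>: the derivative of
  \<open>exp\<close> at \<open>0\<close> is the identity, so the chain rule leaves no other
  possibility.\<close>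

lemma lnb_has_derivative_1:
  "(lnb has_derivative (\<lambda>v. v)) (at (1::'a::{real_normed_algebra_1,banach}))"
proof -
  obtain L' where L': "\<And>x::'a. norm x < 1 \<Longrightarrow> ((\<lambda>z. lnb (1 + z)) has_derivative L' x) (at x)"
    using pser_has_derivative[OF pser_ln1p] by blast
  have shift: "((\<lambda>y::'a. y - 1) has_derivative (\<lambda>v. v)) (at 1)"
    by (auto intro!: derivative_eq_intros)
  have "((\<lambda>z. lnb (1 + z)) has_derivative L' 0) (at ((1::'a) - 1))" using L'[of 0] by simp
  from has_derivative_compose[OF shift this] have d: "(lnb has_derivative L' 0) (at (1::'a))" by simp
  have ln1: "lnb 1 = (0::'a)" by (simp add: lnb_def ln1p_coeff_zero_power)
  obtain D where D: "(exp has_derivative D) (at (0::'a))" by (rule exp_differentiable)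
  have Dv: "D v = v" for v using exp_has_derivative_commuting[OF D, of v] by simp
  have "(exp has_derivative D) (at (lnb (1::'a)))" using D ln1 by simp
  from has_derivative_compose[OF d this] have "((\<lambda>y::'a. exp (lnb y)) has_derivative L' 0) (at 1)"
    by (simp add: Dv)
  then have "((\<lambda>y::'a. y) has_derivative L' 0) (at 1)"
  proof (rule has_derivative_transform_within_open)
    show "open (ball (1::'a) 1)" "(1::'a) \<in> ball 1 1" by auto
    show "exp (lnb y) = y" if "y \<in> ball 1 1" for y :: 'a
      using that by (intro exp_lnb) (simp add: dist_norm norm_minus_commute)
  qed
  from has_derivative_unique[OF this has_derivative_ident] d show ?thesis by simp
qed

section \<open>One-parameter groups in a Banach algebra\<close>

text \<open>Multiplication by \<open>exp (t *\<^sub>R (- A))\<close> from the right makes the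
  derivative vanish. This is the uniqueness theorem for the equation \<open>X' = X A\<close>, used
  for one-parameter groups here and for Kronecker products of characters later.\<close>

lemma vector_derivative_right_mult_imp_exp:
  fixes X :: "real \<Rightarrow> 'a::{real_normed_algebra_1,banach}"
  assumes "\<And>t. (X has_vector_derivative X t * A) (at t)"
  shows "X t = X 0 * exp (t *\<^sub>R A)"
proof -
  define Y where "Y t = X t * exp (t *\<^sub>R (- A))" for t
  have "(Y has_vector_derivative 0) (at t within UNIV)" for t
  proof -
    have "(Y has_vector_derivative (X t * (- A * exp (t *\<^sub>R (- A))) + (X t * A) * exp (t *\<^sub>R (- A)))) (at t)"
      unfolding Y_def by (rule has_vector_derivative_mult[OF assms exp_scaleR_has_vector_derivative_left])
    then show ?thesis by (simp add: mult.assoc)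
  qed
  then obtain c where "\<And>t. Y t = c"
    using has_vector_derivative_zero_constant[of UNIV Y] by auto
  then have "Y t = Y 0" by simp
  then have "X t * exp (- (t *\<^sub>R A)) = X 0" by (simp add: Y_def)
  then have "X 0 * exp (t *\<^sub>R A) = X t * (exp (- (t *\<^sub>R A)) * exp (t *\<^sub>R A))" by (simp add: mult.assoc[symmetric])
  also have "exp (- (t *\<^sub>R A)) * exp (t *\<^sub>R A) = 1"
    using exp_minus_inverse[of "- (t *\<^sub>R A)"] by simp
  finally show ?thesis by simp
qed

lemma continuous_one_parameter_exp:
  fixes X :: "real \<Rightarrow> 'a::{real_normed_algebra_1,banach}"
  assumes cont: "continuous_on UNIV X" and hom: "\<And>s t. X (s + t) = X s * X t" and one: "X 0 = 1"
  obtains A where "\<And>t. X t = exp (t *\<^sub>R A)" "(X has_vector_derivative A) (at 0)"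
proof -
  have contS: "continuous_on S X" for S using cont continuous_on_subset by blast
  have "isCont X 0" using cont by (simp add: continuous_on_eq_continuous_at)
  then obtain e where e: "e > 0" "\<And>s. \<bar>s\<bar> < e \<Longrightarrow> norm (X s - 1) < 1/2"
    unfolding continuous_at_eps_delta by (auto simp: one dist_norm dest: spec[of _ "1/2"])
  define \<tau> where "\<tau> = e / 2"
  have \<tau>: "\<tau> > 0" "\<tau> < e" using e by (auto simp: \<tau>_def)
  \<comment> \<open>The mean of \<open>X\<close> over \<open>[0, \<tau>]\<close> is close to \<open>1\<close>, hence invertible, and \<open>X t\<close> times it is differentiable in \<open>t\<close>.\<close>
  define J where "J = integral {0..\<tau>} X"
  have intX: "X integrable_on {a..b}" for a b by (rule integrable_continuous_real[OF contS])
  have "norm (J - \<tau> *\<^sub>R 1) \<le> 1/2 * \<tau>"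
  proof -
    have "J - \<tau> *\<^sub>R 1 = integral {0..\<tau>} (\<lambda>s. X s - 1)"
      unfolding J_def using \<tau> by (subst integral_diff[OF intX]) auto
    also have "norm \<dots> \<le> 1/2 * (\<tau> - 0)"
      by (rule integral_bound) (use \<tau> e(2) in \<open>auto intro!: continuous_intros contS simp: less_imp_le\<close>)
    finally show ?thesis by simp
  qed
  then have "norm ((1/\<tau>) *\<^sub>R (J - \<tau> *\<^sub>R 1)) \<le> 1/2"
    using \<tau> by (simp add: divide_simps)
  then have "norm ((1/\<tau>) *\<^sub>R J - 1) < 1" using \<tau> by (simp add: scaleR_diff_right)
  from exp_lnb[OF this] have eJ: "exp (lnb ((1/\<tau>) *\<^sub>R J)) = (1/\<tau>) *\<^sub>R J" .
  \<comment> \<open>The mean of \<open>X\<close> has distance less than \<open>1\<close> from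
    \<open>1\<close>, so it is an exponential and can be inverted by changing the sign of its
    logarithm. The factor \<open>1/\<tau>\<close> passes from the mean back to the integral
    \<open>J\<close>.\<close>
  define K where "K = (1/\<tau>) *\<^sub>R exp (- lnb ((1/\<tau>) *\<^sub>R J))"
  have JK: "J * K = 1"
    using exp_minus_inverse[of "lnb ((1/\<tau>) *\<^sub>R J)"] by (simp add: eJ K_def)
  \<comment> \<open>The base point lies far enough to the left that \<open>G\<close> is
    differentiable at \<open>t\<close> and at \<open>\<tau> + t\<close> for all
    \<open>t > - 1\<close>, hence on a neighbourhood of \<open>0\<close>.\<close>
  define G where "G t = integral {- 1 - \<tau>..t} X" for t
  have Gd: "(G has_vector_derivative X t) (at t)" if "t > - 1 - \<tau>" for t
  proof -
    have "(G has_vector_derivative X t) (at t within {- 1 - \<tau>..t + 1})"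
      unfolding G_def by (rule integral_has_vector_derivative[OF contS]) (use that in auto)
    moreover have "at t within {- 1 - \<tau>..t + 1} = at t"
      by (rule at_within_interior) (use that in auto)
    ultimately show ?thesis by simp
  qed
  have XG: "X t = (G (\<tau> + t) - G t) * K" if "t > - 1" for t
  proof -
    have "X t * J = integral {0..\<tau>} (\<lambda>s. X t * X s)"
      unfolding J_def by (rule integral_unique[symmetric], rule has_integral_mult_right, rule integrable_integral[OF intX])
    also have "\<dots> = integral {0..\<tau>} (X \<circ> (+) t)"
      by (simp add: o_def hom)
    also have "\<dots> = integral {0 + t..\<tau> + t} X" by (rule integral_shift_Icc_real)
    also have "\<dots> = G (\<tau> + t) - G t"
      unfolding G_def using Henstock_Kurzweil_Integration.integral_combine[of "- 1 - \<tau>" t "\<tau> + t" X] intX that \<tau>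
      by (simp add: algebra_simps)
    finally have "X t * J * K = (G (\<tau> + t) - G t) * K" by simp
    then show ?thesis by (simp add: mult.assoc JK)
  qed
  define A where "A = (X \<tau> - X 0) * K"
  have d0: "(X has_vector_derivative A) (at 0)"
  proof -
    have "((\<lambda>t. \<tau> + t) has_vector_derivative 1) (at 0)"
      by (auto intro!: derivative_eq_intros simp: has_vector_derivative_def)
    moreover have "(G has_vector_derivative X \<tau>) (at (\<tau> + 0))" using Gd[of \<tau>] \<tau> by simp
    ultimately have "((\<lambda>t. G (\<tau> + t)) has_vector_derivative X \<tau>) (at 0)"
      using vector_diff_chain_at[of "\<lambda>t. \<tau> + t" 1 0 G "X \<tau>"] by (simp add: o_def)
    moreover have "(G has_vector_derivative X 0) (at 0)" using Gd[of 0] \<tau> by simp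
    ultimately have "((\<lambda>t. G (\<tau> + t) - G t) has_vector_derivative (X \<tau> - X 0)) (at 0)"
      by (rule has_vector_derivative_diff)
    then have "((\<lambda>t. (G (\<tau> + t) - G t) * K) has_vector_derivative A) (at 0)"
      unfolding A_def by (rule bounded_linear.has_vector_derivative[OF bounded_linear_mult_left])
    then show ?thesis
      by (rule has_vector_derivative_transform_within_open[of _ _ _ "{- 1<..}"]) (auto simp: XG)
  qed
  \<comment> \<open>The group law moves the derivative at \<open>0\<close> to every other
    parameter.\<close>
  have d: "(X has_vector_derivative X t * A) (at t)" for t
  proof -
    have "((\<lambda>s. s - t) has_vector_derivative 1) (at t)"
      by (auto intro!: derivative_eq_intros simp: has_vector_derivative_def)
    moreover have "(X has_vector_derivative A) (at (t - t))" using d0 by simp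
    ultimately have "((\<lambda>s. X (s - t)) has_vector_derivative A) (at t)"
      using vector_diff_chain_at[of "\<lambda>s. s - t" 1 t X A] by (simp add: o_def)
    then have "((\<lambda>s. X t * X (s - t)) has_vector_derivative X t * A) (at t)"
      by (rule bounded_linear.has_vector_derivative[OF bounded_linear_mult_right])
    moreover have "X t * X (s - t) = X s" for s using hom[of t "s - t"] by simp
    ultimately show ?thesis by simp
  qed
  have "X t = exp (t *\<^sub>R A)" for t
    using vector_derivative_right_mult_imp_exp[OF d, of t] one by simp
  with that d0 show ?thesis by blast
qed

text \<open>The curve \<open>exp (t *\<^sub>R A) - t *\<^sub>R A\<close> has derivative
  \<open>(exp (t *\<^sub>R A) - 1) * A\<close>, of norm at most \<open>\<delta> * norm A\<close>;
  then the mean value inequality applies. Nearness to \<open>1\<close> during the whole interval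
  excludes large generators whose exponential happens to return close to \<open>1\<close>.\<close>

lemma norm_generator_le:
  fixes A :: "'a::{real_normed_algebra_1,banach}"
  assumes \<tau>: "\<tau> > 0" and \<delta>: "\<And>t. t \<in> {0..\<tau>} \<Longrightarrow> norm (exp (t *\<^sub>R A) - 1) \<le> \<delta>"
  shows "(1 - \<delta>) * norm (\<tau> *\<^sub>R A) \<le> \<delta>"
proof -
  let ?f = "\<lambda>t. exp (t *\<^sub>R A) - t *\<^sub>R A"
  have "norm (?f \<tau> - ?f 0) \<le> (\<delta> * norm A) * norm (\<tau> - 0)"
  proof (rule differentiable_bound[of "{0..\<tau>}" ?f "\<lambda>t h. h *\<^sub>R (exp (t *\<^sub>R A) * A - A)"])
    fix t assume t: "t \<in> {0..\<tau>}"
    have "((\<lambda>t. t *\<^sub>R A) has_vector_derivative A) (at t)"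
      by (auto intro!: derivative_eq_intros simp: has_vector_derivative_def)
    from has_vector_derivative_diff[OF exp_scaleR_has_vector_derivative_right this, of A]
    show "(?f has_derivative (\<lambda>h. h *\<^sub>R (exp (t *\<^sub>R A) * A - A))) (at t within {0..\<tau>})"
      by (simp add: has_vector_derivative_def has_derivative_at_withinI)
    show "onorm (\<lambda>h. h *\<^sub>R (exp (t *\<^sub>R A) * A - A)) \<le> \<delta> * norm A"
    proof (rule onorm_le)
      fix h :: real
      have "norm (exp (t *\<^sub>R A) * A - A) \<le> norm (exp (t *\<^sub>R A) - 1) * norm A"
        using norm_mult_ineq[of "exp (t *\<^sub>R A) - 1" A] by (simp add: left_diff_distrib)
      also have "\<dots> \<le> \<delta> * norm A" by (intro mult_right_mono \<delta> t) auto
      finally have "\<bar>h\<bar> * norm (exp (t *\<^sub>R A) * A - A) \<le> \<bar>h\<bar> * (\<delta> * norm A)" by (rule mult_left_mono) auto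
      then show "norm (h *\<^sub>R (exp (t *\<^sub>R A) * A - A)) \<le> \<delta> * norm A * norm h" by (simp add: mult_ac)
    qed
  qed (use \<tau> in auto)
  then have "norm ((exp (\<tau> *\<^sub>R A) - 1) - \<tau> *\<^sub>R A) \<le> \<delta> * norm (\<tau> *\<^sub>R A)"
    using \<tau> by (simp add: algebra_simps)
  moreover have "norm (exp (\<tau> *\<^sub>R A) - 1) \<le> \<delta>" using \<delta>[of \<tau>] \<tau> by simp
  moreover have "norm (\<tau> *\<^sub>R A) \<le> norm (exp (\<tau> *\<^sub>R A) - 1) + norm ((exp (\<tau> *\<^sub>R A) - 1) - \<tau> *\<^sub>R A)"
    using norm_triangle_sub[of "\<tau> *\<^sub>R A" "exp (\<tau> *\<^sub>R A) - 1"] by (simp add: norm_minus_commute)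
  ultimately show ?thesis by (simp add: algebra_simps)
qed

section \<open>Continuity of inversion\<close>

text \<open>In \<open>y' - x' = - (y' * (y - x) * x')\<close> the third assumption bounds the
  right-hand side by half of \<open>norm y'\<close>. This yields
  \<open>norm y' \<le> 2 * norm x'\<close>, and the same identity then gives the estimate.\<close>

lemma inverse_norm_bound:
  fixes x y x' y' :: "'a::real_normed_algebra_1"
  assumes "x * x' = 1" "y' * y = 1" "norm (y - x) * norm x' \<le> 1/2"
  shows "norm (y' - x') \<le> 2 * norm x' * norm x' * norm (y - x)"
proof -
  have eq: "y' - x' = - (y' * (y - x) * x')"
    using assms(1,2) by (simp add: algebra_simps)
  have "norm (y' - x') \<le> norm y' * (norm (y - x) * norm x')"
    unfolding eq norm_minus_cancel mult.assoc
    by (rule order.trans[OF norm_mult_ineq mult_left_mono[OF norm_mult_ineq]]) auto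
  also have "\<dots> \<le> norm y' * (1/2)" by (intro mult_left_mono assms) auto
  finally have "norm (y' - x') \<le> norm y' / 2" by simp
  then have "norm y' \<le> 2 * norm x'" using norm_triangle_ineq2[of y' x'] by linarith
  then have "norm y' * (norm (y - x) * norm x') \<le> (2 * norm x') * (norm (y - x) * norm x')"
    by (intro mult_right_mono) auto
  with \<open>norm (y' - x') \<le> norm y' * (norm (y - x) * norm x')\<close> show ?thesis by (simp add: mult_ac)
qed

lemma tendsto_inverse_algebra:
  fixes x x' :: "'a::real_normed_algebra_1"
  assumes "(y \<longlongrightarrow> x) F" "x * x' = 1" "\<And>n. y' n * y n = 1"
  shows "(y' \<longlongrightarrow> x') F"
proof -
  have 0: "((\<lambda>n. norm (y n - x)) \<longlongrightarrow> 0) F"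
    using assms(1) by (simp add: LIM_zero tendsto_norm_zero)
  have "((\<lambda>n. norm (y n - x) * norm x') \<longlongrightarrow> 0 * norm x') F" by (intro tendsto_intros 0)
  then have "eventually (\<lambda>n. norm (y n - x) * norm x' < 1/2) F" by (rule order_tendstoD(2)) auto
  then have "eventually (\<lambda>n. norm (y' n - x') \<le> 2 * norm x' * norm x' * norm (y n - x)) F"
    by eventually_elim (rule inverse_norm_bound[OF assms(2,3)], simp)
  moreover have "((\<lambda>n. 2 * norm x' * norm x' * norm (y n - x)) \<longlongrightarrow> 0) F"
    using tendsto_mult_left[OF 0, of "2 * norm x' * norm x'"] by simp
  ultimately have "((\<lambda>n. y' n - x') \<longlongrightarrow> 0) F"
    by (rule Lim_null_comparison)
  then show ?thesis by (simp add: LIM_zero_iff)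
qed

section \<open>Finite-dimensional subspaces\<close>

\<comment> \<open>Dual bases, which describe a finite-dimensional subspace together with a bounded projection onto it.\<close>
locale frame =
  fixes d :: nat and b :: "nat \<Rightarrow> 'e::real_normed_vector" and c :: "nat \<Rightarrow> 'e \<Rightarrow> real"
  assumes bl: "i < d \<Longrightarrow> bounded_linear (c i)"
    and dual: "i < d \<Longrightarrow> j < d \<Longrightarrow> c i (b j) = (if i = j then 1 else 0)"
begin

definition comb :: "(nat \<Rightarrow> real) \<Rightarrow> 'e" where "comb a = (\<Sum>i<d. a i *\<^sub>R b i)"
definition proj :: "'e \<Rightarrow> 'e" where "proj x = comb (\<lambda>i. c i x)"
definition F :: "'e set" where "F = {x. proj x = x}"

lemma coord_comb: "i < d \<Longrightarrow> c i (comb a) = a i"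
  unfolding comb_def
  by (simp add: linear_sum[OF bounded_linear.linear[OF bl]] linear_scale[OF bounded_linear.linear[OF bl]]
      dual sum.delta if_distrib[of "\<lambda>x. _ * x"] cong: if_cong)

lemma bounded_linear_proj: "bounded_linear proj"
  unfolding proj_def comb_def
  by (rule bounded_linear_sum) (simp add: bounded_linear_scaleR_const bl)

lemma comb_cong: "(\<And>i. i < d \<Longrightarrow> a i = a' i) \<Longrightarrow> comb a = comb a'"
  by (simp add: comb_def)

lemma proj_comb [simp]: "proj (comb a) = comb a"
  unfolding proj_def by (rule comb_cong) (rule coord_comb)

lemma comb_F [simp]: "comb a \<in> F" by (simp add: F_def)

lemma proj_F [simp]: "proj x \<in> F" by (simp add: proj_def)

lemma F_eq: "F = range comb"
  proof
  show "F \<subseteq> range comb" unfolding F_def proj_def by (auto, metis rangeI)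
qed auto

lemma F_comb: "x \<in> F \<Longrightarrow> x = comb (\<lambda>i. c i x)" by (simp add: F_def proj_def)

lemma basis_F: "i < d \<Longrightarrow> b i \<in> F"
proof -
  assume i: "i < d"
  have "b i = comb (\<lambda>j. if j = i then 1 else 0)"
    unfolding comb_def using i by (simp add: if_distrib[of "\<lambda>x. x *\<^sub>R _"] cong: if_cong)
  then show ?thesis by simp
qed

lemma subspace_F: "subspace F"
proof -
  note l = bounded_linear.linear[OF bounded_linear_proj]
  show ?thesis unfolding subspace_def F_def by (simp add: linear_0[OF l] linear_add[OF l] linear_scale[OF l])
qed

lemmas F_0 = subspace_0[OF subspace_F]
  and F_add = subspace_add[OF subspace_F]
  and F_diff = subspace_diff[OF subspace_F]
  and F_scale = subspace_scale[OF subspace_F]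
  and F_sum = subspace_sum[OF subspace_F]

lemma closed_F: "closed F"
  unfolding F_def
  by (intro closed_Collect_eq linear_continuous_on[OF bounded_linear_proj] continuous_on_id)

lemma F_subset_span: "F \<subseteq> span (b ` {..<d})"
  unfolding F_eq comb_def by (auto intro!: span_sum intro: span_scale[OF span_base])

text \<open>A linear functional extended from a basis of \<open>D\<close> may be unbounded on the
  whole space. Composing it with the bounded projection onto \<open>F\<close> does not change it on
  \<open>D\<close> and makes it bounded; this is the purpose of \<open>c'\<close>.\<close>

lemma subframe:
  assumes D: "subspace D" "D \<subseteq> F"
  shows "\<exists>d' b' c'. frame d' b' c' \<and> frame.F d' b' c' = D"
proof -
  obtain B where B: "B \<subseteq> D" "independent B" "D \<subseteq> span B" by (rule maximal_independent_subset)
  have "finite B"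
    using independent_span_bound[of "b ` {..<d}" B] B D(2) F_subset_span by auto
  then obtain b' where b': "bij_betw b' {0..<card B} B" using ex_bij_betw_nat_finite by blast
  define d' where "d' = card B"
  have bB: "b' i \<in> B" if "i < d'" for i using bij_betwE[OF b'] that by (auto simp: d'_def)
  have b'_inj: "b' i = b' j \<longleftrightarrow> i = j" if "i < d'" "j < d'" for i j
    using bij_betw_imp_inj_on[OF b'] that by (auto simp: d'_def inj_on_def)
  have "\<forall>i. \<exists>r. linear r \<and> (\<forall>x\<in>B. r x = (if x = b' i then 1 else 0 :: real))"
    using linear_independent_extend[OF B(2)] by (intro allI) 
  then obtain r where r: "\<And>i. linear (r i)" "\<And>i x. x \<in> B \<Longrightarrow> r i x = (if x = b' i then 1 else 0 :: real)"
    by metis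
  define c' where "c' i x = (\<Sum>j<d. c j x * r i (b j))" for i x
  have c'r: "c' i x = r i x" if "x \<in> F" for i x
  proof -
    have "r i x = r i (comb (\<lambda>j. c j x))" using F_comb[OF that] by simp
    then show ?thesis by (simp add: comb_def c'_def linear_sum[OF r(1)] linear_scale[OF r(1)])
  qed
  have "bounded_linear (c' i)" for i
    unfolding c'_def by (rule bounded_linear_sum) (simp add: bounded_linear_mult_const bl)
  moreover have "c' i (b' j) = (if i = j then 1 else 0)" if "i < d'" "j < d'" for i j
    using c'r[of "b' j" i] bB[OF that(2)] B(1) D(2) r(2)[of "b' j" i] b'_inj[OF that] by auto
  ultimately interpret f': frame d' b' c' by (simp add: frame_def)
  have im: "b' ` {..<d'} = B" using b' by (auto simp: bij_betw_def d'_def atLeast0LessThan)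
  have "f'.F \<subseteq> D"
    using f'.F_subset_span span_minimal[of B D] B(1) D(1) by (auto simp: im)
  moreover have "D \<subseteq> f'.F"
  proof -
    have "B \<subseteq> f'.F" using f'.basis_F im by auto
    then show ?thesis using span_minimal[OF _ f'.subspace_F] B(3) by blast
  qed
  ultimately show ?thesis using f'.frame_axioms by blast
qed

lemma closed_subspace_of_F:
  assumes "subspace D" "D \<subseteq> F"
  shows "closed D"
  using subframe[OF assms] frame.closed_F by blast

lemma linear_extension:
  assumes D: "subspace D" "D \<subseteq> F"
    and add: "\<And>x y. x \<in> D \<Longrightarrow> y \<in> D \<Longrightarrow> T (x + y) = T x + (T y :: 'z::real_normed_vector)"
    and scale: "\<And>r x. x \<in> D \<Longrightarrow> T (r *\<^sub>R x) = r *\<^sub>R T x"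
  shows "\<exists>T'. bounded_linear T' \<and> (\<forall>x\<in>D. T' x = T x)"
proof -
  obtain d' b' c' where f: "frame d' b' c'" and FD: "frame.F d' b' c' = D" using subframe[OF D] by blast
  interpret f': frame d' b' c' by (rule f)
  have T0: "T 0 = 0" using scale[of 0 0] subspace_0[OF D(1)] by simp
  have sum: "T (\<Sum>i\<in>J. a i *\<^sub>R b' i) = (\<Sum>i\<in>J. a i *\<^sub>R T (b' i))" if "J \<subseteq> {..<d'}" for J a
    using finite_subset[OF that finite_lessThan] that
  proof (induction J rule: finite_induct)
    case (insert j J)
    have "b' i \<in> D" if "i \<in> insert j J" for i using f'.basis_F insert.prems that FD by auto
    then have "a j *\<^sub>R b' j \<in> D" "(\<Sum>i\<in>J. a i *\<^sub>R b' i) \<in> D" "b' j \<in> D"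
      by (auto intro!: subspace_scale subspace_sum D(1))
    with insert show ?case by (simp add: add scale)
  qed (simp add: T0)
  define T' where "T' x = (\<Sum>i<d'. c' i x *\<^sub>R T (b' i))" for x
  have "bounded_linear T'"
    unfolding T'_def by (rule bounded_linear_sum) (simp add: bounded_linear_scaleR_const f'.bl)
  moreover have "T' x = T x" if "x \<in> D" for x
    using sum[of "{..<d'}" "\<lambda>i. c' i x"] f'.F_comb[of x] that FD by (simp add: T'_def f'.comb_def)
  ultimately show ?thesis by blast
qed

lemma bounded_coords_subseq:
  fixes z :: "nat \<Rightarrow> nat \<Rightarrow> real" and k :: nat
  assumes "\<And>i. i < k \<Longrightarrow> bounded (range (\<lambda>n. z n i))"
  shows "\<exists>r l. strict_mono r \<and> (\<forall>i<k. (\<lambda>n. z (r n) i) \<longlonglongrightarrow> l i)"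
  using assms
proof (induct k)
  case 0
  then show ?case using strict_mono_id by blast
next
  case (Suc k)
  then obtain r l where r: "strict_mono r" "\<And>i. i < k \<Longrightarrow> (\<lambda>n. z (r n) i) \<longlonglongrightarrow> l i" by force
  have "bounded (range (\<lambda>n. z (r n) k))"
    using Suc.prems[of k] by (rule bounded_subset) auto
  then obtain l' r' where r': "strict_mono r'" "((\<lambda>n. z (r n) k) \<circ> r') \<longlonglongrightarrow> l'"
    using bounded_imp_convergent_subsequence by blast
  have "(\<lambda>n. z ((r \<circ> r') n) i) \<longlonglongrightarrow> (l(k := l')) i" if "i < Suc k" for i
  proof (cases "i = k")
    case True
    then show ?thesis using r'(2) by (simp add: o_def)
  next
    case False
    then show ?thesis using LIMSEQ_subseq_LIMSEQ[OF r(2) r'(1), of i] that by (simp add: o_def)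
  qed
  moreover have "strict_mono (r \<circ> r')" by (rule strict_mono_o[OF r(1) r'(1)])
  ultimately show ?case by blast
qed

lemma Bolzano_Weierstrass_F:
  fixes y :: "nat \<Rightarrow> 'e"
  assumes "\<And>n. y n \<in> F" and "\<And>n. norm (y n) \<le> M"
  shows "\<exists>r l. strict_mono r \<and> (\<lambda>n. y (r n)) \<longlonglongrightarrow> l"
proof -
  have "bounded (range (\<lambda>n. c i (y n)))" if i: "i < d" for i
  proof -
    obtain K where K: "\<And>x. norm (c i x) \<le> norm x * K" "K \<ge> 0"
      using bounded_linear.nonneg_bounded[OF bl[OF i]] by blast
    have "norm (c i (y n)) \<le> M * K" for n
      by (rule order.trans[OF K(1)]) (intro mult_right_mono assms K)
    then show ?thesis by (auto simp: bounded_iff)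
  qed
  from bounded_coords_subseq[of d "\<lambda>n i. c i (y n)", OF this]
  obtain r l where r: "strict_mono r" "\<And>i. i < d \<Longrightarrow> (\<lambda>n. c i (y (r n))) \<longlonglongrightarrow> l i" by blast
  have "(\<lambda>n. comb (\<lambda>i. c i (y (r n)))) \<longlonglongrightarrow> comb l"
    unfolding comb_def by (intro tendsto_intros r) simp
  then show ?thesis using F_comb[OF assms(1)] r(1) by auto
qed

end

lemma has_vector_derivative_slope:
  assumes "(f has_vector_derivative D) (at 0)"
  shows "((\<lambda>t. (1 / t) *\<^sub>R (f t - f 0)) \<longlongrightarrow> D) (at 0)"
proof -
  have "((\<lambda>t. norm (f t - f 0 - t *\<^sub>R D) / norm t) \<longlongrightarrow> 0) (at 0)"
    using assms by (simp add: has_vector_derivative_def has_derivative_iff_norm)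
  moreover have "\<forall>\<^sub>F t in at 0. norm (f t - f 0 - t *\<^sub>R D) / norm t = norm ((1 / t) *\<^sub>R (f t - f 0) - D)"
    unfolding eventually_at_filter
  proof (rule always_eventually, intro allI impI)
    fix t :: real assume t: "t \<noteq> 0"
    then have "(1 / t) *\<^sub>R (f t - f 0) - D = (1 / t) *\<^sub>R (f t - f 0 - t *\<^sub>R D)"
      by (simp add: scaleR_diff_right)
    then show "norm (f t - f 0 - t *\<^sub>R D) / norm t = norm ((1 / t) *\<^sub>R (f t - f 0) - D)"
      by (simp add: divide_inverse mult.commute)
  qed
  ultimately have "((\<lambda>t. norm ((1 / t) *\<^sub>R (f t - f 0) - D)) \<longlongrightarrow> 0) (at 0)"
    by (rule Lim_transform_eventually)
  then show ?thesis by (rule LIM_zero_cancel[OF tendsto_norm_zero_cancel])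
qed

section \<open>Closed linear groups are Lie groups\<close>

\<comment> \<open>\<open>\<Gamma>\<close> is closed in the group of units only, not in the whole algebra.\<close>
locale closed_group = frame m b c
  for m and b :: "nat \<Rightarrow> 'e::{real_normed_algebra_1,banach}" and c +
  fixes \<Gamma> :: "'e set"
  assumes F_mult: "x \<in> F \<Longrightarrow> y \<in> F \<Longrightarrow> x * y \<in> F"
    and one_\<Gamma>: "1 \<in> \<Gamma>"
    and mult_\<Gamma>: "x \<in> \<Gamma> \<Longrightarrow> y \<in> \<Gamma> \<Longrightarrow> x * y \<in> \<Gamma>"
    and inv_\<Gamma>: "x \<in> \<Gamma> \<Longrightarrow> \<exists>y\<in>\<Gamma>. x * y = 1 \<and> y * x = 1"
    and \<Gamma>_F: "x \<in> \<Gamma> \<Longrightarrow> x - 1 \<in> F"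
    and closed_\<Gamma>: "x \<in> closure \<Gamma> \<Longrightarrow> x * y = 1 \<Longrightarrow> y * x = 1 \<Longrightarrow> x \<in> \<Gamma>"
begin

lemma F_power_Suc: "x \<in> F \<Longrightarrow> x ^ Suc n \<in> F"
  by (induction n) (auto intro: F_mult)

lemma F_sums: "(\<And>n. f n \<in> F) \<Longrightarrow> f sums s \<Longrightarrow> s \<in> F"
  using bounded_linear.sums[OF bounded_linear_proj, of f s] sums_unique2[of f]
  by (auto simp: F_def)

lemma one_plus_F_mult: "x - 1 \<in> F \<Longrightarrow> y - 1 \<in> F \<Longrightarrow> x * y - 1 \<in> F"
proof -
  assume x: "x - 1 \<in> F" and y: "y - 1 \<in> F"
  have "(x - 1) * (y - 1) + (x - 1) = (x - 1) * y" by (simp add: right_diff_distrib)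
  then have "x * y - 1 = ((x - 1) * (y - 1) + (x - 1)) + (y - 1)" by (simp add: left_diff_distrib)
  then show "x * y - 1 \<in> F" using F_add[OF F_add[OF F_mult[OF x y] x] y] by metis
qed

text \<open>\<open>F\<close> is closed under products but is not assumed to contain
  \<open>1\<close>, so the exponential series is used from its linear term on.\<close>

lemma exp_F: "x \<in> F \<Longrightarrow> exp x - 1 \<in> F"
proof (rule F_sums)
  show "(\<lambda>n. x ^ Suc n /\<^sub>R fact (Suc n)) sums (exp x - 1)"
    using sums_split_initial_segment[OF exp_converges[of x], of 1] by simp
  show "x ^ Suc n /\<^sub>R fact (Suc n) \<in> F" if "x \<in> F" for n
    by (rule F_scale[OF F_power_Suc[OF that]])
qed

lemma lnb_F:
  assumes "y - 1 \<in> F" "norm (y - 1) < 1"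
  shows "lnb y \<in> F"
proof (rule F_sums)
  show "(\<lambda>n. ln1p_coeff n *\<^sub>R (y - 1) ^ n) sums lnb y"
    unfolding lnb_def by (rule summable_sums[OF ln1p_summable[OF assms(2)]])
  show "ln1p_coeff n *\<^sub>R (y - 1) ^ n \<in> F" for n
  proof (cases n)
    case 0
    then show ?thesis by (simp add: ln1p_coeff_def F_0)
  next
    case (Suc k)
    show ?thesis unfolding Suc by (rule F_scale[OF F_power_Suc[OF assms(1)]])
  qed
qed

section \<open>The Lie algebra of a closed linear group\<close>

definition lie :: "'e set" where "lie = {x. \<forall>t. exp (t *\<^sub>R x) \<in> \<Gamma>}"

lemma exp_lie: "x \<in> lie \<Longrightarrow> exp (t *\<^sub>R x) \<in> \<Gamma>" by (simp add: lie_def)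
lemma exp_lie1: "x \<in> lie \<Longrightarrow> exp x \<in> \<Gamma>" using exp_lie[of x 1] by simp

lemma lie_scale: "x \<in> lie \<Longrightarrow> r *\<^sub>R x \<in> lie"
  by (auto simp: lie_def)

text \<open>Only \<open>exp (t *\<^sub>R x) - 1\<close> is known to lie in \<open>F\<close>. For
  small \<open>t\<close> the logarithm series recovers \<open>t *\<^sub>R x\<close> from it.\<close>

lemma lie_subset_F: "lie \<subseteq> F"
proof
  fix x assume x: "x \<in> lie"
  \<comment> \<open>Then \<open>norm (t *\<^sub>R x) \<le> 1/24\<close>, and the factor
    \<open>3\<close> of \<open>norm_exp_minus_one_le\<close> leads to the threshold
    \<open>1/8\<close> of \<open>lnb_exp\<close>.\<close>
  define t where "t = 1 / (24 * (norm x + 1))"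
  have t: "t > 0" by (simp add: t_def add_nonneg_pos)
  have nt: "norm (t *\<^sub>R x) \<le> 1/24"
  proof -
    have "norm (t *\<^sub>R x) \<le> t * (norm x + 1)" using t by simp
    also have "\<dots> = 1/24" using add_nonneg_pos[OF norm_ge_zero zero_less_one, of x] by (simp add: t_def)
    finally show ?thesis .
  qed
  have "norm (exp (t *\<^sub>R x) - 1) \<le> 3 * norm (t *\<^sub>R x)" by (rule norm_exp_minus_one_le[OF nt]) simp
  then have e: "norm (exp (t *\<^sub>R x) - 1) \<le> 1/8" using nt by linarith
  have "lnb (exp (t *\<^sub>R x)) = t *\<^sub>R x" by (rule lnb_exp[OF _ e]) (use nt in linarith)
  moreover have "lnb (exp (t *\<^sub>R x)) \<in> F"
    by (rule lnb_F[OF \<Gamma>_F[OF exp_lie[OF x]]]) (use e in linarith)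
  ultimately have "(1/t) *\<^sub>R (t *\<^sub>R x) \<in> F" using F_scale by metis
  then show "x \<in> F" using t by simp
qed

lemma exp_minus_\<Gamma>:
  assumes "exp y \<in> \<Gamma>"
  shows "exp (- y) \<in> \<Gamma>"
proof -
  obtain z where z: "z \<in> \<Gamma>" "exp y * z = 1" using inv_\<Gamma>[OF assms] by blast
  have "exp (- y) * exp y = 1" using exp_minus_inverse[of "- y"] by simp
  then have "exp (- y) = z" using z(2) by (metis mult.assoc mult.left_neutral mult.right_neutral)
  then show ?thesis using z by simp
qed

lemma exp_int_\<Gamma>:
  assumes "exp y \<in> \<Gamma>"
  shows "exp (of_int k *\<^sub>R y) \<in> \<Gamma>"
proof -
  have nat: "exp (real n *\<^sub>R y) \<in> \<Gamma>" for n
  proof (induction n)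
    case (Suc n)
    have "exp (real (Suc n) *\<^sub>R y) = exp (real n *\<^sub>R y + y)" by (simp add: algebra_simps)
    also have "\<dots> = exp (real n *\<^sub>R y) * exp y" by (rule exp_add_commuting) simp
    finally show ?case using mult_\<Gamma>[OF Suc assms] by simp
  qed (simp add: one_\<Gamma>)
  show ?thesis
  proof (cases "k \<ge> 0")
    case True
    then show ?thesis using nat[of "nat k"] by simp
  next
    case False
    then show ?thesis using exp_minus_\<Gamma>[OF nat[of "nat (- k)"]] by simp
  qed
qed

lemma tendsto_exp_algebra: "(f \<longlongrightarrow> l) G \<Longrightarrow> ((\<lambda>x. exp (f x :: 'e)) \<longlongrightarrow> exp l) G"
proof -
  have "continuous_on UNIV (\<lambda>x::'e. exp x)" by (rule continuous_on_exp_algebra[OF continuous_on_id])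
  then have "isCont exp l" by (simp add: continuous_on_eq_continuous_at)
  then show "(f \<longlongrightarrow> l) G \<Longrightarrow> ((\<lambda>x. exp (f x)) \<longlongrightarrow> exp l) G" by (rule isCont_tendsto_compose)
qed

text \<open>The steps \<open>y n\<close> become arbitrarily short, so integer multiples of them
  approximate every point of the line spanned by \<open>Y\<close>. Their exponentials are powers of
  elements of \<Gamma>, and the limit is a unit, hence in \<Gamma>.\<close>

lemma lie_limit:
  assumes "\<And>n. y n \<noteq> 0" "\<And>n. exp (y n) \<in> \<Gamma>" "y \<longlonglongrightarrow> 0" "(\<lambda>n. y n /\<^sub>R norm (y n)) \<longlonglongrightarrow> Y"
  shows "Y \<in> lie"
  unfolding lie_def
proof (rule CollectI, rule allI)
  fix t
  \<comment> \<open>Rounding down costs less than one step: \<open>k n * norm (y n)\<close> differs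
    from \<open>t\<close> by at most \<open>norm (y n)\<close>.\<close>
  define k where "k n = \<lfloor>t / norm (y n)\<rfloor>" for n
  have np: "norm (y n) > 0" for n using assms(1) by simp
  have lim: "(\<lambda>n. of_int (k n) * norm (y n)) \<longlonglongrightarrow> t"
  proof (rule tendsto_sandwich)
    show "\<forall>\<^sub>F n in sequentially. t - norm (y n) \<le> of_int (k n) * norm (y n)"
    proof (rule always_eventually, rule allI)
      fix n
      have "t / norm (y n) - 1 \<le> of_int (k n)" unfolding k_def by linarith
      from mult_right_mono[OF this, of "norm (y n)"] show "t - norm (y n) \<le> of_int (k n) * norm (y n)"
        using np[of n] by (simp add: left_diff_distrib)
    qed
    show "\<forall>\<^sub>F n in sequentially. of_int (k n) * norm (y n) \<le> t"
    proof (rule always_eventually, rule allI)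
      fix n
      have "of_int (k n) \<le> t / norm (y n)" unfolding k_def by linarith
      from mult_right_mono[OF this, of "norm (y n)"] show "of_int (k n) * norm (y n) \<le> t"
        using np[of n] by simp
    qed
    show "(\<lambda>n. t - norm (y n)) \<longlonglongrightarrow> t"
      using tendsto_diff[OF tendsto_const tendsto_norm[OF assms(3)], of t] by simp
  qed simp
  have "(of_int (k n) * norm (y n)) *\<^sub>R (y n /\<^sub>R norm (y n)) = of_int (k n) *\<^sub>R y n" for n
    using np[of n] by simp
  with tendsto_scaleR[OF lim assms(4)] have "(\<lambda>n. of_int (k n) *\<^sub>R y n) \<longlonglongrightarrow> t *\<^sub>R Y"
    by (simp only:)
  from tendsto_exp_algebra[OF this] have "(\<lambda>n. exp (of_int (k n) *\<^sub>R y n)) \<longlonglongrightarrow> exp (t *\<^sub>R Y)" .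
  moreover have "exp (of_int (k n) *\<^sub>R y n) \<in> \<Gamma>" for n by (rule exp_int_\<Gamma>[OF assms(2)])
  ultimately have "exp (t *\<^sub>R Y) \<in> closure \<Gamma>"
    unfolding closure_sequential by (intro exI[of _ "\<lambda>n. exp (of_int (k n) *\<^sub>R y n)"]) simp
  then show "exp (t *\<^sub>R Y) \<in> \<Gamma>"
    by (rule closed_\<Gamma>[of _ "exp (- (t *\<^sub>R Y))"])
       (use exp_minus_inverse[of "t *\<^sub>R Y"] exp_minus_inverse[of "- (t *\<^sub>R Y)"] in auto)
qed

text \<open>The curve \<open>exp (t *\<^sub>R X) * exp (t *\<^sub>R Y)\<close> stays in \<Gamma> and
  leaves \<open>1\<close> with velocity \<open>X + Y\<close>. Its logarithms at times tending to
  \<open>0\<close> point in this direction in the limit, so \<open>lie_limit\<close> applies after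
  normalisation; the case of velocity zero has no direction and is separate.\<close>

lemma lie_add:
  assumes X: "X \<in> lie" and Y: "Y \<in> lie"
  shows "X + Y \<in> lie"
proof (cases "X + Y = 0")
  case True
  then show ?thesis using one_\<Gamma> by (simp add: lie_def)
next
  case False
  define \<gamma> where "\<gamma> t = exp (t *\<^sub>R X) * exp (t *\<^sub>R Y)" for t :: real
  have \<gamma>\<Gamma>: "\<gamma> t \<in> \<Gamma>" for t unfolding \<gamma>_def by (intro mult_\<Gamma> exp_lie X Y)
  have g0: "\<gamma> 0 = 1" by (simp add: \<gamma>_def)
  have d\<gamma>: "(\<gamma> has_vector_derivative (X + Y)) (at 0)"
    using has_vector_derivative_mult[OF exp_scaleR_has_vector_derivative_right[of X 0] exp_scaleR_has_vector_derivative_right[of Y 0]]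
    by (simp add: \<gamma>_def[abs_def] add.commute)
  have "(lnb has_derivative (\<lambda>v. v)) (at (\<gamma> 0))" unfolding g0 by (rule lnb_has_derivative_1)
  from has_derivative_compose[OF d\<gamma>[unfolded has_vector_derivative_def] this]
  have dl: "((\<lambda>t. lnb (\<gamma> t)) has_vector_derivative (X + Y)) (at 0)"
    by (simp add: has_vector_derivative_def)
  define h where "h n = inverse (real (Suc n))" for n
  have h: "h \<longlonglongrightarrow> 0" "\<And>n. h n \<noteq> 0" "\<And>n. h n > 0"
    unfolding h_def by (rule LIMSEQ_inverse_real_of_nat) auto
  have ln0: "lnb (\<gamma> 0) = 0" by (simp add: g0 lnb_def ln1p_coeff_zero_power)
  have lim: "(\<lambda>n. (1 / h n) *\<^sub>R lnb (\<gamma> (h n))) \<longlonglongrightarrow> X + Y"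
  proof -
    have "((\<lambda>t. (1 / t) *\<^sub>R lnb (\<gamma> t)) \<longlongrightarrow> X + Y) (at 0)"
      using has_vector_derivative_slope[OF dl] by (simp add: ln0)
    moreover have "filterlim h (at 0) sequentially"
      unfolding filterlim_at using h by auto
    ultimately show ?thesis by (rule filterlim_compose[of _ _ _ h, rotated 0])
  qed
  have lim0: "(\<lambda>n. lnb (\<gamma> (h n))) \<longlonglongrightarrow> 0"
    using tendsto_scaleR[OF h(1) lim] h(2) by simp
  have "(\<lambda>n. \<gamma> (h n)) \<longlonglongrightarrow> 1"
    using isCont_tendsto_compose[OF has_vector_derivative_continuous[OF d\<gamma>] h(1)] by (simp add: g0)
  then have "\<forall>\<^sub>F n in sequentially. dist (\<gamma> (h n)) 1 < 1" by (rule tendstoD) simp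
  moreover have "\<forall>\<^sub>F n in sequentially. (1 / h n) *\<^sub>R lnb (\<gamma> (h n)) \<noteq> 0"
    by (rule tendsto_imp_eventually_ne[OF lim False])
  ultimately have "\<forall>\<^sub>F n in sequentially. dist (\<gamma> (h n)) 1 < 1 \<and> (1 / h n) *\<^sub>R lnb (\<gamma> (h n)) \<noteq> 0"
    by (rule eventually_conj)
  \<comment> \<open>\<open>lie_limit\<close> wants every term to be nonzero with its exponential in
    \<Gamma>, so the initial segment where this may fail is dropped.\<close>
  then obtain N where N: "\<And>n. n \<ge> N \<Longrightarrow> dist (\<gamma> (h n)) 1 < 1 \<and> (1 / h n) *\<^sub>R lnb (\<gamma> (h n)) \<noteq> 0"
    unfolding eventually_sequentially by blast
  define y where "y n = lnb (\<gamma> (h (n + N)))" for n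
  have y0: "y n \<noteq> 0" for n using N[of "n + N"] by (auto simp: y_def)
  have ey: "exp (y n) \<in> \<Gamma>" for n
    using exp_lnb[of "\<gamma> (h (n + N))"] N[of "n + N"] \<gamma>\<Gamma> by (simp add: y_def dist_norm)
  have yl: "y \<longlonglongrightarrow> 0" unfolding y_def by (rule LIMSEQ_ignore_initial_segment[OF lim0])
  have lim': "(\<lambda>n. (1 / h (n + N)) *\<^sub>R y n) \<longlonglongrightarrow> X + Y"
    unfolding y_def by (rule LIMSEQ_ignore_initial_segment[OF lim])
  have "(\<lambda>n. ((1 / h (n + N)) *\<^sub>R y n) /\<^sub>R norm ((1 / h (n + N)) *\<^sub>R y n)) \<longlonglongrightarrow> (X + Y) /\<^sub>R norm (X + Y)"
    by (intro tendsto_intros lim') (use False in auto)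
  moreover have "((1 / h (n + N)) *\<^sub>R y n) /\<^sub>R norm ((1 / h (n + N)) *\<^sub>R y n) = y n /\<^sub>R norm (y n)" for n
    using h(3)[of "n + N"] y0[of n] by (simp add: inverse_eq_divide)
  ultimately have "(\<lambda>n. y n /\<^sub>R norm (y n)) \<longlonglongrightarrow> (X + Y) /\<^sub>R norm (X + Y)" by (simp only:)
  from lie_limit[OF y0 ey yl this] have "(X + Y) /\<^sub>R norm (X + Y) \<in> lie" .
  from lie_scale[OF this, of "norm (X + Y)"] show ?thesis using False by simp
qed

lemma subspace_lie: "subspace lie"
  unfolding subspace_def using lie_add lie_scale one_\<Gamma> by (auto simp: lie_def)

\<comment> \<open>The map \<open>f \<mapsto> exp (\<pi> f) exp (f - \<pi> f)\<close> is a perturbation of \<open>f \<mapsto> 1 + f\<close> near \<open>0\<close>,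
  so its equations are solved by the contraction principle.\<close>
lemma exp_product_surj:
  assumes \<pi>: "bounded_linear \<pi>" "\<And>x. \<pi> x \<in> F"
  shows "\<exists>\<rho>>0. \<forall>x. x - 1 \<in> F \<longrightarrow> norm (x - 1) \<le> \<rho> \<longrightarrow>
    (\<exists>f\<in>F. norm f \<le> 2 * norm (x - 1) \<and> exp (\<pi> f) * exp (f - \<pi> f) = x)"
proof -
  obtain K0 where K0: "\<And>x. norm (\<pi> x) \<le> norm x * K0" "K0 \<ge> 0"
    using bounded_linear.nonneg_bounded[OF \<pi>(1)] by blast
  \<comment> \<open>A common bound for \<open>\<pi>\<close> and its complement.\<close>
  define K where "K = K0 + 1"
  have K1: "K \<ge> 1" using K0 by (simp add: K_def)
  have \<pi>K: "norm (\<pi> x) \<le> K * norm x" for x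
  proof -
    have "norm x * K0 \<le> K * norm x" by (simp add: K_def algebra_simps)
    with K0(1)[of x] show ?thesis by linarith
  qed
  have \<pi>K': "norm (x - \<pi> x) \<le> K * norm x" for x
    using norm_triangle_ineq4[of x "\<pi> x"] K0(1)[of x] by (simp add: K_def algebra_simps)
  note l\<pi> = bounded_linear.linear[OF \<pi>(1)]
  \<comment> \<open>The four error terms in \<open>lip\<close> add up to \<open>14 * r * K\<close>
    times \<open>norm (f - g)\<close>; this choice makes the factor \<open>1/2\<close>.\<close>
  define r where "r = 1 / (28 * K)"
  have r: "r > 0" "r \<le> 1/28" using K1 by (auto simp: r_def field_simps)
  define \<rho> where "\<rho> = r / K"
  have \<rho>: "\<rho> > 0" using r K1 by (simp add: \<rho>_def)
  have Kr: "K * norm x \<le> r" if "norm x \<le> \<rho>" for x :: 'e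
    using that K1 by (simp add: \<rho>_def field_simps)
  define \<Psi> where "\<Psi> f = exp (\<pi> f) * exp (f - \<pi> f) - 1" for f
  have \<Psi>0: "\<Psi> 0 = 0" by (simp add: \<Psi>_def linear_0[OF l\<pi>])
  have lip: "norm (\<Psi> f - \<Psi> g - (f - g)) \<le> 1/2 * norm (f - g)" if f: "norm f \<le> \<rho>" and g: "norm g \<le> \<rho>" for f g
  proof -
    define a e a' e' where "a = \<pi> f" and "e = f - \<pi> f" and "a' = \<pi> g" and "e' = g - \<pi> g"
    have n: "norm a \<le> r" "norm e \<le> r" "norm a' \<le> r" "norm e' \<le> r"
      unfolding a_def e_def a'_def e'_def
      using order.trans[OF \<pi>K Kr[OF f]] order.trans[OF \<pi>K' Kr[OF f]]
        order.trans[OF \<pi>K Kr[OF g]] order.trans[OF \<pi>K' Kr[OF g]] by auto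
    have r1: "r \<le> 1" using r by simp
    define \<delta> where "\<delta> = K * norm (f - g)"
    have \<delta>: "\<delta> \<ge> 0" using K1 by (simp add: \<delta>_def)
    have da: "norm (a - a') \<le> \<delta>" using \<pi>K[of "f - g"] by (simp add: a_def a'_def \<delta>_def linear_diff[OF l\<pi>])
    have "e - e' = (f - g) - \<pi> (f - g)" by (simp add: e_def e'_def linear_diff[OF l\<pi>])
    then have de: "norm (e - e') \<le> \<delta>" using \<pi>K'[of "f - g"] by (simp add: \<delta>_def)
    have E: "norm (exp x - 1) \<le> 3 * r" if "norm x \<le> r" for x :: 'e
      using norm_exp_minus_one_le[OF that r1] that by linarith
    have E2: "norm (exp x) \<le> 2" if "norm x \<le> r" for x :: 'e
      using E[OF that] norm_triangle_sub[of "exp x" 1] r by (simp add: norm_minus_commute)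
    \<comment> \<open>Replace one factor at a time, and in each change of a factor split off its
      linear part; every remaining summand contains a quantity of order \<open>r\<close>.\<close>
    have ide: "\<Psi> f - \<Psi> g - (f - g) =
        ((exp a - exp a' - (a - a')) * exp e + (a - a') * (exp e - 1)) +
        (exp a' * (exp e - exp e' - (e - e')) + (exp a' - 1) * (e - e'))"
      by (simp add: \<Psi>_def a_def e_def a'_def e'_def algebra_simps)
    have 1: "norm ((exp a - exp a' - (a - a')) * exp e) \<le> (2 * r * \<delta>) * 2"
    proof (rule order.trans[OF norm_mult_ineq mult_mono])
      show "norm (exp a - exp a' - (a - a')) \<le> 2 * r * \<delta>"
        by (rule order.trans[OF exp_near_identity[OF n(1) n(3) r1]]) (use da r in \<open>auto intro: mult_left_mono\<close>)
    qed (use E2[OF n(2)] r \<delta> in auto)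
    have 2: "norm ((a - a') * (exp e - 1)) \<le> \<delta> * (3 * r)"
      by (rule order.trans[OF norm_mult_ineq mult_mono]) (use da E[OF n(2)] \<delta> in auto)
    have 3: "norm (exp a' * (exp e - exp e' - (e - e'))) \<le> 2 * (2 * r * \<delta>)"
    proof (rule order.trans[OF norm_mult_ineq mult_mono])
      show "norm (exp e - exp e' - (e - e')) \<le> 2 * r * \<delta>"
        by (rule order.trans[OF exp_near_identity[OF n(2) n(4) r1]]) (use de r in \<open>auto intro: mult_left_mono\<close>)
    qed (use E2[OF n(3)] r \<delta> in auto)
    have 4: "norm ((exp a' - 1) * (e - e')) \<le> (3 * r) * \<delta>"
      by (rule order.trans[OF norm_mult_ineq mult_mono]) (use de E[OF n(3)] r in auto)
    have "norm (\<Psi> f - \<Psi> g - (f - g)) \<le> (2 * r * \<delta>) * 2 + \<delta> * (3 * r) + (2 * (2 * r * \<delta>) + (3 * r) * \<delta>)"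
      unfolding ide by (intro order.trans[OF norm_triangle_ineq] add_mono 1 2 3 4)
    also have "\<dots> = 14 * r * K * norm (f - g)" by (simp add: \<delta>_def)
    also have "14 * r * K = 1/2" using K1 by (simp add: r_def)
    finally show ?thesis .
  qed
  show ?thesis
  proof (intro exI[of _ "\<rho> / 2"] conjI allI impI)
    show "\<rho> / 2 > 0" using \<rho> by simp
    fix x assume x: "x - 1 \<in> F" "norm (x - 1) \<le> \<rho> / 2"
    \<comment> \<open>A fixed point of \<open>T\<close> solves \<open>\<Psi> g = x - 1\<close>. The
      term \<open>g - \<Psi> g\<close> takes up at most half of the radius \<open>\<rho>\<close>,
      the other half is left for \<open>x - 1\<close>.\<close>
    define T where "T g = g - \<Psi> g + (x - 1)" for g
    define S where "S = F \<inter> cball 0 \<rho>"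
    have \<Psi>F: "\<Psi> g \<in> F" if "g \<in> F" for g
      unfolding \<Psi>_def by (intro one_plus_F_mult exp_F \<pi> F_diff that)
    have "\<exists>!f\<in>S. T f = f"
    proof (rule Banach_fix[where c = "1/2"])
      show "complete S" unfolding S_def complete_eq_closed by (intro closed_Int closed_F closed_cball)
      show "S \<noteq> {}" using F_0 \<rho> by (auto simp: S_def)
      show "T ` S \<subseteq> S"
      proof (rule image_subsetI)
        fix g assume g: "g \<in> S"
        then have "norm (g - \<Psi> g) \<le> 1/2 * norm g"
          using lip[of g 0] \<rho> by (simp add: \<Psi>0 S_def norm_minus_commute)
        also have "\<dots> \<le> \<rho> / 2" using g by (simp add: S_def)
        finally have "norm (T g) \<le> \<rho> / 2 + \<rho> / 2"
          unfolding T_def by (intro order.trans[OF norm_triangle_ineq] add_mono x(2))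
        moreover have "T g \<in> F"
          unfolding T_def using g by (intro F_add F_diff \<Psi>F x(1)) (auto simp: S_def)
        ultimately show "T g \<in> S" by (simp add: S_def)
      qed
      show "dist (T f) (T g) \<le> 1/2 * dist f g" if "f \<in> S" "g \<in> S" for f g
      proof -
        note that
        moreover have "T f - T g = - (\<Psi> f - \<Psi> g - (f - g))" by (simp add: T_def)
        ultimately show ?thesis
          using lip[of f g] by (simp add: dist_norm S_def norm_minus_commute)
      qed
    qed auto
    then obtain f where f: "f \<in> S" "T f = f" by blast
    have \<Psi>f: "\<Psi> f = x - 1" using f(2) by (simp add: T_def algebra_simps)
    have "norm (\<Psi> f - f) \<le> 1/2 * norm f" using lip[of f 0] f(1) \<rho> by (simp add: \<Psi>0 S_def)
    then have "norm f \<le> 2 * norm (x - 1)"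
      using norm_triangle_sub[of f "\<Psi> f"] by (simp add: \<Psi>f norm_minus_commute)
    moreover have "exp (\<pi> f) * exp (f - \<pi> f) = x" using \<Psi>f by (simp add: \<Psi>_def)
    ultimately show "\<exists>f\<in>F. norm f \<le> 2 * norm (x - 1) \<and> exp (\<pi> f) * exp (f - \<pi> f) = x"
      using f(1) by (auto simp: S_def)
  qed
qed

text \<open>The core of the closed subgroup theorem. Were it false, there would be
  \<open>x n\<close> in \<Gamma> tending to \<open>1\<close> with logarithms outside
  \<open>lie\<close>. Split \<open>x n\<close> as an exponential of an element of \<open>lie\<close>
  times \<open>exp (y n)\<close> with \<open>y n\<close> in the complement. Then
  \<open>exp (y n)\<close> is in \<Gamma>, and by compactness the directions of \<open>y n\<close>
  accumulate at a unit vector \<open>Y\<close>. By \<open>lie_limit\<close> it lies in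
  \<open>lie\<close>, yet the projection onto \<open>lie\<close> annihilates it.\<close>

lemma log_near_one_in_lie:
  "\<exists>\<epsilon>>0. \<epsilon> \<le> 1/8 \<and> (\<forall>x\<in>\<Gamma>. norm (x - 1) < \<epsilon> \<longrightarrow> lnb x \<in> lie)"
proof -
  obtain d b' c' where fr: "frame d b' c'" and FL: "frame.F d b' c' = lie"
    using subframe[OF subspace_lie lie_subset_F] by blast
  interpret L: frame d b' c' by (rule fr)
  have pF: "L.proj x \<in> F" for x using L.proj_F lie_subset_F FL by blast
  obtain \<rho> where \<rho>: "\<rho> > 0" "\<And>x. x - 1 \<in> F \<Longrightarrow> norm (x - 1) \<le> \<rho> \<Longrightarrow>
      \<exists>f\<in>F. norm f \<le> 2 * norm (x - 1) \<and> exp (L.proj f) * exp (f - L.proj f) = x"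
    using exp_product_surj[OF L.bounded_linear_proj pF] by blast
  obtain K where K: "\<And>x. norm (L.proj x) \<le> norm x * K" "K \<ge> 0"
    using bounded_linear.nonneg_bounded[OF L.bounded_linear_proj] by blast
  show ?thesis
  proof (rule ccontr)
    assume neg: "\<not> ?thesis"
    \<comment> \<open>The last bound gives
      \<open>(K + 1) * norm (f n) \<le> inverse (real (Suc n)) / 4\<close>. So \<open>y n\<close>
      tends to \<open>0\<close>, and \<open>L.proj (f n)\<close> stays in the ball of radius
      \<open>1/4\<close> on which \<open>lnb\<close> inverts \<open>exp\<close>.\<close>
    define \<epsilon> where "\<epsilon> n = min (min \<rho> (1/8)) (inverse (real (Suc n)) / (8 * (K + 1)))" for n
    have \<epsilon>: "\<epsilon> n > 0" "\<epsilon> n \<le> 1/8" "\<epsilon> n \<le> \<rho>" "\<epsilon> n \<le> inverse (real (Suc n)) / (8 * (K + 1))" for n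
    proof -
      show "\<epsilon> n > 0" using \<rho> K(2) by (simp add: \<epsilon>_def)
      show "\<epsilon> n \<le> 1/8" "\<epsilon> n \<le> \<rho>" "\<epsilon> n \<le> inverse (real (Suc n)) / (8 * (K + 1))"
        unfolding \<epsilon>_def by (rule min.coboundedI1[OF min.cobounded2], rule min.coboundedI1[OF min.cobounded1], rule min.cobounded2)
    qed
    have "\<forall>n. \<exists>x\<in>\<Gamma>. norm (x - 1) < \<epsilon> n \<and> lnb x \<notin> lie" using neg \<epsilon>(1,2) by blast
    then obtain x where x: "\<And>n. x n \<in> \<Gamma>" "\<And>n. norm (x n - 1) < \<epsilon> n" "\<And>n. lnb (x n) \<notin> lie" by metis
    have "\<forall>n. \<exists>f\<in>F. norm f \<le> 2 * norm (x n - 1) \<and> exp (L.proj f) * exp (f - L.proj f) = x n"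
    proof
      fix n show "\<exists>f\<in>F. norm f \<le> 2 * norm (x n - 1) \<and> exp (L.proj f) * exp (f - L.proj f) = x n"
        by (rule \<rho>(2)[OF \<Gamma>_F[OF x(1)]]) (use x(2)[of n] \<epsilon>(3)[of n] in linarith)
    qed
    then obtain f where f: "\<And>n. f n \<in> F" "\<And>n. norm (f n) \<le> 2 * norm (x n - 1)"
      "\<And>n. exp (L.proj (f n)) * exp (f n - L.proj (f n)) = x n" by metis
    define y where "y n = f n - L.proj (f n)" for n
    have Kf: "(K + 1) * norm (f n) \<le> inverse (real (Suc n)) / 4" for n
    proof -
      have "norm (f n) \<le> 2 * (inverse (real (Suc n)) / (8 * (K + 1)))"
        using f(2)[of n] x(2)[of n] \<epsilon>(4)[of n] by linarith
      from mult_left_mono[OF this, of "K + 1"]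
      have "(K + 1) * norm (f n) \<le> (K + 1) * (2 * (inverse (real (Suc n)) / (8 * (K + 1))))" using K(2) by simp
      also have "\<dots> = inverse (real (Suc n)) / 4" using K(2) by (simp add: divide_simps del: of_nat_Suc) 
      finally show ?thesis .
    qed
    have inv1: "inverse (real (Suc n)) \<le> 1" for n by (simp add: field_simps)
    have pf: "norm (L.proj (f n)) \<le> 1/4" for n
    proof -
      have "norm (f n) * K \<le> (K + 1) * norm (f n)" by (simp add: algebra_simps)
      then have "norm (L.proj (f n)) \<le> (K + 1) * norm (f n)" using K(1)[of "f n"] by linarith
      then show ?thesis using Kf[of n] inv1[of n] by linarith
    qed
    have ny: "norm (y n) \<le> inverse (real (Suc n))" for n
    proof -
      have "norm (y n) \<le> norm (f n) + norm (f n) * K"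
        unfolding y_def using norm_triangle_ineq4[of "f n" "L.proj (f n)"] K(1)[of "f n"] by linarith
      then have "norm (y n) \<le> (K + 1) * norm (f n)" by (simp add: algebra_simps)
      moreover have "inverse (real (Suc n)) \<ge> 0" by simp
      ultimately show ?thesis using Kf[of n] by linarith
    qed
    have pl: "L.proj (f n) \<in> lie" for n using L.proj_F FL by blast
    \<comment> \<open>With \<open>y n = 0\<close> the element \<open>x n\<close> would be the
      exponential of a small element of \<open>lie\<close>, and its logarithm would be that
      element.\<close>
    have y0: "y n \<noteq> 0" for n
    proof
      assume "y n = 0"
      then have "x n = exp (L.proj (f n))" using f(3)[of n] by (simp add: y_def)
      moreover have "lnb (exp (L.proj (f n))) = L.proj (f n)"
      proof (rule lnb_exp[OF pf])
        show "norm (exp (L.proj (f n)) - 1) \<le> 1/8"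
          using x(2)[of n] \<epsilon>(2)[of n] unfolding \<open>x n = exp (L.proj (f n))\<close> by linarith
      qed
      ultimately show False using x(3)[of n] pl[of n] by simp
    qed
    have ey: "exp (y n) \<in> \<Gamma>" for n
    proof -
      have "exp (- L.proj (f n)) * x n = exp (- L.proj (f n)) * exp (L.proj (f n)) * exp (y n)"
        using f(3)[of n] by (simp add: y_def mult.assoc)
      also have "exp (- L.proj (f n)) * exp (L.proj (f n)) = 1"
        using exp_minus_inverse[of "- L.proj (f n)"] by simp
      finally show ?thesis
        using mult_\<Gamma>[OF exp_minus_\<Gamma>[OF exp_lie1[OF pl[of n]]] x(1)[of n]] by simp
    qed
    have yl: "y \<longlonglongrightarrow> 0"
      by (rule Lim_null_comparison[OF _ LIMSEQ_inverse_real_of_nat]) (simp add: ny del: of_nat_Suc)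
    define u where "u n = y n /\<^sub>R norm (y n)" for n
    have uF: "u n \<in> F" for n
      unfolding u_def y_def by (intro F_scale F_diff f(1) pF)
    have nu: "norm (u n) = 1" for n using y0[of n] by (simp add: u_def)
    obtain q Y where q: "strict_mono q" and Y: "(\<lambda>n. u (q n)) \<longlonglongrightarrow> Y"
      using Bolzano_Weierstrass_F[of u 1] uF nu by auto
    have "norm Y = 1"
      using tendsto_norm[OF Y] nu by (simp add: LIMSEQ_const_iff)
    have "L.proj (u n) = 0" for n
    proof -
      note l = bounded_linear.linear[OF L.bounded_linear_proj]
      have "L.proj (L.proj (f n)) = L.proj (f n)" by (simp add: L.proj_def[of "f n"])
      then show ?thesis by (simp add: u_def y_def linear_scale[OF l] linear_diff[OF l])
    qed
    then have "L.proj Y = 0"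
      using bounded_linear.tendsto[OF L.bounded_linear_proj Y] by (simp add: LIMSEQ_const_iff)
    moreover have "Y \<in> lie"
    proof (rule lie_limit)
      show "y (q n) \<noteq> 0" "exp (y (q n)) \<in> \<Gamma>" for n by (rule y0, rule ey)
      show "(\<lambda>n. y (q n)) \<longlonglongrightarrow> 0" using LIMSEQ_subseq_LIMSEQ[OF yl q] by (simp add: o_def)
      show "(\<lambda>n. y (q n) /\<^sub>R norm (y (q n))) \<longlonglongrightarrow> Y" using Y by (simp add: u_def)
    qed
    then have "Y \<in> L.F" by (simp add: FL)
    then have "L.proj Y = Y" by (simp add: L.F_def)
    ultimately have "Y = 0" by simp
    with \<open>norm Y = 1\<close> show False by simp
  qed
qed

end

section \<open>Partial derivatives on open subsets of Euclidean spaces\<close>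

lemma Ckv_imp_Ck_on: "Ckv n k U f \<Longrightarrow> Ck_on n k U f"
proof (induction k arbitrary: f)
  case (Suc k)
  then show ?case
    by (auto simp: has_real_derivative_iff_has_vector_derivative) blast
qed simp

lemma continuous_on_fun_upd: "continuous_on UNIV (\<lambda>t. (x :: nat \<Rightarrow> real)(i := t))"
proof (rule continuous_on_coordinatewise_then_product)
  fix j
  show "continuous_on UNIV (\<lambda>t. (x(i := t)) j)"
  proof (cases "j = i")
    case True
    show ?thesis unfolding True fun_upd_same by (rule continuous_on_id)
  qed simp
qed

lemma openin_Euclidean_spaceE:
  assumes "openin (Euclidean_space n) U"
  obtains T where "open T" "U = T \<inter> topspace (Euclidean_space n)"
  using assms unfolding Euclidean_space_def openin_subtopology euclidean_product_topology open_openin[symmetric]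
  by auto

lemma eventually_coordinate_line:
  assumes U: "openin (Euclidean_space n) U" and x: "x \<in> U" and i: "i < n"
  shows "\<forall>\<^sub>F t in nhds (x i). x(i := t) \<in> U"
proof -
  obtain T where T: "open T" "U = T \<inter> topspace (Euclidean_space n)" using U by (rule openin_Euclidean_spaceE)
  have "open ((\<lambda>t. x(i := t)) -` T)" by (rule open_vimage[OF T(1) continuous_on_fun_upd])
  moreover have "x i \<in> (\<lambda>t. x(i := t)) -` T" using x T(2) by simp
  ultimately have "\<forall>\<^sub>F t in nhds (x i). t \<in> (\<lambda>t. x(i := t)) -` T" by (rule eventually_nhds_in_open)
  moreover have "x(i := t) \<in> topspace (Euclidean_space n)" for t
    using x T(2) i by (simp add: topspace_Euclidean_space)
  ultimately show ?thesis by (elim eventually_mono) (simp add: T(2))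
qed

text \<open>A partial derivative at \<open>x\<close> sees the points \<open>x(i := t)\<close>, where
  the two functions could disagree. Openness of \<open>U\<close> in
  \<open>Euclidean_space n\<close>, together with \<open>i < n\<close>, keeps these points in
  \<open>U\<close> for \<open>t\<close> near \<open>x i\<close>.\<close>

lemma Ck_on_cong:
  assumes U: "openin (Euclidean_space n) U" and eq: "\<And>x. x \<in> U \<Longrightarrow> f x = g x" and f: "Ckv n k U f"
  shows "Ck_on n k U g"
proof (cases k)
  case 0
  then show ?thesis using f eq by (simp cong: continuous_on_cong)
next
  case (Suc k')
  have "\<exists>g'. (\<forall>x\<in>U. ((\<lambda>t. g (x(i := t))) has_real_derivative g' x) (at (x i))) \<and> Ck_on n k' U g'"
    if i: "i < n" for i
  proof -
    obtain f' where f': "\<And>x. x \<in> U \<Longrightarrow> ((\<lambda>t. f (x(i := t))) has_vector_derivative f' x) (at (x i))"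
      "Ckv n k' U f'" using f i unfolding Suc Ckv.simps by blast
    have "((\<lambda>t. g (x(i := t))) has_real_derivative f' x) (at (x i))" if x: "x \<in> U" for x
    proof -
      have "\<forall>\<^sub>F t in nhds (x i). f (x(i := t)) = g (x(i := t))"
        using eventually_coordinate_line[OF U x i] by (rule eventually_mono) (rule eq)
      from DERIV_cong_ev[OF refl this refl] f'(1)[OF x] show ?thesis
        by (simp add: has_real_derivative_iff_has_vector_derivative)
    qed
    then show ?thesis using Ckv_imp_Ck_on[OF f'(2)] by (intro exI[of _ f'] conjI ballI)
  qed
  moreover have "continuous_on U g"
    using Ckv_imp_continuous_on[OF f] eq by (simp cong: continuous_on_cong)
  ultimately show ?thesis using Suc by simp
qed

lemma openin_Euclidean_space_Collect:
  assumes "open {x. P x}"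
  shows "openin (Euclidean_space n) {x \<in> topspace (Euclidean_space n). P x}"
proof -
  have "{x \<in> topspace (Euclidean_space n). P x} = {x. P x} \<inter> {x. \<forall>i\<ge>n. x i = 0}"
    by (auto simp: topspace_Euclidean_space)
  then show ?thesis using assms
    unfolding Euclidean_space_def openin_subtopology euclidean_product_topology open_openin[symmetric] by auto
qed

lemma continuous_map_Euclidean_iff:
  "continuous_map (subtopology euclidean A) (subtopology (Euclidean_space n) B) f \<longleftrightarrow>
    continuous_on A f \<and> f ` A \<subseteq> B \<inter> topspace (Euclidean_space n)"
  unfolding Euclidean_space_def euclidean_product_topology subtopology_subtopology
  by (auto simp: continuous_map_in_subtopology)

lemma continuous_map_from_Euclidean:
  assumes "continuous_on (B \<inter> topspace (Euclidean_space n)) f" "f ` (B \<inter> topspace (Euclidean_space n)) \<subseteq> A"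
  shows "continuous_map (subtopology (Euclidean_space n) B) (subtopology euclidean A) f"
proof -
  have "subtopology (Euclidean_space n) B = subtopology euclidean (B \<inter> topspace (Euclidean_space n))"
    unfolding Euclidean_space_def euclidean_product_topology subtopology_subtopology
    by (simp add: Int_commute)
  then show ?thesis using assms by (auto simp: continuous_map_in_subtopology)
qed

\<comment> \<open>\<open>enc\<close> carries the group over to the type which the Lie system requires for its stages.\<close>
locale lie_stage = closed_group m b c \<Gamma> + L: frame d b' c'
  for m and b :: "nat \<Rightarrow> 'e::{real_normed_algebra_1,banach}" and c and \<Gamma>
    and d and b' :: "nat \<Rightarrow> 'e" and c' +
  fixes \<epsilon> :: real and enc :: "'e \<Rightarrow> 'a::topological_space"
  assumes LF: "L.F = lie"
    and \<epsilon>: "\<epsilon> > 0" "\<epsilon> \<le> 1/8"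
    and lnb_lie: "x \<in> \<Gamma> \<Longrightarrow> norm (x - 1) < \<epsilon> \<Longrightarrow> lnb x \<in> lie"
    and enc_inj: "inj_on enc \<Gamma>"
    and enc_cont: "continuous_on \<Gamma> enc"
    and dec_cont: "continuous_on (enc ` \<Gamma>) (inv_into \<Gamma> enc)"
begin

section \<open>Logarithmic charts\<close>

abbreviation dec where "dec \<equiv> inv_into \<Gamma> enc"

text \<open>A chart is labelled by the element \<open>h\<close> that translates its centre to
  \<open>1\<close>, so it is centred at the inverse of \<open>h\<close>; the formula for the chart
  then contains no inverse.\<close>

definition domain :: "'e \<Rightarrow> 'e set" where "domain h = {x \<in> \<Gamma>. norm (h * x - 1) < \<epsilon>}"
definition chart :: "'e \<Rightarrow> 'a \<Rightarrow> nat \<Rightarrow> real" where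
  "chart h y = (\<lambda>i. if i < d then c' i (lnb (h * dec y)) else 0)"

definition G :: "'a lie_group" where
  "G = \<lparr>carrier = enc ` \<Gamma>, monoid.mult = (\<lambda>x y. enc (dec x * dec y)), one = enc 1,
    gtop = subtopology euclidean (enc ` \<Gamma>), ldim = d, atlas = {(enc ` domain h, chart h) | h. h \<in> \<Gamma>}\<rparr>"

lemma G_simps [simp]:
  "carrier G = enc ` \<Gamma>" "x \<otimes>\<^bsub>G\<^esub> y = enc (dec x * dec y)" "\<one>\<^bsub>G\<^esub> = enc 1"
  "gtop G = subtopology euclidean (enc ` \<Gamma>)" "ldim G = d" "atlas G = {(enc ` domain h, chart h) | h. h \<in> \<Gamma>}"
  by (simp_all add: G_def)

lemma dec_enc [simp]: "x \<in> \<Gamma> \<Longrightarrow> dec (enc x) = x" by (rule inv_into_f_f[OF enc_inj])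

lemma group_G: "group G"
proof (rule groupI)
  show "\<exists>y\<in>carrier G. y \<otimes>\<^bsub>G\<^esub> x = \<one>\<^bsub>G\<^esub>" if x: "x \<in> carrier G" for x
  proof -
    obtain u where u: "u \<in> \<Gamma>" "x = enc u" using x by auto
    then obtain v where "v \<in> \<Gamma>" "v * u = 1" using inv_\<Gamma> by blast
    with u show ?thesis by (intro bexI[of _ "enc v"]) auto
  qed
qed (auto simp: mult_\<Gamma> one_\<Gamma> mult.assoc)

lemma inv_enc:
  assumes "x \<in> \<Gamma>" "y \<in> \<Gamma>" "y * x = 1"
  shows "inv\<^bsub>G\<^esub> (enc x) = enc y"
proof -
  interpret group G by (rule group_G)
  show ?thesis by (rule inv_equality) (use assms in auto)
qed

definition ginv :: "'e \<Rightarrow> 'e" where "ginv x = (SOME y. y \<in> \<Gamma> \<and> x * y = 1 \<and> y * x = 1)"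

lemma ginv: "x \<in> \<Gamma> \<Longrightarrow> ginv x \<in> \<Gamma>" "x \<in> \<Gamma> \<Longrightarrow> x * ginv x = 1" "x \<in> \<Gamma> \<Longrightarrow> ginv x * x = 1"
proof -
  assume "x \<in> \<Gamma>"
  then have "\<exists>y. y \<in> \<Gamma> \<and> x * y = 1 \<and> y * x = 1" using inv_\<Gamma> by blast
  from someI_ex[OF this] show "ginv x \<in> \<Gamma>" "x * ginv x = 1" "ginv x * x = 1"
    unfolding ginv_def by blast+
qed

lemma continuous_ginv: "continuous_on \<Gamma> ginv"
  unfolding continuous_on_def
proof
  fix x assume x: "x \<in> \<Gamma>"
  \<comment> \<open>\<open>tendsto_inverse_algebra\<close> asks for an inverse at every point, so
    points outside \<Gamma> are redirected to \<open>x\<close>.\<close>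
  define y where "y z = (if z \<in> \<Gamma> then z else x)" for z
  have "(y \<longlongrightarrow> x) (at x within \<Gamma>)"
    by (rule Lim_transform_eventually[OF tendsto_ident_at]) (auto simp: eventually_at_filter y_def)
  then have "((\<lambda>z. ginv (y z)) \<longlongrightarrow> ginv x) (at x within \<Gamma>)"
    by (rule tendsto_inverse_algebra) (use ginv x in \<open>auto simp: y_def\<close>)
  then show "(ginv \<longlongrightarrow> ginv x) (at x within \<Gamma>)"
    by (rule Lim_transform_eventually) (auto simp: eventually_at_filter y_def)
qed

lemma topological_group_G: "topological_group G"
proof (intro topological_group.intro group_G topological_group_axioms.intro)
  show "topspace (gtop G) = carrier G" by simp
  have "continuous_on (enc ` \<Gamma> \<times> enc ` \<Gamma>) (\<lambda>p. enc (dec (fst p) * dec (snd p)))"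
    by (rule continuous_on_compose2[OF enc_cont])
       (auto intro!: continuous_intros continuous_on_compose2[OF dec_cont] mult_\<Gamma>)
  then show "continuous_map (prod_topology (gtop G) (gtop G)) (gtop G) (\<lambda>(x, y). x \<otimes>\<^bsub>G\<^esub> y)"
    by (auto simp: prod_topology_subtopology_eu continuous_map_in_subtopology split_beta mult_\<Gamma>)
  have "continuous_on (enc ` \<Gamma>) (\<lambda>x. enc (ginv (dec x)))"
    by (rule continuous_on_compose2[OF enc_cont continuous_on_compose2[OF continuous_ginv dec_cont]])
       (auto simp: ginv)
  moreover have "inv\<^bsub>G\<^esub> y = enc (ginv (dec y))" if "y \<in> enc ` \<Gamma>" for y
    using that inv_enc ginv by auto
  ultimately show "continuous_map (gtop G) (gtop G) (\<lambda>x. inv\<^bsub>G\<^esub> x)"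
    by (auto simp: continuous_map_in_subtopology ginv cong: continuous_on_cong)
qed

definition toE :: "(nat \<Rightarrow> real) \<Rightarrow> 'e" where "toE z = L.comb z"
text \<open>The common image of all charts. The second bound describes the domain in exponential
  form; the first one selects the branch, since \<open>exp\<close> may come close to
  \<open>1\<close> far away from \<open>0\<close> as well.\<close>

definition B :: "(nat \<Rightarrow> real) set" where
  "B = {z \<in> topspace (Euclidean_space d). norm (toE z) < 1/4 \<and> norm (exp (toE z) - 1) < \<epsilon>}"

lemma toE_lie [simp]: "toE z \<in> lie" unfolding toE_def LF[symmetric] by simp

lemma exp_toE [simp]: "exp (toE z) \<in> \<Gamma>" by (rule exp_lie1) simp

lemma continuous_toE [continuous_intros]:
  assumes "continuous_on S f"
  shows "continuous_on S (\<lambda>x. toE (f x))"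
  unfolding toE_def L.comb_def
  by (intro continuous_on_sum continuous_on_scaleR continuous_on_const
      continuous_on_compose2[OF continuous_on_product_coordinates assms subset_UNIV])

text \<open>By \<open>lnb_lie\<close> the logarithm lies in \<open>lie\<close>, so its
  \<open>d\<close> coordinates determine it completely and \<open>toE\<close> recovers it.\<close>

lemma chart_in_B:
  assumes h: "h \<in> \<Gamma>" and x: "x \<in> domain h"
  shows "chart h (enc x) \<in> B" "exp (toE (chart h (enc x))) = h * x"
proof -
  have x\<Gamma>: "x \<in> \<Gamma>" and n: "norm (h * x - 1) < \<epsilon>" using x by (auto simp: domain_def)
  have "lnb (h * x) \<in> L.F" unfolding LF by (rule lnb_lie[OF mult_\<Gamma>[OF h x\<Gamma>] n])
  then have "lnb (h * x) = L.comb (\<lambda>i. c' i (lnb (h * x)))" by (rule L.F_comb)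
  also have "\<dots> = toE (chart h (enc x))"
    unfolding toE_def by (rule L.comb_cong) (simp add: chart_def x\<Gamma>)
  finally have t: "toE (chart h (enc x)) = lnb (h * x)" by simp
  have n8: "norm (h * x - 1) \<le> 1/8" using n \<epsilon> by linarith
  show e: "exp (toE (chart h (enc x))) = h * x" unfolding t by (rule exp_lnb) (use n8 in linarith)
  show "chart h (enc x) \<in> B"
    using norm_lnb_less[OF n8] n by (simp add: B_def topspace_Euclidean_space e t[symmetric])
       (simp add: chart_def)
qed

lemma B_chart:
  assumes h: "h \<in> \<Gamma>" and z: "z \<in> B"
  shows "ginv h * exp (toE z) \<in> domain h" "chart h (enc (ginv h * exp (toE z))) = z"
proof -
  have x: "ginv h * exp (toE z) \<in> \<Gamma>" by (intro mult_\<Gamma> ginv h exp_toE)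
  have hx: "h * (ginv h * exp (toE z)) = exp (toE z)" using ginv(2)[OF h] by (simp add: mult.assoc[symmetric])
  show "ginv h * exp (toE z) \<in> domain h" using x z by (simp add: domain_def hx B_def)
  have "lnb (exp (toE z)) = toE z" by (rule lnb_exp) (use z \<epsilon> in \<open>auto simp: B_def\<close>)
  then have "chart h (enc (ginv h * exp (toE z))) = (\<lambda>i. if i < d then c' i (toE z) else 0)"
    by (simp add: chart_def x hx fun_eq_iff)
  also have "\<dots> = z"
    using z by (auto simp: toE_def L.coord_comb B_def topspace_Euclidean_space fun_eq_iff)
  finally show "chart h (enc (ginv h * exp (toE z))) = z" .
qed

lemma chart_image: "h \<in> \<Gamma> \<Longrightarrow> chart h ` enc ` domain h = B"
proof (intro equalityI subsetI)
  assume h: "h \<in> \<Gamma>"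
  show "z \<in> B" if "z \<in> chart h ` enc ` domain h" for z
    using that chart_in_B(1)[OF h] by blast
  show "z \<in> chart h ` enc ` domain h" if "z \<in> B" for z
    using B_chart[OF h that] by (metis imageI)
qed

lemma chart_inv:
  assumes "h \<in> \<Gamma>" "z \<in> B"
  shows "inv_into (enc ` domain h) (chart h) z = enc (ginv h * exp (toE z))"
proof (rule inv_into_f_eq)
  show "inj_on (chart h) (enc ` domain h)"
  proof (rule inj_onI, clarsimp)
    fix x y assume x: "x \<in> domain h" and y: "y \<in> domain h" and eq: "chart h (enc x) = chart h (enc y)"
    then have "h * x = h * y" using chart_in_B(2)[OF assms(1)] by metis
    then have "ginv h * h * x = ginv h * h * y" by (simp add: mult.assoc)
    then show "enc x = enc y" using ginv(3)[OF assms(1)] by simp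
  qed
qed (use B_chart[OF assms] in auto)

lemma domain_\<Gamma>: "domain h \<subseteq> \<Gamma>" by (auto simp: domain_def)

lemma enc_in_enc_domain: "x \<in> \<Gamma> \<Longrightarrow> enc x \<in> enc ` domain h \<longleftrightarrow> norm (h * x - 1) < \<epsilon>"
  unfolding inj_on_image_mem_iff[OF enc_inj _ domain_\<Gamma>] by (simp add: domain_def)

lemma enc_domain: "y \<in> enc ` \<Gamma> \<Longrightarrow> y \<in> enc ` domain h \<longleftrightarrow> norm (h * dec y - 1) < \<epsilon>"
  using enc_in_enc_domain[of "dec y" h] f_inv_into_f[of y enc \<Gamma>] inv_into_into[of y enc \<Gamma>] by simp

lemma open_B_like:
  assumes "continuous_on UNIV w"
  shows "open {z. norm (toE (w z)) < 1/4 \<and> norm (exp (toE (w z)) - 1) < \<epsilon>}"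
  by (intro open_Collect_conj open_Collect_less continuous_intros continuous_on_exp_algebra assms)

lemma openin_B: "openin (Euclidean_space d) B"
  unfolding B_def by (rule openin_Euclidean_space_Collect) (rule open_B_like[OF continuous_on_id])

lemma lnb_continuous: "continuous_on {x::'e. norm (x - 1) < 1} lnb"
proof -
  obtain L' where L': "\<And>x::'e. norm x < 1 \<Longrightarrow> ((\<lambda>z. lnb (1 + z)) has_derivative L' x) (at x)"
    using pser_has_derivative[OF pser_ln1p] by blast
  have "continuous_on {z::'e. norm z < 1} (\<lambda>z. lnb (1 + z))"
    by (rule continuous_at_imp_continuous_on) (use has_derivative_continuous[OF L'] in blast)
  moreover have "continuous_on {x::'e. norm (x - 1) < 1} (\<lambda>x. x - 1)" by (intro continuous_intros)
  ultimately have "continuous_on {x::'e. norm (x - 1) < 1} (\<lambda>x. lnb (1 + (x - 1)))"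
    by (rule continuous_on_compose2) auto
  then show ?thesis by simp
qed

lemma chart_homeomorphic:
  assumes h: "h \<in> \<Gamma>"
  shows "homeomorphic_map (subtopology (gtop G) (enc ` domain h)) (subtopology (Euclidean_space d) B) (chart h)"
proof -
  have sub: "subtopology (gtop G) (enc ` domain h) = subtopology euclidean (enc ` domain h)"
    using domain_\<Gamma>[of h] by (simp add: subtopology_subtopology Int_absorb1 image_mono)
  have cd: "continuous_on (enc ` domain h) dec"
    by (rule continuous_on_subset[OF dec_cont]) (use domain_\<Gamma> in auto)
  have "continuous_on (enc ` domain h) (\<lambda>y. lnb (h * dec y))"
    by (rule continuous_on_compose2[OF lnb_continuous])
       (use cd domain_\<Gamma> \<epsilon> in \<open>auto intro!: continuous_intros simp: domain_def\<close>)
  then have "continuous_on (enc ` domain h) (chart h)"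
  proof (intro continuous_on_coordinatewise_then_product)
    fix i
    show "continuous_on (enc ` domain h) (\<lambda>y. chart h y i)"
    proof (cases "i < d")
      case True
      then show ?thesis
        using bounded_linear.continuous_on[OF L.bl[OF True] \<open>continuous_on (enc ` domain h) (\<lambda>y. lnb (h * dec y))\<close>]
        by (simp add: chart_def)
    qed (simp add: chart_def)
  qed
  moreover have "chart h ` enc ` domain h \<subseteq> B \<inter> topspace (Euclidean_space d)"
    using chart_image[OF h] by (auto simp: B_def)
  ultimately have 1: "continuous_map (subtopology (gtop G) (enc ` domain h)) (subtopology (Euclidean_space d) B) (chart h)"
    unfolding sub continuous_map_Euclidean_iff by blast
  have "continuous_on UNIV (\<lambda>z. ginv h * exp (toE z))"
    by (intro continuous_intros continuous_on_exp_algebra)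
  then have "continuous_on (B \<inter> topspace (Euclidean_space d)) (\<lambda>z. enc (ginv h * exp (toE z)))"
    by (intro continuous_on_compose2[OF enc_cont, of _ "\<lambda>z. ginv h * exp (toE z)"])
       (auto intro: continuous_on_subset mult_\<Gamma>[OF ginv(1)[OF h] exp_toE])
  then have 2: "continuous_map (subtopology (Euclidean_space d) B) (subtopology (gtop G) (enc ` domain h)) (\<lambda>z. enc (ginv h * exp (toE z)))"
    unfolding sub using B_chart(1)[OF h] by (intro continuous_map_from_Euclidean) auto
  show ?thesis
    unfolding homeomorphic_map_maps homeomorphic_maps_def
  proof (intro exI[of _ "\<lambda>z. enc (ginv h * exp (toE z))"] conjI 1 2 ballI)
    fix y assume "y \<in> topspace (subtopology (gtop G) (enc ` domain h))"
    then obtain x where x: "y = enc x" "x \<in> domain h" using domain_\<Gamma> by auto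
    show "enc (ginv h * exp (toE (chart h y))) = y"
      using chart_in_B(2)[OF h x(2)] ginv(3)[OF h] by (simp add: x mult.assoc[symmetric])
  qed (use B_chart(2)[OF h] in auto)
qed

lemma Ckv_exp_comb:
  assumes "\<And>z. z \<in> V \<Longrightarrow> norm (L.comb (y z)) < 1/4" "\<And>j. Ckv n k V (\<lambda>z. y z j)"
  shows "Ckv n k V (\<lambda>z. exp (L.comb (y z)))"
  unfolding L.comb_def
  by (rule Ckv_pser[OF finite_lessThan _ pser_exp, where R = "1/4"])
     (use assms in \<open>auto simp: L.comb_def\<close>)

text \<open>\<open>Ckv_pser\<close> handles combinations of finitely many fixed vectors. The frame
  of \<open>F\<close> supplies such an expansion of \<open>W z - 1\<close>.\<close>

lemma Ckv_lnb:
  assumes W: "\<And>z. W z - 1 \<in> F" "\<And>z. z \<in> V \<Longrightarrow> norm (W z - 1) < 1" and k: "Ckv n k V W"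
  shows "Ckv n k V (\<lambda>z. lnb (W z))"
proof -
  have W': "W z - 1 = (\<Sum>j<m. c j (W z - 1) *\<^sub>R b j)" for z
    using F_comb[OF W(1)] by (simp add: comb_def)
  have "Ckv n k V (\<lambda>z. (\<lambda>v. lnb (1 + v)) (\<Sum>j<m. c j (W z - 1) *\<^sub>R b j))"
  proof (rule Ckv_pser[OF finite_lessThan _ pser_ln1p])
    show "norm (\<Sum>j<m. c j (W z - 1) *\<^sub>R b j) < 1" if "z \<in> V" for z using W(2)[OF that] W' by metis
    show "Ckv n k V (\<lambda>z. c j (W z - 1))" if "j \<in> {..<m}" for j
      using Ckv_bounded_linear[OF bl Ckv_add[OF k Ckv_const[of _ _ _ "- 1"]], of j] that by simp
  qed
  then show ?thesis unfolding W'[symmetric] by simp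
qed

text \<open>Chart changes, multiplication and inversion all read in coordinates as the logarithm of
  a smooth map into \<Gamma>; this treats them together.\<close>

lemma smooth_log_coordinates:
  assumes V: "openin (Euclidean_space n) V"
    and W: "\<And>z. W z \<in> \<Gamma>" "\<And>z. z \<in> V \<Longrightarrow> norm (W z - 1) < \<epsilon>" "\<And>k. Ckv n k V W"
    and f: "\<And>z j. z \<in> V \<Longrightarrow> j < d \<Longrightarrow> f z j = c' j (lnb (W z))"
  shows "smooth_map_on n d V f"
  unfolding smooth_map_on_def
proof (intro allI impI)
  fix j k assume j: "j < d"
  have "Ckv n k V (\<lambda>z. lnb (W z))"
  proof (rule Ckv_lnb)
    show "norm (W z - 1) < 1" if "z \<in> V" for z using W(2)[OF that] \<epsilon> by linarith
  qed (use W \<Gamma>_F in auto)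
  from Ckv_bounded_linear[OF L.bl[OF j] this] show "Ck_on n k V (\<lambda>z. f z j)"
    by (rule Ck_on_cong[OF V, rotated]) (simp add: f j)
qed

lemma Ckv_exp_toE:
  assumes "\<And>z. z \<in> V \<Longrightarrow> w z \<in> B" "\<And>j. Ckv n k V (\<lambda>z. w z j)"
  shows "Ckv n k V (\<lambda>z. exp (toE (w z)))" "Ckv n k V (\<lambda>z. exp (- toE (w z)))"
proof -
  show "Ckv n k V (\<lambda>z. exp (toE (w z)))"
    unfolding toE_def by (rule Ckv_exp_comb) (use assms in \<open>auto simp: B_def toE_def\<close>)
  have "Ckv n k V (\<lambda>z. exp (L.comb (\<lambda>j. - 1 * w z j)))"
  proof (rule Ckv_exp_comb)
    show "norm (L.comb (\<lambda>j. - 1 * w z j)) < 1/4" if "z \<in> V" for z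
      using assms(1)[OF that] by (simp add: B_def toE_def L.comb_def sum_negf)
    show "Ckv n k V (\<lambda>z. - 1 * w z j)" for j by (rule Ckv_mult[OF Ckv_const assms(2)])
  qed
  then show "Ckv n k V (\<lambda>z. exp (- toE (w z)))"
    by (simp add: toE_def L.comb_def sum_negf)
qed

lemma Ckv_mult_const: "Ckv n k V f \<Longrightarrow> Ckv n k V (\<lambda>z. g * f z)" for g :: 'e
  by (rule Ckv_mult[OF Ckv_const])

lemma Ckv_left_half: "Ckv n k V (\<lambda>z. left_half d z j)"
  by (cases "j < d") (simp_all add: left_half_def Ckv_coord Ckv_const)

lemma Ckv_right_half: "Ckv n k V (\<lambda>z. right_half d z j)"
  by (cases "j < d") (simp_all add: right_half_def Ckv_coord Ckv_const)

lemma halves_topspace: "left_half d z \<in> topspace (Euclidean_space d)" "right_half d z \<in> topspace (Euclidean_space d)"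
  by (auto simp: left_half_def right_half_def topspace_Euclidean_space)

lemma continuous_halves [continuous_intros]:
  "continuous_on S (left_half d)" "continuous_on S (right_half d)"
proof -
  have "continuous_on S (\<lambda>z. left_half d z j)" "continuous_on S (\<lambda>z. right_half d z j)" for j
    using Ckv_left_half[of 0 0 S j] Ckv_right_half[of 0 0 S j] by simp_all
  then show "continuous_on S (left_half d)" "continuous_on S (right_half d)"
    by (auto intro: continuous_on_coordinatewise_then_product)
qed

section \<open>Smoothness of the group operations\<close>

lemma transition_smooth:
  assumes h: "h \<in> \<Gamma>" and k: "k \<in> \<Gamma>"
  shows "smooth_map_on d d (chart h ` (enc ` domain h \<inter> enc ` domain k))
    (\<lambda>x. chart k (inv_into (enc ` domain h) (chart h) x))"
proof -
  define W where "W z = k * (ginv h * exp (toE z))" for z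
  define V where "V = {z \<in> B. norm (W z - 1) < \<epsilon>}"
  have W\<Gamma>: "W z \<in> \<Gamma>" for z unfolding W_def by (intro mult_\<Gamma> k ginv h exp_toE)
  have x\<Gamma>: "ginv h * exp (toE z) \<in> \<Gamma>" for z by (intro mult_\<Gamma> ginv h exp_toE)
  have eq: "chart h ` (enc ` domain h \<inter> enc ` domain k) = V"
  proof (intro equalityI subsetI)
    fix z assume "z \<in> chart h ` (enc ` domain h \<inter> enc ` domain k)"
    then obtain x where x: "x \<in> domain h" "enc x \<in> enc ` domain k" "z = chart h (enc x)" by auto
    then have "W z = k * x" using chart_in_B(2)[OF h x(1)] ginv(3)[OF h] by (simp add: W_def mult.assoc[symmetric])
    moreover have "norm (k * x - 1) < \<epsilon>" using x(1,2) enc_in_enc_domain[of x k] domain_\<Gamma>[of h] by blast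
    ultimately show "z \<in> V" using chart_in_B(1)[OF h x(1)] x(3) by (simp add: V_def)
  next
    fix z assume z: "z \<in> V"
    then have "z \<in> B" by (simp add: V_def)
    note x = B_chart[OF h this]
    have "enc (ginv h * exp (toE z)) \<in> enc ` domain k"
      using enc_in_enc_domain[OF x\<Gamma>, of z k] z by (simp add: V_def W_def)
    then show "z \<in> chart h ` (enc ` domain h \<inter> enc ` domain k)"
      using x by (intro image_eqI[of _ _ "enc (ginv h * exp (toE z))"]) auto
  qed
  have "V = {z \<in> topspace (Euclidean_space d). (norm (toE z) < 1/4 \<and> norm (exp (toE z) - 1) < \<epsilon>) \<and> norm (W z - 1) < \<epsilon>}"
    by (auto simp: V_def B_def)
  moreover have "open {z. (norm (toE z) < 1/4 \<and> norm (exp (toE z) - 1) < \<epsilon>) \<and> norm (W z - 1) < \<epsilon>}"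
    unfolding W_def
    by (intro open_Collect_conj[of "\<lambda>z. norm (toE z) < 1/4 \<and> norm (exp (toE z) - 1) < \<epsilon>"] open_B_like[OF continuous_on_id] open_Collect_less
        continuous_intros continuous_on_exp_algebra)
  ultimately have V: "openin (Euclidean_space d) V" by (simp add: openin_Euclidean_space_Collect)
  show ?thesis unfolding eq
  proof (rule smooth_log_coordinates[where W = W])
    show "openin (Euclidean_space d) V" by (rule V)
    show "Ckv d n V W" for n unfolding W_def
      by (intro Ckv_mult_const Ckv_exp_toE(1) Ckv_coord) (simp add: V_def)
    fix z j assume z: "z \<in> V" and j: "j < d"
    then have "inv_into (enc ` domain h) (chart h) z = enc (ginv h * exp (toE z))"
      by (intro chart_inv h) (simp add: V_def)
    then show "chart k (inv_into (enc ` domain h) (chart h) z) j = c' j (lnb (W z))"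
      using j x\<Gamma> by (simp add: chart_def W_def)
  qed (use W\<Gamma> in \<open>auto simp: V_def\<close>)
qed

lemma mult_smooth:
  assumes h: "h \<in> \<Gamma>" and h': "h' \<in> \<Gamma>" and k: "k \<in> \<Gamma>"
  shows "smooth_map_on (2 * d) d
        {z \<in> topspace (Euclidean_space (2 * d)).
           left_half d z \<in> B \<and> right_half d z \<in> B \<and>
           inv_into (enc ` domain h) (chart h) (left_half d z) \<otimes>\<^bsub>G\<^esub> inv_into (enc ` domain h') (chart h') (right_half d z) \<in> enc ` domain k}
        (\<lambda>z. chart k (inv_into (enc ` domain h) (chart h) (left_half d z) \<otimes>\<^bsub>G\<^esub> inv_into (enc ` domain h') (chart h') (right_half d z)))"
    (is "smooth_map_on _ _ ?V _")
proof -
  define X where "X z = ginv h * exp (toE (left_half d z))" for z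
  define Y where "Y z = ginv h' * exp (toE (right_half d z))" for z
  define W where "W z = k * (X z * Y z)" for z
  have XY: "X z \<in> \<Gamma>" "Y z \<in> \<Gamma>" for z unfolding X_def Y_def
    by (rule mult_\<Gamma>[OF ginv(1)[OF h] exp_toE], rule mult_\<Gamma>[OF ginv(1)[OF h'] exp_toE])
  have W\<Gamma>: "W z \<in> \<Gamma>" for z unfolding W_def by (intro mult_\<Gamma> k XY)
  define V where "V = {z \<in> topspace (Euclidean_space (2 * d)).
    left_half d z \<in> B \<and> right_half d z \<in> B \<and> norm (W z - 1) < \<epsilon>}"
  have prod: "inv_into (enc ` domain h) (chart h) (left_half d z) \<otimes>\<^bsub>G\<^esub> inv_into (enc ` domain h') (chart h') (right_half d z) = enc (X z * Y z)"
    if "left_half d z \<in> B" "right_half d z \<in> B" for z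
    unfolding chart_inv[OF h that(1)] chart_inv[OF h' that(2)] X_def[symmetric] Y_def[symmetric]
    using XY by simp
  have "inv_into (enc ` domain h) (chart h) (left_half d z) \<otimes>\<^bsub>G\<^esub> inv_into (enc ` domain h') (chart h') (right_half d z)
      \<in> enc ` domain k \<longleftrightarrow> norm (W z - 1) < \<epsilon>"
    if "left_half d z \<in> B" "right_half d z \<in> B" for z
    unfolding prod[OF that] W_def by (rule enc_in_enc_domain[OF mult_\<Gamma>[OF XY]])
  then have eq: "?V = V" unfolding V_def by blast
  let ?P = "\<lambda>w z. norm (toE (w z)) < 1/4 \<and> norm (exp (toE (w z)) - 1) < \<epsilon>"
  have "V = {z \<in> topspace (Euclidean_space (2 * d)). (?P (left_half d) z \<and> ?P (right_half d) z) \<and> norm (W z - 1) < \<epsilon>}"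
    using halves_topspace by (auto simp: V_def B_def)
  moreover have "open {z. (?P (left_half d) z \<and> ?P (right_half d) z) \<and> norm (W z - 1) < \<epsilon>}"
  proof (intro open_Collect_conj[of "\<lambda>z. ?P (left_half d) z \<and> ?P (right_half d) z"]
      open_Collect_conj[of "?P (left_half d)"] open_B_like continuous_halves)
    show "open {z. norm (W z - 1) < \<epsilon>}"
      unfolding W_def X_def Y_def
      by (intro open_Collect_less continuous_intros continuous_on_exp_algebra)
  qed
  ultimately have V: "openin (Euclidean_space (2 * d)) V" by (simp add: openin_Euclidean_space_Collect)
  show ?thesis unfolding eq
  proof (rule smooth_log_coordinates[where W = W])
    show "openin (Euclidean_space (2 * d)) V" by (rule V)
    show "Ckv (2 * d) n V W" for n unfolding W_def X_def Y_def
      by (intro Ckv_mult_const Ckv_mult Ckv_exp_toE(1) Ckv_left_half Ckv_right_half) (simp_all add: V_def)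
    fix z j assume z: "z \<in> V" and j: "j < d"
    then have "left_half d z \<in> B" "right_half d z \<in> B" by (auto simp: V_def)
    from prod[OF this] show "chart k (inv_into (enc ` domain h) (chart h) (left_half d z) \<otimes>\<^bsub>G\<^esub> inv_into (enc ` domain h') (chart h') (right_half d z)) j = c' j (lnb (W z))"
      using j mult_\<Gamma>[OF XY, of z z] by (simp add: chart_def W_def del: G_simps)
  qed (use W\<Gamma> in \<open>auto simp: V_def\<close>)
qed

text \<open>The inverse of \<open>ginv h * exp (toE z)\<close> is \<open>exp (- toE z) * h\<close>:
  inversion turns into a change of sign in the exponent.\<close>

lemma inv_smooth:
  assumes h: "h \<in> \<Gamma>" and k: "k \<in> \<Gamma>"
  shows "smooth_map_on d d
    {x \<in> B. inv\<^bsub>G\<^esub> (inv_into (enc ` domain h) (chart h) x) \<in> enc ` domain k}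
    (\<lambda>x. chart k (inv\<^bsub>G\<^esub> (inv_into (enc ` domain h) (chart h) x)))" (is "smooth_map_on _ _ ?V _")
proof -
  define Y where "Y z = exp (- toE z) * h" for z
  define W where "W z = k * Y z" for z
  have Y\<Gamma>: "Y z \<in> \<Gamma>" for z unfolding Y_def by (rule mult_\<Gamma>[OF exp_minus_\<Gamma>[OF exp_toE] h])
  have W\<Gamma>: "W z \<in> \<Gamma>" for z unfolding W_def by (intro mult_\<Gamma> k Y\<Gamma>)
  define V where "V = {z \<in> B. norm (W z - 1) < \<epsilon>}"
  have x\<Gamma>: "ginv h * exp (toE z) \<in> \<Gamma>" for z by (intro mult_\<Gamma> ginv h exp_toE)
  have inv: "inv\<^bsub>G\<^esub> (inv_into (enc ` domain h) (chart h) z) = enc (Y z)" if "z \<in> B" for z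
    unfolding chart_inv[OF h that]
  proof (rule inv_enc[OF x\<Gamma> Y\<Gamma>])
    have "Y z * (ginv h * exp (toE z)) = exp (- toE z) * (h * ginv h) * exp (toE z)"
      by (simp only: Y_def mult.assoc)
    also have "\<dots> = 1" using exp_minus_inverse[of "- toE z"] ginv(2)[OF h] by simp
    finally show "Y z * (ginv h * exp (toE z)) = 1" .
  qed
  have "inv\<^bsub>G\<^esub> (inv_into (enc ` domain h) (chart h) z) \<in> enc ` domain k \<longleftrightarrow> norm (W z - 1) < \<epsilon>"
    if "z \<in> B" for z
    unfolding inv[OF that] W_def by (rule enc_in_enc_domain[OF Y\<Gamma>])
  then have eq: "?V = V" unfolding V_def by blast
  have "V = {z \<in> topspace (Euclidean_space d). (norm (toE z) < 1/4 \<and> norm (exp (toE z) - 1) < \<epsilon>) \<and> norm (W z - 1) < \<epsilon>}"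
    by (auto simp: V_def B_def)
  moreover have "open {z. (norm (toE z) < 1/4 \<and> norm (exp (toE z) - 1) < \<epsilon>) \<and> norm (W z - 1) < \<epsilon>}"
    unfolding W_def Y_def
    by (intro open_Collect_conj[of "\<lambda>z. norm (toE z) < 1/4 \<and> norm (exp (toE z) - 1) < \<epsilon>"] open_B_like[OF continuous_on_id] open_Collect_less
        continuous_intros continuous_on_exp_algebra)
  ultimately have V: "openin (Euclidean_space d) V" by (simp add: openin_Euclidean_space_Collect)
  show ?thesis unfolding eq
  proof (rule smooth_log_coordinates[where W = W])
    show "openin (Euclidean_space d) V" by (rule V)
    show "Ckv d n V W" for n unfolding W_def Y_def
      by (intro Ckv_mult_const Ckv_mult Ckv_exp_toE(2) Ckv_coord Ckv_const) (simp add: V_def)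
    fix z j assume z: "z \<in> V" and j: "j < d"
    then have "z \<in> B" by (simp add: V_def)
    from inv[OF this] show "chart k (inv\<^bsub>G\<^esub> (inv_into (enc ` domain h) (chart h) z)) j = c' j (lnb (W z))"
      using j Y\<Gamma> by (simp add: chart_def W_def)
  qed (use W\<Gamma> in \<open>auto simp: V_def\<close>)
qed

theorem finite_dim_lie_group_G:
  assumes H: "Hausdorff_space (subtopology euclidean (enc ` \<Gamma>))"
  shows "finite_dim_lie_group G"
proof (intro finite_dim_lie_group.intro topological_group_G finite_dim_lie_group_axioms.intro)
  show "Hausdorff_space (gtop G)" using H by simp
  show "(\<Union>(U, f)\<in>atlas G. U) = carrier G"
  proof
    show "(\<Union>(U, f)\<in>atlas G. U) \<subseteq> carrier G" using domain_\<Gamma> by auto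
    show "carrier G \<subseteq> (\<Union>(U, f)\<in>atlas G. U)"
    proof
      fix y assume "y \<in> carrier G"
      then obtain x where x: "x \<in> \<Gamma>" "y = enc x" by auto
      \<comment> \<open>The chart centred at \<open>x\<close> carries the inverse of
        \<open>x\<close> as its label.\<close>
      then have "x \<in> domain (ginv x)" using ginv(3) \<epsilon> by (simp add: domain_def)
      moreover have "(enc ` domain (ginv x), chart (ginv x)) \<in> atlas G" using ginv(1)[OF x(1)] by auto
      ultimately show "y \<in> (\<Union>(U, f)\<in>atlas G. U)" using x(2) by blast
    qed
  qed
next
  fix U f assume "(U, f) \<in> atlas G"
  then obtain h where h: "h \<in> \<Gamma>" "U = enc ` domain h" "f = chart h" by auto
  have fU: "f ` U = B" unfolding h(2,3) by (rule chart_image[OF h(1)])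
  have "U = {y \<in> enc ` \<Gamma>. norm (h * dec y - 1) < \<epsilon>}"
    unfolding h(2) using enc_domain[of _ h] domain_\<Gamma>[of h] by blast
  also have "openin (gtop G) \<dots>"
  proof -
    have "continuous_on (enc ` \<Gamma>) (\<lambda>y. norm (h * dec y - 1))" by (intro continuous_intros dec_cont)
    from continuous_openin_preimage_gen[OF this, of "{..<\<epsilon>}"] show ?thesis
      by (simp add: vimage_def Collect_conj_eq)
  qed
  finally show "openin (gtop G) U" .
  show "openin (Euclidean_space (ldim G)) (f ` U)" unfolding fU using openin_B by simp
  show "homeomorphic_map (subtopology (gtop G) U) (subtopology (Euclidean_space (ldim G)) (f ` U)) f"
    unfolding fU using chart_homeomorphic[OF h(1)] by (simp add: h)
  fix V g assume "(V, g) \<in> atlas G"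
  then obtain k where k: "k \<in> \<Gamma>" "V = enc ` domain k" "g = chart k" by auto
  have gV: "g ` V = B" unfolding k(2,3) by (rule chart_image[OF k(1)])
  show "smooth_map_on (ldim G) (ldim G) (f ` (U \<inter> V)) (\<lambda>x. g (inv_into U f x))"
    using transition_smooth[OF h(1) k(1)] by (simp add: h k)
  show "smooth_map_on (ldim G) (ldim G) {x \<in> f ` U. inv\<^bsub>G\<^esub> (inv_into U f x) \<in> V} (\<lambda>x. g (inv\<^bsub>G\<^esub> (inv_into U f x)))"
    unfolding fU unfolding h(2,3) k(2,3) G_simps(5) by (rule inv_smooth[OF h(1) k(1)])
  fix W i assume "(W, i) \<in> atlas G"
  then obtain l where l: "l \<in> \<Gamma>" "W = enc ` domain l" "i = chart l" by auto
  show "smooth_map_on (2 * ldim G) (ldim G)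
        {z \<in> topspace (Euclidean_space (2 * ldim G)).
           left_half (ldim G) z \<in> f ` U \<and> right_half (ldim G) z \<in> g ` V \<and>
           inv_into U f (left_half (ldim G) z) \<otimes>\<^bsub>G\<^esub> inv_into V g (right_half (ldim G) z) \<in> W}
        (\<lambda>z. i (inv_into U f (left_half (ldim G) z) \<otimes>\<^bsub>G\<^esub> inv_into V g (right_half (ldim G) z)))"
    unfolding fU gV unfolding h(2,3) k(2,3) l(2,3) G_simps(5) by (rule mult_smooth[OF h(1) k(1) l(1)])
qed

text \<open>The chart with label \<open>1\<close> is the logarithm itself, whose derivative at
  \<open>1\<close> is the identity. Velocities in this chart are thus plain coordinates of the
  generator.\<close>

lemma chart_one_velocity:
  assumes X: "X \<in> lie" and i: "i < d"
  shows "((\<lambda>t. chart 1 (enc (exp (t *\<^sub>R X))) i) has_real_derivative c' i X) (at 0)"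
proof -
  have dX: "((\<lambda>t. exp (t *\<^sub>R X)) has_vector_derivative X) (at 0)"
    using exp_scaleR_has_vector_derivative_right[of X 0 UNIV]
    unfolding scaleR_zero_left exp_zero mult_1_left .
  have "(lnb has_derivative (\<lambda>v. v)) (at (exp (0 *\<^sub>R X)))"
    unfolding scaleR_zero_left exp_zero by (rule lnb_has_derivative_1)
  from has_derivative_compose[OF dX[unfolded has_vector_derivative_def] this]
  have "((\<lambda>t. lnb (exp (t *\<^sub>R X))) has_vector_derivative X) (at 0)"
    by (simp add: has_vector_derivative_def)
  from bounded_linear.has_vector_derivative[OF L.bl[OF i] this]
  have "((\<lambda>t. c' i (lnb (exp (t *\<^sub>R X)))) has_real_derivative c' i X) (at 0)"
    by (simp add: has_real_derivative_iff_has_vector_derivative)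
  then show ?thesis using i exp_lie[OF X] by (simp add: chart_def)
qed

end

section \<open>Matrices of all sizes in one Banach algebra\<close>

instance bcontfun :: (metric_space, banach) banach ..

\<comment> \<open>Sizes of matrices vary over the indices of a Lie system, so they cannot be types: all matrices
  have to be elements of one Banach algebra.\<close>
typedef seqop = "UNIV :: ((real \<Rightarrow>\<^sub>C real) \<Rightarrow>\<^sub>L (real \<Rightarrow>\<^sub>C real)) set"
  morphisms blinfun_of Op ..

setup_lifting type_definition_seqop

instantiation seqop :: real_normed_algebra_1
begin

lift_definition zero_seqop :: seqop is 0 .
lift_definition one_seqop :: seqop is id_blinfun .
lift_definition plus_seqop :: "seqop \<Rightarrow> seqop \<Rightarrow> seqop" is "(+)" .
lift_definition minus_seqop :: "seqop \<Rightarrow> seqop \<Rightarrow> seqop" is "(-)" .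
lift_definition uminus_seqop :: "seqop \<Rightarrow> seqop" is uminus .
lift_definition times_seqop :: "seqop \<Rightarrow> seqop \<Rightarrow> seqop" is "(o\<^sub>L)" .
lift_definition scaleR_seqop :: "real \<Rightarrow> seqop \<Rightarrow> seqop" is "scaleR" .
lift_definition norm_seqop :: "seqop \<Rightarrow> real" is norm .

definition dist_seqop :: "seqop \<Rightarrow> seqop \<Rightarrow> real" where "dist_seqop x y = norm (x - y)"
definition sgn_seqop :: "seqop \<Rightarrow> seqop" where "sgn_seqop x = scaleR (inverse (norm x)) x"
definition uniformity_seqop :: "(seqop \<times> seqop) filter"
  where "uniformity_seqop = (INF e\<in>{0<..}. principal {(x, y). dist x y < e})"
definition open_seqop :: "seqop set \<Rightarrow> bool"
  where "open_seqop U \<longleftrightarrow> (\<forall>x\<in>U. eventually (\<lambda>(x', y). x' = x \<longrightarrow> y \<in> U) uniformity)"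

lemma norm_id_bcontfun: "norm (id_blinfun :: (real \<Rightarrow>\<^sub>C real) \<Rightarrow>\<^sub>L (real \<Rightarrow>\<^sub>C real)) = 1"
proof (rule antisym[OF norm_blinfun_id_le])
  let ?c = "const_bcontfun 1 :: real \<Rightarrow>\<^sub>C real"
  have "1 \<le> norm ?c" using norm_bounded[of ?c 0] by (simp add: const_bcontfun.rep_eq)
  moreover have "norm ?c \<le> norm (id_blinfun :: (real \<Rightarrow>\<^sub>C real) \<Rightarrow>\<^sub>L (real \<Rightarrow>\<^sub>C real)) * norm ?c"
    using norm_blinfun[of id_blinfun ?c] by simp
  ultimately show "1 \<le> norm (id_blinfun :: (real \<Rightarrow>\<^sub>C real) \<Rightarrow>\<^sub>L (real \<Rightarrow>\<^sub>C real))"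
    by (metis mult_le_cancel_right1 not_one_le_zero order.strict_trans2 not_le zero_less_one)
qed

instance
proof
  fix a b c :: seqop and r s :: real
  show "a + b + c = a + (b + c)" by transfer (rule add.assoc)
  show "a + b = b + a" by transfer (rule add.commute)
  show "0 + a = a" by transfer simp
  show "- a + a = 0" by transfer simp
  show "a - b = a + - b" by transfer simp
  show "r *\<^sub>R (a + b) = r *\<^sub>R a + r *\<^sub>R b" by transfer (rule scaleR_add_right)
  show "(r + s) *\<^sub>R a = r *\<^sub>R a + s *\<^sub>R a" by transfer (rule scaleR_add_left)
  show "r *\<^sub>R s *\<^sub>R a = (r * s) *\<^sub>R a" by transfer simp
  show "1 *\<^sub>R a = a" by transfer simp
  show "a * b * c = a * (b * c)" by transfer (auto intro: blinfun_eqI)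
  show "(a + b) * c = a * c + b * c" by transfer (auto intro: blinfun_eqI simp: blinfun.bilinear_simps)
  show "a * (b + c) = a * b + a * c" by transfer (auto intro: blinfun_eqI simp: blinfun.bilinear_simps)
  show "r *\<^sub>R a * b = r *\<^sub>R (a * b)" by transfer (auto intro: blinfun_eqI simp: blinfun.bilinear_simps)
  show "a * r *\<^sub>R b = r *\<^sub>R (a * b)" by transfer (auto intro: blinfun_eqI simp: blinfun.bilinear_simps)
  show "1 * a = a" "a * 1 = a" by (transfer, auto intro: blinfun_eqI)+
  show n1: "norm (1 :: seqop) = 1" by transfer (rule norm_id_bcontfun)
  show "0 \<noteq> (1 :: seqop)"
    by transfer (metis norm_id_bcontfun norm_zero zero_neq_one)
  show "dist a b = norm (a - b)" by (rule dist_seqop_def)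
  show "sgn a = scaleR (inverse (norm a)) a" by (rule sgn_seqop_def)
  show "uniformity = (INF e\<in>{0<..}. principal {(x, y :: seqop). dist x y < e})"
    by (rule uniformity_seqop_def)
  show "open U \<longleftrightarrow> (\<forall>x\<in>U. \<forall>\<^sub>F (x', y) in uniformity. x' = x \<longrightarrow> y \<in> U)" for U :: "seqop set"
    by (rule open_seqop_def)
  show "norm a = 0 \<longleftrightarrow> a = 0" by transfer simp
  show "norm (a + b) \<le> norm a + norm b" by transfer (rule norm_triangle_ineq)
  show "norm (r *\<^sub>R a) = \<bar>r\<bar> * norm a" by transfer simp
  show "norm (a * b) \<le> norm a * norm b" by transfer (rule norm_blinfun_compose)
qed

end

lemma dist_seqop: "dist x y = dist (blinfun_of x) (blinfun_of y)"
  unfolding dist_norm by transfer simp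

instance seqop :: banach
proof
  fix X :: "nat \<Rightarrow> seqop" assume "Cauchy X"
  then have "Cauchy (\<lambda>n. blinfun_of (X n))" by (simp add: Cauchy_def dist_seqop)
  then have "convergent (\<lambda>n. blinfun_of (X n))" by (rule Cauchy_convergent)
  then obtain L where "(\<lambda>n. blinfun_of (X n)) \<longlonglongrightarrow> L" unfolding convergent_def by blast
  then have "X \<longlonglongrightarrow> Op L" by (simp add: tendsto_iff dist_seqop Op_inverse)
  then show "convergent X" by (rule convergentI)
qed

section \<open>Matrix units and corners\<close>

lemma bump_bcontfun: "(\<lambda>x. max 0 (1 - \<bar>x - real i\<bar>)) \<in> bcontfun"
  by (rule bcontfun_normI[of _ 1]) (auto intro!: continuous_intros)

\<comment> \<open>Together with the evaluations at the natural numbers the bump functions form a biorthogonal system.\<close>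
definition bump :: "nat \<Rightarrow> (real \<Rightarrow>\<^sub>C real)" where
  "bump i = Bcontfun (\<lambda>x. max 0 (1 - \<bar>x - real i\<bar>))"

lemma apply_bump: "apply_bcontfun (bump i) x = max 0 (1 - \<bar>x - real i\<bar>)"
  by (simp add: bump_def Bcontfun_inverse[OF bump_bcontfun])

lemma apply_bump_nat: "apply_bcontfun (bump i) (real k) = (if k = i then 1 else 0)"
  unfolding apply_bump by (cases k i rule: linorder_cases) auto

lemma abs_bcontfun_le: "\<bar>apply_bcontfun v k\<bar> \<le> norm (v :: real \<Rightarrow>\<^sub>C real)"
  using norm_bounded[of v k] by simp

lemma apply_bcontfun_simps:
  "apply_bcontfun (u + v) k = apply_bcontfun u k + apply_bcontfun (v :: real \<Rightarrow>\<^sub>C real) k"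
  "apply_bcontfun (r *\<^sub>R v) k = r * apply_bcontfun v k"
  "apply_bcontfun (0 :: real \<Rightarrow>\<^sub>C real) k = 0"
  by (simp_all add: plus_bcontfun.rep_eq scaleR_bcontfun.rep_eq zero_bcontfun.rep_eq)

lemma bounded_linear_apply_bcontfun: "bounded_linear (\<lambda>v :: real \<Rightarrow>\<^sub>C real. apply_bcontfun v k)"
  by (rule bounded_linear_intro[of _ 1]) (auto simp: apply_bcontfun_simps abs_bcontfun_le)

text \<open>A rank-one operator, made from the evaluation at \<open>j\<close> and the bump at
  \<open>i\<close>. By biorthogonality these multiply like matrix units.\<close>

lift_definition elem :: "nat \<Rightarrow> nat \<Rightarrow> seqop" is
  "\<lambda>i j. Blinfun (\<lambda>v. apply_bcontfun v (real j) *\<^sub>R bump i)" .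

lemma apply_elem: "blinfun_apply (blinfun_of (elem i j)) v = apply_bcontfun v (real j) *\<^sub>R bump i"
  by (simp add: elem.rep_eq bounded_linear_Blinfun_apply[OF bounded_linear_scaleR_const[OF bounded_linear_apply_bcontfun]])

lemma elem_mult: "elem i j * elem k l = (if j = k then elem i l else 0)"
proof -
  have "blinfun_of (elem i j * elem k l) = blinfun_of (if j = k then elem i l else 0)"
  proof (rule blinfun_eqI, rule bcontfun_eqI)
    fix v x
    show "apply_bcontfun (blinfun_apply (blinfun_of (elem i j * elem k l)) v) x =
        apply_bcontfun (blinfun_apply (blinfun_of (if j = k then elem i l else 0)) v) x"
      by (simp add: times_seqop.rep_eq apply_elem apply_bump_nat zero_seqop.rep_eq apply_bcontfun_simps)
  qed
  then show ?thesis by (simp add: blinfun_of_inject)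
qed

definition entry :: "nat \<Rightarrow> nat \<Rightarrow> seqop \<Rightarrow> real" where
  "entry i j T = apply_bcontfun (blinfun_apply (blinfun_of T) (bump j)) (real i)"

lemma bounded_linear_entry: "bounded_linear (entry i j)"
proof -
  have "bounded_linear blinfun_of"
    by (rule bounded_linear_intro[of _ 1]) (auto simp: plus_seqop.rep_eq scaleR_seqop.rep_eq norm_seqop.rep_eq)
  then have "bounded_linear (\<lambda>T. blinfun_apply (blinfun_of T) (bump j))"
    by (rule bounded_linear_compose[OF bounded_bilinear.bounded_linear_left[OF bounded_bilinear_blinfun_apply]])
  from bounded_linear_compose[OF bounded_linear_apply_bcontfun this] show ?thesis
    by (simp add: entry_def[abs_def])
qed

lemma entry_elem: "entry i j (elem k l) = (if i = k \<and> j = l then 1 else 0)"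
  by (simp add: entry_def apply_elem apply_bump_nat apply_bcontfun_simps)

lemma entry_one: "entry i j 1 = (if i = j then 1 else 0)"
  by (simp add: entry_def one_seqop.rep_eq apply_bump_nat)

text \<open>Embeds the matrices of size \<open>n\<close> as a corner. The identity matrix goes to an
  idempotent different from \<open>1\<close>, so groups of such matrices have to be completed by the
  complementary idempotent.\<close>

definition opmat :: "nat \<Rightarrow> (nat \<Rightarrow> nat \<Rightarrow> real) \<Rightarrow> seqop" where
  "opmat n M = (\<Sum>i<n. \<Sum>j<n. M i j *\<^sub>R elem i j)"

lemma opmat_cong: "(\<And>i j. i < n \<Longrightarrow> j < n \<Longrightarrow> M i j = M' i j) \<Longrightarrow> opmat n M = opmat n M'"
  by (simp add: opmat_def)

lemma opmat_add: "opmat n (\<lambda>i j. M i j + M' i j) = opmat n M + opmat n M'"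
  by (simp add: opmat_def scaleR_add_left sum.distrib)

lemma opmat_scale: "opmat n (\<lambda>i j. r * M i j) = r *\<^sub>R opmat n M"
  by (simp add: opmat_def scaleR_sum_right)

lemma opmat_mult: "opmat n M * opmat n M' = opmat n (\<lambda>i j. \<Sum>k<n. M i k * M' k j)"
proof -
  have "(\<Sum>k<n. M i k *\<^sub>R elem i k) * (\<Sum>j<n. M' l j *\<^sub>R elem l j) = (\<Sum>j<n. (M i l * M' l j) *\<^sub>R elem i j)"
    if l: "l < n" for i l
  proof -
    have "(\<Sum>k<n. M i k *\<^sub>R elem i k) * (\<Sum>j<n. M' l j *\<^sub>R elem l j) =
        (\<Sum>k<n. \<Sum>j<n. (M i k * M' l j) *\<^sub>R (elem i k * elem l j))"
      by (simp add: sum_product mult.commute[of "M' _ _"])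
    also have "\<dots> = (\<Sum>k<n. if k = l then (\<Sum>j<n. (M i l * M' l j) *\<^sub>R elem i j) else 0)"
      by (intro sum.cong refl) (simp add: elem_mult)
    finally show ?thesis using l by simp
  qed
  then have "opmat n M * opmat n M' = (\<Sum>i<n. \<Sum>l<n. \<Sum>j<n. (M i l * M' l j) *\<^sub>R elem i j)"
    unfolding opmat_def sum_product[of "\<lambda>i. \<Sum>j<n. M i j *\<^sub>R elem i j"] by simp
  also have "\<dots> = (\<Sum>i<n. \<Sum>j<n. \<Sum>l<n. (M i l * M' l j) *\<^sub>R elem i j)"
    by (rule sum.cong[OF refl]) (rule sum.swap)
  finally show ?thesis by (simp add: opmat_def scaleR_sum_left)
qed

lemma entry_opmat: "entry i j (opmat n M) = (if i < n \<and> j < n then M i j else 0)"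
proof -
  note l = bounded_linear.linear[OF bounded_linear_entry]
  have "entry i j (opmat n M) = (\<Sum>k<n. \<Sum>l<n. if i = k \<and> j = l then M k l else 0)"
    unfolding opmat_def by (simp add: linear_sum[OF l] linear_scale[OF l] entry_elem if_distrib[of "(*) _"] cong: if_cong)
  also have "\<dots> = (\<Sum>k<n. if i = k then (\<Sum>l<n. if j = l then M i l else 0) else 0)"
    by (intro sum.cong refl) auto
  finally show ?thesis by auto
qed

definition mat_basis :: "nat \<Rightarrow> nat \<Rightarrow> seqop" where "mat_basis n k = elem (k div n) (k mod n)"
definition mat_coord :: "nat \<Rightarrow> nat \<Rightarrow> seqop \<Rightarrow> real" where "mat_coord n k = entry (k div n) (k mod n)"

lemma sum_rect: "(\<Sum>k<p*q. f (k div q) (k mod q)) = (\<Sum>i<p. \<Sum>j<q. f i j)" for p q :: nat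
proof -
  have "(\<Sum>i<p. \<Sum>j<q. f i j) = (\<Sum>x\<in>{..<p}\<times>{..<q}. f (fst x) (snd x))"
    by (simp add: sum.cartesian_product split_beta)
  also have "\<dots> = (\<Sum>k<p*q. f (k div q) (k mod q))"
  proof (rule sum.reindex_bij_witness[of _ "\<lambda>k. (k div q, k mod q)" "\<lambda>x. fst x * q + snd x"])
    fix x assume x: "x \<in> {..<p} \<times> {..<q}"
    then show "((fst x * q + snd x) div q, (fst x * q + snd x) mod q) = x" by (cases x) auto
    have "fst x * q + snd x < fst x * q + q" using x by auto
    also have "\<dots> = (fst x + 1) * q" by simp
    also have "\<dots> \<le> p * q" using x by (intro mult_right_mono) auto
    finally show "fst x * q + snd x \<in> {..<p * q}" by simp
    show "f ((fst x * q + snd x) div q) ((fst x * q + snd x) mod q) = f (fst x) (snd x)" using x by auto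
  next
    fix k assume k: "k \<in> {..<p * q}"
    then have "q > 0" by (cases q) auto
    then show "(k div q, k mod q) \<in> {..<p} \<times> {..<q}"
      using k less_mult_imp_div_less[of k p q] by auto
  qed auto
  finally show ?thesis by simp
qed

lemma div_mod_bounds: "k < p * q \<Longrightarrow> k div q < p" "k < p * q \<Longrightarrow> k mod q < (q::nat)"
proof -
  assume k: "k < p * q"
  then show "k div q < p" by (rule less_mult_imp_div_less)
  have "q > 0" using k by (cases q) auto
  then show "k mod q < q" by simp
qed

lemma frame_mat: "frame (n * n) (mat_basis n) (mat_coord n)"
proof (rule frame.intro)
  show "bounded_linear (mat_coord n i)" for i unfolding mat_coord_def by (rule bounded_linear_entry)
  show "mat_coord n i (mat_basis n j) = (if i = j then 1 else 0)" for i j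
  proof -
    have "i div n = j div n \<and> i mod n = j mod n \<longleftrightarrow> i = j" by (metis div_mult_mod_eq)
    then show ?thesis by (simp add: mat_coord_def mat_basis_def entry_elem)
  qed
qed

interpretation mat: frame "n * n" "mat_basis n" "mat_coord n" for n by (rule frame_mat)

lemma mat_comb: "mat.comb n a = opmat n (\<lambda>i j. a (i * n + j))"
proof -
  have "mat.comb n a = (\<Sum>k<n*n. a ((k div n) * n + k mod n) *\<^sub>R elem (k div n) (k mod n))"
    unfolding mat.comb_def mat_basis_def by simp
  then show ?thesis unfolding opmat_def by (simp only: sum_rect[of "\<lambda>i j. a (i * n + j) *\<^sub>R elem i j"])
qed

lemma mat_F: "mat.F n = range (opmat n)"
proof
  show "mat.F n \<subseteq> range (opmat n)" unfolding mat.F_eq by (auto simp: mat_comb)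
  show "range (opmat n) \<subseteq> mat.F n"
  proof clarify
    fix M
    have "opmat n M = mat.comb n (\<lambda>k. M (k div n) (k mod n))"
      unfolding mat_comb by (rule opmat_cong) (simp add: div_mult_self3)
    then show "opmat n M \<in> mat.F n" by simp
  qed
qed

lemma mat_F_eq: "x \<in> mat.F n \<Longrightarrow> x = opmat n (\<lambda>i j. entry i j x)"
  unfolding mat_F by (auto intro!: opmat_cong simp: entry_opmat)

lemma mat_F_mult: "x \<in> mat.F n \<Longrightarrow> y \<in> mat.F n \<Longrightarrow> x * y \<in> mat.F n"
  unfolding mat_F by (auto simp: opmat_mult)

section \<open>Encoding of matrices as real sequences\<close>

text \<open>Lists all entries irrespective of the size, so one encoding serves all stages.\<close>

definition enc :: "seqop \<Rightarrow> nat \<Rightarrow> real" where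
  "enc T = (\<lambda>k. entry (fst (prod_decode k)) (snd (prod_decode k)) T)"

lemma continuous_on_enc: "continuous_on S enc"
  unfolding enc_def
  by (intro continuous_on_coordinatewise_then_product linear_continuous_on[OF bounded_linear_entry])

text \<open>Decodes elements of \<open>1 + mat.F n\<close>. It is continuous on all sequences
  because it reads only finitely many of their terms, and so it makes \<open>enc\<close> an
  embedding.\<close>

definition undec :: "nat \<Rightarrow> (nat \<Rightarrow> real) \<Rightarrow> seqop" where
  "undec n x = 1 + opmat n (\<lambda>i j. x (prod_encode (i, j)) - (if i = j then 1 else 0))"

lemma undec_enc: "T - 1 \<in> mat.F n \<Longrightarrow> undec n (enc T) = T"
proof -
  assume "T - 1 \<in> mat.F n"
  then have "T - 1 = opmat n (\<lambda>i j. entry i j (T - 1))" by (rule mat_F_eq)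
  also have "\<dots> = opmat n (\<lambda>i j. enc T (prod_encode (i, j)) - (if i = j then 1 else 0))"
    by (rule opmat_cong) (simp add: enc_def linear_diff[OF bounded_linear.linear[OF bounded_linear_entry]] entry_one)
  finally show ?thesis by (simp add: undec_def algebra_simps)
qed

lemma continuous_on_undec: "continuous_on S (undec n)"
proof -
  have c: "continuous_on S (\<lambda>x :: nat \<Rightarrow> real. x k)" for k
    by (rule continuous_on_subset[OF continuous_on_product_coordinates subset_UNIV])
  show ?thesis
    unfolding undec_def opmat_def
    by (intro continuous_on_add continuous_on_const continuous_on_sum continuous_on_scaleR continuous_on_diff c)
qed

lemma enc_homeo:
  assumes "\<And>x. x \<in> \<Gamma> \<Longrightarrow> x - 1 \<in> mat.F n"
  shows "inj_on enc \<Gamma>" "continuous_on (enc ` \<Gamma>) (inv_into \<Gamma> enc)"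
proof -
  show i: "inj_on enc \<Gamma>" by (rule inj_on_inverseI[of _ "undec n"]) (use undec_enc assms in auto)
  show "continuous_on (enc ` \<Gamma>) (inv_into \<Gamma> enc)"
    by (rule continuous_on_eq[OF continuous_on_undec[of _ n]]) (use undec_enc assms i in auto)
qed

section \<open>Matrix coalgebras and convolution\<close>

lemma vector_space_field_mult: "vector_space ((*) :: 'k::field \<Rightarrow> 'k \<Rightarrow> 'k)"
  by unfold_locales (auto simp: algebra_simps)

lemma linear_0': "Vector_Spaces.linear s1 s2 f \<Longrightarrow> f 0 = 0"
  and linear_add': "Vector_Spaces.linear s1 s2 f \<Longrightarrow> f (x + y) = f x + f y"
  and linear_scale': "Vector_Spaces.linear s1 s2 f \<Longrightarrow> f (s1 c x) = s2 c (f x)"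
  and linear_diff': "Vector_Spaces.linear s1 s2 f \<Longrightarrow> f (x - y) = f x - f y"
  and linear_sum': "Vector_Spaces.linear s1 s2 f \<Longrightarrow> f (sum g A) = (\<Sum>a\<in>A. f (g a))"
proof -
  assume l: "Vector_Spaces.linear s1 s2 f"
  then interpret Vector_Spaces.linear s1 s2 f .
  show "f 0 = 0" "f (x + y) = f x + f y" "f (s1 c x) = s2 c (f x)" "f (x - y) = f x - f y"
    "f (sum g A) = (\<Sum>a\<in>A. f (g a))"
    by (simp_all add: add scale diff sum)
qed

context vector_space
begin

text \<open>The functionals are defined on the whole space rather than on \<open>W\<close>, so that
  they can be composed with maps that leave \<open>W\<close>.\<close>

lemma finite_dual_basis:
  assumes X: "finite X" and W: "subspace W" "W \<subseteq> span X"
  obtains p :: nat and w ws where "\<And>i. i < p \<Longrightarrow> w i \<in> W" "\<And>i. Vector_Spaces.linear scale (*) (ws i)"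
    "\<And>i j. i < p \<Longrightarrow> j < p \<Longrightarrow> ws i (w j) = (if i = j then 1 else 0)"
    "\<And>x. x \<in> W \<Longrightarrow> (\<Sum>i<p. scale (ws i x) (w i)) = x"
proof -
  interpret pair: vector_space_pair scale "(*)"
    unfolding vector_space_pair_def using vector_space_axioms vector_space_field_mult by blast
  obtain B where B: "B \<subseteq> W" "independent B" "W \<subseteq> span B" by (rule maximal_independent_subset)
  have "finite B" using independent_span_bound[OF X B(2)] B(1) W(2) by blast
  then obtain w where w: "bij_betw w {0..<card B} B" using ex_bij_betw_nat_finite by blast
  define p where "p = card B"
  have wB: "w i \<in> B" if "i < p" for i using bij_betwE[OF w] that by (auto simp: p_def)
  have inj: "w i = w j \<longleftrightarrow> i = j" if "i < p" "j < p" for i j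
    using bij_betw_imp_inj_on[OF w] that by (auto simp: p_def inj_on_def)
  have "\<forall>i. \<exists>g. Vector_Spaces.linear scale (*) g \<and> (\<forall>x\<in>B. g x = (if x = w i then 1 else 0))"
    using pair.linear_independent_extend[OF B(2)] by (intro allI)
  then obtain ws where ws: "\<And>i. Vector_Spaces.linear scale (*) (ws i)"
    "\<And>i x. x \<in> B \<Longrightarrow> ws i x = (if x = w i then 1 else 0)" by metis
  have dual: "ws i (w j) = (if i = j then 1 else 0)" if "i < p" "j < p" for i j
    using ws(2)[OF wB[OF that(2)], of i] inj[OF that(2,1)] by auto
  define L where "L x = (\<Sum>i<p. scale (ws i x) (w i))" for x
  have L: "L 0 = 0" "L (x + y) = L x + L y" "L (scale c x) = scale c (L x)" for x y c
    unfolding L_def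
    by (simp_all add: linear_0'[OF ws(1)] linear_add'[OF ws(1)] linear_scale'[OF ws(1)]
        scale_left_distrib sum.distrib scale_sum_right)
  have "subspace {x. L x = x}" unfolding subspace_def by (simp add: L)
  moreover have "B \<subseteq> {x. L x = x}"
  proof
    fix x assume "x \<in> B"
    then have "x \<in> w ` {0..<card B}" using bij_betw_imp_surj_on[OF w] by blast
    then obtain j where j: "j < p" "x = w j" by (auto simp: p_def)
    have "(\<Sum>i<p. scale (ws i (w j)) (w i)) = (\<Sum>i<p. if i = j then w j else 0)"
      by (rule sum.cong) (auto simp: dual j)
    then show "x \<in> {x. L x = x}" using j by (simp add: L_def)
  qed
  ultimately have "span B \<subseteq> {x. L x = x}" by (intro span_minimal)
  show ?thesis
  proof (rule that)
    show "w i \<in> W" if "i < p" for i using wB[OF that] B(1) by blast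
    show "(\<Sum>i<p. scale (ws i x) (w i)) = x" if "x \<in> W" for x
      using \<open>span B \<subseteq> {x. L x = x}\<close> B(3) that by (auto simp: L_def)
  qed (use ws(1) dual in auto)
qed

lemma functionals_separate:
  assumes "\<And>g. Vector_Spaces.linear scale (*) g \<Longrightarrow> g x = (g y :: 'a)"
  shows "x = y"
proof (rule ccontr)
  assume ne: "x \<noteq> y"
  interpret pair: vector_space_pair scale "(*)"
    unfolding vector_space_pair_def using vector_space_axioms vector_space_field_mult by blast
  have "independent {x - y}" using ne by (simp add: independent_insert)
  from pair.linear_independent_extend[OF this, of "\<lambda>_. 1"] obtain g where
    "Vector_Spaces.linear scale (*) g" "g (x - y) = 1" by auto
  with assms[of g] show False by (simp add: linear_diff')
qed

end

section \<open>Linear maps out of free spaces and tensor powers\<close>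

lemma lookup_free_scale: "Poly_Mapping.lookup (free_scale c p) x = c * Poly_Mapping.lookup p x"
  by (simp add: free_scale_def Poly_Mapping.map.rep_eq when_def)

lemma vector_space_free_scale: "vector_space free_scale"
  by unfold_locales (auto intro!: poly_mapping_eqI simp: lookup_free_scale lookup_add algebra_simps)

lemma free_lift_superset:
  fixes sc :: "'k::field \<Rightarrow> 'v::ab_group_add \<Rightarrow> 'v"
  assumes "vector_space sc" "finite A" "Poly_Mapping.keys p \<subseteq> A"
  shows "free_lift sc f p = (\<Sum>x\<in>A. sc (Poly_Mapping.lookup p x) (f x))"
proof -
  interpret vector_space sc by fact
  show ?thesis unfolding free_lift_def
    by (rule sum.mono_neutral_left) (use assms in \<open>auto simp: in_keys_iff\<close>)
qed

lemma linear_free_lift: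
  fixes sc :: "'k::field \<Rightarrow> 'v::ab_group_add \<Rightarrow> 'v"
  assumes "vector_space sc"
  shows "Vector_Spaces.linear free_scale sc (free_lift sc (f :: 'x \<Rightarrow> 'v))"
  unfolding Vector_Spaces.linear_iff
proof (intro conjI allI vector_space_free_scale assms)
  interpret vector_space sc by fact
  fix p q :: "'x \<Rightarrow>\<^sub>0 'k" and c
  let ?A = "Poly_Mapping.keys p \<union> Poly_Mapping.keys q"
  have "Poly_Mapping.keys (p + q) \<subseteq> ?A" by (rule Poly_Mapping.keys_add)
  then show "free_lift sc f (p + q) = free_lift sc f p + free_lift sc f q"
    by (simp add: free_lift_superset[OF assms, of ?A] lookup_add scale_left_distrib sum.distrib)
  have "Poly_Mapping.keys (free_scale c p) \<subseteq> Poly_Mapping.keys p"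
    by (auto simp: in_keys_iff lookup_free_scale)
  then show "free_lift sc f (free_scale c p) = sc c (free_lift sc f p)"
    by (simp add: free_lift_superset[OF assms, of "Poly_Mapping.keys p"] lookup_free_scale scale_sum_right)
qed

lemma free_lift_basis:
  fixes sc :: "'k::field \<Rightarrow> 'v::ab_group_add \<Rightarrow> 'v"
  assumes "vector_space sc"
  shows "free_lift sc f (free_basis x) = f x"
proof -
  interpret vector_space sc by fact
  show ?thesis by (simp add: free_lift_def free_basis_def)
qed

lemma linear_comp_free_lift:
  assumes "Vector_Spaces.linear s1 s2 g"
  shows "g (free_lift s1 f p) = free_lift s2 (\<lambda>x. g (f x)) p"
  by (simp add: free_lift_def linear_sum'[OF assms] linear_scale'[OF assms])

lemma free_lift_nested:
  assumes "vector_space sc"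
  shows "free_lift sc m (free_lift free_scale g p) = free_lift sc (\<lambda>x. free_lift sc m (g x)) p"
  by (rule linear_comp_free_lift[OF linear_free_lift[OF assms]])

lemma free_lift_eq_if_span:
  assumes "vector_space sc" "p - q \<in> module.span free_scale R" "\<And>r. r \<in> R \<Longrightarrow> free_lift sc m r = 0"
  shows "free_lift sc m p = free_lift sc m q"
proof -
  interpret l: Vector_Spaces.linear free_scale sc "free_lift sc m" by (rule linear_free_lift) fact
  have "free_lift sc m (p - q) = 0" by (rule l.eq_0_on_span[OF assms(3,2)])
  then show ?thesis by (simp add: l.diff)
qed

definition bilin :: "('k \<Rightarrow> 'v \<Rightarrow> 'v) \<Rightarrow> ('k \<Rightarrow> 'w \<Rightarrow> 'w) \<Rightarrow> ('v::ab_group_add \<times> 'v \<Rightarrow> 'w::ab_group_add) \<Rightarrow> bool" where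
  "bilin s1 s2 m \<longleftrightarrow> (\<forall>a a' b. m (a + a', b) = m (a, b) + m (a', b)) \<and> (\<forall>a b b'. m (a, b + b') = m (a, b) + m (a, b')) \<and>
    (\<forall>c a b. m (s1 c a, b) = s2 c (m (a, b))) \<and> (\<forall>c a b. m (a, s1 c b) = s2 c (m (a, b)))"

definition trilin :: "('k \<Rightarrow> 'v \<Rightarrow> 'v) \<Rightarrow> ('k \<Rightarrow> 'w \<Rightarrow> 'w) \<Rightarrow> ('v::ab_group_add \<times> 'v \<times> 'v \<Rightarrow> 'w::ab_group_add) \<Rightarrow> bool" where
  "trilin s1 s2 m \<longleftrightarrow> (\<forall>x. bilin s1 s2 (\<lambda>(a, b). m (x, a, b))) \<and> (\<forall>x. bilin s1 s2 (\<lambda>(a, b). m (a, x, b)))"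

lemma free_lift_tensor2_eq:
  assumes V: "vector_space sc" and m: "bilin s1 sc m" and pq: "tensor2_eq s1 p q"
  shows "free_lift sc m p = free_lift sc m q"
proof (rule free_lift_eq_if_span[OF V])
  show "p - q \<in> module.span free_scale (tensor2_relations s1)" using pq by (simp add: tensor2_eq_def)
  interpret l: Vector_Spaces.linear free_scale sc "free_lift sc m" by (rule linear_free_lift[OF V])
  fix r assume "r \<in> tensor2_relations s1"
  then show "free_lift sc m r = 0"
    using m by (auto simp: tensor2_relations_def bilin_def l.diff l.scale free_lift_basis[OF V])
qed

lemma free_lift_tensor3_eq:
  assumes V: "vector_space sc" and m: "trilin s1 sc m" and pq: "tensor3_eq s1 p q"
  shows "free_lift sc m p = free_lift sc m q"
proof (rule free_lift_eq_if_span[OF V])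
  show "p - q \<in> module.span free_scale (tensor3_relations s1)" using pq by (simp add: tensor3_eq_def)
  interpret l: Vector_Spaces.linear free_scale sc "free_lift sc m" by (rule linear_free_lift[OF V])
  fix r assume "r \<in> tensor3_relations s1"
  then show "free_lift sc m r = 0"
    using m by (auto simp: tensor3_relations_def trilin_def bilin_def l.diff l.scale free_lift_basis[OF V])
qed

\<comment> \<open>Products of functionals separate the elements of a tensor square.\<close>
lemma (in vector_space) free_lift_eq_if_functionals:
  assumes V: "vector_space sc" and m: "bilin scale sc m"
    and eq: "\<And>f g. Vector_Spaces.linear scale (*) f \<Longrightarrow> Vector_Spaces.linear scale (*) g \<Longrightarrow>
      free_lift (*) (\<lambda>(a, b). f a * g b) p = free_lift (*) (\<lambda>(a, b). f a * g b) q"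
  shows "free_lift sc m p = free_lift sc m q"
proof -
  interpret sc: vector_space sc by fact
  define P where "P = Poly_Mapping.keys p \<union> Poly_Mapping.keys q"
  define X where "X = fst ` P \<union> snd ` P"
  have X: "finite X" by (simp add: X_def P_def)
  obtain n :: nat and w ws where "\<And>i. i < n \<Longrightarrow> w i \<in> span X" and lin: "\<And>i. Vector_Spaces.linear scale (*) (ws i)"
    and "\<And>i j. i < n \<Longrightarrow> j < n \<Longrightarrow> ws i (w j) = (if i = j then 1 else 0)"
    and rep: "\<And>x. x \<in> span X \<Longrightarrow> (\<Sum>i<n. scale (ws i x) (w i)) = x"
    by (rule finite_dual_basis[OF X subspace_span order_refl], rule that)
  have sumL: "m (\<Sum>i\<in>J. scale (f i) (u i), b) = (\<Sum>i\<in>J. sc (f i) (m (u i, b)))" if "finite J" for J :: "nat set" and f u b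
    using that
  proof (induction J rule: finite_induct)
    case empty
    have "m (scale 0 0, b) = sc 0 (m (0, b))" using m unfolding bilin_def by blast
    then show ?case by simp
  qed (use m in \<open>simp add: bilin_def\<close>)
  have sumR: "m (a, \<Sum>i\<in>J. scale (f i) (u i)) = (\<Sum>i\<in>J. sc (f i) (m (a, u i)))" if "finite J" for J :: "nat set" and f u a
    using that
  proof (induction J rule: finite_induct)
    case empty
    have "m (a, scale 0 0) = sc 0 (m (a, 0))" using m unfolding bilin_def by blast
    then show ?case by simp
  qed (use m in \<open>simp add: bilin_def\<close>)
  have mexp: "m (a, b) = (\<Sum>i<n. \<Sum>j<n. sc (ws i a * ws j b) (m (w i, w j)))" if "(a, b) \<in> P" for a b
  proof -
    have "a \<in> span X" "b \<in> span X" using that by (force simp: X_def intro: span_base)+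
    then have "m (a, b) = m (\<Sum>i<n. scale (ws i a) (w i), \<Sum>j<n. scale (ws j b) (w j))"
      by (simp only: rep)
    also have "\<dots> = (\<Sum>i<n. sc (ws i a) (m (w i, \<Sum>j<n. scale (ws j b) (w j))))" by (rule sumL) simp
    finally show ?thesis by (simp add: sumR sc.scale_sum_right)
  qed
  have exp: "free_lift sc m r = (\<Sum>i<n. \<Sum>j<n. sc (free_lift (*) (\<lambda>(a, b). ws i a * ws j b) r) (m (w i, w j)))"
    if r: "Poly_Mapping.keys r \<subseteq> P" for r
  proof -
    have fP: "finite P" by (simp add: P_def)
    have "free_lift sc m r = (\<Sum>x\<in>P. sc (Poly_Mapping.lookup r x) (m x))"
      by (rule free_lift_superset[OF V fP r])
    also have "\<dots> = (\<Sum>x\<in>P. \<Sum>i<n. \<Sum>j<n. sc (Poly_Mapping.lookup r x * (ws i (fst x) * ws j (snd x))) (m (w i, w j)))"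
      by (rule sum.cong[OF refl]) (simp add: mexp[of "fst x" "snd x" for x, simplified] sc.scale_sum_right)
    also have "\<dots> = (\<Sum>i<n. \<Sum>j<n. \<Sum>x\<in>P. sc (Poly_Mapping.lookup r x * (ws i (fst x) * ws j (snd x))) (m (w i, w j)))"
      by (subst sum.swap, rule sum.cong[OF refl], rule sum.swap)
    also have "\<dots> = (\<Sum>i<n. \<Sum>j<n. sc (free_lift (*) (\<lambda>(a, b). ws i a * ws j b) r) (m (w i, w j)))"
      by (simp add: free_lift_superset[OF vector_space_field_mult fP r] split_beta sc.scale_sum_left)
    finally show ?thesis .
  qed
  show ?thesis
    unfolding exp[of p, unfolded P_def, OF Un_upper1] exp[of q, unfolded P_def, OF Un_upper2]
    by (intro sum.cong refl) (simp add: eq lin)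
qed

section \<open>Matrix coalgebras inside a Hopf algebra\<close>

context hopf_algebra
begin

lemma V: "vector_space smul" by (rule vector_space_axioms)

abbreviation functional :: "('h \<Rightarrow> 'k) \<Rightarrow> bool" where "functional \<equiv> Vector_Spaces.linear smul (*)"

lemma bilinI:
  assumes "Vector_Spaces.linear smul s2 f" "Vector_Spaces.linear smul s2 g" "unital_algebra s2"
  shows "bilin smul s2 (\<lambda>(a, b). f a * g b)"
proof -
  interpret s2: unital_algebra s2 by fact
  have "f a * s2 c (g b) = s2 c (f a) * g b" for c a b by (metis s2.smul_mult_left s2.smul_mult_right)
  then show ?thesis unfolding bilin_def
    by (simp add: linear_add'[OF assms(1)] linear_add'[OF assms(2)] linear_scale'[OF assms(1)] linear_scale'[OF assms(2)]
        distrib_left distrib_right s2.smul_mult_left)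
qed

lemma unital_algebra_field: "unital_algebra ((*) :: 'k \<Rightarrow> 'k \<Rightarrow> 'k)"
  by (intro unital_algebra.intro vector_space_field_mult) (simp add: unital_algebra_axioms_def algebra_simps)

lemmas bilin_functionals = bilinI[OF _ _ unital_algebra_field]

text \<open>The map induced by \<open>m\<close> on \<open>H \<otimes> H\<close>, composed with the
  coproduct; in Sweedler notation the sum of all \<open>m (x1, x2)\<close>.\<close>

definition lift where "lift sc m x = free_lift sc m (\<Delta> x)"

lemma lift_add: "vector_space sc \<Longrightarrow> bilin smul sc m \<Longrightarrow> lift sc m (x + y) = lift sc m x + lift sc m y"
  unfolding lift_def
  using free_lift_tensor2_eq[OF _ _ coproduct_add] linear_add'[OF linear_free_lift] by metis

lemma lift_scale: "vector_space sc \<Longrightarrow> bilin smul sc m \<Longrightarrow> lift sc m (smul c x) = sc c (lift sc m x)"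
  unfolding lift_def
  using free_lift_tensor2_eq[OF _ _ coproduct_scale] linear_scale'[OF linear_free_lift] by metis

lemma linear_lift: "vector_space sc \<Longrightarrow> bilin smul sc m \<Longrightarrow> Vector_Spaces.linear smul sc (lift sc m)"
  unfolding Vector_Spaces.linear_iff using lift_add lift_scale V by blast

lemma lift_one: "vector_space sc \<Longrightarrow> bilin smul sc m \<Longrightarrow> lift sc m 1 = m (1, 1)"
  unfolding lift_def using free_lift_tensor2_eq[OF _ _ coproduct_one] free_lift_basis by metis

lemma lift_mult:
  assumes V: "vector_space sc" and m: "bilin smul sc m"
  shows "lift sc m (x * y) = lift sc (\<lambda>(a, b). lift sc (\<lambda>(c, d). m (a * c, b * d)) y) x"
proof -
  have "lift sc m (x * y) = free_lift sc m (tensor2_mult (\<Delta> x) (\<Delta> y))"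
    unfolding lift_def by (rule free_lift_tensor2_eq[OF V m coproduct_mult])
  then show ?thesis
    unfolding tensor2_mult_def lift_def
    by (simp add: free_lift_nested[OF V] free_lift_basis[OF V] case_prod_unfold)
qed

definition conv :: "('h \<Rightarrow> 'k) \<Rightarrow> ('h \<Rightarrow> 'k) \<Rightarrow> 'h \<Rightarrow> 'k" where
  "conv f g = lift (*) (\<lambda>(a, b). f a * g b)"

lemma functional_conv: "functional f \<Longrightarrow> functional g \<Longrightarrow> functional (conv f g)"
  unfolding conv_def by (intro linear_lift vector_space_field_mult bilin_functionals)

lemma conv_assoc:
  assumes f: "functional f" and g: "functional g" and k: "functional k"
  shows "conv (conv f g) k = conv f (conv g k)"
proof
  fix x
  define t where "t = (\<lambda>(a, b, d). f a * g b * k d)"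
  have t: "trilin smul (*) t"
    unfolding trilin_def bilin_def t_def
    by (simp add: linear_add'[OF f] linear_add'[OF g] linear_add'[OF k] linear_scale'[OF f] linear_scale'[OF g] linear_scale'[OF k] algebra_simps)
  note nest = free_lift_nested[OF vector_space_field_mult] free_lift_basis[OF vector_space_field_mult]
  have "conv (conv f g) k x = lift (*) (\<lambda>(a, b). lift (*) (\<lambda>(a1, a2). t (a1, a2, b)) a) x"
    unfolding conv_def lift_def t_def
    by (simp add: free_lift_def sum_distrib_right case_prod_unfold mult.assoc)
  also have "\<dots> = lift (*) (\<lambda>(a, b). lift (*) (\<lambda>(b1, b2). t (a, b1, b2)) b) x"
    using free_lift_tensor3_eq[OF vector_space_field_mult t coassociative[of x]]
    by (simp add: nest lift_def case_prod_unfold)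
  also have "\<dots> = conv f (conv g k) x"
    unfolding conv_def lift_def t_def
    by (simp add: free_lift_def sum_distrib_left case_prod_unfold mult_ac)
  finally show "conv (conv f g) k x = conv f (conv g k) x" .
qed

\<comment> \<open>\<open>p \<times> p\<close> matrices with comatrix coproduct, i.e. matrix coefficients of comodules.\<close>
definition matrix_coalgebra :: "nat \<Rightarrow> (nat \<Rightarrow> nat \<Rightarrow> 'h) \<Rightarrow> bool" where
  "matrix_coalgebra p a \<longleftrightarrow> (\<forall>i<p. \<forall>j<p. \<epsilon> (a i j) = (if i = j then 1 else 0) \<and>
    (\<forall>f g. functional f \<longrightarrow> functional g \<longrightarrow> conv f g (a i j) = (\<Sum>k<p. f (a i k) * g (a k j))))"

definition coeff_span :: "nat \<Rightarrow> (nat \<Rightarrow> nat \<Rightarrow> 'h) \<Rightarrow> 'h set" where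
  "coeff_span p a = span {a i j | i j. i < p \<and> j < p}"

lemma matrix_coalgebra_\<epsilon>: "matrix_coalgebra p a \<Longrightarrow> i < p \<Longrightarrow> j < p \<Longrightarrow> \<epsilon> (a i j) = (if i = j then 1 else 0)"
  by (simp add: matrix_coalgebra_def)

text \<open>The definition tests the coproduct with pairs of functionals only. Since these separate
  the tensor square, the comatrix formula holds under every bilinear map.\<close>

lemma matrix_coalgebra_lift:
  assumes a: "matrix_coalgebra p a" and ij: "i < p" "j < p" and sc: "vector_space sc" and m: "bilin smul sc m"
  shows "lift sc m (a i j) = (\<Sum>k<p. m (a i k, a k j))"
proof -
  have fl: "free_lift sc' m' (\<Sum>k<p. free_basis (a i k, a k j)) = (\<Sum>k<p. m' (a i k, a k j))"
    if "vector_space sc'" for sc' :: "'k \<Rightarrow> 'z::ab_group_add \<Rightarrow> 'z" and m'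
    by (simp add: linear_sum'[OF linear_free_lift[OF that]] free_lift_basis[OF that])
  have "free_lift sc m (\<Delta> (a i j)) = free_lift sc m (\<Sum>k<p. free_basis (a i k, a k j))"
  proof (rule free_lift_eq_if_functionals[OF sc m])
    fix f g assume "functional f" "functional g"
    then have "conv f g (a i j) = (\<Sum>k<p. f (a i k) * g (a k j))" using a ij by (simp add: matrix_coalgebra_def)
    then show "free_lift (*) (\<lambda>(a, b). f a * g b) (\<Delta> (a i j)) =
        free_lift (*) (\<lambda>(a, b). f a * g b) (\<Sum>k<p. free_basis (a i k, a k j))"
      by (simp add: fl[OF vector_space_field_mult] conv_def lift_def)
  qed
  then show ?thesis by (simp add: fl[OF sc] lift_def)
qed

text \<open>The local finiteness of coalgebras. The dual space acts on \<open>H\<close> through the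
  coproduct, and the orbit \<open>W\<close> of \<open>h\<close> is finite-dimensional, since it lies
  in the span of the second components of one representative of \<open>\<Delta> h\<close>. The
  matrix coefficients of this comodule form the coalgebra.\<close>

lemma exists_matrix_coalgebra: "\<exists>p a. matrix_coalgebra p a \<and> h \<in> coeff_span p a"
proof -
  have \<epsilon>: "functional \<epsilon>" by (rule counit_linear)
  \<comment> \<open>\<open>act f\<close> is \<open>(f \<otimes> id) \<Delta>\<close>; by
    coassociativity, successive actions compose by convolution.\<close>
  define act where "act f x = lift smul (\<lambda>(u, v). smul (f u) v) x" for f x
  have bil: "bilin smul smul (\<lambda>(u, v). smul (f u) v)" if "functional f" for f
    using that by (simp add: bilin_def linear_add' linear_scale' scale_left_distrib scale_right_distrib mult.commute)
  have bil': "bilin smul smul (\<lambda>(u, v). smul (f v) u)" if "functional f" for f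
    using that by (simp add: bilin_def linear_add' linear_scale' scale_left_distrib scale_right_distrib mult.commute)
  have actl: "Vector_Spaces.linear smul smul (act f)" if "functional f" for f
    using linear_lift[OF V bil[OF that]] by (simp add: act_def[abs_def])
  have gact: "g (act f x) = conv f g x" if "functional g" for f g x
    unfolding act_def conv_def lift_def linear_comp_free_lift[OF that]
    by (simp add: case_prod_unfold linear_scale'[OF that])
  have act\<epsilon>: "act \<epsilon> x = x" for x unfolding act_def lift_def by (rule counit_left)
  have conv\<epsilon>: "conv f \<epsilon> x = f x" if "functional f" for f x
  proof -
    have "f x = f (free_lift smul (\<lambda>(a, b). smul (\<epsilon> b) a) (\<Delta> x))" by (simp add: counit_right)
    then show ?thesis unfolding conv_def lift_def linear_comp_free_lift[OF that]
      by (simp add: case_prod_unfold linear_scale'[OF that] mult.commute)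
  qed
  have actact: "act f' (act f x) = act (conv f f') x" if "functional f" "functional f'" for f f' x
  proof (rule functionals_separate)
    fix g assume g: "functional g"
    show "g (act f' (act f x)) = g (act (conv f f') x)"
      by (simp add: gact[OF g] gact[OF functional_conv[OF that(2) g]] conv_assoc[OF that g])
  qed
  define W where "W = {act f h | f. functional f}"
  define X where "X = snd ` Poly_Mapping.keys (\<Delta> h)"
  have fadd: "functional (\<lambda>x. f x + g x)" if "functional f" "functional g" for f g
    using that V vector_space_field_mult unfolding Vector_Spaces.linear_iff by (auto simp: algebra_simps)
  have fscale: "functional (\<lambda>x. c * f x)" if "functional f" for c f
    using that V vector_space_field_mult unfolding Vector_Spaces.linear_iff by (auto simp: algebra_simps)
  have sW: "subspace W"
    unfolding subspace_def
  proof (intro conjI ballI allI)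
    have "act (\<lambda>x. 0 * \<epsilon> x) h = 0" by (simp add: act_def lift_def free_lift_def case_prod_unfold)
    then show "0 \<in> W" unfolding W_def using fscale[OF \<epsilon>, of 0] by (metis (mono_tags, lifting) mem_Collect_eq)
    fix x y assume "x \<in> W" "y \<in> W"
    then obtain f g where fg: "functional f" "functional g" "x = act f h" "y = act g h" by (auto simp: W_def)
    have "act (\<lambda>x. f x + g x) h = x + y"
      by (simp add: fg act_def lift_def free_lift_def case_prod_unfold scale_left_distrib scale_right_distrib sum.distrib)
    then show "x + y \<in> W" unfolding W_def using fadd[OF fg(1,2)] by (metis (mono_tags, lifting) mem_Collect_eq)
  next
    fix c x assume "x \<in> W"
    then obtain f where f: "functional f" "x = act f h" by (auto simp: W_def)
    have "act (\<lambda>x. c * f x) h = smul c x"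
      by (simp add: f act_def lift_def free_lift_def case_prod_unfold scale_sum_right mult_ac)
    then show "smul c x \<in> W" unfolding W_def using fscale[OF f(1), of c] by (metis (mono_tags, lifting) mem_Collect_eq)
  qed
  have WX: "W \<subseteq> span X"
    unfolding W_def act_def lift_def free_lift_def X_def
    by (auto intro!: span_sum span_scale simp: case_prod_unfold) (force intro!: span_base)
  have fX: "finite X" by (simp add: X_def)
  obtain p :: nat and w ws where wW: "\<And>i. i < p \<Longrightarrow> w i \<in> W" and ws: "\<And>i. functional (ws i)"
    and dual: "\<And>i j. i < p \<Longrightarrow> j < p \<Longrightarrow> ws i (w j) = (if i = j then 1 else 0)"
    and rep: "\<And>x. x \<in> W \<Longrightarrow> (\<Sum>i<p. smul (ws i x) (w i)) = x"
    by (rule finite_dual_basis[OF fX sW WX], rule that)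
  \<comment> \<open>The coefficients of the coaction
    \<open>\<Delta> (w j) = \<Sum>\<^sub>i a j i \<otimes> w i\<close>, extracted with the dual
    functionals.\<close>
  define a where "a j i = lift smul (\<lambda>(u, v). smul (ws i v) u) (w j)" for j i
  have fa: "f (a j i) = conv f (ws i) (w j)" if "functional f" for f i j
    unfolding a_def conv_def lift_def linear_comp_free_lift[OF that]
    by (simp add: case_prod_unfold linear_scale'[OF that] mult.commute)
  have actW: "act f x \<in> W" if "functional f" "x \<in> W" for f x
    using that actact functional_conv by (auto simp: W_def)
  have actw: "act f (w j) = (\<Sum>i<p. smul (f (a j i)) (w i))" if "functional f" "j < p" for f j
    using rep[OF actW[OF that(1) wW[OF that(2)]], symmetric] by (simp add: gact ws fa[OF that(1)])
  have "matrix_coalgebra p a"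
    unfolding matrix_coalgebra_def
  proof (intro allI impI conjI)
    fix j i assume ji: "j < p" "i < p"
    show "\<epsilon> (a j i) = (if j = i then 1 else 0)"
      using gact[OF ws[of i], of \<epsilon> "w j"] dual[OF ji(2,1)] by (simp add: fa[OF \<epsilon>] act\<epsilon> eq_commute)
    fix f f' assume f: "functional f" "functional f'"
    have "conv f f' (a j i) = ws i (act f' (act f (w j)))"
      by (simp add: fa[OF functional_conv[OF f]] actact[OF f] gact[OF ws])
    also have "\<dots> = (\<Sum>k<p. f (a j k) * ws i (act f' (w k)))"
      by (simp add: actw[OF f(1) ji(1)] linear_sum'[OF actl[OF f(2)]] linear_scale'[OF actl[OF f(2)]]
          linear_sum'[OF ws] linear_scale'[OF ws])
    also have "\<dots> = (\<Sum>k<p. f (a j k) * f' (a k i))"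
      by (simp add: gact[OF ws] fa[OF f(2)])
    finally show "conv f f' (a j i) = (\<Sum>k<p. f (a j k) * f' (a k i))" .
  qed
  moreover have "h \<in> coeff_span p a"
  proof -
    have "h \<in> W" unfolding W_def using \<epsilon> act\<epsilon>[of h] by (intro CollectI exI[of _ \<epsilon>]) simp
    \<comment> \<open>Expand \<open>h\<close> in the basis, insert the coaction and apply the counit
      to the second factor.\<close>
    define h' where "h' = (\<Sum>j<p. \<Sum>i<p. smul (ws j h * \<epsilon> (w i)) (a j i))"
    have "h = h'"
    proof (rule functionals_separate)
      fix f assume f: "functional f"
      have "f h = \<epsilon> (act f h)" by (simp add: gact[OF \<epsilon>] conv\<epsilon>[OF f])
      also have "act f h = (\<Sum>j<p. smul (ws j h) (act f (w j)))"
        using arg_cong[OF rep[OF \<open>h \<in> W\<close>, symmetric], of "act f"]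
        by (simp add: linear_sum'[OF actl[OF f]] linear_scale'[OF actl[OF f]])
      also have "\<epsilon> \<dots> = (\<Sum>j<p. \<Sum>i<p. (ws j h * \<epsilon> (w i)) * f (a j i))"
        by (simp add: actw[OF f] linear_sum'[OF \<epsilon>] linear_scale'[OF \<epsilon>] sum_distrib_left mult_ac)
      also have "\<dots> = f h'"
        by (simp add: h'_def linear_sum'[OF f] linear_scale'[OF f])
      finally show "f h = f h'" .
    qed
    moreover have "h' \<in> coeff_span p a"
      unfolding h'_def coeff_span_def
    proof (intro span_sum span_scale)
      fix j i assume "j \<in> {..<p}" "i \<in> {..<p}"
      then show "a j i \<in> span {a i j | i j. i < p \<and> j < p}" by (intro span_base) auto
    qed
    ultimately show ?thesis by simp
  qed
  ultimately show ?thesis by blast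
qed

end

lemma rect_index:
  fixes i p k q :: nat
  assumes "i < p" "k < q"
  shows "i * q + k < p * q" "(i * q + k) div q = i" "(i * q + k) mod q = k"
proof -
  have "i * q + k < (i + 1) * q" using assms by simp
  also have "\<dots> \<le> p * q" using assms by (intro mult_right_mono) auto
  finally show "i * q + k < p * q" .
qed (use assms in auto)

lemma div_mod_eq_iff: "i div q = j div q \<and> i mod q = j mod q \<longleftrightarrow> i = (j::nat)"
  by (metis div_mult_mod_eq)

lemma matrix_inverse_unique:
  fixes U V W :: "nat \<Rightarrow> nat \<Rightarrow> 'r::{ring,monoid_mult}"
  assumes VU: "\<And>i j. i < n \<Longrightarrow> j < n \<Longrightarrow> (\<Sum>k<n. V i k * U k j) = (if i = j then 1 else 0)"
    and UW: "\<And>i j. i < n \<Longrightarrow> j < n \<Longrightarrow> (\<Sum>k<n. U i k * W k j) = (if i = j then 1 else 0)"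
    and ij: "i < n" "j < n"
  shows "V i j = W i j"
proof -
  have "V i j = (\<Sum>k<n. if k = j then V i j else 0)" using ij by simp
  also have "\<dots> = (\<Sum>k<n. V i k * (\<Sum>l<n. U k l * W l j))"
    by (rule sum.cong) (auto simp: UW ij)
  also have "\<dots> = (\<Sum>l<n. (\<Sum>k<n. V i k * U k l) * W l j)"
    by (simp add: sum_distrib_left sum_distrib_right mult.assoc, rule sum.swap)
  also have "\<dots> = (\<Sum>l<n. if l = i then W i j else 0)"
    by (rule sum.cong) (auto simp: VU ij)
  also have "\<dots> = W i j" using ij by simp
  finally show ?thesis .
qed

section \<open>Block sums and Kronecker products\<close>

definition blocksum :: "nat \<Rightarrow> (nat \<Rightarrow> nat \<Rightarrow> 'r::zero) \<Rightarrow> (nat \<Rightarrow> nat \<Rightarrow> 'r) \<Rightarrow> nat \<Rightarrow> nat \<Rightarrow> 'r" where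
  "blocksum p a b i j = (if i < p \<and> j < p then a i j else if p \<le> i \<and> p \<le> j then b (i - p) (j - p) else 0)"

lemma sum_lessThan_add: "(\<Sum>k<p + q. f k) = (\<Sum>k<p. f k) + (\<Sum>k<q. f (p + k))" for p q :: nat
  by (induction q) (auto simp: add.assoc)

context hopf_algebra
begin

lemma bilin_sum:
  assumes "vector_space sc" "\<And>k. k \<in> K \<Longrightarrow> bilin smul sc (\<lambda>(u, v). m k u v)"
  shows "bilin smul sc (\<lambda>(u, v). \<Sum>k\<in>K. m k u v)"
proof -
  interpret sc: vector_space sc by fact
  show ?thesis using assms(2) unfolding bilin_def
    by (simp add: sum.distrib[symmetric] sc.scale_sum_right cong: sum.cong)
qed

lemma bilin_translate:
  assumes "bilin smul sc m"
  shows "bilin smul sc (\<lambda>(u, v). m (u * b, v * b'))" "bilin smul sc (\<lambda>(u, v). m (b * u, b' * v))"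
  using assms unfolding bilin_def
  by (simp_all add: distrib_left distrib_right smul_mult_left[symmetric] smul_mult_right[symmetric])

text \<open>The coproduct is multiplicative, so the two comatrix formulas multiply: this is the
  coaction on the tensor product of the two comodules.\<close>

lemma lift_kron:
  assumes a: "matrix_coalgebra p a" and b: "matrix_coalgebra q b" and ij: "i < p" "j < p" and kl: "k < q" "l < q"
    and sc: "vector_space sc" and m: "bilin smul sc m"
  shows "lift sc m (a i j * b k l) = (\<Sum>s<p. \<Sum>t<q. m (a i s * b k t, a s j * b t l))"
proof -
  have "lift sc (\<lambda>(c, d). m (u * c, v * d)) (b k l) = (\<Sum>t<q. m (u * b k t, v * b t l))" for u v
    using matrix_coalgebra_lift[OF b kl sc bilin_translate(2)[OF m]] by simp
  then have "lift sc m (a i j * b k l) = lift sc (\<lambda>(u, v). \<Sum>t<q. m (u * b k t, v * b t l)) (a i j)"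
    by (simp add: lift_mult[OF sc m])
  also have "\<dots> = (\<Sum>s<p. \<Sum>t<q. m (a i s * b k t, a s j * b t l))"
  proof -
    have "bilin smul sc (\<lambda>(u, v). \<Sum>t<q. m (u * b k t, v * b t l))"
      by (rule bilin_sum[OF sc]) (rule bilin_translate(1)[OF m])
    from matrix_coalgebra_lift[OF a ij sc this] show ?thesis by simp
  qed
  finally show ?thesis .
qed

definition kron :: "nat \<Rightarrow> (nat \<Rightarrow> nat \<Rightarrow> 'h) \<Rightarrow> (nat \<Rightarrow> nat \<Rightarrow> 'h) \<Rightarrow> nat \<Rightarrow> nat \<Rightarrow> 'h" where
  "kron q a b i j = a (i div q) (j div q) * b (i mod q) (j mod q)"

text \<open>Thanks to this, the values of a linear map on products of coefficients are the entries
  of one matrix, and multiplicativity can be shown by uniqueness of inverses or of solutions of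
  differential equations.\<close>

lemma matrix_coalgebra_kron:
  assumes a: "matrix_coalgebra p a" and b: "matrix_coalgebra q b"
  shows "matrix_coalgebra (p * q) (kron q a b)"
  unfolding matrix_coalgebra_def
proof (intro allI impI conjI)
  fix i j assume ij: "i < p * q" "j < p * q"
  note bounds = div_mod_bounds(1)[OF ij(1)] div_mod_bounds(1)[OF ij(2)] div_mod_bounds(2)[OF ij(1)] div_mod_bounds(2)[OF ij(2)]
  show "\<epsilon> (kron q a b i j) = (if i = j then 1 else 0)"
    using div_mod_eq_iff[of i q j] bounds
    by (auto simp: kron_def counit_mult matrix_coalgebra_\<epsilon>[OF a] matrix_coalgebra_\<epsilon>[OF b])
  fix f g assume fg: "functional f" "functional g"
  show "conv f g (kron q a b i j) = (\<Sum>k<p*q. f (kron q a b i k) * g (kron q a b k j))"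
    unfolding conv_def kron_def
    using lift_kron[OF a b bounds vector_space_field_mult bilin_functionals[OF fg]]
    by (simp add: sum_rect[of "\<lambda>s t. f (a (i div q) s * b (i mod q) t) * g (a s (j div q) * b t (j mod q))"])
qed

text \<open>The direct sum of comodules. It is the reason why the coefficient spans form a directed
  family.\<close>

lemma matrix_coalgebra_blocksum:
  assumes a: "matrix_coalgebra p a" and b: "matrix_coalgebra q b"
  shows "matrix_coalgebra (p + q) (blocksum p a b)"
  unfolding matrix_coalgebra_def
proof (intro allI impI conjI)
  fix i j assume ij: "i < p + q" "j < p + q"
  have \<epsilon>0: "\<epsilon> 0 = 0" by (rule linear_0'[OF counit_linear])
  show "\<epsilon> (blocksum p a b i j) = (if i = j then 1 else 0)"
    using ij by (auto simp: blocksum_def matrix_coalgebra_\<epsilon>[OF a] matrix_coalgebra_\<epsilon>[OF b] \<epsilon>0)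
  fix f g assume fg: "functional f" "functional g"
  have c0: "conv f g 0 = 0" by (rule linear_0'[OF functional_conv[OF fg]])
  have f0: "f 0 = 0" "g 0 = 0" using fg by (auto intro: linear_0')
  have A: "conv f g (a i j) = (\<Sum>k<p. f (a i k) * g (a k j))" if "i < p" "j < p" for i j
    using a fg that unfolding matrix_coalgebra_def by blast
  have B: "conv f g (b i j) = (\<Sum>k<q. f (b i k) * g (b k j))" if "i < q" "j < q" for i j
    using b fg that unfolding matrix_coalgebra_def by blast
  have 1: "(\<Sum>k<p. f (blocksum p a b i k) * g (blocksum p a b k j)) =
      (if i < p \<and> j < p then (\<Sum>k<p. f (a i k) * g (a k j)) else 0)"
    by (cases "i < p"; cases "j < p") (simp_all add: blocksum_def f0)
  have 2: "(\<Sum>k<q. f (blocksum p a b i (p + k)) * g (blocksum p a b (p + k) j)) =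
      (if p \<le> i \<and> p \<le> j then (\<Sum>k<q. f (b (i - p) k) * g (b k (j - p))) else 0)"
    by (cases "p \<le> i"; cases "p \<le> j") (simp_all add: blocksum_def f0)
  show "conv f g (blocksum p a b i j) = (\<Sum>k<p+q. f (blocksum p a b i k) * g (blocksum p a b k j))"
    unfolding sum_lessThan_add 1 2
  proof (cases "i < p"; cases "j < p")
    assume "i < p" "j < p"
    then show "conv f g (blocksum p a b i j) =
      (if i < p \<and> j < p then (\<Sum>k<p. f (a i k) * g (a k j)) else 0) +
      (if p \<le> i \<and> p \<le> j then (\<Sum>k<q. f (b (i - p) k) * g (b k (j - p))) else 0)"
      using A by (simp add: blocksum_def)
  next
    assume "\<not> i < p" "\<not> j < p"
    moreover from this have "i - p < q" "j - p < q" using ij by auto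
    ultimately show "conv f g (blocksum p a b i j) =
      (if i < p \<and> j < p then (\<Sum>k<p. f (a i k) * g (a k j)) else 0) +
      (if p \<le> i \<and> p \<le> j then (\<Sum>k<q. f (b (i - p) k) * g (b k (j - p))) else 0)"
      using B[of "i - p" "j - p"] by (simp add: blocksum_def)
  qed (simp_all add: blocksum_def c0)
qed

lemma coeff_span_blocksum: "coeff_span p a \<subseteq> coeff_span (p + q) (blocksum p a b)" "coeff_span q b \<subseteq> coeff_span (p + q) (blocksum p a b)"
proof -
  have "a i j \<in> {blocksum p a b i j | i j. i < p + q \<and> j < p + q}" if "i < p" "j < p" for i j
    using that by (intro CollectI exI[of _ i] exI[of _ j]) (simp add: blocksum_def)
  then show "coeff_span p a \<subseteq> coeff_span (p + q) (blocksum p a b)"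
    unfolding coeff_span_def by (intro span_mono) blast
  have "b i j \<in> {blocksum p a b i j | i j. i < p + q \<and> j < p + q}" if "i < q" "j < q" for i j
    using that by (intro CollectI exI[of _ "p + i"] exI[of _ "p + j"]) (simp add: blocksum_def)
  then show "coeff_span q b \<subseteq> coeff_span (p + q) (blocksum p a b)"
    unfolding coeff_span_def by (intro span_mono) blast
qed

lemma linear_eq_on_coeff_span:
  assumes f: "Vector_Spaces.linear smul s2 f" and g: "Vector_Spaces.linear smul s2 g"
    and eq: "\<And>i j. i < p \<Longrightarrow> j < p \<Longrightarrow> f (a i j) = g (a i j)" and x: "x \<in> coeff_span p a"
  shows "f x = g x"
proof -
  have "vector_space s2" using f by (simp add: Vector_Spaces.linear_iff)
  then interpret pair: vector_space_pair smul s2 by (simp add: vector_space_pair_def V)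
  show ?thesis
    by (rule pair.linear_eq_on_span[OF f g _ x[unfolded coeff_span_def]]) (use eq in auto)
qed

lemma linear_eqI:
  assumes f: "Vector_Spaces.linear smul s2 f" and g: "Vector_Spaces.linear smul s2 g"
    and eq: "\<And>p a i j. matrix_coalgebra p a \<Longrightarrow> i < p \<Longrightarrow> j < p \<Longrightarrow> f (a i j) = g (a i j)"
  shows "f = g"
proof
  fix x
  obtain p a where a: "matrix_coalgebra p a" "x \<in> coeff_span p a" using exists_matrix_coalgebra by blast
  show "f x = g x" by (rule linear_eq_on_coeff_span[OF f g eq[OF a(1)] a(2)])
qed

end

section \<open>Convolution and the group of characters\<close>

locale hopf_pair = hopf_algebra smul \<Delta> \<epsilon> S + B: unital_algebra sB
  for smul :: "'k::field \<Rightarrow> 'h::{ring,monoid_mult} \<Rightarrow> 'h" and \<Delta> \<epsilon> S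
    and sB :: "'k \<Rightarrow> 'b::{comm_ring,comm_monoid_mult,topological_space} \<Rightarrow> 'b"
begin

lemma VB: "vector_space sB" by (rule B.vector_space_axioms)

abbreviation Lin :: "('h \<Rightarrow> 'b) set" where "Lin \<equiv> {\<phi>. Vector_Spaces.linear smul sB \<phi>}"
abbreviation star :: "('h \<Rightarrow> 'b) \<Rightarrow> ('h \<Rightarrow> 'b) \<Rightarrow> 'h \<Rightarrow> 'b" where "star \<equiv> convolution \<Delta> sB"
definition \<eta> :: "'h \<Rightarrow> 'b" where "\<eta> x = sB (\<epsilon> x) 1"
abbreviation Chars where "Chars \<equiv> characters smul sB"
abbreviation Inf where "Inf \<equiv> infinitesimal_characters smul \<epsilon> sB"

lemma star_lift: "star \<phi> \<psi> x = lift sB (\<lambda>(a, b). \<phi> a * \<psi> b) x"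
  by (simp add: convolution_def lift_def)

lemma LinI: "(\<And>x y. \<phi> (x + y) = \<phi> x + \<phi> y) \<Longrightarrow> (\<And>c x. \<phi> (smul c x) = sB c (\<phi> x)) \<Longrightarrow> \<phi> \<in> Lin"
  unfolding mem_Collect_eq Vector_Spaces.linear_iff using V VB by blast

lemma Lin_add: "\<phi> \<in> Lin \<Longrightarrow> \<phi> (x + y) = \<phi> x + \<phi> y"
  and Lin_scale: "\<phi> \<in> Lin \<Longrightarrow> \<phi> (smul c x) = sB c (\<phi> x)"
  and Lin_0: "\<phi> \<in> Lin \<Longrightarrow> \<phi> 0 = 0"
  by (simp_all add: linear_add' linear_scale' linear_0')

lemma bilin_star: "\<phi> \<in> Lin \<Longrightarrow> \<psi> \<in> Lin \<Longrightarrow> bilin smul sB (\<lambda>(a, b). \<phi> a * \<psi> b)"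
  by (intro bilinI B.unital_algebra_axioms) auto

lemma star_Lin: "\<phi> \<in> Lin \<Longrightarrow> \<psi> \<in> Lin \<Longrightarrow> star \<phi> \<psi> \<in> Lin"
  using linear_lift[OF VB bilin_star] by (simp add: star_lift[abs_def])

lemma star_matrix_coalgebra:
  "matrix_coalgebra p a \<Longrightarrow> \<phi> \<in> Lin \<Longrightarrow> \<psi> \<in> Lin \<Longrightarrow> i < p \<Longrightarrow> j < p \<Longrightarrow> star \<phi> \<psi> (a i j) = (\<Sum>k<p. \<phi> (a i k) * \<psi> (a k j))"
  using matrix_coalgebra_lift[OF _ _ _ VB bilin_star] by (simp add: star_lift)

lemma Lin_eqI:
  "\<phi> \<in> Lin \<Longrightarrow> \<psi> \<in> Lin \<Longrightarrow> (\<And>p a i j. matrix_coalgebra p a \<Longrightarrow> i < p \<Longrightarrow> j < p \<Longrightarrow> \<phi> (a i j) = \<psi> (a i j)) \<Longrightarrow> \<phi> = \<psi>"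
  using linear_eqI[of sB \<phi> \<psi>] by simp

lemma \<eta>_Lin: "\<eta> \<in> Lin"
  by (rule LinI) (simp_all add: \<eta>_def linear_add'[OF counit_linear] linear_scale'[OF counit_linear] B.scale_left_distrib)

lemma \<eta>_matrix_coalgebra: "matrix_coalgebra p a \<Longrightarrow> i < p \<Longrightarrow> j < p \<Longrightarrow> \<eta> (a i j) = (if i = j then 1 else 0)"
  by (simp add: \<eta>_def matrix_coalgebra_\<epsilon>)

lemma sum_delta_mult:
  fixes f :: "nat \<Rightarrow> 'b"
  assumes "i < n"
  shows "(\<Sum>k<n. (if i = k then 1 else 0) * f k) = f i" "(\<Sum>k<n. f k * (if k = i then 1 else 0)) = f i"
proof -
  have 1: "(if i = k then 1 else 0) * f k = (if i = k then f k else 0)"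
    "f k * (if k = i then 1 else 0) = (if k = i then f k else 0)" for k by simp_all
  show "(\<Sum>k<n. (if i = k then 1 else 0) * f k) = f i" "(\<Sum>k<n. f k * (if k = i then 1 else 0)) = f i"
    unfolding 1 using assms by (simp_all add: sum.delta sum.delta')
qed

lemma star_unit: "\<phi> \<in> Lin \<Longrightarrow> star \<eta> \<phi> = \<phi>" "\<phi> \<in> Lin \<Longrightarrow> star \<phi> \<eta> = \<phi>"
proof -
  assume \<phi>: "\<phi> \<in> Lin"
  show "star \<eta> \<phi> = \<phi>"
    by (rule Lin_eqI[OF star_Lin[OF \<eta>_Lin \<phi>] \<phi>])
       (simp add: star_matrix_coalgebra[OF _ \<eta>_Lin \<phi>] \<eta>_matrix_coalgebra sum_delta_mult)
  show "star \<phi> \<eta> = \<phi>"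
    by (rule Lin_eqI[OF star_Lin[OF \<phi> \<eta>_Lin] \<phi>])
       (simp add: star_matrix_coalgebra[OF _ \<phi> \<eta>_Lin] \<eta>_matrix_coalgebra sum_delta_mult)
qed

text \<open>On matrix coefficients convolution is matrix multiplication, so an exchange of two
  finite sums is all that remains.\<close>

lemma star_assoc:
  assumes "\<phi> \<in> Lin" "\<psi> \<in> Lin" "\<omega> \<in> Lin"
  shows "star (star \<phi> \<psi>) \<omega> = star \<phi> (star \<psi> \<omega>)"
proof (rule Lin_eqI)
  fix p a i j assume a: "matrix_coalgebra p a" "i < p" "j < p"
  have "(\<Sum>k<p. \<Sum>l<p. \<phi> (a i l) * \<psi> (a l k) * \<omega> (a k j)) = (\<Sum>k<p. \<Sum>l<p. \<phi> (a i k) * \<psi> (a k l) * \<omega> (a l j))"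
    by (rule sum.swap)
  then show "star (star \<phi> \<psi>) \<omega> (a i j) = star \<phi> (star \<psi> \<omega>) (a i j)"
    using a(2,3)
    by (simp add: star_matrix_coalgebra[OF a(1) star_Lin[OF assms(1,2)] assms(3)] star_matrix_coalgebra[OF a(1) assms(1) star_Lin[OF assms(2,3)]]
        star_matrix_coalgebra[OF a(1) assms(1,2)] star_matrix_coalgebra[OF a(1) assms(2,3)] sum_distrib_left sum_distrib_right mult.assoc)
qed (use assms star_Lin in auto)

lemma Chars_Lin: "\<phi> \<in> Chars \<Longrightarrow> \<phi> \<in> Lin" and Chars_one: "\<phi> \<in> Chars \<Longrightarrow> \<phi> 1 = 1"
  and Chars_mult: "\<phi> \<in> Chars \<Longrightarrow> \<phi> (x * y) = \<phi> x * \<phi> y"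
  by (simp_all add: characters_def)

lemma CharsI: "\<phi> \<in> Lin \<Longrightarrow> \<phi> 1 = 1 \<Longrightarrow> (\<And>x y. \<phi> (x * y) = \<phi> x * \<phi> y) \<Longrightarrow> \<phi> \<in> Chars"
  by (simp add: characters_def)

\<comment> \<open>Bilinear identities on \<open>H\<close> need only be checked on matrix coefficients.\<close>
lemma bilinear_eqI:
  assumes F: "\<And>y. (\<lambda>x. F x y) \<in> Lin" "\<And>x. (\<lambda>y. F x y) \<in> Lin"
    and G: "\<And>y. (\<lambda>x. G x y) \<in> Lin" "\<And>x. (\<lambda>y. G x y) \<in> Lin"
    and eq: "\<And>p a q b i j k l. matrix_coalgebra p a \<Longrightarrow> matrix_coalgebra q b \<Longrightarrow> i < p \<Longrightarrow> j < p \<Longrightarrow> k < q \<Longrightarrow> l < q \<Longrightarrow> F (a i j) (b k l) = G (a i j) (b k l)"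
  shows "F x y = G x y"
proof -
  have "(\<lambda>x. F x (b k l)) = (\<lambda>x. G x (b k l))" if "matrix_coalgebra q b" "k < q" "l < q" for q b k l
    by (rule Lin_eqI[OF F(1) G(1)]) (use eq that in blast)
  then have "F x (b k l) = G x (b k l)" if "matrix_coalgebra q b" "k < q" "l < q" for q b k l
    using that by meson
  then have "(\<lambda>y. F x y) = (\<lambda>y. G x y)" by (intro Lin_eqI[OF F(2) G(2)])
  then show ?thesis by meson
qed

lemma Lin_translate:
  assumes "\<phi> \<in> Lin"
  shows "(\<lambda>x. \<phi> (x * y)) \<in> Lin" "(\<lambda>y. \<phi> (x * y)) \<in> Lin"
  by (rule LinI; simp add: Lin_add[OF assms] Lin_scale[OF assms] distrib_left distrib_right
      smul_mult_left[symmetric] smul_mult_right[symmetric])+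

lemma Lin_mult_const:
  assumes "\<phi> \<in> Lin"
  shows "(\<lambda>x. \<phi> x * y) \<in> Lin" "(\<lambda>x. y * \<phi> x) \<in> Lin"
proof -
  show "(\<lambda>x. \<phi> x * y) \<in> Lin"
    by (rule LinI) (simp_all add: Lin_add[OF assms] Lin_scale[OF assms] distrib_right B.smul_mult_left)
  then show "(\<lambda>x. y * \<phi> x) \<in> Lin" by (simp add: mult.commute)
qed

lemma star_mult_matrix_coalgebra:
  assumes a: "matrix_coalgebra p a" and b: "matrix_coalgebra q b" and ij: "i < p" "j < p" and kl: "k < q" "l < q"
    and \<phi>: "\<phi> \<in> Lin" and \<psi>: "\<psi> \<in> Lin"
  shows "star \<phi> \<psi> (a i j * b k l) = (\<Sum>s<p. \<Sum>t<q. \<phi> (a i s * b k t) * \<psi> (a s j * b t l))"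
  using lift_kron[OF a b ij kl VB bilin_star[OF \<phi> \<psi>]] by (simp add: star_lift)

text \<open>On coefficients both sides are double sums with two factors from \<open>\<phi>\<close>
  and two from \<open>\<psi>\<close>, in different order. Commutativity of \<open>B\<close> moves
  the middle factors past each other.\<close>

lemma star_Chars:
  assumes \<phi>: "\<phi> \<in> Chars" and \<psi>: "\<psi> \<in> Chars"
  shows "star \<phi> \<psi> \<in> Chars"
proof (rule CharsI)
  note l = Chars_Lin[OF \<phi>] Chars_Lin[OF \<psi>]
  show L: "star \<phi> \<psi> \<in> Lin" by (rule star_Lin[OF l])
  show "star \<phi> \<psi> 1 = 1"
    using lift_one[OF VB bilin_star[OF l]] by (simp add: star_lift Chars_one \<phi> \<psi>)
  show "star \<phi> \<psi> (x * y) = star \<phi> \<psi> x * star \<phi> \<psi> y" for x y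
  proof (rule bilinear_eqI[of "\<lambda>x y. star \<phi> \<psi> (x * y)" "\<lambda>x y. star \<phi> \<psi> x * star \<phi> \<psi> y"])
    fix p a q b i j k l assume a: "matrix_coalgebra p a" "matrix_coalgebra q b" "i < p" "j < p" "k < q" "l < q"
    show "star \<phi> \<psi> (a i j * b k l) = star \<phi> \<psi> (a i j) * star \<phi> \<psi> (b k l)"
      using a by (simp add: star_mult_matrix_coalgebra[OF a l] star_matrix_coalgebra[OF _ l] Chars_mult[OF \<phi>] Chars_mult[OF \<psi>] sum_product mult_ac)
  qed (intro Lin_translate Lin_mult_const L)+
qed

lemma \<eta>_Chars: "\<eta> \<in> Chars"
proof (rule CharsI[OF \<eta>_Lin])
  show "\<eta> 1 = 1" by (simp add: \<eta>_def counit_one)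
  show "\<eta> (x * y) = \<eta> x * \<eta> y" for x y
    unfolding \<eta>_def counit_mult by (metis B.scale_scale B.smul_mult_left mult.left_neutral)
qed

lemma antipode_inverse:
  assumes \<phi>: "\<phi> \<in> Chars"
  shows "star (\<phi> \<circ> S) \<phi> = \<eta>" "star \<phi> (\<phi> \<circ> S) = \<eta>"
proof -
  have l: "Vector_Spaces.linear smul sB \<phi>" using Chars_Lin[OF \<phi>] by simp
  show "star (\<phi> \<circ> S) \<phi> = \<eta>"
  proof
    fix x
    have "star (\<phi> \<circ> S) \<phi> x = \<phi> (free_lift smul (\<lambda>(a, b). S a * b) (\<Delta> x))"
      unfolding linear_comp_free_lift[OF l] by (simp add: convolution_def case_prod_unfold Chars_mult[OF \<phi>])
    then show "star (\<phi> \<circ> S) \<phi> x = \<eta> x"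
      by (simp add: antipode_left linear_scale'[OF l] Chars_one[OF \<phi>] \<eta>_def)
  qed
  show "star \<phi> (\<phi> \<circ> S) = \<eta>"
  proof
    fix x
    have "star \<phi> (\<phi> \<circ> S) x = \<phi> (free_lift smul (\<lambda>(a, b). a * S b) (\<Delta> x))"
      unfolding linear_comp_free_lift[OF l] by (simp add: convolution_def case_prod_unfold Chars_mult[OF \<phi>])
    then show "star \<phi> (\<phi> \<circ> S) x = \<eta> x"
      by (simp add: antipode_right linear_scale'[OF l] Chars_one[OF \<phi>] \<eta>_def)
  qed
qed

lemma antipode_Lin: "\<phi> \<in> Lin \<Longrightarrow> \<phi> \<circ> S \<in> Lin"
  by (rule LinI) (simp_all add: linear_add'[OF antipode_linear] linear_scale'[OF antipode_linear] Lin_add Lin_scale del: mem_Collect_eq)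

\<comment> \<open>On a Kronecker product of two matrix coalgebras both sides are the inverse of the same matrix.\<close>
lemma antipode_Chars:
  assumes \<phi>: "\<phi> \<in> Chars"
  shows "\<phi> \<circ> S \<in> Chars"
proof (rule CharsI)
  note l = Chars_Lin[OF \<phi>]
  show L: "\<phi> \<circ> S \<in> Lin" by (rule antipode_Lin[OF l])
  have bl: "bilin smul smul (\<lambda>(a, b). S a * b)"
    by (rule bilinI[OF antipode_linear _ unital_algebra_axioms, where g = "\<lambda>x. x"])
       (simp add: Vector_Spaces.linear_iff V)
  have "S 1 = 1" using antipode_left[of 1] lift_one[OF V bl] by (simp add: lift_def counit_one)
  then show "(\<phi> \<circ> S) 1 = 1" by (simp add: Chars_one[OF \<phi>])
  show "(\<phi> \<circ> S) (x * y) = (\<phi> \<circ> S) x * (\<phi> \<circ> S) y" for x y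
  proof (rule bilinear_eqI[of "\<lambda>x y. (\<phi> \<circ> S) (x * y)" "\<lambda>x y. (\<phi> \<circ> S) x * (\<phi> \<circ> S) y"])
    fix p a q b i j k l assume a: "matrix_coalgebra p a" and b: "matrix_coalgebra q b" and ij: "i < p" "j < p" and kl: "k < q" "l < q"
    let ?c = "kron q a b"
    have c: "matrix_coalgebra (p * q) ?c" by (rule matrix_coalgebra_kron[OF a b])
    have "(\<phi> \<circ> S) (?c I J) = (\<phi> \<circ> S) (a (I div q) (J div q)) * (\<phi> \<circ> S) (b (I mod q) (J mod q))"
      if IJ: "I < p * q" "J < p * q" for I J
    proof (rule matrix_inverse_unique[of "p * q" "\<lambda>I J. (\<phi> \<circ> S) (?c I J)" "\<lambda>I J. \<phi> (?c I J)"
          "\<lambda>I J. (\<phi> \<circ> S) (a (I div q) (J div q)) * (\<phi> \<circ> S) (b (I mod q) (J mod q))", OF _ _ IJ])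
      fix I J assume IJ: "I < p * q" "J < p * q"
      show "(\<Sum>K<p * q. (\<phi> \<circ> S) (?c I K) * \<phi> (?c K J)) = (if I = J then 1 else 0)"
        using star_matrix_coalgebra[OF c L l IJ] \<eta>_matrix_coalgebra[OF c IJ] by (simp add: antipode_inverse[OF \<phi>])
      note bounds = div_mod_bounds(1)[OF IJ(1)] div_mod_bounds(1)[OF IJ(2)] div_mod_bounds(2)[OF IJ(1)] div_mod_bounds(2)[OF IJ(2)]
      \<comment> \<open>The candidate on the right is the Kronecker product of the two inverse
        matrices. As \<open>\<phi>\<close> is multiplicative and \<open>B\<close> commutative, the
        sum separates into one convolution for \<open>a\<close> and one for
        \<open>b\<close>.\<close>
      have "(\<Sum>K<p * q. \<phi> (?c I K) * ((\<phi> \<circ> S) (a (K div q) (J div q)) * (\<phi> \<circ> S) (b (K mod q) (J mod q)))) =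
          (\<Sum>s<p. \<Sum>t<q. (\<phi> (a (I div q) s) * (\<phi> \<circ> S) (a s (J div q))) * (\<phi> (b (I mod q) t) * (\<phi> \<circ> S) (b t (J mod q))))"
        using sum_rect[of "\<lambda>s t. (\<phi> (a (I div q) s) * (\<phi> \<circ> S) (a s (J div q))) * (\<phi> (b (I mod q) t) * (\<phi> \<circ> S) (b t (J mod q)))" q p]
        by (simp add: kron_def Chars_mult[OF \<phi>] mult_ac)
      also have "\<dots> = star \<phi> (\<phi> \<circ> S) (a (I div q) (J div q)) * star \<phi> (\<phi> \<circ> S) (b (I mod q) (J mod q))"
        by (simp only: star_matrix_coalgebra[OF a l L bounds(1,2)] star_matrix_coalgebra[OF b l L bounds(3,4)] sum_product)
      also have "\<dots> = (if I = J then 1 else 0)"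
        using div_mod_eq_iff[of I q J] by (auto simp: antipode_inverse[OF \<phi>] \<eta>_matrix_coalgebra[OF a bounds(1,2)] \<eta>_matrix_coalgebra[OF b bounds(3,4)])
      finally show "(\<Sum>K<p * q. \<phi> (?c I K) * ((\<phi> \<circ> S) (a (K div q) (J div q)) * (\<phi> \<circ> S) (b (K mod q) (J mod q)))) =
        (if I = J then 1 else 0)" .
    qed
    from this[OF rect_index(1)[OF ij(1) kl(1)] rect_index(1)[OF ij(2) kl(2)]]
    show "(\<phi> \<circ> S) (a i j * b k l) = (\<phi> \<circ> S) (a i j) * (\<phi> \<circ> S) (b k l)"
      by (simp only: kron_def rect_index[OF ij(1) kl(1)] rect_index[OF ij(2) kl(2)])
  qed (intro Lin_translate Lin_mult_const L)+
qed

end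

section \<open>Matrix representations of weakly complete algebras\<close>

text \<open>The class of scalars offers a norm-preserving ring isomorphism, not one known to be
  real-linear. It fixes \<open>0\<close> and \<open>1\<close>, and the distances to these two points
  determine a real number; therefore it fixes the reals.\<close>

lemma norm_diff_one_determines:
  fixes w r :: real
  assumes "\<bar>w\<bar> = \<bar>r\<bar>" "\<bar>w - 1\<bar> = \<bar>r - 1\<bar>"
  shows "w = r"
  using assms by arith

lemma complex_norm_diff_one_determines:
  fixes w :: complex
  assumes "cmod w = \<bar>r\<bar>" "cmod (w - 1) = \<bar>r - 1\<bar>"
  shows "w = of_real r"
proof -
  have 1: "(Re w)\<^sup>2 + (Im w)\<^sup>2 = r\<^sup>2" using assms(1) by (metis cmod_power2 power2_abs)
  have "(Re w - 1)\<^sup>2 + (Im w)\<^sup>2 = (r - 1)\<^sup>2"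
    using assms(2) cmod_power2[of "w - 1"] by (metis minus_complex.sel one_complex.sel diff_zero power2_abs)
  with 1 have "Re w = r" by (simp add: power2_eq_square algebra_simps)
  with 1 have "Im w = 0" by simp
  with \<open>Re w = r\<close> show ?thesis by (simp add: complex_eq_iff)
qed

lemma norm_ring_hom_of_real:
  fixes f :: "'k::real_normed_field \<Rightarrow> 'l::real_normed_field"
  assumes add: "\<And>x y. f (x + y) = f x + f y" and mult: "\<And>x y. f (x * y) = f x * f y"
    and norm: "\<And>x. norm (f x) = norm x"
  shows "norm (f (of_real r)) = \<bar>r\<bar>" "norm (f (of_real r) - 1) = \<bar>r - 1\<bar>" "f 1 = 1"
proof -
  have "f 1 * f 1 = f 1" using mult[of 1 1] by simp
  moreover have "f 1 \<noteq> 0" using norm[of 1] by auto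
  ultimately show f1: "f 1 = 1" by simp
  show "norm (f (of_real r)) = \<bar>r\<bar>" by (simp add: norm)
  have "f (of_real r - 1) + f 1 = f (of_real r)" using add[of "of_real r - 1" 1] by simp
  then have "f (of_real r) - 1 = f (of_real (r - 1))" by (simp add: f1 algebra_simps)
  then show "norm (f (of_real r) - 1) = \<bar>r - 1\<bar>" by (simp only: norm norm_of_real)
qed

text \<open>Since the isomorphism fixes the reals, it is real-linear and bounded, so real and
  imaginary part can be pulled back. Indexing by \<open>bool\<close> lets one pair of coordinates
  serve both fields, with a zero coordinate in the real case.\<close>

lemma real_or_complex_coordinates:
  obtains \<kappa> :: "bool \<Rightarrow> 'k::real_or_complex \<Rightarrow> real" and u :: "bool \<Rightarrow> 'k"
  where "\<And>s. bounded_linear (\<kappa> s)" "\<And>z. (\<Sum>s\<in>UNIV. \<kappa> s z *\<^sub>R u s) = z"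
  using real_or_complex[where 'a = 'k]
proof
  assume "\<exists>f :: 'k \<Rightarrow> real. bij f \<and> (\<forall>x y. f (x + y) = f x + f y \<and> f (x * y) = f x * f y) \<and> (\<forall>x. norm (f x) = norm x)"
  then obtain f :: "'k \<Rightarrow> real" where bij: "bij f" and add: "\<And>x y. f (x + y) = f x + f y"
    and mult: "\<And>x y. f (x * y) = f x * f y" and norm: "\<And>x. norm (f x) = norm x" by blast
  note h = norm_ring_hom_of_real[of f, OF add mult norm]
  have fr: "f (of_real r) = r" for r
    using norm_diff_one_determines[of "f (of_real r)" r] h(1,2)[of r] by simp
  have bl: "bounded_linear f"
    by (rule bounded_linear_intro[of _ 1]) (simp_all add: add scaleR_conv_of_real mult fr norm[symmetric])
  have e: "f z *\<^sub>R 1 = z" for z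
    using fr[of "f z"] bij by (simp add: scaleR_conv_of_real bij_def inj_eq)
  show ?thesis
    by (rule that[of "\<lambda>s. if s then f else (\<lambda>_. 0)" "\<lambda>_. 1"])
       (auto simp: bl e UNIV_bool split: if_splits)
next
  assume "\<exists>f :: 'k \<Rightarrow> complex. bij f \<and> (\<forall>x y. f (x + y) = f x + f y \<and> f (x * y) = f x * f y) \<and> (\<forall>x. norm (f x) = norm x)"
  then obtain f :: "'k \<Rightarrow> complex" where bij: "bij f" and add: "\<And>x y. f (x + y) = f x + f y"
    and mult: "\<And>x y. f (x * y) = f x * f y" and norm: "\<And>x. norm (f x) = norm x" by blast
  note h = norm_ring_hom_of_real[of f, OF add mult norm]
  have fr: "f (of_real r) = of_real r" for r
    by (rule complex_norm_diff_one_determines[OF h(1,2)])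
  have bl: "bounded_linear f"
    by (rule bounded_linear_intro[of _ 1]) (simp_all add: add scaleR_conv_of_real mult fr norm)
  have ri: "f (inv_into UNIV f \<i>) = \<i>" by (rule f_inv_into_f) (use bij in \<open>auto simp: bij_def\<close>)
  have e: "Re (f z) *\<^sub>R 1 + Im (f z) *\<^sub>R inv_into UNIV f \<i> = z" for z
  proof -
    have "f (Re (f z) *\<^sub>R 1 + Im (f z) *\<^sub>R inv_into UNIV f \<i>) = f z"
      by (simp add: scaleR_conv_of_real add mult fr ri complex_eq_iff)
    then show ?thesis using bij by (simp add: bij_def inj_eq)
  qed
  show ?thesis
  proof (rule that[of "\<lambda>s. if s then (\<lambda>z. Re (f z)) else (\<lambda>z. Im (f z))" "\<lambda>s. if s then 1 else inv_into UNIV f \<i>"])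
    show "bounded_linear (if s then (\<lambda>z. Re (f z)) else (\<lambda>z. Im (f z)))" for s
      using bounded_linear_compose[OF bounded_linear_Re bl] bounded_linear_compose[OF bounded_linear_Im bl] by auto
    show "(\<Sum>s\<in>UNIV. (if s then (\<lambda>z. Re (f z)) else (\<lambda>z. Im (f z))) z *\<^sub>R (if s then 1 else inv_into UNIV f \<i>)) = z" for z
      using e[of z] by (simp add: UNIV_bool add.commute)
  qed
qed

\<comment> \<open>Real and imaginary part, for complex scalars; for real scalars one of the two coordinates vanishes.\<close>
definition \<kappa> :: "bool \<Rightarrow> 'k::real_or_complex \<Rightarrow> real" where
  "\<kappa> = (SOME \<kappa>. \<exists>u. (\<forall>s. bounded_linear (\<kappa> s)) \<and> (\<forall>z. (\<Sum>s\<in>UNIV. \<kappa> s z *\<^sub>R u s) = z))"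
definition \<kappa>u :: "bool \<Rightarrow> 'k::real_or_complex" where
  "\<kappa>u = (SOME u. \<forall>z. (\<Sum>s\<in>UNIV. \<kappa> s z *\<^sub>R u s) = z)"

lemma bounded_linear_\<kappa>: "bounded_linear (\<kappa> s :: 'k::real_or_complex \<Rightarrow> real)" and \<kappa>_sum: "(\<Sum>s\<in>UNIV. \<kappa> s z *\<^sub>R \<kappa>u s) = (z :: 'k::real_or_complex)"
proof -
  have "\<exists>\<kappa> :: bool \<Rightarrow> 'k \<Rightarrow> real. \<exists>u. (\<forall>s. bounded_linear (\<kappa> s)) \<and> (\<forall>z. (\<Sum>s\<in>UNIV. \<kappa> s z *\<^sub>R u s) = z)"
    by (rule real_or_complex_coordinates) blast
  from someI_ex[OF this]
  have *: "\<exists>u. (\<forall>s. bounded_linear (\<kappa> s :: 'k \<Rightarrow> real)) \<and> (\<forall>z :: 'k. (\<Sum>s\<in>UNIV. \<kappa> s z *\<^sub>R u s) = z)"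
    unfolding \<kappa>_def .
  then show "bounded_linear (\<kappa> s :: 'k \<Rightarrow> real)" by blast
  from * have "\<exists>u. \<forall>z :: 'k. (\<Sum>s\<in>UNIV. \<kappa> s z *\<^sub>R u s) = z" by blast
  from someI_ex[OF this] show "(\<Sum>s\<in>UNIV. \<kappa> s z *\<^sub>R \<kappa>u s) = z" unfolding \<kappa>u_def by blast
qed

lemma \<kappa>_add: "\<kappa> s (x + y) = \<kappa> s x + \<kappa> s (y :: 'k::real_or_complex)"
  by (rule linear_add[OF bounded_linear.linear[OF bounded_linear_\<kappa>]])

lemma \<kappa>_scaleR: "\<kappa> s (r *\<^sub>R x) = r * \<kappa> s (x :: 'k::real_or_complex)"
  using linear_scale[OF bounded_linear.linear[OF bounded_linear_\<kappa>]] by simp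

definition fun_scale :: "real \<Rightarrow> ('x \<Rightarrow> real) \<Rightarrow> 'x \<Rightarrow> real" where "fun_scale r \<mu> = (\<lambda>x. r * \<mu> x)"

lemma vector_space_fun_scale: "vector_space fun_scale"
  by unfold_locales (auto simp: fun_scale_def fun_eq_iff algebra_simps)

lemma sum_fun_apply: "(\<Sum>i\<in>A. f i) x = (\<Sum>i\<in>A. f i x)" for f :: "'i \<Rightarrow> 'x \<Rightarrow> real"
  by (induction A rule: infinite_finite_induct) auto

section \<open>Continuous functionals and finite-dimensional representations\<close>

context weakly_complete_algebra
begin

definition coords :: "'b \<Rightarrow> 'x \<Rightarrow> 'k" where
  "coords = (SOME f. homeomorphic_map euclidean (product_topology (\<lambda>_. euclidean) I) f \<and>
      (\<forall>x y. \<forall>i\<in>I. f (x + y) i = f x i + f y i) \<and> (\<forall>c x. \<forall>i\<in>I. f (smul c x) i = c * f x i))"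

lemma coords: "homeomorphic_map euclidean (product_topology (\<lambda>_. euclidean) I) coords"
  "i \<in> I \<Longrightarrow> coords (x + y) i = coords x i + coords y i" "i \<in> I \<Longrightarrow> coords (smul c x) i = c * coords x i"
  using someI_ex[OF iso_power] unfolding coords_def[symmetric] by blast+

lemma coords_extensional: "coords x \<in> Pi\<^sub>E I (\<lambda>_. UNIV)"
  using homeomorphic_imp_surjective_map[OF coords(1)] by auto

lemma coords_eqI: "(\<And>i. i \<in> I \<Longrightarrow> coords x i = coords y i) \<Longrightarrow> x = y"
proof -
  assume "\<And>i. i \<in> I \<Longrightarrow> coords x i = coords y i"
  then have "coords x = coords y" using coords_extensional[of x] coords_extensional[of y] by (intro PiE_ext) auto
  then show ?thesis using homeomorphic_imp_injective_map[OF coords(1)] by (simp add: inj_on_def)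
qed

lemma coords_surj: obtains x where "\<And>i. i \<in> I \<Longrightarrow> coords x i = z i"
proof -
  have "restrict z I \<in> coords ` UNIV"
    using homeomorphic_imp_surjective_map[OF coords(1)] by auto
  then obtain x where "coords x = restrict z I" by (metis imageE)
  then show ?thesis using that[of x] by simp
qed

lemma coords_0: "i \<in> I \<Longrightarrow> coords 0 i = 0" using coords(2)[of i 0 0] by simp
lemma coords_diff: "i \<in> I \<Longrightarrow> coords (x - y) i = coords x i - coords y i" using coords(2)[of i "x - y" y] by simp
lemma coords_sum: "i \<in> I \<Longrightarrow> coords (\<Sum>j\<in>A. g j) i = (\<Sum>j\<in>A. coords (g j) i)"
  by (induction A rule: infinite_finite_induct) (auto simp: coords_0 coords)

lemma continuous_coords: "i \<in> I \<Longrightarrow> continuous_on UNIV (\<lambda>x. coords x i)"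
  using homeomorphic_imp_continuous_map[OF coords(1)]
  by (simp add: continuous_map_componentwise)

lemma continuous_map_coordsI:
  assumes "\<And>i. i \<in> I \<Longrightarrow> continuous_map X euclidean (\<lambda>x. coords (g x) i)"
  shows "continuous_map X euclidean g"
proof -
  obtain h where h: "homeomorphic_maps euclidean (product_topology (\<lambda>_. euclidean) I) coords h"
    using coords(1) homeomorphic_map_maps by blast
  have "continuous_map X (product_topology (\<lambda>_. euclidean) I) (\<lambda>x. coords (g x))"
    unfolding continuous_map_componentwise using assms coords_extensional by (auto simp: PiE_def)
  then have "continuous_map X euclidean (h \<circ> (\<lambda>x. coords (g x)))"
    by (rule continuous_map_compose) (use h in \<open>auto simp: homeomorphic_maps_def\<close>)
  moreover have "h (coords y) = y" for y using h by (simp add: homeomorphic_maps_def)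
  ultimately show ?thesis by (simp add: o_def)
qed

text \<open>A basic open set of a product restricts only finitely many coordinates, so every
  neighbourhood of \<open>0\<close> contains a subspace of finite codimension.\<close>

lemma neighbourhood_0:
  assumes "open U" "0 \<in> U"
  obtains I0 where "finite I0" "I0 \<subseteq> I" "{x. \<forall>i\<in>I0. coords x i = 0} \<subseteq> U"
proof -
  have "openin (product_topology (\<lambda>_. euclidean) I) (coords ` U)"
    using homeomorphic_map_openness[OF coords(1), of U] assms(1) by simp
  moreover have "coords 0 \<in> coords ` U" using assms(2) by blast
  ultimately have "\<exists>V. finite {i \<in> I. V i \<noteq> topspace euclidean} \<and> (\<forall>i\<in>I. openin euclidean (V i)) \<and>
      coords 0 \<in> Pi\<^sub>E I V \<and> Pi\<^sub>E I V \<subseteq> coords ` U"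
    unfolding openin_product_topology_alt by (rule bspec)
  then obtain V where V: "finite {i \<in> I. V i \<noteq> UNIV}" "coords 0 \<in> Pi\<^sub>E I V" "Pi\<^sub>E I V \<subseteq> coords ` U"
    by auto
  show ?thesis
  proof (rule that[OF V(1)])
    show "{x. \<forall>i\<in>{i \<in> I. V i \<noteq> UNIV}. coords x i = 0} \<subseteq> U"
    proof (rule subsetI)
    fix x assume "x \<in> {x. \<forall>i\<in>{i \<in> I. V i \<noteq> UNIV}. coords x i = 0}"
    then have x: "\<And>i. i \<in> {i \<in> I. V i \<noteq> UNIV} \<Longrightarrow> coords x i = 0" by blast
    have "coords x \<in> Pi\<^sub>E I V"
    proof (rule PiE_I)
      fix i assume i: "i \<in> I"
      show "coords x i \<in> V i"
      proof (cases "V i = UNIV")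
        case False
        then have "coords x i = coords 0 i" using x i coords_0 by auto
        then show ?thesis using V(2) i by auto
      qed simp
    qed (use coords_extensional[of x] in \<open>auto simp: PiE_def extensional_def\<close>)
    then obtain y where "y \<in> U" "coords x = coords y" using V(3) by blast
    then show "x \<in> U" using coords_eqI[of x y] by simp
    qed
  qed auto
qed

definition rlin :: "('b \<Rightarrow> real) \<Rightarrow> bool" where
  "rlin l \<longleftrightarrow> (\<forall>x y. l (x + y) = l x + l y) \<and> (\<forall>r x. l (smul (of_real r) x) = r * l x)"

lemma rlin_add: "rlin l \<Longrightarrow> l (x + y) = l x + l y"
  and rlin_scale: "rlin l \<Longrightarrow> l (smul (of_real r) x) = r * l x"
  by (simp_all add: rlin_def)

lemma rlin_0: "rlin l \<Longrightarrow> l 0 = 0" using rlin_add[of l 0 0] by simp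
lemma rlin_diff: "rlin l \<Longrightarrow> l (x - y) = l x - l y" using rlin_add[of l "x - y" y] by simp
lemma rlin_sum: "rlin l \<Longrightarrow> l (\<Sum>j\<in>A. g j) = (\<Sum>j\<in>A. l (g j))"
  by (induction A rule: infinite_finite_induct) (auto simp: rlin_0 rlin_add)

lemma rlin_\<kappa>_coords: "i \<in> I \<Longrightarrow> rlin (\<lambda>x. \<kappa> s (coords x i))"
  unfolding rlin_def by (simp add: coords \<kappa>_add \<kappa>_scaleR scaleR_conv_of_real[symmetric])

lemma continuous_\<kappa>_coords: "i \<in> I \<Longrightarrow> continuous_on UNIV (\<lambda>x. \<kappa> s (coords x i))"
  by (rule bounded_linear.continuous_on[OF bounded_linear_\<kappa> continuous_coords])

text \<open>On the subspace provided by \<open>neighbourhood_0\<close> the functional is bounded by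
  \<open>1\<close>, and rescaling forces it to vanish there.\<close>

lemma rlin_vanish:
  assumes l: "rlin l" "continuous_on UNIV l"
  shows "\<exists>I0. finite I0 \<and> I0 \<subseteq> I \<and> (\<forall>x. (\<forall>i\<in>I0. coords x i = 0) \<longrightarrow> l x = 0)"
proof -
  have "open {x. \<bar>l x\<bar> < 1}" by (intro open_Collect_less continuous_intros l(2))
  moreover have "0 \<in> {x. \<bar>l x\<bar> < 1}" by (simp add: rlin_0[OF l(1)])
  ultimately obtain I0 where I0: "finite I0" "I0 \<subseteq> I" and I0': "{x. \<forall>i\<in>I0. coords x i = 0} \<subseteq> {x. \<bar>l x\<bar> < 1}"
    by (rule neighbourhood_0)
  have "l x = 0" if x: "\<And>i. i \<in> I0 \<Longrightarrow> coords x i = 0" for x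
  proof (rule ccontr)
    assume n: "l x \<noteq> 0"
    have "smul (of_real (1 / l x)) x \<in> {x. \<bar>l x\<bar> < 1}" by (rule subsetD[OF I0']) (use x I0(2) coords(3) in auto)
    then have "\<bar>1 / l x * l x\<bar> < 1" by (simp only: mem_Collect_eq rlin_scale[OF l(1)])
    then show False using n by simp
  qed
  then show ?thesis using I0(1,2) by (intro exI[of _ I0]) simp
qed

definition matrix_rep :: "nat \<Rightarrow> ('b \<Rightarrow> nat \<Rightarrow> nat \<Rightarrow> real) \<Rightarrow> bool" where
  "matrix_rep q \<beta> \<longleftrightarrow> (\<forall>k<q. \<forall>l<q. rlin (\<lambda>x. \<beta> x k l) \<and> continuous_on UNIV (\<lambda>x. \<beta> x k l) \<and>
     \<beta> 1 k l = (if k = l then 1 else 0) \<and> (\<forall>x y. \<beta> (x * y) k l = (\<Sum>m<q. \<beta> x k m * \<beta> y m l)))"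

\<comment> \<open>By continuity of the product, \<open>l\<close> vanishes on \<open>V * V\<close> for a subspace \<open>V\<close> of finite codimension.
  Hence the translates \<open>\<lambda>x. l (z * x)\<close> span a finite-dimensional space, on which the algebra acts.\<close>
lemma matrix_rep_factor:
  assumes l: "rlin l" "continuous_on UNIV l"
  shows "\<exists>q \<beta> \<gamma>. matrix_rep q \<beta> \<and> (\<forall>x. l x = (\<Sum>k<q. \<Sum>m<q. \<gamma> k m * \<beta> x k m))"
proof -
  have "open {p. \<bar>l (fst p * snd p)\<bar> < 1}"
    by (intro open_Collect_less continuous_intros continuous_on_compose2[OF l(2)])
       (use continuous_mult in \<open>auto simp: case_prod_unfold\<close>)
  moreover have "(0, 0) \<in> {p. \<bar>l (fst p * snd p)\<bar> < 1}" by (simp add: rlin_0[OF l(1)])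
  ultimately obtain A B where AB: "open A" "open B" "0 \<in> A" "0 \<in> B" "A \<times> B \<subseteq> {p. \<bar>l (fst p * snd p)\<bar> < 1}"
    by (elim open_prod_elim) auto
  obtain I1 where I1: "finite I1" "I1 \<subseteq> I" and I1': "{x. \<forall>i\<in>I1. coords x i = 0} \<subseteq> A"
    by (rule neighbourhood_0[OF AB(1,3)])
  obtain I2 where I2: "finite I2" "I2 \<subseteq> I" and I2': "{x. \<forall>i\<in>I2. coords x i = 0} \<subseteq> B"
    by (rule neighbourhood_0[OF AB(2,4)])
  define I0 where "I0 = I1 \<union> I2"
  have I0: "finite I0" "I0 \<subseteq> I" using I1 I2 by (auto simp: I0_def)
  define V where "V = {x. \<forall>i\<in>I0. coords x i = 0}"
  have VV: "l (x * y) = 0" if xy: "x \<in> V" "y \<in> V" for x y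
  proof (rule ccontr)
    assume n: "l (x * y) \<noteq> 0"
    \<comment> \<open>The subspace is stable under scaling, so a nonzero value could be rescaled to
      \<open>1\<close>.\<close>
    let ?x = "smul (of_real (1 / l (x * y))) x"
    have "?x \<in> A" by (rule subsetD[OF I1']) (use xy I1(2) coords(3) in \<open>auto simp: V_def I0_def\<close>)
    moreover have "y \<in> B" by (rule subsetD[OF I2']) (use xy in \<open>auto simp: V_def I0_def\<close>)
    ultimately have "\<bar>l (?x * y)\<bar> < 1" using AB(5) by auto
    then have "\<bar>1 / l (x * y) * l (x * y)\<bar> < 1" by (simp only: smul_mult_left[symmetric] rlin_scale[OF l(1)])
    then show False using n by simp
  qed
  define D where "D = I0 \<times> (UNIV :: bool set)"
  have fD: "finite D" using I0 by (simp add: D_def)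
  define \<nu> where "\<nu> \<delta> x = \<kappa> (snd \<delta>) (coords x (fst \<delta>))" for \<delta> x
  have \<nu>l: "rlin (\<nu> \<delta>)" and \<nu>c: "continuous_on UNIV (\<nu> \<delta>)" if "\<delta> \<in> D" for \<delta>
    using that I0 rlin_\<kappa>_coords continuous_\<kappa>_coords by (auto simp: D_def \<nu>_def[abs_def])
  \<comment> \<open>Vectors concentrated in one coordinate. Together with the functionals
    \<open>\<nu>\<close> they rebuild the coordinates of \<open>x\<close> with index in
    \<open>I0\<close>, so subtracting this finite part leaves an element \<open>v x\<close> of
    \<open>V\<close>.\<close>
  have "\<exists>x. \<forall>i\<in>I. coords x i = (if i = fst \<delta> then \<kappa>u (snd \<delta>) else 0)" for \<delta>
    by (rule coords_surj[of "\<lambda>i. if i = fst \<delta> then \<kappa>u (snd \<delta>) else 0"]) blast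
  then obtain dd where dd: "\<And>\<delta> i. i \<in> I \<Longrightarrow> coords (dd \<delta>) i = (if i = fst \<delta> then \<kappa>u (snd \<delta>) else 0)" by metis
  define v where "v x = x - (\<Sum>\<delta>\<in>D. smul (of_real (\<nu> \<delta> x)) (dd \<delta>))" for x
  have vV: "v x \<in> V" for x
    unfolding V_def
  proof (rule CollectI, rule ballI)
    fix i assume i: "i \<in> I0"
    then have iI: "i \<in> I" using I0 by blast
    have "(\<Sum>\<delta>\<in>D. coords (smul (of_real (\<nu> \<delta> x)) (dd \<delta>)) i) =
        (\<Sum>j\<in>I0. \<Sum>s\<in>UNIV. coords (smul (of_real (\<nu> (j, s) x)) (dd (j, s))) i)"
    proof -
      define h where "h \<delta> = coords (smul (of_real (\<nu> \<delta> x)) (dd \<delta>)) i" for \<delta>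
      have "(\<Sum>\<delta>\<in>D. h \<delta>) = (\<Sum>(j, s)\<in>D. h (j, s))" by (rule sum.cong) auto
      also have "\<dots> = (\<Sum>j\<in>I0. \<Sum>s\<in>UNIV. h (j, s))" unfolding D_def by (rule sum.cartesian_product[symmetric])
      finally show ?thesis unfolding h_def .
    qed
    also have "\<dots> = (\<Sum>j\<in>I0. \<Sum>s\<in>UNIV. if i = j then \<kappa> s (coords x i) *\<^sub>R \<kappa>u s else 0)"
      by (intro sum.cong refl) (simp add: coords(3)[OF iI] dd[OF iI] \<nu>_def scaleR_conv_of_real)
    also have "\<dots> = (\<Sum>j\<in>I0. if i = j then coords x i else 0)"
      by (intro sum.cong refl) (simp add: \<kappa>_sum)
    also have "\<dots> = coords x i" using i I0 by simp
    finally show "coords (v x) i = 0" by (simp add: v_def coords_diff[OF iI] coords_sum[OF iI])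
  qed
  define T where "T z x = l (z * x)" for z x
  interpret fs: vector_space fun_scale by (rule vector_space_fun_scale)
  have Tadd: "T (z + z') = T z + T z'" for z z'
    by (rule ext) (simp add: T_def distrib_right rlin_add[OF l(1)])
  have Tscale: "T (smul (of_real r) z) = fun_scale r (T z)" for r z
    by (rule ext) (simp add: T_def fun_scale_def smul_mult_left[symmetric] rlin_scale[OF l(1)])
  have T0: "T 0 = 0" by (rule ext) (simp add: T_def rlin_0[OF l(1)])
  have lexp: "l (y * x) = l (y * v x) + (\<Sum>\<delta>\<in>D. \<nu> \<delta> x * l (y * dd \<delta>))" for x y
  proof -
    have "y * x = y * v x + (\<Sum>\<delta>\<in>D. smul (of_real (\<nu> \<delta> x)) (y * dd \<delta>))"
      by (simp add: v_def right_diff_distrib sum_distrib_left smul_mult_right)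
    then show ?thesis by (simp add: rlin_add[OF l(1)] rlin_sum[OF l(1)] rlin_scale[OF l(1)])
  qed
  have lexp': "l (y * x) = l (v y * x) + (\<Sum>\<delta>\<in>D. \<nu> \<delta> y * l (dd \<delta> * x))" for x y
  proof -
    have "y * x = v y * x + (\<Sum>\<delta>\<in>D. smul (of_real (\<nu> \<delta> y)) (dd \<delta> * x))"
      by (simp add: v_def left_diff_distrib sum_distrib_right smul_mult_left)
    then show ?thesis by (simp add: rlin_add[OF l(1)] rlin_sum[OF l(1)] rlin_scale[OF l(1)])
  qed
  \<comment> \<open>Decompose both factors of \<open>z * x\<close> into their parts in
    \<open>V\<close> and finite parts. The product of the parts in \<open>V\<close> is annihilated
    by \<open>l\<close>, so every translate is a combination of the same finitely many
    functionals.\<close>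
  have Texp: "T z = (\<Sum>\<delta>\<in>D. fun_scale (l (v z * dd \<delta>)) (\<nu> \<delta>)) + (\<Sum>\<delta>\<in>D. fun_scale (\<nu> \<delta> z) (T (dd \<delta>)))" for z
  proof
    fix x
    have "l (v z * x) = (\<Sum>\<delta>\<in>D. \<nu> \<delta> x * l (v z * dd \<delta>))"
      using lexp[of "v z" x] VV[OF vV vV] by simp
    then show "T z x = ((\<Sum>\<delta>\<in>D. fun_scale (l (v z * dd \<delta>)) (\<nu> \<delta>)) + (\<Sum>\<delta>\<in>D. fun_scale (\<nu> \<delta> z) (T (dd \<delta>)))) x"
      using lexp'[of z x] by (simp add: T_def sum_fun_apply fun_scale_def mult.commute)
  qed
  define X where "X = \<nu> ` D \<union> (\<lambda>\<delta>. T (dd \<delta>)) ` D"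
  have fX: "finite X" using fD by (simp add: X_def)
  have W: "fs.subspace (range T)"
    unfolding fs.subspace_def
  proof (intro conjI ballI allI)
    show "0 \<in> range T" unfolding T0[symmetric] by (rule rangeI)
    fix f g assume "f \<in> range T" "g \<in> range T"
    then obtain a b where "f = T a" "g = T b" by blast
    then have "f + g = T (a + b)" by (simp only: Tadd)
    then show "f + g \<in> range T" by (simp only: rangeI)
  next
    fix r f assume "f \<in> range T"
    then obtain a where "f = T a" by blast
    then have "fun_scale r f = T (smul (of_real r) a)" by (simp only: Tscale)
    then show "fun_scale r f \<in> range T" by (simp only: rangeI)
  qed
  have WX: "range T \<subseteq> fs.span X"
  proof (rule image_subsetI)
    fix z
    show "T z \<in> fs.span X"
      unfolding Texp[of z] by (intro fs.span_add fs.span_sum fs.span_scale fs.span_base) (auto simp: X_def)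
  qed
  obtain q :: nat and w ws where wW: "\<And>i. i < q \<Longrightarrow> w i \<in> range T" and ws: "\<And>i. Vector_Spaces.linear fun_scale (*) (ws i)"
    and dual: "\<And>i j. i < q \<Longrightarrow> j < q \<Longrightarrow> ws i (w j) = (if i = j then 1 else 0)"
    and rep: "\<And>x. x \<in> range T \<Longrightarrow> (\<Sum>i<q. fun_scale (ws i x) (w i)) = x"
    by (rule fs.finite_dual_basis[OF fX W WX], rule that)
  have "\<forall>i. \<exists>z. i < q \<longrightarrow> w i = T z" using wW by blast
  then obtain z where z: "\<And>i. i < q \<Longrightarrow> w i = T (z i)" by metis
  \<comment> \<open>The matrix of the operator sending \<open>T z\<close> to
    \<open>T (z * y)\<close>, in the basis \<open>w k = T (z k)\<close>.\<close>
  define \<beta> where "\<beta> y k m = ws m (T (z k * y))" for y k m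
  have exp: "l (y * x) = (\<Sum>m<q. ws m (T y) * l (z m * x))" for y x
  proof -
    have "T y x = (\<Sum>m<q. fun_scale (ws m (T y)) (w m)) x" using rep[of "T y"] by simp
    then show ?thesis by (simp add: sum_fun_apply fun_scale_def z T_def)
  qed
  have bm: "matrix_rep q \<beta>"
    unfolding matrix_rep_def
  proof (intro allI impI conjI)
    fix k m assume k: "k < q" and m: "m < q"
    show "rlin (\<lambda>x. \<beta> x k m)"
      unfolding rlin_def \<beta>_def
      by (simp add: distrib_left Tadd linear_add'[OF ws] smul_mult_right[symmetric] Tscale linear_scale'[OF ws])
    show "\<beta> 1 k m = (if k = m then 1 else 0)"
      using dual[OF m k] by (auto simp: \<beta>_def z[OF k])
    show "\<beta> (x * y) k m = (\<Sum>j<q. \<beta> x k j * \<beta> y j m)" for x y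
    proof -
      have "T (z k * (x * y)) = (\<Sum>j<q. fun_scale (\<beta> x k j) (T (z j * y)))"
      proof
        fix a
        show "T (z k * (x * y)) a = (\<Sum>j<q. fun_scale (\<beta> x k j) (T (z j * y))) a"
          using exp[of "z k * x" "y * a"] by (simp add: T_def \<beta>_def sum_fun_apply fun_scale_def mult.assoc)
      qed
      then show ?thesis unfolding \<beta>_def[of "x * y"]
        by (simp add: linear_sum'[OF ws] linear_scale'[OF ws] \<beta>_def[of y])
    qed
    have cm: "continuous_on UNIV (\<lambda>y. l (z k * y * u))" "continuous_on UNIV (\<lambda>y. \<nu> \<delta> (z k * y))"
      if "\<delta> \<in> D" for u \<delta>
    proof -
      have c1: "continuous_on UNIV (\<lambda>y. z k * y)"
        using continuous_on_compose2[OF continuous_mult, of UNIV "\<lambda>y. (z k, y)"] by (simp add: continuous_on_Pair)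
      have c2: "continuous_on UNIV (\<lambda>y. z k * y * u)"
        using continuous_on_compose2[OF continuous_mult, of UNIV "\<lambda>y. (z k * y, u)"] c1 by (simp add: continuous_on_Pair)
      show "continuous_on UNIV (\<lambda>y. l (z k * y * u))" by (rule continuous_on_compose2[OF l(2) c2]) simp
      show "continuous_on UNIV (\<lambda>y. \<nu> \<delta> (z k * y))" by (rule continuous_on_compose2[OF \<nu>c[OF that] c1]) simp
    qed
    have lv: "l (v y * u) = l (y * u) - (\<Sum>\<delta>\<in>D. \<nu> \<delta> y * l (dd \<delta> * u))" for y u
      using lexp'[of y u] by simp
    \<comment> \<open>No continuity of \<open>ws m\<close> is available. The expansion
      \<open>Texp\<close> applies it to fixed vectors only and leaves continuous functions of
      \<open>y\<close> as coefficients.\<close>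
    have "\<beta> y k m = (\<Sum>\<delta>\<in>D. l (v (z k * y) * dd \<delta>) * ws m (\<nu> \<delta>)) + (\<Sum>\<delta>\<in>D. \<nu> \<delta> (z k * y) * ws m (T (dd \<delta>)))" for y
      unfolding \<beta>_def Texp[of "z k * y"] by (simp add: linear_add'[OF ws] linear_sum'[OF ws] linear_scale'[OF ws])
    then show "continuous_on UNIV (\<lambda>x. \<beta> x k m)"
      unfolding lv
      by (simp add: lv) (intro continuous_on_add continuous_on_sum continuous_on_mult continuous_on_diff continuous_on_const cm; assumption)
  qed
  \<comment> \<open>Here \<open>l = T 1\<close>: expand it in the basis, and expand each
    \<open>l (z k * x)\<close> once more before evaluating at \<open>1\<close>.\<close>
  have fac: "l x = (\<Sum>k<q. \<Sum>m<q. (ws k (T 1) * l (z m)) * \<beta> x k m)" for x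
  proof -
    have "l x = (\<Sum>k<q. ws k (T 1) * l (z k * x))" using exp[of 1 x] by simp
    also have "\<dots> = (\<Sum>k<q. ws k (T 1) * (\<Sum>m<q. \<beta> x k m * l (z m)))"
      using exp[of "z k * x" 1 for k] by (simp add: \<beta>_def)
    finally show ?thesis by (simp add: sum_distrib_left mult_ac)
  qed
  show ?thesis
    by (intro exI[of _ q] exI[of _ \<beta>] exI[of _ "\<lambda>k m. ws k (T 1) * l (z m)"] conjI allI bm fac)
qed

lemma matrix_repD:
  assumes "matrix_rep q \<beta>" "k < q" "l < q"
  shows "rlin (\<lambda>x. \<beta> x k l)" "continuous_on UNIV (\<lambda>x. \<beta> x k l)"
    "\<beta> 1 k l = (if k = l then 1 else 0)" "\<beta> (x * y) k l = (\<Sum>m<q. \<beta> x k m * \<beta> y m l)"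
  using assms unfolding matrix_rep_def by blast+

text \<open>The entries are only real-linear. A scalar \<open>c\<close> of the ground field acts
  through the matrix of \<open>smul c 1\<close>, which may mix rows.\<close>

lemma matrix_rep_smul:
  assumes "matrix_rep q \<beta>" "k < q" "l < q"
  shows "\<beta> (smul c x) k l = (\<Sum>m<q. \<beta> (smul c 1) k m * \<beta> x m l)"
  using matrix_repD(4)[OF assms, of "smul c 1" x] smul_mult_left[of c 1 x] by simp

section \<open>Kernels of representations and completeness of the algebra\<close>

definition rep_kernel :: "nat \<Rightarrow> ('b \<Rightarrow> nat \<Rightarrow> nat \<Rightarrow> real) \<Rightarrow> 'b set" where
  "rep_kernel q \<beta> = {x. \<forall>k<q. \<forall>l<q. \<beta> x k l = 0}"

definition kernels :: "'b set set" where "kernels = {J. \<exists>q \<beta>. matrix_rep q \<beta> \<and> J = rep_kernel q \<beta>}"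

lemma kernelsI: "matrix_rep q \<beta> \<Longrightarrow> rep_kernel q \<beta> \<in> kernels" by (auto simp: kernels_def)

lemma matrix_rep_blocksum:
  assumes 1: "matrix_rep q \<beta>" and 2: "matrix_rep q' \<beta>'"
  shows "matrix_rep (q + q') (\<lambda>x. blocksum q (\<beta> x) (\<beta>' x))"
proof -
  have z: "rlin (\<lambda>_. 0)" by (simp add: rlin_def)
  have rs: "rlin (\<lambda>x. blocksum q (\<beta> x) (\<beta>' x) k l) \<and> continuous_on UNIV (\<lambda>x. blocksum q (\<beta> x) (\<beta>' x) k l)"
    if "k < q + q'" "l < q + q'" for k l
    using that matrix_repD(1,2)[OF 1, of k l] matrix_repD(1,2)[OF 2, of "k - q" "l - q"] z
    by (cases "k < q \<and> l < q"; cases "q \<le> k \<and> q \<le> l") (auto simp: blocksum_def)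
  have one: "blocksum q (\<beta> 1) (\<beta>' 1) k l = (if k = l then 1 else 0)" if "k < q + q'" "l < q + q'" for k l
    using that matrix_repD(3)[OF 1, of k l] matrix_repD(3)[OF 2, of "k - q" "l - q"]
    by (auto simp: blocksum_def)
  have mult: "blocksum q (\<beta> (x * y)) (\<beta>' (x * y)) k l = (\<Sum>m<q + q'. blocksum q (\<beta> x) (\<beta>' x) k m * blocksum q (\<beta> y) (\<beta>' y) m l)"
    if "k < q + q'" "l < q + q'" for k l x y
    using that matrix_repD(4)[OF 1, of k l] matrix_repD(4)[OF 2, of "k - q" "l - q"]
    unfolding sum_lessThan_add by (cases "k < q"; cases "l < q") (auto simp: blocksum_def)
  show ?thesis unfolding matrix_rep_def using rs one mult by blast
qed

lemma rep_kernel_blocksum: "rep_kernel (q + q') (\<lambda>x. blocksum q (\<beta> x) (\<beta>' x)) = rep_kernel q \<beta> \<inter> rep_kernel q' \<beta>'"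
proof
  show "rep_kernel (q + q') (\<lambda>x. blocksum q (\<beta> x) (\<beta>' x)) \<subseteq> rep_kernel q \<beta> \<inter> rep_kernel q' \<beta>'"
  proof
    fix x assume "x \<in> rep_kernel (q + q') (\<lambda>x. blocksum q (\<beta> x) (\<beta>' x))"
    then have a: "blocksum q (\<beta> x) (\<beta>' x) k l = 0" if "k < q + q'" "l < q + q'" for k l
      using that by (auto simp: rep_kernel_def)
    have "\<beta> x k l = 0" if "k < q" "l < q" for k l using a[of k l] that by (simp add: blocksum_def)
    moreover have "\<beta>' x k l = 0" if "k < q'" "l < q'" for k l
      using a[of "q + k" "q + l"] that by (simp add: blocksum_def)
    ultimately show "x \<in> rep_kernel q \<beta> \<inter> rep_kernel q' \<beta>'" by (simp add: rep_kernel_def)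
  qed
  show "rep_kernel q \<beta> \<inter> rep_kernel q' \<beta>' \<subseteq> rep_kernel (q + q') (\<lambda>x. blocksum q (\<beta> x) (\<beta>' x))"
    by (auto simp: rep_kernel_def blocksum_def)
qed

lemma kernels_Int: "J \<in> kernels \<Longrightarrow> J' \<in> kernels \<Longrightarrow> J \<inter> J' \<in> kernels"
  unfolding kernels_def using matrix_rep_blocksum rep_kernel_blocksum by blast

lemma kernels_UNIV: "UNIV \<in> kernels"
  by (auto simp: kernels_def matrix_rep_def rep_kernel_def intro!: exI[of _ "0::nat"])

lemma kernels_INT: "finite A \<Longrightarrow> (\<And>i. i \<in> A \<Longrightarrow> J i \<in> kernels) \<Longrightarrow> (\<Inter>i\<in>A. J i) \<in> kernels"
  by (induction A rule: finite_induct) (simp_all add: kernels_UNIV kernels_Int)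

lemma kernels_closed:
  assumes J: "J \<in> kernels"
  shows "0 \<in> J" "x \<in> J \<Longrightarrow> y \<in> J \<Longrightarrow> x + y \<in> J" "x \<in> J \<Longrightarrow> y \<in> J \<Longrightarrow> x - y \<in> J" "x \<in> J \<Longrightarrow> smul c x \<in> J"
proof -
  obtain q \<beta> where b: "matrix_rep q \<beta>" "J = rep_kernel q \<beta>" using J by (auto simp: kernels_def)
  show "0 \<in> J" "x \<in> J \<Longrightarrow> y \<in> J \<Longrightarrow> x + y \<in> J" "x \<in> J \<Longrightarrow> y \<in> J \<Longrightarrow> x - y \<in> J"
    using rlin_add[OF matrix_repD(1)[OF b(1)]] rlin_diff[OF matrix_repD(1)[OF b(1)]] rlin_0[OF matrix_repD(1)[OF b(1)]]
    by (auto simp: b(2) rep_kernel_def)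
  show "x \<in> J \<Longrightarrow> smul c x \<in> J"
    by (auto simp: b(2) rep_kernel_def matrix_rep_smul[OF b(1), where c = c])
qed

lemma kernels_coords: "i \<in> I \<Longrightarrow> \<exists>J\<in>kernels. \<forall>x\<in>J. coords x i = 0"
proof -
  assume i: "i \<in> I"
  have "\<exists>J\<in>kernels. \<forall>x\<in>J. \<kappa> s (coords x i) = 0" for s
  proof -
    obtain q \<beta> \<gamma> where b: "matrix_rep q \<beta>" and e: "\<forall>x. \<kappa> s (coords x i) = (\<Sum>k<q. \<Sum>m<q. \<gamma> k m * \<beta> x k m)"
      using matrix_rep_factor[OF rlin_\<kappa>_coords[OF i] continuous_\<kappa>_coords[OF i]] by blast
    show ?thesis by (rule bexI[OF _ kernelsI[OF b]]) (simp add: rep_kernel_def e)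
  qed
  then obtain J where J: "\<And>s. J s \<in> kernels" "\<And>s x. x \<in> J s \<Longrightarrow> \<kappa> s (coords x i) = 0" by metis
  show ?thesis
  proof (rule bexI[OF _ kernels_Int[OF J(1)[of True] J(1)[of False]]], rule ballI)
    fix x assume "x \<in> J True \<inter> J False"
    then have "\<kappa> s (coords x i) = 0" for s using J(2) by (cases s) auto
    then show "coords x i = 0" using \<kappa>_sum[of "coords x i"] by simp
  qed
qed

lemma kernels_vanish: "J \<in> kernels \<Longrightarrow> \<exists>I0. finite I0 \<and> I0 \<subseteq> I \<and> (\<forall>x. (\<forall>i\<in>I0. coords x i = 0) \<longrightarrow> x \<in> J)"
proof -
  assume "J \<in> kernels"
  then obtain q \<beta> where b: "matrix_rep q \<beta>" "J = rep_kernel q \<beta>" by (auto simp: kernels_def)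
  have "\<exists>I0. finite I0 \<and> I0 \<subseteq> I \<and> (\<forall>x. (\<forall>i\<in>I0. coords x i = 0) \<longrightarrow> \<beta> x k l = 0)" if "k < q" "l < q" for k l
    by (rule rlin_vanish[OF matrix_repD(1,2)[OF b(1) that]])
  then obtain I0 where I0: "\<And>k l. k < q \<Longrightarrow> l < q \<Longrightarrow> finite (I0 k l) \<and> I0 k l \<subseteq> I \<and> (\<forall>x. (\<forall>i\<in>I0 k l. coords x i = 0) \<longrightarrow> \<beta> x k l = 0)"
    by metis
  show ?thesis
    by (rule exI[of _ "\<Union>k<q. \<Union>l<q. I0 k l"]) (use I0 in \<open>auto simp: b(2) rep_kernel_def\<close>)
qed

lemma kernels_separate: "(\<And>J. J \<in> kernels \<Longrightarrow> x \<in> J) \<Longrightarrow> x = 0"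
  by (rule coords_eqI) (use kernels_coords coords_0 in force)

text \<open>Each coordinate vanishes on some kernel \<open>K i\<close>, so the value of
  \<open>f\<close> there determines the coordinate of the limit. The coordinates can be prescribed
  freely by \<open>coords_surj\<close>.\<close>

lemma kernels_complete:
  assumes compat: "\<And>J J'. J \<in> kernels \<Longrightarrow> J' \<in> kernels \<Longrightarrow> J' \<subseteq> J \<Longrightarrow> f J' - f J \<in> J"
  obtains b where "\<And>J. J \<in> kernels \<Longrightarrow> b - f J \<in> J"
proof -
  obtain K where K: "\<And>i. i \<in> I \<Longrightarrow> K i \<in> kernels" "\<And>i x. i \<in> I \<Longrightarrow> x \<in> K i \<Longrightarrow> coords x i = 0" using kernels_coords by metis
  obtain b where b: "\<And>i. i \<in> I \<Longrightarrow> coords b i = coords (f (K i)) i" by (rule coords_surj[of "\<lambda>i. coords (f (K i)) i"], rule that)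
  have "b - f J \<in> J" if J: "J \<in> kernels" for J
  proof -
    obtain I0 where I0: "finite I0" "I0 \<subseteq> I" "\<And>x. (\<forall>i\<in>I0. coords x i = 0) \<Longrightarrow> x \<in> J" using kernels_vanish[OF J] by blast
    \<comment> \<open>A kernel below \<open>J\<close> and below all the \<open>K i\<close> that
      matter for \<open>J\<close>. At \<open>J'\<close> the family agrees with \<open>b\<close> in
      the coordinates of \<open>I0\<close> and with \<open>f J\<close> modulo
      \<open>J\<close>.\<close>
    define J' where "J' = J \<inter> (\<Inter>i\<in>I0. K i)"
    have J': "J' \<in> kernels" unfolding J'_def by (intro kernels_Int J kernels_INT I0) (use I0 K in auto)
    have "b - f J' \<in> J"
    proof (rule I0(3), rule ballI)
      fix i assume i: "i \<in> I0"
      then have iI: "i \<in> I" using I0 by blast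
      have "f J' - f (K i) \<in> K i" by (rule compat[OF K(1)[OF iI] J']) (use i in \<open>auto simp: J'_def\<close>)
      from K(2)[OF iI this] show "coords (b - f J') i = 0" by (simp add: coords_diff[OF iI] b[OF iI])
    qed
    moreover have "f J' - f J \<in> J" by (rule compat[OF J J']) (auto simp: J'_def)
    ultimately show ?thesis using kernels_closed(2)[OF J, of "b - f J'" "f J' - f J"] by simp
  qed
  then show ?thesis by (rule that)
qed

lemma continuous_map_matrix_repI:
  assumes c: "\<And>q \<beta> k l. matrix_rep q \<beta> \<Longrightarrow> k < q \<Longrightarrow> l < q \<Longrightarrow> continuous_map X euclideanreal (\<lambda>x. \<beta> (g x) k l)"
  shows "continuous_map X euclidean g"
proof (rule continuous_map_coordsI)
  fix i assume i: "i \<in> I"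
  have "continuous_map X euclideanreal (\<lambda>x. \<kappa> s (coords (g x) i))" for s
  proof -
    obtain q \<beta> \<gamma> where b: "matrix_rep q \<beta>" and e: "\<forall>x. \<kappa> s (coords x i) = (\<Sum>k<q. \<Sum>m<q. \<gamma> k m * \<beta> x k m)"
      using matrix_rep_factor[OF rlin_\<kappa>_coords[OF i] continuous_\<kappa>_coords[OF i]] by blast
    have "continuous_map X euclideanreal (\<lambda>x. \<Sum>k<q. \<Sum>m<q. \<gamma> k m * \<beta> (g x) k m)"
      by (intro continuous_map_sum continuous_map_real_mult continuous_map_const[THEN iffD2] c[OF b]) auto
    then show ?thesis by (simp only: e)
  qed
  then have 1: "continuous_map X euclidean (\<lambda>x. \<Sum>s\<in>UNIV. \<kappa> s (coords (g x) i) *\<^sub>R (\<kappa>u s :: 'k))"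
  proof (intro continuous_map_sum)
    fix s :: bool
    have "continuous_map euclideanreal euclidean (\<lambda>r. r *\<^sub>R (\<kappa>u s :: 'k))"
      by (simp add: continuous_on_scaleR)
    from continuous_map_compose[OF \<open>\<And>s. continuous_map X euclideanreal (\<lambda>x. \<kappa> s (coords (g x) i))\<close>[of s] this]
    show "continuous_map X euclidean (\<lambda>x. \<kappa> s (coords (g x) i) *\<^sub>R (\<kappa>u s :: 'k))" by (simp add: o_def)
  qed auto
  show "continuous_map X euclidean (\<lambda>x. coords (g x) i)" using 1 by (simp only: \<kappa>_sum)
qed

end

section \<open>Limits of linear groups\<close>

lemma closure_mult_closed:
  fixes S :: "'e::real_normed_algebra set"
  assumes "\<And>x y. x \<in> S \<Longrightarrow> y \<in> S \<Longrightarrow> x * y \<in> S" "x \<in> closure S" "y \<in> closure S"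
  shows "x * y \<in> closure S"
proof -
  obtain f g where "\<And>n. f n \<in> S" "f \<longlonglongrightarrow> x" "\<And>n. g n \<in> S" "g \<longlonglongrightarrow> y"
    using assms(2,3) unfolding closure_sequential by blast
  then show ?thesis
    unfolding closure_sequential using assms(1) by (intro exI[of _ "\<lambda>n. f n * g n"]) (auto intro: tendsto_mult)
qed

lemma continuous_map_euclidean_compose:
  "continuous_map X euclidean f \<Longrightarrow> continuous_on UNIV h \<Longrightarrow> continuous_map X euclidean (\<lambda>x. h (f x))"
  using continuous_map_compose[of X euclidean f euclidean h] by (simp add: o_def)

\<comment> \<open>In the application \<open>V\<close> consists of all linear maps \<open>H \<rightarrow> B\<close> and \<open>Gr\<close> of the characters. Continuity into \<open>V\<close>
  is assumed for topologies on the type of \<open>V\<close> only, as assumptions are monomorphic; \<open>continuous_intoI\<close> is general.\<close>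
locale tower =
  fixes Idx :: "'i set" and below :: "'i \<Rightarrow> 'i \<Rightarrow> bool" and N :: "'i \<Rightarrow> nat"
    and R :: "'i \<Rightarrow> 'v::topological_space \<Rightarrow> seqop" and V :: "'v set"
    and add :: "'v \<Rightarrow> 'v \<Rightarrow> 'v" and sc :: "real \<Rightarrow> 'v \<Rightarrow> 'v" and star :: "'v \<Rightarrow> 'v \<Rightarrow> 'v" and \<eta> :: 'v
    and Gr :: "'v set"
  assumes Idx: "Idx \<noteq> {}"
    and refl: "i \<in> Idx \<Longrightarrow> below i i"
    and trans: "i \<in> Idx \<Longrightarrow> j \<in> Idx \<Longrightarrow> k \<in> Idx \<Longrightarrow> below i j \<Longrightarrow> below j k \<Longrightarrow> below i k"
    and directed: "i \<in> Idx \<Longrightarrow> j \<in> Idx \<Longrightarrow> \<exists>k\<in>Idx. below i k \<and> below j k"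
    and V: "\<eta> \<in> V" "\<phi> \<in> V \<Longrightarrow> \<psi> \<in> V \<Longrightarrow> add \<phi> \<psi> \<in> V" "\<phi> \<in> V \<Longrightarrow> sc r \<phi> \<in> V" "\<phi> \<in> V \<Longrightarrow> \<psi> \<in> V \<Longrightarrow> star \<phi> \<psi> \<in> V"
    and R: "i \<in> Idx \<Longrightarrow> \<phi> \<in> V \<Longrightarrow> \<psi> \<in> V \<Longrightarrow> R i (add \<phi> \<psi>) = R i \<phi> + R i \<psi>"
      "i \<in> Idx \<Longrightarrow> \<phi> \<in> V \<Longrightarrow> R i (sc r \<phi>) = r *\<^sub>R R i \<phi>"
      "i \<in> Idx \<Longrightarrow> \<phi> \<in> V \<Longrightarrow> \<psi> \<in> V \<Longrightarrow> R i (star \<phi> \<psi>) = R i \<phi> * R i \<psi>"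
    and R_F: "i \<in> Idx \<Longrightarrow> \<phi> \<in> V \<Longrightarrow> R i \<phi> \<in> mat.F (N i)"
    and unit: "\<phi> \<in> V \<Longrightarrow> star \<eta> \<phi> = \<phi>" "\<phi> \<in> V \<Longrightarrow> star \<phi> \<eta> = \<phi>"
    and R_inj: "\<phi> \<in> V \<Longrightarrow> \<psi> \<in> V \<Longrightarrow> (\<And>i. i \<in> Idx \<Longrightarrow> R i \<phi> = R i \<psi>) \<Longrightarrow> \<phi> = \<psi>"
    and R_below: "i \<in> Idx \<Longrightarrow> j \<in> Idx \<Longrightarrow> below i j \<Longrightarrow> \<phi> \<in> V \<Longrightarrow> \<psi> \<in> V \<Longrightarrow> R j \<phi> = R j \<psi> \<Longrightarrow> R i \<phi> = R i \<psi>"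
    and complete: "(\<And>i. i \<in> Idx \<Longrightarrow> x i \<in> R i ` V) \<Longrightarrow>
      (\<And>i j \<phi>. i \<in> Idx \<Longrightarrow> j \<in> Idx \<Longrightarrow> below i j \<Longrightarrow> \<phi> \<in> V \<Longrightarrow> R j \<phi> = x j \<Longrightarrow> R i \<phi> = x i) \<Longrightarrow>
      \<exists>\<phi>\<in>V. \<forall>i\<in>Idx. R i \<phi> = x i"
    and continuous_R: "i \<in> Idx \<Longrightarrow> continuous_on V (R i)"
    and continuous_into: "\<And>X :: 'v topology. \<And>g. g ` topspace X \<subseteq> V \<Longrightarrow> (\<And>i. i \<in> Idx \<Longrightarrow> continuous_map X euclidean (\<lambda>x. R i (g x))) \<Longrightarrow> continuous_map X euclidean g"
    and Gr_V: "Gr \<subseteq> V" and Gr_\<eta>: "\<eta> \<in> Gr" and Gr_star: "\<phi> \<in> Gr \<Longrightarrow> \<psi> \<in> Gr \<Longrightarrow> star \<phi> \<psi> \<in> Gr"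
    and Gr_inv: "\<phi> \<in> Gr \<Longrightarrow> \<exists>\<psi>\<in>Gr. star \<phi> \<psi> = \<eta> \<and> star \<psi> \<phi> = \<eta>"
    and Gr_closed: "\<phi> \<in> V \<Longrightarrow> (\<And>i. i \<in> Idx \<Longrightarrow> R i \<phi> \<in> closure (R i ` Gr)) \<Longrightarrow> \<phi> \<in> Gr"
begin

text \<open>Every map into \<open>V\<close> with continuous \<open>R i\<close> factors through the
  initial topology of the \<open>R i\<close> on \<open>V\<close>, a topology on the type of
  \<open>V\<close>; there the assumption \<open>continuous_into\<close> applies to the
  identity.\<close>

lemma continuous_intoI:
  assumes g: "g ` topspace X \<subseteq> V" and c: "\<And>i. i \<in> Idx \<Longrightarrow> continuous_map X euclidean (\<lambda>x. R i (g x))"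
  shows "continuous_map X euclidean g"
proof -
  define B where "B = {{\<phi> \<in> V. R i \<phi> \<in> U} | i U. i \<in> Idx \<and> open U}"
  have UB: "\<Union>B = V" using Idx unfolding B_def by (auto intro!: exI[of _ "{\<phi> \<in> V. R _ \<phi> \<in> UNIV}"])
  have 1: "continuous_map (topology_generated_by B) euclidean (\<lambda>\<phi>. \<phi>)"
  proof (rule continuous_into)
    fix i assume i: "i \<in> Idx"
    show "continuous_map (topology_generated_by B) euclidean (R i)"
      unfolding continuous_map_def
    proof (intro conjI allI impI)
      fix U :: "seqop set" assume "openin euclidean U"
      then have "{\<phi> \<in> V. R i \<phi> \<in> U} \<in> B" using i by (auto simp: B_def)
      then show "openin (topology_generated_by B) {x \<in> topspace (topology_generated_by B). R i x \<in> U}"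
        by (simp add: UB topology_generated_by_Basis)
    qed auto
  qed (simp add: UB)
  have "continuous_map X (topology_generated_by B) g"
    unfolding continuous_on_generated_topo_iff
  proof (intro conjI allI impI)
    fix U assume "U \<in> B"
    then obtain i O' where i: "i \<in> Idx" "open O'" "U = {\<phi> \<in> V. R i \<phi> \<in> O'}" by (auto simp: B_def)
    have "openin X {x \<in> topspace X. R i (g x) \<in> O'}" using c[OF i(1)] i(2) by (simp add: continuous_map_def)
    moreover have "g -` U \<inter> topspace X = {x \<in> topspace X. R i (g x) \<in> O'}" using g by (auto simp: i(3))
    ultimately show "openin X (g -` U \<inter> topspace X)" by simp
  qed (use g UB in auto)
  from continuous_map_compose[OF this 1] show ?thesis by (simp add: o_def)
qed

\<comment> \<open>The matrices \<open>R i \<phi>\<close> lie in the corner cut out by the idempotent \<open>R i \<eta>\<close>; adding the complementary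
  idempotent makes the images of group elements invertible.\<close>
definition E :: "'i \<Rightarrow> seqop" where "E i = 1 - R i \<eta>"
definition \<rho> :: "'i \<Rightarrow> 'v \<Rightarrow> seqop" where "\<rho> i \<phi> = E i + R i \<phi>"
definition \<Gamma> :: "'i \<Rightarrow> seqop set" where "\<Gamma> i = {x \<in> closure (\<rho> i ` Gr). \<exists>y. x * y = 1 \<and> y * x = 1}"

lemma GrV: "\<phi> \<in> Gr \<Longrightarrow> \<phi> \<in> V" using Gr_V by blast

lemma \<rho>_\<eta>: "\<rho> i \<eta> = 1" by (simp add: \<rho>_def E_def)

text \<open>The products of \<open>E i\<close> with any \<open>R i \<phi>\<close> are zero and
  \<open>E i\<close> is idempotent, so the two summands multiply separately.\<close>

lemma \<rho>_star: "i \<in> Idx \<Longrightarrow> \<phi> \<in> V \<Longrightarrow> \<psi> \<in> V \<Longrightarrow> \<rho> i (star \<phi> \<psi>) = \<rho> i \<phi> * \<rho> i \<psi>"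
proof -
  assume a: "i \<in> Idx" "\<phi> \<in> V" "\<psi> \<in> V"
  have "R i \<eta> * R i \<eta> = R i \<eta>" "R i \<eta> * R i \<psi> = R i \<psi>" "R i \<phi> * R i \<eta> = R i \<phi>"
    using R(3)[OF a(1) V(1) V(1)] R(3)[OF a(1) V(1) a(3)] R(3)[OF a(1,2) V(1)] a(2,3) unit V(1) by auto
  then show ?thesis by (simp add: \<rho>_def E_def R(3)[OF a] algebra_simps)
qed

lemma \<rho>_eq_iff: "\<rho> i \<phi> = \<rho> i \<psi> \<longleftrightarrow> R i \<phi> = R i \<psi>" by (simp add: \<rho>_def)

lemma star_assoc: "\<phi> \<in> V \<Longrightarrow> \<psi> \<in> V \<Longrightarrow> \<omega> \<in> V \<Longrightarrow> star (star \<phi> \<psi>) \<omega> = star \<phi> (star \<psi> \<omega>)"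
  by (rule R_inj) (simp_all add: V R mult.assoc)

lemma subspace_RV: "i \<in> Idx \<Longrightarrow> subspace (R i ` V)"
  unfolding subspace_def
proof (intro conjI ballI allI)
  assume i: "i \<in> Idx"
  have "R i (sc 0 \<eta>) = 0" using R(2)[OF i V(1)] by simp
  then show "0 \<in> R i ` V" using V(3)[OF V(1)] by (metis image_eqI)
  fix x y assume "x \<in> R i ` V" "y \<in> R i ` V"
  then show "x + y \<in> R i ` V" using R(1)[OF i] V(2) by (auto simp: image_iff) metis
next
  fix c x assume i: "i \<in> Idx" and "x \<in> R i ` V"
  then show "c *\<^sub>R x \<in> R i ` V" using R(2)[OF i] V(3) by (auto simp: image_iff) metis
qed

lemma RV_F: "i \<in> Idx \<Longrightarrow> R i ` V \<subseteq> mat.F (N i)" using R_F by blast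

lemma closed_RV: "i \<in> Idx \<Longrightarrow> closed (R i ` V)"
  by (rule mat.closed_subspace_of_F[OF subspace_RV RV_F])

text \<open>\<open>R i\<close> maps \<open>V\<close> onto a finite-dimensional, hence closed
  subspace. Elements of the closure of the group image thus still come from linear maps, on which
  all computations with bonding maps can be carried out.\<close>

lemma closure_\<rho>: "i \<in> Idx \<Longrightarrow> x \<in> closure (\<rho> i ` V) \<Longrightarrow> \<exists>\<phi>\<in>V. x = \<rho> i \<phi>"
proof -
  assume i: "i \<in> Idx" and x: "x \<in> closure (\<rho> i ` V)"
  have "closed ((\<lambda>x. x - E i) -` (R i ` V))" by (intro closed_vimage closed_RV i continuous_intros)
  moreover have "\<rho> i ` V \<subseteq> (\<lambda>x. x - E i) -` (R i ` V)" by (auto simp: \<rho>_def)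
  ultimately have "x \<in> (\<lambda>x. x - E i) -` (R i ` V)" using x closure_minimal by blast
  then obtain \<phi> where "\<phi> \<in> V" "x - E i = R i \<phi>" by auto
  then show ?thesis by (intro bexI[of _ \<phi>]) (auto simp: \<rho>_def algebra_simps)
qed

lemma \<Gamma>_\<rho>: "i \<in> Idx \<Longrightarrow> x \<in> \<Gamma> i \<Longrightarrow> \<exists>\<phi>\<in>V. x = \<rho> i \<phi>"
  by (rule closure_\<rho>) (use closure_mono[OF image_mono[OF Gr_V]] in \<open>auto simp: \<Gamma>_def\<close>)

lemma \<rho>_\<Gamma>: "i \<in> Idx \<Longrightarrow> \<phi> \<in> Gr \<Longrightarrow> \<rho> i \<phi> \<in> \<Gamma> i"
  unfolding \<Gamma>_def
proof (intro CollectI conjI)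
  assume i: "i \<in> Idx" and \<phi>: "\<phi> \<in> Gr"
  show "\<rho> i \<phi> \<in> closure (\<rho> i ` Gr)" by (rule subsetD[OF closure_subset imageI[OF \<phi>]])
  obtain \<psi> where \<psi>: "\<psi> \<in> Gr" "star \<phi> \<psi> = \<eta>" "star \<psi> \<phi> = \<eta>" using Gr_inv[OF \<phi>] by blast
  have "\<rho> i \<phi> * \<rho> i \<psi> = 1" "\<rho> i \<psi> * \<rho> i \<phi> = 1"
    using \<rho>_star[OF i GrV[OF \<phi>] GrV[OF \<psi>(1)]] \<rho>_star[OF i GrV[OF \<psi>(1)] GrV[OF \<phi>]] by (simp_all add: \<psi> \<rho>_\<eta>)
  then show "\<exists>y. \<rho> i \<phi> * y = 1 \<and> y * \<rho> i \<phi> = 1" by blast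
qed

text \<open>Approximate \<open>x\<close> by group images. Their inverses are group images too, and
  they converge to the inverse of \<open>x\<close>.\<close>

lemma closure_inverse:
  assumes i: "i \<in> Idx" and x: "x \<in> closure (\<rho> i ` Gr)" and y: "x * y = 1" "y * x = 1"
  shows "y \<in> closure (\<rho> i ` Gr)"
proof -
  obtain f where f: "\<And>n. f n \<in> \<rho> i ` Gr" "f \<longlonglongrightarrow> x" using x unfolding closure_sequential by blast
  have "\<exists>z\<in>\<rho> i ` Gr. z * f n = 1" for n
  proof -
    obtain \<phi> where \<phi>: "\<phi> \<in> Gr" "f n = \<rho> i \<phi>" using f(1) by blast
    obtain \<psi> where \<psi>: "\<psi> \<in> Gr" "star \<psi> \<phi> = \<eta>" using Gr_inv[OF \<phi>(1)] by blast
    have "\<rho> i \<psi> * f n = 1" using \<rho>_star[OF i GrV[OF \<psi>(1)] GrV[OF \<phi>(1)]] by (simp add: \<psi>(2) \<phi>(2) \<rho>_\<eta>)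
    then show ?thesis using \<psi>(1) by blast
  qed
  then obtain g where g: "\<And>n. g n \<in> \<rho> i ` Gr" "\<And>n. g n * f n = 1" by metis
  have "g \<longlonglongrightarrow> y" by (rule tendsto_inverse_algebra[OF f(2) y(1) g(2)])
  then show ?thesis unfolding closure_sequential using g(1) by blast
qed

lemma closed_group_\<Gamma>:
  assumes i: "i \<in> Idx"
  shows "closed_group (N i * N i) (mat_basis (N i)) (mat_coord (N i)) (\<Gamma> i)"
proof (rule closed_group.intro[OF frame_mat closed_group_axioms.intro])
  fix x y
  show "x \<in> mat.F (N i) \<Longrightarrow> y \<in> mat.F (N i) \<Longrightarrow> x * y \<in> mat.F (N i)" by (rule mat_F_mult)
  show "1 \<in> \<Gamma> i" using \<rho>_\<Gamma>[OF i Gr_\<eta>] by (simp add: \<rho>_\<eta>)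
  show "x * y \<in> \<Gamma> i" if xy: "x \<in> \<Gamma> i" "y \<in> \<Gamma> i"
  proof -
    obtain x' y' where x': "x * x' = 1" "x' * x = 1" and y': "y * y' = 1" "y' * y = 1"
      using xy unfolding \<Gamma>_def by blast
    have "x * y \<in> closure (\<rho> i ` Gr)"
    proof (rule closure_mult_closed)
      show "u * v \<in> \<rho> i ` Gr" if uv: "u \<in> \<rho> i ` Gr" "v \<in> \<rho> i ` Gr" for u v
      proof -
        obtain \<phi> \<psi> where "\<phi> \<in> Gr" "\<psi> \<in> Gr" "u = \<rho> i \<phi>" "v = \<rho> i \<psi>" using uv by blast
        then have "u * v = \<rho> i (star \<phi> \<psi>)" "star \<phi> \<psi> \<in> Gr" using \<rho>_star[OF i] GrV Gr_star by auto
        then show ?thesis by blast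
      qed
    qed (use that in \<open>auto simp: \<Gamma>_def\<close>)
    moreover have "x * y * (y' * x') = 1" "y' * x' * (x * y) = 1"
      using x' y' by (metis mult.assoc mult_1_left)+
    ultimately show ?thesis unfolding \<Gamma>_def by blast
  qed
  show "\<exists>y\<in>\<Gamma> i. x * y = 1 \<and> y * x = 1" if x: "x \<in> \<Gamma> i"
  proof -
    obtain y where y: "x * y = 1" "y * x = 1" using x by (auto simp: \<Gamma>_def)
    have "y \<in> closure (\<rho> i ` Gr)" by (rule closure_inverse[OF i _ y]) (use x in \<open>simp add: \<Gamma>_def\<close>)
    then show ?thesis using y by (auto simp: \<Gamma>_def)
  qed
  show "x - 1 \<in> mat.F (N i)" if x: "x \<in> \<Gamma> i"
  proof -
    obtain \<phi> where "\<phi> \<in> V" "x = \<rho> i \<phi>" using \<Gamma>_\<rho>[OF i x] by blast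
    then show ?thesis using mat.F_diff[OF R_F[OF i] R_F[OF i V(1)]] by (simp add: \<rho>_def E_def)
  qed
  show "x \<in> \<Gamma> i" if "x \<in> closure (\<Gamma> i)" "x * y = 1" "y * x = 1"
  proof -
    have "closure (\<Gamma> i) \<subseteq> closure (\<rho> i ` Gr)" by (rule closure_minimal) (auto simp: \<Gamma>_def)
    then show ?thesis using that by (auto simp: \<Gamma>_def)
  qed
qed

lemma \<Gamma>_F: "i \<in> Idx \<Longrightarrow> x \<in> \<Gamma> i \<Longrightarrow> x - 1 \<in> mat.F (N i)"
  using closed_group.\<Gamma>_F[OF closed_group_\<Gamma>] by blast

lemma undec_enc_\<Gamma>: "i \<in> Idx \<Longrightarrow> x \<in> \<Gamma> i \<Longrightarrow> undec (N i) (enc x) = x"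
  by (rule undec_enc[OF \<Gamma>_F])

lemma exists_lie_stage:
  assumes i: "i \<in> Idx"
  shows "\<exists>L d b' c' \<epsilon>. lie_stage (N i * N i) (mat_basis (N i)) (mat_coord (N i)) (\<Gamma> i) d b' c' \<epsilon> enc
    \<and> L = lie_stage.G (\<Gamma> i) d c' \<epsilon> enc"
proof -
  interpret g: closed_group "N i * N i" "mat_basis (N i)" "mat_coord (N i)" "\<Gamma> i" by (rule closed_group_\<Gamma>[OF i])
  obtain d b' c' where f: "frame d b' c'" "frame.F d b' c' = g.lie"
    using mat.subframe[OF g.subspace_lie g.lie_subset_F] by blast
  obtain \<epsilon> where e: "\<epsilon> > 0" "\<epsilon> \<le> 1/8" "\<And>x. x \<in> \<Gamma> i \<Longrightarrow> norm (x - 1) < \<epsilon> \<Longrightarrow> lnb x \<in> g.lie"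
    using g.log_near_one_in_lie by blast
  have "lie_stage (N i * N i) (mat_basis (N i)) (mat_coord (N i)) (\<Gamma> i) d b' c' \<epsilon> enc"
    by (intro lie_stage.intro lie_stage_axioms.intro g.closed_group_axioms f e)
       (use enc_homeo[of "\<Gamma> i" "N i"] \<Gamma>_F[OF i] continuous_on_enc in auto)
  then show ?thesis by blast
qed

definition stage_group :: "'i \<Rightarrow> (nat \<Rightarrow> real) lie_group" where
  "stage_group i = (SOME L. \<exists>d b' c' \<epsilon>. lie_stage (N i * N i) (mat_basis (N i)) (mat_coord (N i)) (\<Gamma> i) d b' c' \<epsilon> enc
    \<and> L = lie_stage.G (\<Gamma> i) d c' \<epsilon> enc)"

lemma stage_group: "i \<in> Idx \<Longrightarrow> \<exists>d b' c' \<epsilon>. lie_stage (N i * N i) (mat_basis (N i)) (mat_coord (N i)) (\<Gamma> i) d b' c' \<epsilon> enc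
    \<and> stage_group i = lie_stage.G (\<Gamma> i) d c' \<epsilon> enc"
  unfolding stage_group_def by (rule someI_ex[OF exists_lie_stage])

lemma stage_group_simps:
  assumes i: "i \<in> Idx"
  shows "carrier (stage_group i) = enc ` \<Gamma> i" "gtop (stage_group i) = subtopology euclidean (enc ` \<Gamma> i)" "\<one>\<^bsub>stage_group i\<^esub> = enc 1"
    "x \<in> \<Gamma> i \<Longrightarrow> y \<in> \<Gamma> i \<Longrightarrow> enc x \<otimes>\<^bsub>stage_group i\<^esub> enc y = enc (x * y)" "finite_dim_lie_group (stage_group i)"
proof -
  obtain d b' c' \<epsilon> where l: "lie_stage (N i * N i) (mat_basis (N i)) (mat_coord (N i)) (\<Gamma> i) d b' c' \<epsilon> enc"
    and G: "stage_group i = lie_stage.G (\<Gamma> i) d c' \<epsilon> enc" using stage_group[OF i] by blast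
  interpret s: lie_stage "N i * N i" "mat_basis (N i)" "mat_coord (N i)" "\<Gamma> i" d b' c' \<epsilon> enc by (rule l)
  show "carrier (stage_group i) = enc ` \<Gamma> i" "gtop (stage_group i) = subtopology euclidean (enc ` \<Gamma> i)" "\<one>\<^bsub>stage_group i\<^esub> = enc 1"
    "x \<in> \<Gamma> i \<Longrightarrow> y \<in> \<Gamma> i \<Longrightarrow> enc x \<otimes>\<^bsub>stage_group i\<^esub> enc y = enc (x * y)"
    unfolding G by simp_all
  show "finite_dim_lie_group (stage_group i)" unfolding G
    by (rule s.finite_dim_lie_group_G) (simp add: Hausdorff_space_subtopology)
qed

section \<open>Bonding maps between the stages\<close>

definition transition :: "'i \<Rightarrow> 'i \<Rightarrow> seqop \<Rightarrow> seqop" where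
  "transition i j = (SOME T. bounded_linear T \<and> (\<forall>\<phi>\<in>V. T (R j \<phi>) = R i \<phi>))"

text \<open>By \<open>R_below\<close> the finer matrix determines the coarser one, and linearly so;
  on a finite-dimensional subspace this map has a bounded extension.\<close>

lemma transition:
  assumes ij: "i \<in> Idx" "j \<in> Idx" "below i j"
  shows "bounded_linear (transition i j)" "\<phi> \<in> V \<Longrightarrow> transition i j (R j \<phi>) = R i \<phi>"
proof -
  define T0 where "T0 x = R i (SOME \<phi>. \<phi> \<in> V \<and> R j \<phi> = x)" for x
  have T0: "T0 (R j \<phi>) = R i \<phi>" if "\<phi> \<in> V" for \<phi>
    unfolding T0_def
  proof (rule someI2)
    show "\<phi> \<in> V \<and> R j \<phi> = R j \<phi>" using that by simp
    show "R i \<psi> = R i \<phi>" if "\<psi> \<in> V \<and> R j \<psi> = R j \<phi>" for \<psi>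
      using R_below[OF ij, of \<psi> \<phi>] that \<open>\<phi> \<in> V\<close> by simp
  qed
  have "\<exists>T. bounded_linear T \<and> (\<forall>x\<in>R j ` V. T x = T0 x)"
  proof (rule mat.linear_extension[OF subspace_RV[OF ij(2)] RV_F[OF ij(2)]])
    fix x y r assume "x \<in> R j ` V"
    then obtain \<phi> where \<phi>: "\<phi> \<in> V" "x = R j \<phi>" by blast
    show "T0 (r *\<^sub>R x) = r *\<^sub>R T0 x"
      using T0[OF V(3)[OF \<phi>(1)]] by (simp add: \<phi> T0 R(2) ij)
    assume "y \<in> R j ` V"
    then obtain \<psi> where \<psi>: "\<psi> \<in> V" "y = R j \<psi>" by blast
    show "T0 (x + y) = T0 x + T0 y"
      using T0[OF V(2)[OF \<phi>(1) \<psi>(1)]] by (simp add: \<phi> \<psi> T0 R(1) ij)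
  qed
  then have "\<exists>T. bounded_linear T \<and> (\<forall>\<phi>\<in>V. T (R j \<phi>) = R i \<phi>)" using T0 by auto
  from someI_ex[OF this] show "bounded_linear (transition i j)" "\<phi> \<in> V \<Longrightarrow> transition i j (R j \<phi>) = R i \<phi>"
    unfolding transition_def by blast+
qed

text \<open>An affine map: the complementary idempotent of the finer stage has to be exchanged for
  that of the coarser one.\<close>

definition bonding :: "'i \<Rightarrow> 'i \<Rightarrow> seqop \<Rightarrow> seqop" where "bonding i j x = E i + transition i j (x - E j)"

lemma bonding_\<rho>: "i \<in> Idx \<Longrightarrow> j \<in> Idx \<Longrightarrow> below i j \<Longrightarrow> \<phi> \<in> V \<Longrightarrow> bonding i j (\<rho> j \<phi>) = \<rho> i \<phi>"
  by (simp add: bonding_def \<rho>_def transition)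

lemma continuous_on_bonding: "i \<in> Idx \<Longrightarrow> j \<in> Idx \<Longrightarrow> below i j \<Longrightarrow> continuous_on S (bonding i j)"
  unfolding bonding_def
  by (intro continuous_on_add continuous_on_const bounded_linear.continuous_on[OF transition(1)] continuous_on_diff continuous_on_id)

text \<open>A linear map need not preserve invertibility. Here the inverse is also of the form
  \<open>\<rho> j \<psi>\<close> with \<open>\<psi>\<close> in \<open>V\<close>, and equality with
  \<open>\<rho> j \<eta>\<close> at the finer stage passes to the coarser one. Membership in the
  closure is preserved by continuity.\<close>

lemma bonding_\<Gamma>:
  assumes ij: "i \<in> Idx" "j \<in> Idx" "below i j" and x: "x \<in> \<Gamma> j"
  shows "bonding i j x \<in> \<Gamma> i"
proof -
  have c: "bonding i j z \<in> closure (\<rho> i ` Gr)" if "z \<in> closure (\<rho> j ` Gr)" for z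
  proof -
    have "bonding i j ` closure (\<rho> j ` Gr) \<subseteq> closure (bonding i j ` \<rho> j ` Gr)"
      by (rule image_closure_subset[OF continuous_on_bonding[OF ij] closed_closure closure_subset])
    moreover have "bonding i j ` \<rho> j ` Gr = \<rho> i ` Gr" unfolding image_image by (rule image_cong) (auto simp: bonding_\<rho>[OF ij GrV])
    ultimately show ?thesis using that by auto
  qed
  obtain y where y: "y \<in> \<Gamma> j" "x * y = 1" "y * x = 1" using closed_group.inv_\<Gamma>[OF closed_group_\<Gamma>[OF ij(2)] x] by blast
  obtain \<phi> \<psi> where \<phi>: "\<phi> \<in> V" "x = \<rho> j \<phi>" and \<psi>: "\<psi> \<in> V" "y = \<rho> j \<psi>" using \<Gamma>_\<rho>[OF ij(2)] x y(1) by metis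
  have "\<rho> j (star \<phi> \<psi>) = \<rho> j \<eta>" "\<rho> j (star \<psi> \<phi>) = \<rho> j \<eta>"
    using y(2,3) by (simp_all add: \<phi> \<psi> \<rho>_star ij \<rho>_\<eta>)
  then have "\<rho> i (star \<phi> \<psi>) = \<rho> i \<eta>" "\<rho> i (star \<psi> \<phi>) = \<rho> i \<eta>"
    using bonding_\<rho>[OF ij] V(4)[OF \<phi>(1) \<psi>(1)] V(4)[OF \<psi>(1) \<phi>(1)] V(1) by metis+
  then have "\<rho> i \<phi> * \<rho> i \<psi> = 1" "\<rho> i \<psi> * \<rho> i \<phi> = 1" by (simp_all add: \<phi> \<psi> \<rho>_star ij \<rho>_\<eta>)
  moreover have "bonding i j x = \<rho> i \<phi>" by (simp add: \<phi> bonding_\<rho>[OF ij])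
  ultimately show ?thesis using c[of x] x unfolding \<Gamma>_def by auto
qed

definition tower_system :: "('i, nat \<Rightarrow> real) lie_system" where
  "tower_system = \<lparr>indices = Idx, below = below, stage = stage_group, bond = (\<lambda>i j u. enc (bonding i j (undec (N j) u)))\<rparr>"

lemma tower_system_simps [simp]: "indices tower_system = Idx" "lie_system.below tower_system = below" "stage tower_system = stage_group"
  "bond tower_system i j u = enc (bonding i j (undec (N j) u))"
  by (simp_all add: tower_system_def)

lemma directed_tower_system: "directed_lie_system tower_system"
proof (rule directed_lie_system.intro; unfold tower_system_simps)
  fix i j k x assume i: "i \<in> Idx"
  show "below i i" by (rule refl[OF i])
  show "finite_dim_lie_group (stage_group i)" by (rule stage_group_simps(5)[OF i])
  show "enc (bonding i i (undec (N i) x)) = x" if x: "x \<in> carrier (stage_group i)"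
  proof -
    obtain y where y: "y \<in> \<Gamma> i" "x = enc y" using x by (auto simp: stage_group_simps[OF i])
    obtain \<phi> where "\<phi> \<in> V" "y = \<rho> i \<phi>" using \<Gamma>_\<rho>[OF i y(1)] by blast
    then show ?thesis using undec_enc_\<Gamma>[OF i y(1)] bonding_\<rho>[OF i i refl[OF i]] by (simp add: y(2))
  qed
  assume j: "j \<in> Idx"
  show "\<exists>k\<in>Idx. below i k \<and> below j k" by (rule directed[OF i j])
  assume ij: "below i j"
  show "(\<lambda>u. enc (bonding i j (undec (N j) u))) \<in> hom (stage_group j) (stage_group i)"
  proof (rule homI)
    fix x assume "x \<in> carrier (stage_group j)"
    then obtain x' where x': "x' \<in> \<Gamma> j" "x = enc x'" by (auto simp: stage_group_simps[OF j])
    then show "enc (bonding i j (undec (N j) x)) \<in> carrier (stage_group i)"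
      using bonding_\<Gamma>[OF i j ij x'(1)] by (simp add: stage_group_simps[OF i] undec_enc_\<Gamma>[OF j])
    fix y assume "y \<in> carrier (stage_group j)"
    then obtain y' where y': "y' \<in> \<Gamma> j" "y = enc y'" by (auto simp: stage_group_simps[OF j])
    have xy: "x' * y' \<in> \<Gamma> j" by (rule closed_group.mult_\<Gamma>[OF closed_group_\<Gamma>[OF j] x'(1) y'(1)])
    obtain \<phi> \<psi> where \<phi>: "\<phi> \<in> V" "x' = \<rho> j \<phi>" and \<psi>: "\<psi> \<in> V" "y' = \<rho> j \<psi>" using \<Gamma>_\<rho>[OF j] x'(1) y'(1) by metis
    have "bonding i j (x' * y') = bonding i j x' * bonding i j y'"
      using bonding_\<rho>[OF i j ij V(4)[OF \<phi>(1) \<psi>(1)]] by (simp add: \<phi> \<psi> \<rho>_star i j bonding_\<rho> ij)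
    then show "enc (bonding i j (undec (N j) (x \<otimes>\<^bsub>stage_group j\<^esub> y))) =
        enc (bonding i j (undec (N j) x)) \<otimes>\<^bsub>stage_group i\<^esub> enc (bonding i j (undec (N j) y))"
      using stage_group_simps(4)[OF i bonding_\<Gamma>[OF i j ij x'(1)] bonding_\<Gamma>[OF i j ij y'(1)]]
      by (simp add: x'(2) y'(2) stage_group_simps(4)[OF j x'(1) y'(1)] undec_enc_\<Gamma>[OF j] xy x'(1) y'(1))
  qed
  show "continuous_map (gtop (stage_group j)) (gtop (stage_group i)) (\<lambda>u. enc (bonding i j (undec (N j) u)))"
    unfolding stage_group_simps(2)[OF i] stage_group_simps(2)[OF j] continuous_map_in_subtopology
  proof
    have "continuous_on (enc ` \<Gamma> j) (\<lambda>u. enc (bonding i j (undec (N j) u)))"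
      by (rule continuous_on_compose2[OF continuous_on_enc[of UNIV] continuous_on_compose2[OF continuous_on_bonding[OF i j ij, of UNIV] continuous_on_undec]]) simp_all
    then show "continuous_map (subtopology euclidean (enc ` \<Gamma> j)) euclidean (\<lambda>u. enc (bonding i j (undec (N j) u)))" by simp
    show "(\<lambda>u. enc (bonding i j (undec (N j) u))) \<in> topspace (subtopology euclidean (enc ` \<Gamma> j)) \<rightarrow> enc ` \<Gamma> i"
    proof (rule Pi_I)
      fix u assume "u \<in> topspace (subtopology euclidean (enc ` \<Gamma> j))"
      then obtain y where y: "y \<in> \<Gamma> j" "u = enc y" by auto
      show "enc (bonding i j (undec (N j) u)) \<in> enc ` \<Gamma> i"
        unfolding y(2) undec_enc_\<Gamma>[OF j y(1)] by (rule imageI[OF bonding_\<Gamma>[OF i j ij y(1)]])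
    qed
  qed
  assume k: "k \<in> Idx" and jk: "below j k"
  show "below i k" by (rule trans[OF i j k ij jk])
  show "enc (bonding i j (undec (N j) (enc (bonding j k (undec (N k) x))))) = enc (bonding i k (undec (N k) x))"
    if x: "x \<in> carrier (stage_group k)"
  proof -
    obtain y where y: "y \<in> \<Gamma> k" "x = enc y" using x by (auto simp: stage_group_simps[OF k])
    obtain \<phi> where \<phi>: "\<phi> \<in> V" "y = \<rho> k \<phi>" using \<Gamma>_\<rho>[OF k y(1)] by blast
    show ?thesis
      unfolding y(2) undec_enc_\<Gamma>[OF k y(1)] undec_enc_\<Gamma>[OF j bonding_\<Gamma>[OF j k jk y(1)]]
      unfolding \<phi>(2) bonding_\<rho>[OF j k jk \<phi>(1)] bonding_\<rho>[OF i j ij \<phi>(1)] bonding_\<rho>[OF i k trans[OF i j k ij jk] \<phi>(1)] ..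
  qed
qed (rule Idx)

section \<open>The group as projective limit of its stages\<close>

definition top_grp :: "'v top_group" where
  "top_grp = \<lparr>carrier = Gr, monoid.mult = star, one = \<eta>, gtop = subtopology euclidean Gr\<rparr>"

lemma top_grp_simps [simp]: "carrier top_grp = Gr" "x \<otimes>\<^bsub>top_grp\<^esub> y = star x y" "\<one>\<^bsub>top_grp\<^esub> = \<eta>" "gtop top_grp = subtopology euclidean Gr"
  by (simp_all add: top_grp_def)

lemma group_top_grp: "group top_grp"
proof (rule groupI)
  show "\<exists>y\<in>carrier top_grp. y \<otimes>\<^bsub>top_grp\<^esub> x = \<one>\<^bsub>top_grp\<^esub>" if "x \<in> carrier top_grp" for x
    using Gr_inv[of x] that by auto
qed (use Gr_\<eta> Gr_star star_assoc unit GrV in auto)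

lemma continuous_\<rho>: "i \<in> Idx \<Longrightarrow> continuous_on V (\<rho> i)"
  unfolding \<rho>_def by (intro continuous_on_add continuous_on_const continuous_R)

lemma continuous_map_\<rho>: "i \<in> Idx \<Longrightarrow> S \<subseteq> V \<Longrightarrow> continuous_map (subtopology euclidean S) euclidean (\<rho> i)"
  by (simp add: continuous_on_subset[OF continuous_\<rho>])

lemma continuous_into_GrI:
  assumes g: "g ` topspace X \<subseteq> Gr" and c: "\<And>i. i \<in> Idx \<Longrightarrow> continuous_map X euclidean (\<lambda>x. \<rho> i (g x))"
  shows "continuous_map X (gtop top_grp) g"
proof -
  have "continuous_map X euclidean g"
  proof (rule continuous_intoI)
    fix i assume "i \<in> Idx"
    from continuous_map_euclidean_compose[OF c[OF this], of "\<lambda>x. x - E i"]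
    show "continuous_map X euclidean (\<lambda>x. R i (g x))" by (simp add: \<rho>_def continuous_on_diff)
  qed (use g Gr_V in auto)
  then show ?thesis using g by (auto simp: continuous_map_in_subtopology)
qed

lemma topological_group_top_grp: "topological_group top_grp"
proof (intro topological_group.intro group_top_grp topological_group_axioms.intro)
  interpret g: group top_grp by (rule group_top_grp)
  show "topspace (gtop top_grp) = carrier top_grp" by simp
  show "continuous_map (prod_topology (gtop top_grp) (gtop top_grp)) (gtop top_grp) (\<lambda>(x, y). x \<otimes>\<^bsub>top_grp\<^esub> y)"
  proof (rule continuous_into_GrI)
    fix i assume i: "i \<in> Idx"
    have "continuous_map (gtop top_grp) euclidean (\<rho> i)" using continuous_map_\<rho>[OF i Gr_V] by simp
    note c = continuous_map_compose[OF continuous_map_fst this, unfolded o_def]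
      continuous_map_compose[OF continuous_map_snd this, unfolded o_def]
    have "continuous_map (prod_topology (gtop top_grp) (gtop top_grp)) euclidean (\<lambda>p. (\<rho> i (fst p), \<rho> i (snd p)))"
      unfolding prod_topology_euclidean[symmetric] by (rule continuous_map_pairedI[OF c])
    from continuous_map_euclidean_compose[OF this, of "\<lambda>p. fst p * snd p"]
    have "continuous_map (prod_topology (gtop top_grp) (gtop top_grp)) euclidean (\<lambda>p. \<rho> i (fst p) * \<rho> i (snd p))"
      by (simp add: continuous_on_mult continuous_on_fst continuous_on_snd)
    then show "continuous_map (prod_topology (gtop top_grp) (gtop top_grp)) euclidean (\<lambda>p. \<rho> i (case p of (x, y) \<Rightarrow> x \<otimes>\<^bsub>top_grp\<^esub> y))"
      by (rule continuous_map_eq) (auto simp: \<rho>_star i GrV)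
  qed (auto simp: Gr_star)
  show "continuous_map (gtop top_grp) (gtop top_grp) (\<lambda>x. inv\<^bsub>top_grp\<^esub> x)"
  proof (rule continuous_into_GrI)
    fix i assume i: "i \<in> Idx"
    have inv: "\<rho> i (inv\<^bsub>top_grp\<^esub> x) * \<rho> i x = 1" "\<rho> i x * \<rho> i (inv\<^bsub>top_grp\<^esub> x) = 1" if x: "x \<in> Gr" for x
      using g.l_inv[of x] g.r_inv[of x] g.inv_closed[of x] x \<rho>_star[OF i, of x "inv\<^bsub>top_grp\<^esub> x"] \<rho>_star[OF i, of "inv\<^bsub>top_grp\<^esub> x" x] GrV \<rho>_\<eta>
      by auto
    have "continuous_on Gr (\<lambda>x. \<rho> i (inv\<^bsub>top_grp\<^esub> x))"
      unfolding continuous_on_def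
    proof
      fix x assume x: "x \<in> Gr"
      have t: "(\<rho> i \<longlongrightarrow> \<rho> i x) (at x within Gr)"
        using continuous_on_subset[OF continuous_\<rho>[OF i] Gr_V] x by (simp add: continuous_on_def)
      have ev: "\<forall>\<^sub>F y in at x within Gr. y \<in> Gr" by (simp add: eventually_at_filter)
      \<comment> \<open>The value \<open>1\<close> outside the group satisfies the inverse equation
        required by \<open>tendsto_inverse_algebra\<close> at all points.\<close>
      have "((\<lambda>y. if y \<in> Gr then \<rho> i (inv\<^bsub>top_grp\<^esub> y) else 1) \<longlongrightarrow> \<rho> i (inv\<^bsub>top_grp\<^esub> x)) (at x within Gr)"
      proof (rule tendsto_inverse_algebra)
        show "((\<lambda>y. if y \<in> Gr then \<rho> i y else 1) \<longlongrightarrow> \<rho> i x) (at x within Gr)"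
          by (rule Lim_transform_eventually[OF t]) (use ev in eventually_elim, simp)
      qed (use inv x in auto)
      then show "((\<lambda>x. \<rho> i (inv\<^bsub>top_grp\<^esub> x)) \<longlongrightarrow> \<rho> i (inv\<^bsub>top_grp\<^esub> x)) (at x within Gr)"
        by (rule Lim_transform_eventually) (use ev in eventually_elim, simp)
    qed
    then show "continuous_map (gtop top_grp) euclidean (\<lambda>x. \<rho> i (inv\<^bsub>top_grp\<^esub> x))" by simp
  qed (use g.inv_closed in auto)
qed

definition limit_map :: "'v \<Rightarrow> 'i \<Rightarrow> nat \<Rightarrow> real" where "limit_map \<phi> = restrict (\<lambda>i. enc (\<rho> i \<phi>)) Idx"

lemma limit_map_limit: "\<phi> \<in> Gr \<Longrightarrow> limit_map \<phi> \<in> limit_carrier tower_system"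
  unfolding limit_carrier_def product_group_def
  by (auto simp: limit_map_def stage_group_simps \<rho>_\<Gamma> undec_enc_\<Gamma> bonding_\<rho> GrV)

lemma limit_map_inj: "inj_on limit_map Gr"
proof (rule inj_onI)
  fix \<phi> \<psi> assume a: "\<phi> \<in> Gr" "\<psi> \<in> Gr" "limit_map \<phi> = limit_map \<psi>"
  show "\<phi> = \<psi>"
  proof (rule R_inj[OF GrV[OF a(1)] GrV[OF a(2)]])
    fix i assume i: "i \<in> Idx"
    have "enc (\<rho> i \<phi>) = enc (\<rho> i \<psi>)" using fun_cong[OF a(3), of i] i by (simp add: limit_map_def)
    then have "\<rho> i \<phi> = \<rho> i \<psi>" using undec_enc_\<Gamma>[OF i \<rho>_\<Gamma>[OF i]] a(1,2) by metis
    then show "R i \<phi> = R i \<psi>" by (simp add: \<rho>_eq_iff)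
  qed
qed

text \<open>The components of a point of the limit come from linear maps. Coherence and completeness
  produce one linear map for all stages, and since it lies in the closure of the group image at each
  of them, \<open>Gr_closed\<close> places it in the group.\<close>

lemma limit_map_surj: "x \<in> limit_carrier tower_system \<Longrightarrow> \<exists>\<phi>\<in>Gr. limit_map \<phi> = x \<and> (\<forall>i\<in>Idx. \<rho> i \<phi> = undec (N i) (x i))"
proof -
  assume x: "x \<in> limit_carrier tower_system"
  have xG: "x i \<in> enc ` \<Gamma> i" if "i \<in> Idx" for i
    using x that stage_group_simps(1)[OF that] unfolding limit_carrier_def product_group_def by (auto simp: PiE_def Pi_def)
  have xe: "x \<in> extensional Idx" using x by (auto simp: limit_carrier_def product_group_def PiE_def)
  have xb: "bond tower_system i j (x j) = x i" if "i \<in> Idx" "j \<in> Idx" "below i j" for i j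
    using x that by (simp add: limit_carrier_def)
  define u where "u i = undec (N i) (x i)" for i
  have u: "u i \<in> \<Gamma> i" "x i = enc (u i)" if "i \<in> Idx" for i
    using xG[OF that] undec_enc_\<Gamma>[OF that] by (auto simp: u_def)
  have ub: "bonding i j (u j) = u i" if ij: "i \<in> Idx" "j \<in> Idx" "below i j" for i j
  proof -
    have "enc (bonding i j (u j)) = enc (u i)" using xb[OF ij] by (simp only: tower_system_simps u_def[symmetric] u(2)[OF ij(1)])
    from arg_cong[OF this, of "undec (N i)"] show ?thesis
      by (simp only: undec_enc_\<Gamma>[OF ij(1) bonding_\<Gamma>[OF ij u(1)[OF ij(2)]]] undec_enc_\<Gamma>[OF ij(1) u(1)[OF ij(1)]])
  qed
  have "\<exists>\<phi>\<in>V. \<forall>i\<in>Idx. R i \<phi> = u i - E i"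
  proof (rule complete)
    fix i assume i: "i \<in> Idx"
    obtain \<omega> where "\<omega> \<in> V" "u i = \<rho> i \<omega>" using \<Gamma>_\<rho>[OF i u(1)[OF i]] by blast
    then show "u i - E i \<in> R i ` V" by (simp add: \<rho>_def)
    fix j \<phi> assume j: "j \<in> Idx" "below i j" and \<phi>: "\<phi> \<in> V" "R j \<phi> = u j - E j"
    then have "\<rho> j \<phi> = u j" by (simp add: \<rho>_def)
    then have "\<rho> i \<phi> = u i" using bonding_\<rho>[OF i j \<phi>(1)] ub[OF i j] by simp
    then show "R i \<phi> = u i - E i" by (simp add: \<rho>_def algebra_simps)
  qed
  then obtain \<phi> where \<phi>: "\<phi> \<in> V" and "\<forall>i\<in>Idx. R i \<phi> = u i - E i" by (rule bexE)
  then have \<phi>u: "R i \<phi> = u i - E i" if "i \<in> Idx" for i using that by (rule_tac bspec)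
  have \<rho>u: "\<rho> i \<phi> = u i" if "i \<in> Idx" for i using \<phi>u[OF that] by (simp add: \<rho>_def)
  have "\<phi> \<in> Gr"
  proof (rule Gr_closed[OF \<phi>])
    fix i assume i: "i \<in> Idx"
    have "(\<lambda>x. x - E i) ` closure (\<rho> i ` Gr) \<subseteq> closure (R i ` Gr)"
    proof (rule image_closure_subset[OF _ closed_closure])
      show "(\<lambda>x. x - E i) ` \<rho> i ` Gr \<subseteq> closure (R i ` Gr)"
        using closure_subset[of "R i ` Gr"] by (auto simp: \<rho>_def)
    qed (intro continuous_intros)
    then show "R i \<phi> \<in> closure (R i ` Gr)" using u(1)[OF i] unfolding \<phi>u[OF i] \<Gamma>_def by blast
  qed
  moreover have "limit_map \<phi> = x"
  proof
    fix i show "limit_map \<phi> i = x i"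
      using xe \<rho>u[of i] u(2)[of i] by (cases "i \<in> Idx") (simp_all add: limit_map_def extensional_def)
  qed
  ultimately show ?thesis using \<rho>u unfolding u_def by blast
qed

lemma pro_lie_top_grp: "is_pro_lie_limit tower_system top_grp limit_map"
  unfolding is_pro_lie_limit_def
proof (intro conjI directed_tower_system topological_group_top_grp)
  have im: "limit_map ` Gr = limit_carrier tower_system" using limit_map_limit limit_map_surj by (auto simp: image_iff) metis
  have "limit_map \<in> hom top_grp (limit_group tower_system)"
  proof (rule homI)
    fix x y assume xy: "x \<in> carrier top_grp" "y \<in> carrier top_grp"
    then show "limit_map (x \<otimes>\<^bsub>top_grp\<^esub> y) = limit_map x \<otimes>\<^bsub>limit_group tower_system\<^esub> limit_map y"
      by (auto simp: limit_group_def product_group_def limit_map_def fun_eq_iff stage_group_simps \<rho>_\<Gamma> \<rho>_star GrV)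
  qed (use limit_map_limit in \<open>simp add: limit_group_def\<close>)
  then show "limit_map \<in> iso top_grp (limit_group tower_system)"
    using limit_map_inj im by (simp add: iso_def bij_betw_def limit_group_def)
  have top: "gtop (limit_group tower_system) = subtopology (product_topology (\<lambda>i. gtop (stage_group i)) Idx) (limit_carrier tower_system)"
    by (simp add: limit_group_def)
  have lc: "limit_carrier tower_system \<subseteq> topspace (product_topology (\<lambda>i. gtop (stage_group i)) Idx)"
    using stage_group_simps(1,2) by (auto simp: limit_carrier_def product_group_def PiE_def Pi_def)
  have "homeomorphic_maps (gtop top_grp) (gtop (limit_group tower_system)) limit_map (inv_into Gr limit_map)"
    unfolding homeomorphic_maps_def
  proof (intro conjI ballI)
    show "continuous_map (gtop top_grp) (gtop (limit_group tower_system)) limit_map"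
      unfolding top continuous_map_in_subtopology continuous_map_componentwise
    proof (intro conjI ballI)
      show "limit_map ` topspace (gtop top_grp) \<subseteq> extensional Idx" by (auto simp: limit_map_def)
      show "limit_map \<in> topspace (gtop top_grp) \<rightarrow> limit_carrier tower_system" using limit_map_limit by auto
      fix i assume i: "i \<in> Idx"
      have "continuous_map (gtop top_grp) euclidean (\<lambda>x. enc (\<rho> i x))"
        using continuous_map_euclidean_compose[OF continuous_map_\<rho>[OF i Gr_V] continuous_on_enc] by simp
      then show "continuous_map (gtop top_grp) (gtop (stage_group i)) (\<lambda>x. limit_map x i)"
        unfolding stage_group_simps(2)[OF i] using \<rho>_\<Gamma>[OF i] i by (auto simp: limit_map_def continuous_map_in_subtopology)
    qed
    have sur: "inv_into Gr limit_map x \<in> Gr" "limit_map (inv_into Gr limit_map x) = x" if "x \<in> limit_carrier tower_system" for x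
      using that im by (auto intro: inv_into_into f_inv_into_f)
    have \<rho>x: "\<rho> i (inv_into Gr limit_map x) = undec (N i) (x i)" if "x \<in> limit_carrier tower_system" "i \<in> Idx" for i x
      using limit_map_surj[OF that(1)] inv_into_f_f[OF limit_map_inj] that(2) by metis
    show "continuous_map (gtop (limit_group tower_system)) (gtop top_grp) (inv_into Gr limit_map)"
    proof (rule continuous_into_GrI)
      show "inv_into Gr limit_map ` topspace (gtop (limit_group tower_system)) \<subseteq> Gr" using sur lc by (auto simp: top)
      fix i assume i: "i \<in> Idx"
      have "continuous_map (product_topology (\<lambda>i. gtop (stage_group i)) Idx) (gtop (stage_group i)) (\<lambda>x. x i)"
        by (rule continuous_map_product_projection[OF i])
      then have "continuous_map (product_topology (\<lambda>i. gtop (stage_group i)) Idx) euclidean (\<lambda>x. x i)"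
        by (simp add: stage_group_simps(2)[OF i] continuous_map_in_subtopology)
      then have "continuous_map (gtop (limit_group tower_system)) euclidean (\<lambda>x. x i)"
        unfolding top by (rule continuous_map_from_subtopology)
      from continuous_map_euclidean_compose[OF this continuous_on_undec]
      have "continuous_map (gtop (limit_group tower_system)) euclidean (\<lambda>x. undec (N i) (x i))" .
      then show "continuous_map (gtop (limit_group tower_system)) euclidean (\<lambda>x. \<rho> i (inv_into Gr limit_map x))"
        by (rule continuous_map_eq) (use \<rho>x i in \<open>auto simp: top\<close>)
    qed
    show "inv_into Gr limit_map (limit_map x) = x" if "x \<in> topspace (gtop top_grp)" for x using that limit_map_inj by simp
    show "limit_map (inv_into Gr limit_map y) = y" if "y \<in> topspace (gtop (limit_group tower_system))" for y
      using that sur lc by (auto simp: top)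
  qed
  then show "homeomorphic_map (gtop top_grp) (gtop (limit_group tower_system)) limit_map" using homeomorphic_map_maps by blast
qed

end

context tower
begin

section \<open>Exponentials of elements of the limit\<close>

text \<open>The limits at the stages are coherent because the transition maps are continuous, and
  each lies in the image of \<open>V\<close> because this image is closed.\<close>

lemma complete_seq:
  assumes \<psi>: "\<And>n::nat. \<psi> n \<in> V" and x: "\<And>i. i \<in> Idx \<Longrightarrow> (\<lambda>n. R i (\<psi> n)) \<longlonglongrightarrow> x i"
  shows "\<exists>\<phi>\<in>V. \<forall>i\<in>Idx. R i \<phi> = x i"
proof (rule complete)
  fix i assume i: "i \<in> Idx"
  show "x i \<in> R i ` V"
    by (rule closed_sequentially[OF closed_RV[OF i] _ x[OF i]]) (use \<psi> in auto)
  fix j \<phi> assume j: "j \<in> Idx" "below i j" and \<phi>: "\<phi> \<in> V" "R j \<phi> = x j"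
  have "(\<lambda>n. transition i j (R j (\<psi> n))) \<longlonglongrightarrow> transition i j (x j)"
    by (rule bounded_linear.tendsto[OF transition(1)[OF i j] x[OF j(1)]])
  then have "(\<lambda>n. R i (\<psi> n)) \<longlonglongrightarrow> R i \<phi>"
    unfolding \<phi>(2)[symmetric] transition(2)[OF i j \<phi>(1)] transition(2)[OF i j \<psi>] .
  then show "R i \<phi> = x i" using x[OF i] by (rule LIMSEQ_unique)
qed

primrec conv_power :: "'v \<Rightarrow> nat \<Rightarrow> 'v" where
  "conv_power \<phi> 0 = \<eta>" | "conv_power \<phi> (Suc n) = star \<phi> (conv_power \<phi> n)"

text \<open>Partial sums of the convolution exponential, formed inside \<open>V\<close> so that
  \<open>complete_seq\<close> applies to them.\<close>

primrec expsum :: "'v \<Rightarrow> real \<Rightarrow> nat \<Rightarrow> 'v" where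
  "expsum \<phi> t 0 = \<eta>" | "expsum \<phi> t (Suc n) = add (expsum \<phi> t n) (sc (t ^ Suc n / fact (Suc n)) (conv_power \<phi> (Suc n)))"

lemma conv_power_V: "\<phi> \<in> V \<Longrightarrow> conv_power \<phi> n \<in> V" by (induction n) (simp_all add: V)

lemma expsum_V: "\<phi> \<in> V \<Longrightarrow> expsum \<phi> t n \<in> V" by (induction n) (simp_all add: V conv_power_V del: conv_power.simps)

text \<open>Restricted to positive exponents, as \<open>R i \<eta>\<close> is an idempotent that may
  differ from \<open>1\<close>; in degree zero \<open>\<rho>\<close> supplies the missing
  part.\<close>

lemma R_conv_power: "i \<in> Idx \<Longrightarrow> \<phi> \<in> V \<Longrightarrow> R i (conv_power \<phi> (Suc n)) = R i \<phi> ^ Suc n"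
proof (induction n)
  case (Suc n)
  have "R i (conv_power \<phi> (Suc (Suc n))) = R i \<phi> * R i (conv_power \<phi> (Suc n))"
    unfolding conv_power.simps(2)[of \<phi> "Suc n"] by (rule R(3)[OF Suc.prems conv_power_V[OF Suc.prems(2)]])
  then show ?case using Suc by simp
qed (simp add: unit)

lemma \<rho>_expsum: "i \<in> Idx \<Longrightarrow> \<phi> \<in> V \<Longrightarrow> \<rho> i (expsum \<phi> t n) = (\<Sum>k\<le>n. (t *\<^sub>R R i \<phi>) ^ k /\<^sub>R fact k)"
proof (induction n)
  case 0
  then show ?case by (simp add: \<rho>_\<eta>)
next
  case (Suc n)
  have "R i (expsum \<phi> t (Suc n)) = R i (expsum \<phi> t n) + (t ^ Suc n / fact (Suc n)) *\<^sub>R R i \<phi> ^ Suc n"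
    unfolding expsum.simps(2) using Suc.prems
    by (simp only: R(1)[OF Suc.prems(1) expsum_V V(3)[OF conv_power_V]] R(2)[OF Suc.prems(1) conv_power_V] R_conv_power)
  then have "\<rho> i (expsum \<phi> t (Suc n)) = \<rho> i (expsum \<phi> t n) + (t *\<^sub>R R i \<phi>) ^ Suc n /\<^sub>R fact (Suc n)"
    by (simp only: \<rho>_def scaleR_power scaleR_scaleR add.assoc divide_inverse mult.commute)
  then show ?case using Suc.IH[OF Suc.prems] by simp
qed

lemma exists_exp:
  assumes \<phi>: "\<phi> \<in> V"
  shows "\<exists>\<psi>\<in>V. \<forall>i\<in>Idx. \<rho> i \<psi> = exp (t *\<^sub>R R i \<phi>)"
proof -
  have "\<exists>\<psi>\<in>V. \<forall>i\<in>Idx. R i \<psi> = exp (t *\<^sub>R R i \<phi>) - E i"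
  proof (rule complete_seq[of "expsum \<phi> t"])
    fix i assume i: "i \<in> Idx"
    have "(\<lambda>n. \<rho> i (expsum \<phi> t n)) \<longlonglongrightarrow> exp (t *\<^sub>R R i \<phi>)"
      unfolding \<rho>_expsum[OF i \<phi>] using exp_converges[of "t *\<^sub>R R i \<phi>"] by (simp only: sums_def_le)
    from tendsto_diff[OF this tendsto_const[of "E i"]]
    show "(\<lambda>n. R i (expsum \<phi> t n)) \<longlonglongrightarrow> exp (t *\<^sub>R R i \<phi>) - E i" by (simp add: \<rho>_def)
  qed (rule expsum_V[OF \<phi>])
  then show ?thesis by (simp add: \<rho>_def algebra_simps)
qed

definition \<Phi> :: "'v \<Rightarrow> real \<Rightarrow> 'v" where
  "\<Phi> \<phi> t = (SOME \<psi>. \<psi> \<in> V \<and> (\<forall>i\<in>Idx. \<rho> i \<psi> = exp (t *\<^sub>R R i \<phi>)))"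

lemma \<Phi>: "\<phi> \<in> V \<Longrightarrow> \<Phi> \<phi> t \<in> V" "\<phi> \<in> V \<Longrightarrow> i \<in> Idx \<Longrightarrow> \<rho> i (\<Phi> \<phi> t) = exp (t *\<^sub>R R i \<phi>)"
proof -
  assume "\<phi> \<in> V"
  from someI_ex[OF exists_exp[OF this, unfolded Bex_def], of t]
  show "\<Phi> \<phi> t \<in> V" "i \<in> Idx \<Longrightarrow> \<rho> i (\<Phi> \<phi> t) = exp (t *\<^sub>R R i \<phi>)"
    unfolding \<Phi>_def[symmetric] by blast+
qed

lemma \<rho>_inj: "\<phi> \<in> V \<Longrightarrow> \<psi> \<in> V \<Longrightarrow> (\<And>i. i \<in> Idx \<Longrightarrow> \<rho> i \<phi> = \<rho> i \<psi>) \<Longrightarrow> \<phi> = \<psi>"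
  by (rule R_inj) (simp_all add: \<rho>_eq_iff)

lemma exp_determines_generator:
  fixes A B :: seqop
  assumes "\<And>t. exp (t *\<^sub>R A) = exp (t *\<^sub>R B)"
  shows "A = B"
proof -
  have "((\<lambda>t. exp (t *\<^sub>R A)) has_vector_derivative A) (at 0)" "((\<lambda>t. exp (t *\<^sub>R B)) has_vector_derivative B) (at 0)"
    using exp_scaleR_has_vector_derivative_right[of A 0 UNIV] exp_scaleR_has_vector_derivative_right[of B 0 UNIV]
    unfolding scaleR_zero_left exp_zero mult_1_left .
  then show ?thesis unfolding assms by (rule vector_derivative_unique_at)
qed

lemma exp_add_scaleR: "exp ((s + t) *\<^sub>R A) = exp (s *\<^sub>R A) * exp (t *\<^sub>R (A :: seqop))"
  unfolding scaleR_add_left by (rule exp_add_commuting) simp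

end

section \<open>The Lie algebra of the limit\<close>

text \<open>In the application \<open>Lg\<close> consists of the infinitesimal characters.
  \<open>Lg_iff\<close> speaks of any curve with the right exponentials, so it applies both to
  \<open>\<Phi> \<phi>\<close> and to a given one-parameter subgroup.\<close>

locale tower_lie = tower Idx below N R V add sc star \<eta> Gr
  for Idx :: "'i set" and below N and R :: "'i \<Rightarrow> 'v::topological_space \<Rightarrow> seqop" and V add sc star \<eta> Gr +
  fixes Lg :: "'v set" and bracket :: "'v \<Rightarrow> 'v \<Rightarrow> 'v"
  assumes Lg_V: "Lg \<subseteq> V" and Lg: "\<phi> \<in> Lg \<Longrightarrow> \<psi> \<in> Lg \<Longrightarrow> add \<phi> \<psi> \<in> Lg" "\<phi> \<in> Lg \<Longrightarrow> sc r \<phi> \<in> Lg"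
      "\<phi> \<in> Lg \<Longrightarrow> \<psi> \<in> Lg \<Longrightarrow> bracket \<phi> \<psi> \<in> Lg"
    and R_bracket: "i \<in> Idx \<Longrightarrow> \<phi> \<in> Lg \<Longrightarrow> \<psi> \<in> Lg \<Longrightarrow> R i (bracket \<phi> \<psi>) = R i \<phi> * R i \<psi> - R i \<psi> * R i \<phi>"
    and Lg_iff: "\<phi> \<in> V \<Longrightarrow> (\<And>t. X t \<in> V) \<Longrightarrow> (\<And>i t. i \<in> Idx \<Longrightarrow> \<rho> i (X t) = exp (t *\<^sub>R R i \<phi>)) \<Longrightarrow>
      \<phi> \<in> Lg \<longleftrightarrow> (\<forall>t. X t \<in> Gr)"
begin

lemma LgV: "\<phi> \<in> Lg \<Longrightarrow> \<phi> \<in> V" using Lg_V by blast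

lemma \<Phi>_Gr: "\<phi> \<in> Lg \<Longrightarrow> \<Phi> \<phi> t \<in> Gr"
  using Lg_iff[OF LgV, of \<phi> "\<Phi> \<phi>"] \<Phi> LgV by blast

lemma \<rho>_\<Phi>: "\<phi> \<in> Lg \<Longrightarrow> i \<in> Idx \<Longrightarrow> \<rho> i (\<Phi> \<phi> t) = exp (t *\<^sub>R R i \<phi>)" by (rule \<Phi>(2)[OF LgV])

lemma \<Phi>_one_param: "\<phi> \<in> Lg \<Longrightarrow> \<Phi> \<phi> \<in> one_param_subgroups top_grp"
  unfolding one_param_subgroups_def
proof (intro CollectI conjI allI)
  assume \<phi>: "\<phi> \<in> Lg"
  show "continuous_map euclideanreal (gtop top_grp) (\<Phi> \<phi>)"
  proof (rule continuous_into_GrI)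
    show "continuous_map euclideanreal euclidean (\<lambda>t. \<rho> i (\<Phi> \<phi> t))" if "i \<in> Idx" for i
      unfolding \<rho>_\<Phi>[OF \<phi> that] by (simp add: continuous_on_exp_algebra continuous_on_scaleR)
  qed (use \<Phi>_Gr[OF \<phi>] in auto)
  show "\<Phi> \<phi> (s + t) = \<Phi> \<phi> s \<otimes>\<^bsub>top_grp\<^esub> \<Phi> \<phi> t" for s t
    unfolding top_grp_simps
    by (rule \<rho>_inj) (simp_all add: \<rho>_star \<rho>_\<Phi>[OF \<phi>] \<Phi>(1)[OF LgV[OF \<phi>]] V(4) exp_add_scaleR)
qed

lemma \<Phi>_inj: "inj_on \<Phi> Lg"
proof (rule inj_onI)
  fix \<phi> \<psi> assume a: "\<phi> \<in> Lg" "\<psi> \<in> Lg" "\<Phi> \<phi> = \<Phi> \<psi>"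
  show "\<phi> = \<psi>"
  proof (rule R_inj[OF LgV[OF a(1)] LgV[OF a(2)]])
    fix i assume i: "i \<in> Idx"
    show "R i \<phi> = R i \<psi>"
      by (rule exp_determines_generator) (simp only: \<rho>_\<Phi>[OF a(1) i, symmetric] \<rho>_\<Phi>[OF a(2) i, symmetric] a(3))
  qed
qed

text \<open>At each stage a continuous one-parameter group is an exponential with some generator.
  These generators are limits of difference quotients of \<open>X\<close>, which exist already in
  \<open>V\<close>, so they come from a single element of \<open>V\<close>.\<close>

lemma \<Phi>_surj:
  assumes X: "X \<in> one_param_subgroups top_grp"
  shows "\<exists>\<phi>\<in>Lg. \<Phi> \<phi> = X"
proof -
  interpret g: group top_grp by (rule group_top_grp)
  have c: "continuous_map euclideanreal (gtop top_grp) X" and h: "X (s + t) = star (X s) (X t)" for s t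
    using X by (auto simp: one_param_subgroups_def)
  have XG: "X t \<in> Gr" for t using continuous_map_image_subset_topspace[OF c] by auto
  then have XV: "X t \<in> V" for t using GrV by blast
  have "X 0 \<otimes>\<^bsub>top_grp\<^esub> X 0 = X 0" using h[of 0 0] by simp
  then have X0: "X 0 = \<eta>" using g.l_cancel_one[of "X 0" "X 0"] XG by simp
  have "\<exists>A. \<forall>t. \<rho> i (X t) = exp (t *\<^sub>R A)" if i: "i \<in> Idx" for i
  proof -
    have "continuous_map euclideanreal euclidean (\<rho> i \<circ> X)"
      by (rule continuous_map_compose[OF c]) (use continuous_map_\<rho>[OF i Gr_V] in simp)
    then have "continuous_on UNIV (\<lambda>t. \<rho> i (X t))" by (simp add: o_def)
    then obtain A where "\<And>t. \<rho> i (X t) = exp (t *\<^sub>R A)"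
      by (rule continuous_one_parameter_exp) (simp_all add: h \<rho>_star i XV X0 \<rho>_\<eta>)
    then show ?thesis by blast
  qed
  then obtain A where A: "\<And>i t. i \<in> Idx \<Longrightarrow> \<rho> i (X t) = exp (t *\<^sub>R A i)" by metis
  \<comment> \<open>The difference quotient of \<open>X\<close> at \<open>0\<close> with increment
    \<open>1 / real (Suc n)\<close>, written with the operations of \<open>V\<close>.\<close>
  define \<psi> where "\<psi> n = sc (real (Suc n)) (add (X (1 / real (Suc n))) (sc (-1) \<eta>))" for n
  have "\<exists>\<phi>\<in>V. \<forall>i\<in>Idx. R i \<phi> = A i"
  proof (rule complete_seq[of \<psi>])
    show "\<psi> n \<in> V" for n unfolding \<psi>_def by (intro V XV)
    fix i assume i: "i \<in> Idx"
    have R\<psi>: "R i (\<psi> n) = (exp ((1 / real (Suc n)) *\<^sub>R A i) - 1) /\<^sub>R (1 / real (Suc n))" for n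
    proof -
      have "R i (\<psi> n) = real (Suc n) *\<^sub>R (R i (X (1 / real (Suc n))) - R i \<eta>)"
        unfolding \<psi>_def by (simp add: R i XV V)
      also have "R i (X (1 / real (Suc n))) - R i \<eta> = \<rho> i (X (1 / real (Suc n))) - 1" by (simp add: \<rho>_def E_def)
      finally show ?thesis by (simp add: A[OF i])
    qed
    have d: "((\<lambda>t. exp (t *\<^sub>R A i)) has_vector_derivative A i) (at 0)"
      using exp_scaleR_has_vector_derivative_right[of "A i" 0 UNIV]
      unfolding scaleR_zero_left exp_zero mult_1_left .
    have "((\<lambda>h. (exp (h *\<^sub>R A i) - 1) /\<^sub>R h) \<longlongrightarrow> A i) (at 0)"
      using has_vector_derivative_slope[OF d] by (simp add: inverse_eq_divide)
    moreover have "filterlim (\<lambda>n. 1 / real (Suc n)) (at 0) sequentially"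
      unfolding filterlim_at using LIMSEQ_Suc[OF lim_1_over_n] by simp
    ultimately show "(\<lambda>n. R i (\<psi> n)) \<longlonglongrightarrow> A i" unfolding R\<psi> by (rule filterlim_compose)
  qed
  then obtain \<phi> where \<phi>: "\<phi> \<in> V" "\<And>i. i \<in> Idx \<Longrightarrow> R i \<phi> = A i" by blast
  have "\<phi> \<in> Lg" using Lg_iff[OF \<phi>(1), of X] A \<phi>(2) XV XG by simp
  moreover have "\<Phi> \<phi> = X"
    by (rule ext, rule \<rho>_inj[OF \<Phi>(1)[OF \<phi>(1)] XV]) (simp add: \<Phi>(2)[OF \<phi>(1)] A \<phi>(2))
  ultimately show ?thesis by blast
qed

lemma \<Phi>_bij: "bij_betw \<Phi> Lg (one_param_subgroups top_grp)"
  unfolding bij_betw_def using \<Phi>_inj \<Phi>_surj \<Phi>_one_param by blast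

section \<open>Comparison with the compact-open topology\<close>

lemma topspace_compact_open: "topspace (compact_open_topology G) = one_param_subgroups G"
  unfolding compact_open_topology_def topology_generated_by_topspace
proof
  have "{X \<in> one_param_subgroups G. X ` {} \<subseteq> {}} \<in> {{X \<in> one_param_subgroups G. X ` K \<subseteq> U} |K U. compact K \<and> openin (gtop G) U}"
    using openin_empty compact_empty by blast
  then show "one_param_subgroups G \<subseteq> \<Union>{{X \<in> one_param_subgroups G. X ` K \<subseteq> U} |K U. compact K \<and> openin (gtop G) U}"
    by auto
qed auto

lemma openin_compact_open:
  "compact K \<Longrightarrow> openin (gtop G) U \<Longrightarrow> openin (compact_open_topology G) {X \<in> one_param_subgroups G. X ` K \<subseteq> U}"
  unfolding compact_open_topology_def by (rule topology_generated_by_Basis) blast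

lemma continuous_map_\<Phi>_joint:
  "continuous_map (prod_topology (subtopology euclidean Lg) (subtopology euclideanreal K)) (gtop top_grp) (\<lambda>(\<phi>, t). \<Phi> \<phi> t)"
proof (rule continuous_into_GrI)
  let ?T = "prod_topology (subtopology euclidean Lg) (subtopology euclideanreal K)"
  fix i assume i: "i \<in> Idx"
  have "continuous_map (subtopology euclidean Lg) euclidean (R i)"
    by (simp add: continuous_on_subset[OF continuous_R[OF i] Lg_V])
  note c1 = continuous_map_compose[OF continuous_map_fst this, unfolded o_def]
  have "continuous_map (subtopology euclideanreal K) euclideanreal (\<lambda>t. t)" by simp
  note c2 = continuous_map_compose[OF continuous_map_snd this, unfolded o_def]
  have "continuous_map ?T euclidean (\<lambda>p. (snd p, R i (fst p)))"
    unfolding prod_topology_euclidean[symmetric] by (rule continuous_map_pairedI[OF c2 c1])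
  from continuous_map_euclidean_compose[OF this, of "\<lambda>p. exp (fst p *\<^sub>R snd p)"]
  have "continuous_map ?T euclidean (\<lambda>p. exp (snd p *\<^sub>R R i (fst p)))"
    by (simp add: continuous_on_exp_algebra continuous_on_scaleR continuous_on_fst continuous_on_snd)
  then show "continuous_map ?T euclidean (\<lambda>p. \<rho> i (case p of (\<phi>, t) \<Rightarrow> \<Phi> \<phi> t))"
    by (rule continuous_map_eq) (auto simp: \<rho>_\<Phi> i)
qed (auto simp: \<Phi>_Gr)

\<comment> \<open>Projection along a compact factor is a closed map.\<close>
lemma continuous_map_\<Phi>: "continuous_map (subtopology euclidean Lg) (compact_open_topology top_grp) \<Phi>"
  unfolding compact_open_topology_def continuous_on_generated_topo_iff
proof (intro conjI allI impI)
  fix W assume "W \<in> {{X \<in> one_param_subgroups top_grp. X ` K \<subseteq> U} |K U. compact K \<and> openin (gtop top_grp) U}"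
  then obtain K U where K: "compact K" "openin (gtop top_grp) U" and W: "W = {X \<in> one_param_subgroups top_grp. X ` K \<subseteq> U}" by blast
  let ?L = "subtopology euclidean Lg" and ?K = "subtopology euclideanreal K"
  define C where "C = {p \<in> topspace (prod_topology ?L ?K). (\<lambda>(\<phi>, t). \<Phi> \<phi> t) p \<in> topspace (gtop top_grp) - U}"
  have "closedin (prod_topology ?L ?K) C"
    unfolding C_def by (rule closedin_continuous_map_preimage[OF continuous_map_\<Phi>_joint]) (use K in auto)
  moreover have "compact_space ?K" using K by (simp add: compact_space_subtopology)
  ultimately have "closedin ?L (fst ` C)"
    using Abstract_Topological_Spaces.closed_map_fst[of ?K ?L] by (auto simp: closed_map_def)
  then have "openin ?L (topspace ?L - fst ` C)" by blast
  moreover have "topspace ?L - fst ` C = \<Phi> -` W \<inter> topspace ?L"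
    using \<Phi>_one_param \<Phi>_Gr by (auto simp: C_def W image_iff; blast)
  ultimately show "openin ?L (\<Phi> -` W \<inter> topspace ?L)" by simp
next
  show "\<Phi> ` topspace (subtopology euclidean Lg) \<subseteq> \<Union>{{X \<in> one_param_subgroups top_grp. X ` K \<subseteq> U} |K U. compact K \<and> openin (gtop top_grp) U}"
    using image_subsetI[of Lg \<Phi>, OF \<Phi>_one_param] topspace_compact_open[of top_grp]
    unfolding compact_open_topology_def topology_generated_by_topspace by simp
qed

lemma openin_\<rho>: "i \<in> Idx \<Longrightarrow> open U \<Longrightarrow> openin (gtop top_grp) {g \<in> Gr. \<rho> i g \<in> U}"
  using openin_continuous_map_preimage[OF continuous_map_\<rho>[OF _ Gr_V], of i U] by simp

text \<open>The bound \<open>1/5\<close> makes \<open>norm_generator_le\<close> yield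
  \<open>norm (\<tau> *\<^sub>R A) \<le> 1/4\<close>, the range in which \<open>exp\<close> has a
  Lipschitz inverse with constant \<open>2\<close>.\<close>

lemma generators_near:
  fixes A A0 :: seqop
  assumes \<tau>: "\<tau> > 0" "\<tau> * norm A0 \<le> 1/16" and A: "\<And>t. t \<in> {0..\<tau>} \<Longrightarrow> norm (exp (t *\<^sub>R A) - 1) \<le> 1/5"
    and e: "norm (exp (\<tau> *\<^sub>R A) - exp (\<tau> *\<^sub>R A0)) < \<tau> * \<epsilon> / 2"
  shows "norm (A - A0) < \<epsilon>"
proof -
  have "(1 - 1/5) * norm (\<tau> *\<^sub>R A) \<le> 1/5" by (rule norm_generator_le[OF \<tau>(1) A])
  then have "norm (\<tau> *\<^sub>R A - \<tau> *\<^sub>R A0) \<le> 2 * norm (exp (\<tau> *\<^sub>R A) - exp (\<tau> *\<^sub>R A0))"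
    by (intro exp_lower_Lipschitz) (use \<tau> in auto)
  moreover have "norm (\<tau> *\<^sub>R A - \<tau> *\<^sub>R A0) = \<tau> * norm (A - A0)"
    using \<tau>(1) by (simp add: scaleR_diff_right[symmetric])
  ultimately have "\<tau> * norm (A - A0) < \<tau> * \<epsilon>" using e by linarith
  then show ?thesis using \<tau>(1) mult_less_cancel_left_pos by blast
qed

text \<open>Two subbasic sets suffice near \<open>X0\<close>. One keeps the curve close to
  \<open>1\<close> on a whole interval, which bounds the generator; the other keeps its value at the
  end of the interval close to that of \<open>X0\<close>.\<close>

lemma continuous_map_\<Phi>_inverse: "continuous_map (compact_open_topology top_grp) (subtopology euclidean Lg) (inv_into Lg \<Phi>)"
proof -
  let ?\<Psi> = "inv_into Lg \<Phi>" and ?O = "compact_open_topology top_grp"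
  have \<Psi>: "?\<Psi> X \<in> Lg" "\<Phi> (?\<Psi> X) = X" if "X \<in> one_param_subgroups top_grp" for X
    using bij_betw_inv_into_right[OF \<Phi>_bij that] bij_betw_apply[OF bij_betw_inv_into[OF \<Phi>_bij] that] by auto
  have "continuous_map ?O euclidean ?\<Psi>"
  proof (rule continuous_intoI)
    show "?\<Psi> ` topspace ?O \<subseteq> V" using \<Psi>(1) Lg_V by (auto simp: topspace_compact_open)
    fix i assume i: "i \<in> Idx"
    have \<rho>X: "\<rho> i (X t) = exp (t *\<^sub>R R i (?\<Psi> X))" if "X \<in> one_param_subgroups top_grp" for X t
      using \<rho>_\<Phi>[OF \<Psi>(1)[OF that] i] by (simp add: \<Psi>(2)[OF that])
    show "continuous_map ?O euclidean (\<lambda>X. R i (?\<Psi> X))"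
      unfolding continuous_map_def
    proof (intro conjI allI impI)
      fix U :: "seqop set" assume "openin euclidean U"
      then have U: "open U" by simp
      show "openin ?O {X \<in> topspace ?O. R i (?\<Psi> X) \<in> U}"
        unfolding topspace_compact_open
      proof (subst openin_subopen, rule ballI)
        fix X0 assume "X0 \<in> {X \<in> one_param_subgroups top_grp. R i (?\<Psi> X) \<in> U}"
        then have X0: "X0 \<in> one_param_subgroups top_grp" "R i (?\<Psi> X0) \<in> U" by auto
        let ?A0 = "R i (?\<Psi> X0)"
        obtain \<epsilon> where \<epsilon>: "\<epsilon> > 0" "ball ?A0 \<epsilon> \<subseteq> U" using U X0(2) open_contains_ball by blast
        \<comment> \<open>Then \<open>norm (t *\<^sub>R ?A0) \<le> 1/16\<close> on the interval, so
          \<open>X0\<close> stays within \<open>3/16 < 1/5\<close> of \<open>1\<close> and belongs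
          to the neighbourhood.\<close>
        define \<tau> where "\<tau> = 1 / (16 * (norm ?A0 + 1))"
        have p: "norm ?A0 + 1 > 0" by (simp add: add_nonneg_pos)
        have \<tau>: "\<tau> > 0" "\<tau> * norm ?A0 \<le> 1/16" using p by (auto simp: \<tau>_def field_simps)
        define U1 where "U1 = {g \<in> Gr. \<rho> i g \<in> ball 1 (1/5)}"
        define U2 where "U2 = {g \<in> Gr. \<rho> i g \<in> ball (exp (\<tau> *\<^sub>R ?A0)) (\<tau> * \<epsilon> / 2)}"
        define W where "W = {X \<in> one_param_subgroups top_grp. X ` {0..\<tau>} \<subseteq> U1} \<inter> {X \<in> one_param_subgroups top_grp. X ` {\<tau>} \<subseteq> U2}"
        have XG: "X t \<in> Gr" if "X \<in> one_param_subgroups top_grp" for X t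
          using \<Phi>_Gr[OF \<Psi>(1)[OF that]] by (simp add: \<Psi>(2)[OF that])
        have "openin ?O W" unfolding W_def U1_def U2_def
          by (intro openin_Int openin_compact_open openin_\<rho> i) auto
        moreover have "X0 \<in> W"
        proof -
          have "norm (exp (t *\<^sub>R ?A0) - 1) < 1/5" if "t \<in> {0..\<tau>}" for t
          proof -
            have "norm (t *\<^sub>R ?A0) \<le> \<tau> * norm ?A0" using that by (auto intro: mult_right_mono)
            then have n: "norm (t *\<^sub>R ?A0) \<le> 1/16" using \<tau>(2) by simp
            show ?thesis using norm_exp_minus_one_le[OF n] n by simp
          qed
          then show ?thesis using X0(1) XG[OF X0(1)] \<tau>(1) \<epsilon>(1)
            by (auto simp: W_def U1_def U2_def \<rho>X[OF X0(1)] dist_norm norm_minus_commute)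
        qed
        moreover have "R i (?\<Psi> X) \<in> U" "X \<in> one_param_subgroups top_grp" if X: "X \<in> W" for X
        proof -
          show X': "X \<in> one_param_subgroups top_grp" using X by (simp add: W_def)
          have "norm (R i (?\<Psi> X) - ?A0) < \<epsilon>"
          proof (rule generators_near[OF \<tau>])
            fix t assume "t \<in> {0..\<tau>}"
            then have "X t \<in> U1" using X unfolding W_def by blast
            then show "norm (exp (t *\<^sub>R R i (?\<Psi> X)) - 1) \<le> 1/5"
              by (simp add: U1_def \<rho>X[OF X'] dist_norm norm_minus_commute)
          next
            have "X \<tau> \<in> U2" using X unfolding W_def by blast
            then show "norm (exp (\<tau> *\<^sub>R R i (?\<Psi> X)) - exp (\<tau> *\<^sub>R ?A0)) < \<tau> * \<epsilon> / 2"
              by (simp add: U2_def \<rho>X[OF X'] dist_norm norm_minus_commute)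
          qed
          then show "R i (?\<Psi> X) \<in> U" using \<epsilon>(2) by (auto simp: subset_iff dist_norm norm_minus_commute)
        qed
        ultimately show "\<exists>T. openin ?O T \<and> X0 \<in> T \<and> T \<subseteq> {X \<in> one_param_subgroups top_grp. R i (?\<Psi> X) \<in> U}"
          by (intro exI[of _ W]) auto
      qed
    qed auto
  qed
  then show ?thesis using \<Psi>(1) by (auto simp: continuous_map_in_subtopology topspace_compact_open)
qed

lemma homeomorphic_map_\<Phi>: "homeomorphic_map (subtopology euclidean Lg) (compact_open_topology top_grp) \<Phi>"
proof -
  have "homeomorphic_maps (subtopology euclidean Lg) (compact_open_topology top_grp) \<Phi> (inv_into Lg \<Phi>)"
    unfolding homeomorphic_maps_def
  proof (intro conjI ballI continuous_map_\<Phi> continuous_map_\<Phi>_inverse)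
    show "inv_into Lg \<Phi> (\<Phi> x) = x" if "x \<in> topspace (subtopology euclidean Lg)" for x
      using that \<Phi>_inj by simp
    show "\<Phi> (inv_into Lg \<Phi> y) = y" if "y \<in> topspace (compact_open_topology top_grp)" for y
      using that bij_betw_inv_into_right[OF \<Phi>_bij] by (simp add: topspace_compact_open)
  qed
  then show ?thesis using homeomorphic_map_maps by blast
qed

lemma limit_map_\<Phi>: "\<phi> \<in> Lg \<Longrightarrow> i \<in> Idx \<Longrightarrow> (\<lambda>t. limit_map (\<Phi> \<phi> t) i) = (\<lambda>t. enc (exp (t *\<^sub>R R i \<phi>)))"
  by (rule ext) (simp add: limit_map_def \<rho>_\<Phi>)

lemma exp_\<Gamma>: "\<phi> \<in> Lg \<Longrightarrow> i \<in> Idx \<Longrightarrow> exp (t *\<^sub>R R i \<phi>) \<in> \<Gamma> i"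
  using \<rho>_\<Gamma>[of i "\<Phi> \<phi> t"] \<rho>_\<Phi> \<Phi>_Gr by simp

lemma one_param_stage_group: "\<phi> \<in> Lg \<Longrightarrow> i \<in> Idx \<Longrightarrow> (\<lambda>t. enc (exp (t *\<^sub>R R i \<phi>))) \<in> one_param_subgroups (stage_group i)"
  unfolding one_param_subgroups_def
proof (intro CollectI conjI allI)
  assume \<phi>: "\<phi> \<in> Lg" and i: "i \<in> Idx"
  have "continuous_on UNIV (\<lambda>t. enc (exp (t *\<^sub>R R i \<phi>)))"
    by (rule continuous_on_compose2[OF continuous_on_enc[of UNIV]])
       (simp_all add: continuous_on_exp_algebra continuous_on_scaleR)
  then show "continuous_map euclideanreal (gtop (stage_group i)) (\<lambda>t. enc (exp (t *\<^sub>R R i \<phi>)))"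
    unfolding stage_group_simps(2)[OF i] using exp_\<Gamma>[OF \<phi> i] by (auto simp: continuous_map_in_subtopology)
  show "enc (exp ((s + t) *\<^sub>R R i \<phi>)) = enc (exp (s *\<^sub>R R i \<phi>)) \<otimes>\<^bsub>stage_group i\<^esub> enc (exp (t *\<^sub>R R i \<phi>))" for s t
    using stage_group_simps(4)[OF i exp_\<Gamma>[OF \<phi> i] exp_\<Gamma>[OF \<phi> i]] by (simp add: exp_add_scaleR)
qed

section \<open>Sums and brackets at the stages\<close>

lemma lie_sum_stage_group:
  assumes \<phi>: "\<phi> \<in> Lg" and \<psi>: "\<psi> \<in> Lg" and i: "i \<in> Idx"
  shows "is_lie_sum (stage_group i) (\<lambda>t. enc (exp (t *\<^sub>R R i \<phi>))) (\<lambda>t. enc (exp (t *\<^sub>R R i \<psi>))) (\<lambda>t. enc (exp (t *\<^sub>R R i (add \<phi> \<psi>))))"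
proof -
  obtain d b' c' \<epsilon> where l: "lie_stage (N i * N i) (mat_basis (N i)) (mat_coord (N i)) (\<Gamma> i) d b' c' \<epsilon> enc"
    and G: "stage_group i = lie_stage.G (\<Gamma> i) d c' \<epsilon> enc" using stage_group[OF i] by blast
  interpret s: lie_stage "N i * N i" "mat_basis (N i)" "mat_coord (N i)" "\<Gamma> i" d b' c' \<epsilon> enc by (rule l)
  have lie: "R i \<omega> \<in> s.lie" if "\<omega> \<in> Lg" for \<omega> using exp_\<Gamma>[OF that i] by (simp add: s.lie_def)
  have at: "(enc ` s.domain 1, s.chart 1) \<in> atlas (stage_group i)" using s.one_\<Gamma> unfolding G s.G_simps by blast
  have one: "\<one>\<^bsub>stage_group i\<^esub> \<in> enc ` s.domain 1"
    unfolding G s.G_simps s.domain_def using s.one_\<Gamma> s.\<epsilon> by auto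
  have vel: "has_velocity (ldim (stage_group i)) (s.chart 1) (\<lambda>t. enc (exp (t *\<^sub>R R i \<omega>))) (\<lambda>k. c' k (R i \<omega>))" if "\<omega> \<in> Lg" for \<omega>
    unfolding has_velocity_def G s.G_simps using s.chart_one_velocity[OF lie[OF that]] by blast
  have "has_velocity (ldim (stage_group i)) (s.chart 1) (\<lambda>t. enc (exp (t *\<^sub>R R i (add \<phi> \<psi>)))) (\<lambda>k. c' k (R i \<phi>) + c' k (R i \<psi>))"
    using vel[OF Lg(1)[OF \<phi> \<psi>]] linear_add[OF bounded_linear.linear[OF s.L.bl]]
    by (simp add: has_velocity_def R(1)[OF i LgV[OF \<phi>] LgV[OF \<psi>]] G)
  with vel[OF \<phi>] vel[OF \<psi>] at one one_param_stage_group[OF Lg(1)[OF \<phi> \<psi>] i]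
  show ?thesis unfolding is_lie_sum_def by blast
qed

text \<open>Conjugation by \<open>exp (u *\<^sub>R A)\<close> turns the one-parameter group of
  \<open>B\<close> into that of \<open>Ad u\<close>, whose velocity in the chart with label
  \<open>1\<close> is linear in \<open>Ad u\<close>. The derivative of \<open>Ad\<close> at
  \<open>0\<close> is the commutator.\<close>

lemma lie_bracket_stage_group:
  assumes \<phi>: "\<phi> \<in> Lg" and \<psi>: "\<psi> \<in> Lg" and i: "i \<in> Idx"
  shows "is_lie_bracket (stage_group i) (\<lambda>t. enc (exp (t *\<^sub>R R i \<phi>))) (\<lambda>t. enc (exp (t *\<^sub>R R i \<psi>))) (\<lambda>t. enc (exp (t *\<^sub>R R i (bracket \<phi> \<psi>))))"
proof -
  obtain d b' c' \<epsilon> where l: "lie_stage (N i * N i) (mat_basis (N i)) (mat_coord (N i)) (\<Gamma> i) d b' c' \<epsilon> enc"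
    and G: "stage_group i = lie_stage.G (\<Gamma> i) d c' \<epsilon> enc" using stage_group[OF i] by blast
  interpret s: lie_stage "N i * N i" "mat_basis (N i)" "mat_coord (N i)" "\<Gamma> i" d b' c' \<epsilon> enc by (rule l)
  have at: "(enc ` s.domain 1, s.chart 1) \<in> atlas (stage_group i)" using s.one_\<Gamma> unfolding G s.G_simps by blast
  have one: "\<one>\<^bsub>stage_group i\<^esub> \<in> enc ` s.domain 1"
    unfolding G s.G_simps s.domain_def using s.one_\<Gamma> s.\<epsilon> by auto
  define A where "A = R i \<phi>"
  define B where "B = R i \<psi>"
  define Ad where "Ad u = exp (u *\<^sub>R A) * B * exp (u *\<^sub>R (- A))" for u
  have inv: "exp (u *\<^sub>R A) * exp (u *\<^sub>R (- A)) = 1" "exp (u *\<^sub>R (- A)) * exp (u *\<^sub>R A) = 1" for u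
    using exp_minus_inverse[of "u *\<^sub>R A"] exp_minus_inverse[of "- (u *\<^sub>R A)"] by simp_all
  have A\<Gamma>: "exp (u *\<^sub>R A) \<in> \<Gamma> i" "exp (u *\<^sub>R B) \<in> \<Gamma> i" for u
    using exp_\<Gamma>[OF \<phi> i] exp_\<Gamma>[OF \<psi> i] by (simp_all add: A_def B_def)
  have A\<Gamma>': "exp (u *\<^sub>R (- A)) \<in> \<Gamma> i" for u using A\<Gamma>(1)[of "- u"] by simp
  have conj: "exp (t *\<^sub>R Ad u) = exp (u *\<^sub>R A) * exp (t *\<^sub>R B) * exp (u *\<^sub>R (- A))" for t u
    using exp_conj[OF inv(2) inv(1), of u "t *\<^sub>R B"] by (simp add: Ad_def)
  have Ad: "Ad u \<in> s.lie" for u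
    unfolding s.lie_def using s.mult_\<Gamma>[OF s.mult_\<Gamma>[OF A\<Gamma>] A\<Gamma>'] by (simp add: conj)
  have XYX: "(\<lambda>t. enc (exp (u *\<^sub>R A)) \<otimes>\<^bsub>stage_group i\<^esub> enc (exp (t *\<^sub>R B)) \<otimes>\<^bsub>stage_group i\<^esub> inv\<^bsub>stage_group i\<^esub> (enc (exp (u *\<^sub>R A))))
      = (\<lambda>t. enc (exp (t *\<^sub>R Ad u)))" for u
  proof
    fix t
    have iv: "inv\<^bsub>stage_group i\<^esub> (enc (exp (u *\<^sub>R A))) = enc (exp (u *\<^sub>R (- A)))"
      unfolding G by (rule s.inv_enc[OF A\<Gamma>(1) A\<Gamma>' inv(2)])
    show "enc (exp (u *\<^sub>R A)) \<otimes>\<^bsub>stage_group i\<^esub> enc (exp (t *\<^sub>R B)) \<otimes>\<^bsub>stage_group i\<^esub> inv\<^bsub>stage_group i\<^esub> (enc (exp (u *\<^sub>R A))) = enc (exp (t *\<^sub>R Ad u))"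
      unfolding iv stage_group_simps(4)[OF i A\<Gamma>] stage_group_simps(4)[OF i s.mult_\<Gamma>[OF A\<Gamma>] A\<Gamma>'] conj ..
  qed
  have "((\<lambda>u. exp (u *\<^sub>R A) * B) has_vector_derivative A * B) (at 0)"
    using has_vector_derivative_mult[OF exp_scaleR_has_vector_derivative_right[of A 0 UNIV] has_vector_derivative_const[of B]]
    by simp
  from has_vector_derivative_mult[OF this exp_scaleR_has_vector_derivative_right[of "- A" 0 UNIV]]
  have dAd: "(Ad has_vector_derivative A * B - B * A) (at 0)"
    unfolding Ad_def[abs_def] by simp
  have dc: "((\<lambda>u. c' k (Ad u)) has_real_derivative c' k (A * B - B * A)) (at 0)" if "k < d" for k
    using bounded_linear.has_vector_derivative[OF s.L.bl[OF that] dAd]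
    by (simp add: has_real_derivative_iff_has_vector_derivative)
  have 1: "\<forall>u. has_velocity (ldim (stage_group i)) (s.chart 1) (\<lambda>t. enc (exp (u *\<^sub>R A)) \<otimes>\<^bsub>stage_group i\<^esub> enc (exp (t *\<^sub>R B)) \<otimes>\<^bsub>stage_group i\<^esub> inv\<^bsub>stage_group i\<^esub> (enc (exp (u *\<^sub>R A)))) (\<lambda>k. c' k (Ad u))"
    unfolding XYX unfolding has_velocity_def G s.G_simps by (intro allI impI s.chart_one_velocity[OF Ad])
  have 2: "\<forall>k<ldim (stage_group i). ((\<lambda>u. c' k (Ad u)) has_real_derivative c' k (A * B - B * A)) (at 0)"
    unfolding G s.G_simps by (intro allI impI dc)
  have R: "R i (bracket \<phi> \<psi>) = A * B - B * A" using R_bracket[OF i \<phi> \<psi>] by (simp add: A_def B_def)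
  have RL: "R i (bracket \<phi> \<psi>) \<in> s.lie" using exp_\<Gamma>[OF Lg(3)[OF \<phi> \<psi>] i] by (simp add: s.lie_def)
  have 3: "has_velocity (ldim (stage_group i)) (s.chart 1) (\<lambda>t. enc (exp (t *\<^sub>R R i (bracket \<phi> \<psi>)))) (\<lambda>k. c' k (A * B - B * A))"
    unfolding has_velocity_def G s.G_simps R by (intro allI impI s.chart_one_velocity RL[unfolded R])
  show ?thesis
    unfolding is_lie_bracket_def A_def[symmetric] B_def[symmetric]
    by (intro conjI one_param_stage_group Lg(3) \<phi> \<psi> i bexI[OF _ at], unfold split_conv, intro conjI one)
       (rule exI[of _ "\<lambda>u k. c' k (Ad u)"], rule exI[of _ "\<lambda>k. c' k (A * B - B * A)"], intro conjI 1 2 3)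
qed

definition lie_alg :: "'v top_lie_algebra" where
  "lie_alg = \<lparr>carrier = Lg, vtop = subtopology euclidean Lg, vadd = add, vscale = sc, vbracket = bracket\<rparr>"

theorem iso_lie_alg: "is_iso_onto_pro_lie_algebra lie_alg tower_system top_grp limit_map \<Phi>"
proof -
  have s: "is_pro_lie_sum tower_system top_grp limit_map (\<Phi> \<phi>) (\<Phi> \<psi>) (\<Phi> (add \<phi> \<psi>))"
    and b: "is_pro_lie_bracket tower_system top_grp limit_map (\<Phi> \<phi>) (\<Phi> \<psi>) (\<Phi> (bracket \<phi> \<psi>))" if "\<phi> \<in> Lg" "\<psi> \<in> Lg" for \<phi> \<psi>
    using that by (auto simp: is_pro_lie_sum_def is_pro_lie_bracket_def limit_map_\<Phi> Lg \<Phi>_one_param lie_sum_stage_group lie_bracket_stage_group)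
  have "\<Phi> (sc r \<phi>) = (\<lambda>t. \<Phi> \<phi> (r * t))" if \<phi>: "\<phi> \<in> Lg" for r \<phi>
  proof (rule ext, rule \<rho>_inj)
    fix t i assume i: "i \<in> Idx"
    show "\<rho> i (\<Phi> (sc r \<phi>) t) = \<rho> i (\<Phi> \<phi> (r * t))"
      using \<phi> Lg(2)[OF \<phi>] by (simp add: \<rho>_\<Phi> i R(2)[OF i LgV] mult.commute)
  qed (use \<Phi>(1) LgV[OF \<phi>] V(3) in auto)
  then show ?thesis
    unfolding is_iso_onto_pro_lie_algebra_def lie_alg_def
    using \<Phi>_bij homeomorphic_map_\<Phi> Lg s b by simp
qed

end

section \<open>Characters of Hopf algebras\<close>

locale hopf_weakly_complete = hopf_pair smul \<Delta> \<epsilon> S sB + W: weakly_complete_algebra sB I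
  for smul :: "'k::real_or_complex \<Rightarrow> 'h::{ring,monoid_mult} \<Rightarrow> 'h" and \<Delta> \<epsilon> S
    and sB :: "'k \<Rightarrow> 'b::{comm_ring,comm_monoid_mult,topological_space} \<Rightarrow> 'b" and I :: "'x set"
begin

lemma matrix_rep_eqI: "(\<And>q \<beta> k l. W.matrix_rep q \<beta> \<Longrightarrow> k < q \<Longrightarrow> l < q \<Longrightarrow> \<beta> x k l = \<beta> y k l) \<Longrightarrow> x = y"
proof -
  assume e: "\<And>q \<beta> k l. W.matrix_rep q \<beta> \<Longrightarrow> k < q \<Longrightarrow> l < q \<Longrightarrow> \<beta> x k l = \<beta> y k l"
  have "x - y = 0"
  proof (rule W.kernels_separate)
    fix J assume "J \<in> W.kernels"
    then obtain q \<beta> where b: "W.matrix_rep q \<beta>" "J = W.rep_kernel q \<beta>" by (auto simp: W.kernels_def)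
    show "x - y \<in> J" unfolding b(2) W.rep_kernel_def using e[OF b(1)] by (simp add: W.rlin_diff[OF W.matrix_repD(1)[OF b(1)]])
  qed
  then show ?thesis by simp
qed

section \<open>Real matrices of linear maps\<close>

text \<open>The matrix \<open>u\<close> over \<open>B\<close> with every entry replaced by the real
  block that represents it.\<close>

definition block_matrix :: "nat \<Rightarrow> nat \<Rightarrow> ('b \<Rightarrow> nat \<Rightarrow> nat \<Rightarrow> real) \<Rightarrow> (nat \<Rightarrow> nat \<Rightarrow> 'b) \<Rightarrow> seqop" where
  "block_matrix p q \<beta> u = opmat (p * q) (\<lambda>i j. \<beta> (u (i div q) (j div q)) (i mod q) (j mod q))"

lemma block_matrix_cong: "(\<And>i j k l. i < p \<Longrightarrow> j < p \<Longrightarrow> k < q \<Longrightarrow> l < q \<Longrightarrow> \<beta> (u i j) k l = \<beta>' (v i j) k l) \<Longrightarrow> block_matrix p q \<beta> u = block_matrix p q \<beta>' v"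
  unfolding block_matrix_def by (rule opmat_cong) (simp add: div_mod_bounds)

lemma entry_block_matrix: "i < p \<Longrightarrow> j < p \<Longrightarrow> k < q \<Longrightarrow> l < q \<Longrightarrow> entry (i * q + k) (j * q + l) (block_matrix p q \<beta> u) = \<beta> (u i j) k l"
  by (simp add: block_matrix_def entry_opmat rect_index)

lemma block_matrix_mult:
  assumes b: "W.matrix_rep q \<beta>"
  shows "block_matrix p q \<beta> u * block_matrix p q \<beta> v = block_matrix p q \<beta> (\<lambda>i j. \<Sum>k<p. u i k * v k j)"
  unfolding block_matrix_def opmat_mult
proof (rule opmat_cong)
  fix i j assume ij: "i < p * q" "j < p * q"
  have m: "i mod q < q" "j mod q < q" using ij div_mod_bounds by auto
  show "(\<Sum>k<p * q. \<beta> (u (i div q) (k div q)) (i mod q) (k mod q) * \<beta> (v (k div q) (j div q)) (k mod q) (j mod q)) =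
      \<beta> (\<Sum>k<p. u (i div q) k * v k (j div q)) (i mod q) (j mod q)"
    unfolding sum_rect[of "\<lambda>s t. \<beta> (u (i div q) s) (i mod q) t * \<beta> (v s (j div q)) t (j mod q)"]
    by (simp add: W.rlin_sum[OF W.matrix_repD(1)[OF b m]] W.matrix_repD(4)[OF b m])
qed

lemma block_matrix_has_vector_derivative:
  assumes "\<And>i j k l. i < p \<Longrightarrow> j < p \<Longrightarrow> k < q \<Longrightarrow> l < q \<Longrightarrow> ((\<lambda>t. \<beta> (u t i j) k l) has_real_derivative \<beta> (u' i j) k l) (at t)"
  shows "((\<lambda>t. block_matrix p q \<beta> (u t)) has_vector_derivative block_matrix p q \<beta> u') (at t)"
  unfolding block_matrix_def opmat_def
proof (intro has_vector_derivative_sum)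
  fix i j assume "i \<in> {..<p * q}" "j \<in> {..<p * q}"
  then have "((\<lambda>t. \<beta> (u t (i div q) (j div q)) (i mod q) (j mod q)) has_real_derivative \<beta> (u' (i div q) (j div q)) (i mod q) (j mod q)) (at t)"
    by (intro assms) (simp_all add: div_mod_bounds)
  from bounded_linear.has_vector_derivative[OF bounded_linear_scaleR_left this[unfolded has_real_derivative_iff_has_vector_derivative], of "elem i j"]
  show "((\<lambda>t. \<beta> (u t (i div q) (j div q)) (i mod q) (j mod q) *\<^sub>R elem i j) has_vector_derivative
      \<beta> (u' (i div q) (j div q)) (i mod q) (j mod q) *\<^sub>R elem i j) (at t)" .
qed

definition rep_matrix :: "nat \<Rightarrow> (nat \<Rightarrow> nat \<Rightarrow> 'h) \<Rightarrow> nat \<Rightarrow> ('b \<Rightarrow> nat \<Rightarrow> nat \<Rightarrow> real) \<Rightarrow> ('h \<Rightarrow> 'b) \<Rightarrow> seqop" where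
  "rep_matrix p a q \<beta> \<phi> = block_matrix p q \<beta> (\<lambda>i j. \<phi> (a i j))"

definition fun_add :: "('h \<Rightarrow> 'b) \<Rightarrow> ('h \<Rightarrow> 'b) \<Rightarrow> 'h \<Rightarrow> 'b" where "fun_add \<phi> \<psi> = (\<lambda>x. \<phi> x + \<psi> x)"
definition fun_rscale :: "real \<Rightarrow> ('h \<Rightarrow> 'b) \<Rightarrow> 'h \<Rightarrow> 'b" where "fun_rscale r \<phi> = (\<lambda>x. sB (of_real r) (\<phi> x))"

lemma fun_add_Lin: "\<phi> \<in> Lin \<Longrightarrow> \<psi> \<in> Lin \<Longrightarrow> fun_add \<phi> \<psi> \<in> Lin"
  by (rule LinI) (simp_all add: fun_add_def Lin_add Lin_scale B.scale_right_distrib algebra_simps del: mem_Collect_eq)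

lemma fun_rscale_Lin: "\<phi> \<in> Lin \<Longrightarrow> fun_rscale r \<phi> \<in> Lin"
  by (rule LinI) (simp_all add: fun_rscale_def Lin_add Lin_scale B.scale_right_distrib mult.commute del: mem_Collect_eq)

lemma rep_matrix_add: "W.matrix_rep q \<beta> \<Longrightarrow> rep_matrix p a q \<beta> (fun_add \<phi> \<psi>) = rep_matrix p a q \<beta> \<phi> + rep_matrix p a q \<beta> \<psi>"
  unfolding rep_matrix_def block_matrix_def opmat_add[symmetric]
  by (rule opmat_cong) (simp add: fun_add_def W.rlin_add[OF W.matrix_repD(1)] div_mod_bounds)

lemma rep_matrix_scale: "W.matrix_rep q \<beta> \<Longrightarrow> rep_matrix p a q \<beta> (fun_rscale r \<phi>) = r *\<^sub>R rep_matrix p a q \<beta> \<phi>"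
  unfolding rep_matrix_def block_matrix_def opmat_scale[symmetric]
  by (rule opmat_cong) (simp add: fun_rscale_def W.rlin_scale[OF W.matrix_repD(1)] div_mod_bounds)

lemma rep_matrix_star: "W.matrix_rep q \<beta> \<Longrightarrow> matrix_coalgebra p a \<Longrightarrow> \<phi> \<in> Lin \<Longrightarrow> \<psi> \<in> Lin \<Longrightarrow>
    rep_matrix p a q \<beta> (star \<phi> \<psi>) = rep_matrix p a q \<beta> \<phi> * rep_matrix p a q \<beta> \<psi>"
  unfolding rep_matrix_def block_matrix_mult by (rule block_matrix_cong) (simp add: star_matrix_coalgebra del: mem_Collect_eq)

lemma rep_matrix_F: "rep_matrix p a q \<beta> \<phi> \<in> mat.F (p * q)" unfolding rep_matrix_def block_matrix_def mat_F by blast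

lemma continuous_on_rep_matrix:
  assumes b: "W.matrix_rep q \<beta>"
  shows "continuous_on A (rep_matrix p a q \<beta>)"
  unfolding rep_matrix_def block_matrix_def opmat_def
proof (intro continuous_on_sum continuous_on_scaleR continuous_on_const)
  fix i j assume ij: "i \<in> {..<p * q}" "j \<in> {..<p * q}"
  have "continuous_on A (\<lambda>\<phi> :: 'h \<Rightarrow> 'b. \<phi> x)" for x
    by (rule continuous_on_subset[OF continuous_on_product_coordinates subset_UNIV])
  from continuous_on_compose2[OF W.matrix_repD(2)[OF b, of "i mod q" "j mod q"] this]
  show "continuous_on A (\<lambda>\<phi>. \<beta> (\<phi> (a (i div q) (j div q))) (i mod q) (j mod q))"
    using ij by (simp add: div_mod_bounds)
qed

text \<open>The entries for \<open>x\<close> in the span of the coefficients are read off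
  \<open>rep_matrix\<close> linearly. The proof is by span induction, where a scalar of the ground
  field acts by a real matrix.\<close>

lemma rep_matrix_functional:
  assumes b: "W.matrix_rep q \<beta>" and x: "x \<in> coeff_span p a" and kl: "k < q" "l < q"
  shows "\<exists>T. bounded_linear T \<and> (\<forall>\<phi>\<in>Lin. \<beta> (\<phi> x) k l = T (rep_matrix p a q \<beta> \<phi>))"
proof -
  \<comment> \<open>All rows are treated at once because multiplication by a scalar mixes
    them.\<close>
  let ?P = "\<lambda>x. \<forall>k<q. \<forall>l<q. \<exists>T. bounded_linear T \<and> (\<forall>\<phi>\<in>Lin. \<beta> (\<phi> x) k l = T (rep_matrix p a q \<beta> \<phi>))"
  have "?P x"
  proof (rule span_induct[OF x[unfolded coeff_span_def], where P = ?P])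
    show "subspace (Collect ?P)"
      unfolding subspace_def
    proof (intro conjI ballI allI CollectI impI)
      fix k l assume "k < q" "l < q"
      then show "\<exists>T. bounded_linear T \<and> (\<forall>\<phi>\<in>Lin. \<beta> (\<phi> 0) k l = T (rep_matrix p a q \<beta> \<phi>))"
        by (intro exI[of _ "\<lambda>_. 0"]) (simp add: W.rlin_0[OF W.matrix_repD(1)[OF b]] Lin_0 del: mem_Collect_eq)
    next
      fix x y k l assume xy: "x \<in> Collect ?P" "y \<in> Collect ?P" and kl: "k < q" "l < q"
      from xy(1) kl obtain T1 where "bounded_linear T1" "\<forall>\<phi>\<in>Lin. \<beta> (\<phi> x) k l = T1 (rep_matrix p a q \<beta> \<phi>)"
        unfolding mem_Collect_eq[of _ ?P] by meson
      moreover from xy(2) kl obtain T2 where "bounded_linear T2" "\<forall>\<phi>\<in>Lin. \<beta> (\<phi> y) k l = T2 (rep_matrix p a q \<beta> \<phi>)"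
        unfolding mem_Collect_eq[of _ ?P] by meson
      ultimately
      show "\<exists>T. bounded_linear T \<and> (\<forall>\<phi>\<in>Lin. \<beta> (\<phi> (x + y)) k l = T (rep_matrix p a q \<beta> \<phi>))"
        by (intro exI[of _ "\<lambda>r. T1 r + T2 r"])
           (simp add: bounded_linear_add W.rlin_add[OF W.matrix_repD(1)[OF b kl]] Lin_add del: mem_Collect_eq)
    next
      fix c x k l assume x: "x \<in> Collect ?P" and kl: "k < q" "l < q"
      then have "\<forall>m. \<exists>T. m < q \<longrightarrow> bounded_linear T \<and> (\<forall>\<phi>\<in>Lin. \<beta> (\<phi> x) m l = T (rep_matrix p a q \<beta> \<phi>))" by simp
      from choice[OF this] obtain T
        where T0: "\<forall>m. m < q \<longrightarrow> bounded_linear (T m) \<and> (\<forall>\<phi>\<in>Lin. \<beta> (\<phi> x) m l = T m (rep_matrix p a q \<beta> \<phi>))" ..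
      have T: "bounded_linear (T m)" "\<phi> \<in> Lin \<Longrightarrow> \<beta> (\<phi> x) m l = T m (rep_matrix p a q \<beta> \<phi>)" if "m < q" for m \<phi>
        using T0[rule_format, OF that] by (rule conjunct1) (rule bspec[OF T0[rule_format, OF that, THEN conjunct2]])
      show "\<exists>T. bounded_linear T \<and> (\<forall>\<phi>\<in>Lin. \<beta> (\<phi> (smul c x)) k l = T (rep_matrix p a q \<beta> \<phi>))"
      proof (intro exI conjI ballI)
        show "bounded_linear (\<lambda>r. \<Sum>m<q. \<beta> (sB c 1) k m * T m r)"
          by (intro bounded_linear_sum bounded_linear_const_mult T) simp
        show "\<beta> (\<phi> (smul c x)) k l = (\<Sum>m<q. \<beta> (sB c 1) k m * T m (rep_matrix p a q \<beta> \<phi>))" if "\<phi> \<in> Lin" for \<phi>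
          using that by (simp add: Lin_scale W.matrix_rep_smul[OF b kl, where c = c] T del: mem_Collect_eq)
      qed
    qed
    fix y assume "y \<in> {a i j | i j. i < p \<and> j < p}"
    then obtain i j where ij: "i < p" "j < p" "y = a i j" by blast
    show "\<forall>k<q. \<forall>l<q. \<exists>T. bounded_linear T \<and> (\<forall>\<phi>\<in>Lin. \<beta> (\<phi> y) k l = T (rep_matrix p a q \<beta> \<phi>))"
    proof (intro allI impI)
      fix k l assume "k < q" "l < q"
      then show "\<exists>T. bounded_linear T \<and> (\<forall>\<phi>\<in>Lin. \<beta> (\<phi> y) k l = T (rep_matrix p a q \<beta> \<phi>))"
        by (intro exI[of _ "entry (i * q + k) (j * q + l)"]) (simp add: bounded_linear_entry rep_matrix_def entry_block_matrix ij)
    qed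
  qed
  then show ?thesis using kl by simp
qed

text \<open>The equivalence relation induced on linear maps depends only on the span of
  \<open>a\<close> and the kernel of \<open>\<beta>\<close>, which justifies taking this pair as the
  index.\<close>

lemma rep_matrix_eq_iff:
  assumes b: "W.matrix_rep q \<beta>" and \<phi>: "\<phi> \<in> Lin" and \<psi>: "\<psi> \<in> Lin"
  shows "rep_matrix p a q \<beta> \<phi> = rep_matrix p a q \<beta> \<psi> \<longleftrightarrow> (\<forall>x\<in>coeff_span p a. \<phi> x - \<psi> x \<in> W.rep_kernel q \<beta>)"
proof
  assume e: "rep_matrix p a q \<beta> \<phi> = rep_matrix p a q \<beta> \<psi>"
  have "\<beta> (\<phi> x) k l = \<beta> (\<psi> x) k l" if x: "x \<in> coeff_span p a" and kl: "k < q" "l < q" for x k l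
  proof -
    obtain T where "\<forall>\<phi>\<in>Lin. \<beta> (\<phi> x) k l = T (rep_matrix p a q \<beta> \<phi>)" using rep_matrix_functional[OF b x kl] by meson
    then show ?thesis using e bspec[of Lin _ \<phi>] bspec[of Lin _ \<psi>] \<phi> \<psi> by presburger
  qed
  then show "\<forall>x\<in>coeff_span p a. \<phi> x - \<psi> x \<in> W.rep_kernel q \<beta>"
    by (simp add: W.rep_kernel_def W.rlin_diff[OF W.matrix_repD(1)[OF b]])
next
  assume e: "\<forall>x\<in>coeff_span p a. \<phi> x - \<psi> x \<in> W.rep_kernel q \<beta>"
  show "rep_matrix p a q \<beta> \<phi> = rep_matrix p a q \<beta> \<psi>"
    unfolding rep_matrix_def
  proof (rule block_matrix_cong)
    fix i j k l assume ij: "i < p" "j < p" and kl: "k < q" "l < q"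
    have "a i j \<in> coeff_span p a" unfolding coeff_span_def using ij by (intro span_base) blast
    then have "\<beta> (\<phi> (a i j) - \<psi> (a i j)) k l = 0" using e kl by (auto simp: W.rep_kernel_def)
    then show "\<beta> (\<phi> (a i j)) k l = \<beta> (\<psi> (a i j)) k l" by (simp add: W.rlin_diff[OF W.matrix_repD(1)[OF b kl]])
  qed
qed

text \<open>By \<open>rep_matrix_eq_iff\<close> the finer matrix determines the coarser one. The
  assignment is real-linear on a finite-dimensional space, hence extends to a bounded map.\<close>

lemma rep_matrix_transfer:
  assumes b: "W.matrix_rep q \<beta>" and b': "W.matrix_rep q' \<beta>'" and sub: "coeff_span p' a' \<subseteq> coeff_span p a" "W.rep_kernel q \<beta> \<subseteq> W.rep_kernel q' \<beta>'"
  shows "\<exists>T. bounded_linear T \<and> (\<forall>\<phi>\<in>Lin. rep_matrix p' a' q' \<beta>' \<phi> = T (rep_matrix p a q \<beta> \<phi>))"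
proof -
  have le: "rep_matrix p' a' q' \<beta>' \<phi> = rep_matrix p' a' q' \<beta>' \<psi>" if "rep_matrix p a q \<beta> \<phi> = rep_matrix p a q \<beta> \<psi>" "\<phi> \<in> Lin" "\<psi> \<in> Lin" for \<phi> \<psi>
    using that(1) sub unfolding rep_matrix_eq_iff[OF b that(2,3)] rep_matrix_eq_iff[OF b' that(2,3)] by blast
  define T0 where "T0 x = rep_matrix p' a' q' \<beta>' (SOME \<phi>. \<phi> \<in> Lin \<and> rep_matrix p a q \<beta> \<phi> = x)" for x
  have T0: "T0 (rep_matrix p a q \<beta> \<phi>) = rep_matrix p' a' q' \<beta>' \<phi>" if \<phi>: "\<phi> \<in> Lin" for \<phi>
    unfolding T0_def
  proof (rule someI2[of "\<lambda>\<psi>. \<psi> \<in> Lin \<and> rep_matrix p a q \<beta> \<psi> = rep_matrix p a q \<beta> \<phi>" \<phi> "\<lambda>\<psi>. rep_matrix p' a' q' \<beta>' \<psi> = rep_matrix p' a' q' \<beta>' \<phi>"])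
    show "\<phi> \<in> Lin \<and> rep_matrix p a q \<beta> \<phi> = rep_matrix p a q \<beta> \<phi>" using \<phi> by blast
    show "rep_matrix p' a' q' \<beta>' \<psi> = rep_matrix p' a' q' \<beta>' \<phi>" if "\<psi> \<in> Lin \<and> rep_matrix p a q \<beta> \<psi> = rep_matrix p a q \<beta> \<phi>" for \<psi>
      using le[of \<psi> \<phi>] that \<phi> by blast
  qed
  have add: "x + y \<in> rep_matrix p a q \<beta> ` Lin \<and> T0 (x + y) = T0 x + T0 y" if x: "x \<in> rep_matrix p a q \<beta> ` Lin" and y: "y \<in> rep_matrix p a q \<beta> ` Lin" for x y
  proof -
    obtain \<phi> \<psi> where \<phi>: "\<phi> \<in> Lin" "x = rep_matrix p a q \<beta> \<phi>" and \<psi>: "\<psi> \<in> Lin" "y = rep_matrix p a q \<beta> \<psi>" using x y by blast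
    have 1: "fun_add \<phi> \<psi> \<in> Lin" by (rule fun_add_Lin[OF \<phi>(1) \<psi>(1)])
    show ?thesis
      unfolding \<phi>(2) \<psi>(2) rep_matrix_add[OF b, symmetric] T0[OF 1] T0[OF \<phi>(1)] T0[OF \<psi>(1)] rep_matrix_add[OF b', symmetric]
      using 1 by blast
  qed
  have scale: "r *\<^sub>R x \<in> rep_matrix p a q \<beta> ` Lin \<and> T0 (r *\<^sub>R x) = r *\<^sub>R T0 x" if x: "x \<in> rep_matrix p a q \<beta> ` Lin" for r x
  proof -
    obtain \<phi> where \<phi>: "\<phi> \<in> Lin" "x = rep_matrix p a q \<beta> \<phi>" using x by blast
    have 1: "fun_rscale r \<phi> \<in> Lin" by (rule fun_rscale_Lin[OF \<phi>(1)])
    show ?thesis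
      unfolding \<phi>(2) rep_matrix_scale[OF b, symmetric] T0[OF 1] T0[OF \<phi>(1)] rep_matrix_scale[OF b', symmetric]
      using 1 by blast
  qed
  have "rep_matrix p a q \<beta> \<eta> \<in> rep_matrix p a q \<beta> ` Lin" by (rule imageI[OF \<eta>_Lin])
  from scale[OF this, of 0] have "Real_Vector_Spaces.subspace (rep_matrix p a q \<beta> ` Lin)"
    unfolding Real_Vector_Spaces.subspace_def using add scale by simp
  moreover have "rep_matrix p a q \<beta> ` Lin \<subseteq> mat.F (p * q)" using rep_matrix_F by blast
  ultimately have "\<exists>T. bounded_linear T \<and> (\<forall>x\<in>rep_matrix p a q \<beta> ` Lin. T x = T0 x)"
    by (rule mat.linear_extension) (use add scale in blast)+
  then show ?thesis using T0 by (auto simp del: mem_Collect_eq)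
qed

\<comment> \<open>An index records only the span of a matrix coalgebra and the kernel of a representation; the
  matrices themselves are chosen afterwards.\<close>
definition coalgs :: "'h set set" where "coalgs = {C. \<exists>p a. matrix_coalgebra p a \<and> C = coeff_span p a}"

lemma coalgs_directed: "C \<in> coalgs \<Longrightarrow> C' \<in> coalgs \<Longrightarrow> \<exists>D\<in>coalgs. C \<subseteq> D \<and> C' \<subseteq> D"
proof -
  assume "C \<in> coalgs" "C' \<in> coalgs"
  then obtain p a p' a' where a: "matrix_coalgebra p a" "C = coeff_span p a" "matrix_coalgebra p' a'" "C' = coeff_span p' a'" by (auto simp: coalgs_def)
  show ?thesis
    unfolding a(2,4)
  proof (rule bexI[of _ "coeff_span (p + p') (blocksum p a a')"], rule conjI[OF coeff_span_blocksum])
    show "coeff_span (p + p') (blocksum p a a') \<in> coalgs" using matrix_coalgebra_blocksum[OF a(1,3)] by (auto simp: coalgs_def)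
  qed
qed

lemma coalgs_cover: "\<exists>C\<in>coalgs. x \<in> C" using exists_matrix_coalgebra[of x] by (auto simp: coalgs_def)

lemma coalgs_cover2: "\<exists>C\<in>coalgs. x \<in> C \<and> y \<in> C"
  using coalgs_cover[of x] coalgs_cover[of y] coalgs_directed by (meson subsetD)

lemma coalgs_cover3: "\<exists>C\<in>coalgs. x \<in> C \<and> y \<in> C \<and> z \<in> C"
  using coalgs_cover2[of x y] coalgs_cover[of z] coalgs_directed by (meson subsetD)

lemma coalgs_subspace: "C \<in> coalgs \<Longrightarrow> subspace C" by (auto simp: coalgs_def coeff_span_def)

section \<open>The index set and its matrices\<close>

definition Idx :: "('h set \<times> 'b set) set" where "Idx = coalgs \<times> W.kernels"
definition below :: "'h set \<times> 'b set \<Rightarrow> 'h set \<times> 'b set \<Rightarrow> bool" where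
  "below i j \<longleftrightarrow> fst i \<subseteq> fst j \<and> snd j \<subseteq> snd i"

definition coalg_data :: "'h set \<Rightarrow> nat \<times> (nat \<Rightarrow> nat \<Rightarrow> 'h)" where
  "coalg_data C = (SOME z. matrix_coalgebra (fst z) (snd z) \<and> C = coeff_span (fst z) (snd z))"
definition rep_data :: "'b set \<Rightarrow> nat \<times> ('b \<Rightarrow> nat \<Rightarrow> nat \<Rightarrow> real)" where
  "rep_data J = (SOME z. W.matrix_rep (fst z) (snd z) \<and> J = W.rep_kernel (fst z) (snd z))"

lemma coalg_data: "C \<in> coalgs \<Longrightarrow> matrix_coalgebra (fst (coalg_data C)) (snd (coalg_data C)) \<and> C = coeff_span (fst (coalg_data C)) (snd (coalg_data C))"
  unfolding coalg_data_def by (rule someI_ex) (auto simp: coalgs_def)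

lemma rep_data: "J \<in> W.kernels \<Longrightarrow> W.matrix_rep (fst (rep_data J)) (snd (rep_data J)) \<and> J = W.rep_kernel (fst (rep_data J)) (snd (rep_data J))"
  unfolding rep_data_def by (rule someI_ex) (auto simp: W.kernels_def)

definition N :: "'h set \<times> 'b set \<Rightarrow> nat" where "N i = fst (coalg_data (fst i)) * fst (rep_data (snd i))"
definition R :: "'h set \<times> 'b set \<Rightarrow> ('h \<Rightarrow> 'b) \<Rightarrow> seqop" where
  "R i = rep_matrix (fst (coalg_data (fst i))) (snd (coalg_data (fst i))) (fst (rep_data (snd i))) (snd (rep_data (snd i)))"

lemma Idx_cases:
  assumes "i \<in> Idx"
  obtains p a q \<beta> where "matrix_coalgebra p a" "W.matrix_rep q \<beta>" "i = (coeff_span p a, W.rep_kernel q \<beta>)" "N i = p * q" "R i = rep_matrix p a q \<beta>"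
  using coalg_data[of "fst i"] rep_data[of "snd i"] assms that unfolding Idx_def N_def R_def
  by (metis mem_Times_iff prod.collapse)

lemma R_eq_iff: "i \<in> Idx \<Longrightarrow> \<phi> \<in> Lin \<Longrightarrow> \<psi> \<in> Lin \<Longrightarrow> R i \<phi> = R i \<psi> \<longleftrightarrow> (\<forall>x\<in>fst i. \<phi> x - \<psi> x \<in> snd i)"
  by (erule Idx_cases) (simp add: rep_matrix_eq_iff del: mem_Collect_eq)

text \<open>The matrices chosen for an index need not be those at hand; passing through
  \<open>rep_matrix_transfer\<close> makes the choice immaterial.\<close>

lemma R_functional:
  assumes i: "i \<in> Idx" and x: "x \<in> fst i" and b: "W.matrix_rep q \<beta>" and sub: "snd i \<subseteq> W.rep_kernel q \<beta>" and kl: "k < q" "l < q"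
  shows "\<exists>T. bounded_linear T \<and> (\<forall>\<phi>\<in>Lin. \<beta> (\<phi> x) k l = T (R i \<phi>))"
proof -
  obtain p a q' \<beta>' where a: "matrix_coalgebra p a" "W.matrix_rep q' \<beta>'" "i = (coeff_span p a, W.rep_kernel q' \<beta>')" "R i = rep_matrix p a q' \<beta>'"
    using Idx_cases[OF i] by metis
  have x': "x \<in> coeff_span p a" using x a(3) by simp
  have sub': "W.rep_kernel q' \<beta>' \<subseteq> W.rep_kernel q \<beta>" using sub a(3) by simp
  obtain T1 where T1: "bounded_linear T1" "\<forall>\<phi>\<in>Lin. \<beta> (\<phi> x) k l = T1 (rep_matrix p a q \<beta> \<phi>)"
    using rep_matrix_functional[OF b x' kl] by meson
  obtain T2 where T2: "bounded_linear T2" "\<forall>\<phi>\<in>Lin. rep_matrix p a q \<beta> \<phi> = T2 (rep_matrix p a q' \<beta>' \<phi>)"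
    using rep_matrix_transfer[OF a(2) b order_refl sub'] by meson
  show ?thesis
    by (rule exI[of _ "\<lambda>r. T1 (T2 r)"], rule conjI[OF bounded_linear_compose[OF T1(1) T2(1)]])
       (use T1(2) T2(2) in \<open>simp add: a(4) del: mem_Collect_eq\<close>)
qed

end

section \<open>Linear maps and characters as a tower\<close>

context hopf_weakly_complete
begin

lemma diff_triangle: "J \<in> W.kernels \<Longrightarrow> x - y \<in> J \<Longrightarrow> z - y \<in> J \<Longrightarrow> x - z \<in> J"
  using W.kernels_closed(3)[of J "x - y" "z - y"] by simp

text \<open>Choose \<open>f i\<close> with the prescribed matrix at each index. Compatibility says
  that the values at \<open>h\<close> agree modulo the kernels, so completeness of \<open>B\<close>
  yields a value at \<open>h\<close>. Linearity of the result holds modulo every kernel, hence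
  exactly.\<close>

lemma R_complete:
  assumes x: "\<And>i. i \<in> Idx \<Longrightarrow> x i \<in> R i ` Lin"
    and compat: "\<And>i j \<phi>. i \<in> Idx \<Longrightarrow> j \<in> Idx \<Longrightarrow> below i j \<Longrightarrow> \<phi> \<in> Lin \<Longrightarrow> R j \<phi> = x j \<Longrightarrow> R i \<phi> = x i"
  shows "\<exists>\<phi>\<in>Lin. \<forall>i\<in>Idx. R i \<phi> = x i"
proof -
  define f where "f i = (SOME \<phi>. \<phi> \<in> Lin \<and> R i \<phi> = x i)" for i
  have f: "f i \<in> Lin \<and> R i (f i) = x i" if i: "i \<in> Idx" for i
  proof -
    obtain \<phi> where "\<phi> \<in> Lin" "x i = R i \<phi>" using x[OF i] by (rule imageE)
    then have "\<phi> \<in> Lin \<and> R i \<phi> = x i" by (simp del: mem_Collect_eq)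
    then show ?thesis unfolding f_def by (rule someI[of "\<lambda>\<phi>. \<phi> \<in> Lin \<and> R i \<phi> = x i"])
  qed
  note fL = f[THEN conjunct1] and fx = f[THEN conjunct2]
  have ff: "f (C', J') h - f (C, J) h \<in> J" if c: "C \<in> coalgs" "C' \<in> coalgs" "C \<subseteq> C'" "J \<in> W.kernels" "J' \<in> W.kernels" "J' \<subseteq> J" "h \<in> C" for C C' J J' h
  proof -
    have i: "(C, J) \<in> Idx" "(C', J') \<in> Idx" by (simp_all add: Idx_def c)
    have "R (C, J) (f (C', J')) = x (C, J)"
      by (rule compat[OF i _ fL[OF i(2)] fx[OF i(2)]]) (simp add: below_def c)
    then have "R (C, J) (f (C', J')) = R (C, J) (f (C, J))" by (simp only: fx[OF i(1)])
    then show ?thesis unfolding R_eq_iff[OF i(1) fL[OF i(2)] fL[OF i(1)]] using c(7) by simp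
  qed
  have "\<exists>b. \<forall>C\<in>coalgs. \<forall>J\<in>W.kernels. h \<in> C \<longrightarrow> b - f (C, J) h \<in> J" for h
  proof -
    \<comment> \<open>The value at \<open>h\<close> is built from one coalgebra \<open>D\<close>
      containing \<open>h\<close>; comparison with another one goes through a coalgebra containing
      both.\<close>
    obtain D where D: "D \<in> coalgs" "h \<in> D" using coalgs_cover by blast
    obtain b where b: "\<And>J. J \<in> W.kernels \<Longrightarrow> b - f (D, J) h \<in> J"
      by (rule W.kernels_complete[of "\<lambda>J. f (D, J) h"], rule ff[OF D(1) D(1) order_refl _ _ _ D(2)], assumption+, rule that, assumption)
    have bC: "b - f (C, J) h \<in> J" if C: "C \<in> coalgs" "J \<in> W.kernels" "h \<in> C" for C J
    proof -
      obtain D' where D': "D' \<in> coalgs" "D \<subseteq> D'" "C \<subseteq> D'" using coalgs_directed[OF D(1) C(1)] by blast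
      have "b - f (D', J) h \<in> J"
        by (rule diff_triangle[OF C(2) b[OF C(2)] ff[OF D(1) D'(1,2) C(2) C(2) order_refl D(2)]])
      note W.kernels_closed(2)[OF C(2) this ff[OF C(1) D'(1,3) C(2) C(2) order_refl C(3)]]
      moreover have "(b - f (D', J) h) + (f (D', J) h - f (C, J) h) = b - f (C, J) h" by simp
      ultimately show ?thesis by simp
    qed
    show ?thesis by (intro exI[of _ b] ballI impI bC)
  qed
  then have exb: "\<forall>h. \<exists>b. \<forall>C\<in>coalgs. \<forall>J\<in>W.kernels. h \<in> C \<longrightarrow> b - f (C, J) h \<in> J" by (rule allI)
  from choice[OF this] obtain g where
    g0: "\<forall>h. \<forall>C\<in>coalgs. \<forall>J\<in>W.kernels. h \<in> C \<longrightarrow> g h - f (C, J) h \<in> J" ..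
  have g: "g h - f (C, J) h \<in> J" if "C \<in> coalgs" "J \<in> W.kernels" "h \<in> C" for h C J
    by (rule g0[THEN spec, THEN bspec, THEN bspec, THEN mp, OF that])
  have gL: "g \<in> Lin"
  proof (rule LinI)
    show "g (u + v) = g u + g v" for u v
    proof -
      obtain C where C: "C \<in> coalgs" "u \<in> C" "v \<in> C" using coalgs_cover2 by blast
      have uv: "u + v \<in> C" by (rule subspace_add[OF coalgs_subspace[OF C(1)] C(2,3)])
      have "g (u + v) - g u - g v = 0"
      proof (rule W.kernels_separate)
        fix J assume J: "J \<in> W.kernels"
        have i: "(C, J) \<in> Idx" using C J by (simp add: Idx_def)
        have "(g (u + v) - f (C, J) (u + v)) - (g u - f (C, J) u) - (g v - f (C, J) v) \<in> J"
          by (rule W.kernels_closed(3)[OF J W.kernels_closed(3)[OF J g[OF C(1) J uv] g[OF C(1) J C(2)]] g[OF C(1) J C(3)]])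
        then show "g (u + v) - g u - g v \<in> J" by (simp add: Lin_add[OF fL[OF i]])
      qed
      then show ?thesis by (simp add: diff_eq_eq add.commute)
    qed
    show "g (smul c u) = sB c (g u)" for c u
    proof -
      obtain C where C: "C \<in> coalgs" "u \<in> C" using coalgs_cover by blast
      have cu: "smul c u \<in> C" by (rule subspace_scale[OF coalgs_subspace[OF C(1)] C(2)])
      have "g (smul c u) - sB c (g u) = 0"
      proof (rule W.kernels_separate)
        fix J assume J: "J \<in> W.kernels"
        have i: "(C, J) \<in> Idx" using C J by (simp add: Idx_def)
        have "(g (smul c u) - f (C, J) (smul c u)) - sB c (g u - f (C, J) u) \<in> J"
          by (rule W.kernels_closed(3)[OF J g[OF C(1) J cu] W.kernels_closed(4)[OF J g[OF C(1) J C(2)]]])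
        moreover have "(g (smul c u) - f (C, J) (smul c u)) - sB c (g u - f (C, J) u) = g (smul c u) - sB c (g u)"
          unfolding Lin_scale[OF fL[OF i]] B.scale_right_diff_distrib by simp
        ultimately show "g (smul c u) - sB c (g u) \<in> J" by (simp only:)
      qed
      then show ?thesis by simp
    qed
  qed
  have Rg: "R i g = x i" if i: "i \<in> Idx" for i
  proof -
    obtain C J where CJ: "i = (C, J)" "C \<in> coalgs" "J \<in> W.kernels" using i by (auto simp: Idx_def)
    have "R i g = R i (f i)" unfolding R_eq_iff[OF i gL fL[OF i]]
      by (rule ballI) (simp only: CJ(1) fst_conv snd_conv g[OF CJ(2,3)])
    then show ?thesis by (simp only: fx[OF i])
  qed
  show ?thesis by (intro bexI[OF _ gL] ballI Rg)
qed

lemma R_continuous_into: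
  fixes X :: "('h \<Rightarrow> 'b) topology"
  assumes g: "g ` topspace X \<subseteq> Lin" and c: "\<And>i. i \<in> Idx \<Longrightarrow> continuous_map X euclidean (\<lambda>x. R i (g x))"
  shows "continuous_map X euclidean g"
proof -
  have "continuous_map X euclidean (\<lambda>x. g x h)" for h
  proof (rule W.continuous_map_matrix_repI)
    fix q \<beta> and k l :: nat assume b: "W.matrix_rep q \<beta>" and kl: "k < q" "l < q"
    obtain C where C: "C \<in> coalgs" "h \<in> C" using coalgs_cover by blast
    define i where "i = (C, W.rep_kernel q \<beta>)"
    have i: "i \<in> Idx" using C W.kernelsI[OF b] by (simp add: i_def Idx_def)
    obtain T where T: "bounded_linear T" "\<forall>\<phi>\<in>Lin. \<beta> (\<phi> h) k l = T (R i \<phi>)"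
      using R_functional[OF i _ b _ kl, of h] C by (auto simp: i_def simp del: mem_Collect_eq)
    have "continuous_map X euclidean (\<lambda>x. T (R i (g x)))"
      by (rule continuous_map_euclidean_compose[OF c[OF i] linear_continuous_on[OF T(1)]])
    then show "continuous_map X euclideanreal (\<lambda>x. \<beta> (g x h) k l)"
    proof (rule continuous_map_eq)
      fix x assume "x \<in> topspace X"
      then have "g x \<in> Lin" by (rule subsetD[OF g imageI])
      from bspec[OF T(2) this] show "T (R i (g x)) = \<beta> (g x h) k l" by (rule sym)
    qed
  qed
  then show ?thesis
    unfolding euclidean_product_topology[symmetric] continuous_map_componentwise_UNIV by blast
qed

text \<open>The equations \<open>\<phi> 1 = 1\<close> and
  \<open>\<phi> (x * y) = \<phi> x * \<phi> y\<close>, seen through a representation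
  \<open>\<beta>\<close>, are polynomial equations in \<open>R i \<phi>\<close> once the coalgebra
  of \<open>i\<close> contains the arguments. They therefore pass to the closure.\<close>

lemma R_closed_Chars:
  assumes \<phi>: "\<phi> \<in> Lin" and cl: "\<And>i. i \<in> Idx \<Longrightarrow> R i \<phi> \<in> closure (R i ` Chars)"
  shows "\<phi> \<in> Chars"
proof (rule CharsI[OF \<phi>])
  have lim: "Q (R i \<phi>)" if "i \<in> Idx" "closed (Collect Q)" "\<And>\<psi>. \<psi> \<in> Chars \<Longrightarrow> Q (R i \<psi>)" for Q i
    using closure_minimal[of "R i ` Chars" "Collect Q"] that cl[OF that(1)] by blast
  have fn: "\<exists>T. bounded_linear T \<and> (\<forall>\<phi>\<in>Lin. \<beta> (\<phi> x) k l = T (R (C, W.rep_kernel q \<beta>) \<phi>))"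
    if "C \<in> coalgs" "x \<in> C" "W.matrix_rep q \<beta>" "k < q" "l < q" for C q \<beta> x k l
    by (rule R_functional[OF _ _ that(3) _ that(4,5)]) (use that W.kernelsI in \<open>auto simp: Idx_def\<close>)
  show "\<phi> 1 = 1"
  proof (rule matrix_rep_eqI)
    fix q \<beta> and k l :: nat assume b: "W.matrix_rep q \<beta>" and kl: "k < q" "l < q"
    obtain C where C: "C \<in> coalgs" "1 \<in> C" using coalgs_cover by blast
    have i: "(C, W.rep_kernel q \<beta>) \<in> Idx" using C W.kernelsI[OF b] by (simp add: Idx_def)
    obtain T where T: "bounded_linear T" "\<forall>\<phi>\<in>Lin. \<beta> (\<phi> 1) k l = T (R (C, W.rep_kernel q \<beta>) \<phi>)"
      using fn[OF C b kl] by meson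
    have "T (R (C, W.rep_kernel q \<beta>) \<phi>) = \<beta> 1 k l"
    proof (rule lim[OF i])
      show "closed {x. T x = \<beta> 1 k l}"
        by (intro closed_Collect_eq linear_continuous_on[OF T(1)] continuous_on_const)
      show "T (R (C, W.rep_kernel q \<beta>) \<psi>) = \<beta> 1 k l" if "\<psi> \<in> Chars" for \<psi>
        using bspec[OF T(2) Chars_Lin[OF that]] Chars_one[OF that] by simp
    qed
    then show "\<beta> (\<phi> 1) k l = \<beta> 1 k l" using bspec[OF T(2) \<phi>] by simp
  qed
  show "\<phi> (x * y) = \<phi> x * \<phi> y" for x y
  proof (rule matrix_rep_eqI)
    fix q \<beta> and k l :: nat assume b: "W.matrix_rep q \<beta>" and kl: "k < q" "l < q"
    obtain C where C: "C \<in> coalgs" "x \<in> C" "y \<in> C" "x * y \<in> C" using coalgs_cover3 by blast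
    let ?i = "(C, W.rep_kernel q \<beta>)"
    have i: "?i \<in> Idx" using C W.kernelsI[OF b] by (simp add: Idx_def)
    obtain T where T: "bounded_linear T" "\<forall>\<phi>\<in>Lin. \<beta> (\<phi> (x * y)) k l = T (R ?i \<phi>)"
      using fn[OF C(1,4) b kl] by meson
    have "\<forall>m. \<exists>T. m < q \<longrightarrow> bounded_linear T \<and> (\<forall>\<phi>\<in>Lin. \<beta> (\<phi> x) k m = T (R ?i \<phi>))"
      using fn[OF C(1,2) b kl(1)] by meson
    from choice[OF this] obtain T1 where T1: "\<forall>m. m < q \<longrightarrow> bounded_linear (T1 m) \<and> (\<forall>\<phi>\<in>Lin. \<beta> (\<phi> x) k m = T1 m (R ?i \<phi>))" ..
    have "\<forall>m. \<exists>T. m < q \<longrightarrow> bounded_linear T \<and> (\<forall>\<phi>\<in>Lin. \<beta> (\<phi> y) m l = T (R ?i \<phi>))"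
      using fn[OF C(1,3) b _ kl(2)] by meson
    from choice[OF this] obtain T2 where T2: "\<forall>m. m < q \<longrightarrow> bounded_linear (T2 m) \<and> (\<forall>\<phi>\<in>Lin. \<beta> (\<phi> y) m l = T2 m (R ?i \<phi>))" ..
    have prod: "\<beta> (\<psi> x * \<psi> y) k l = (\<Sum>m<q. T1 m (R ?i \<psi>) * T2 m (R ?i \<psi>))" if \<psi>: "\<psi> \<in> Lin" for \<psi>
      unfolding W.matrix_repD(4)[OF b kl] by (rule sum.cong) (use T1 T2 \<psi> in auto)
    have "T (R ?i \<phi>) = (\<Sum>m<q. T1 m (R ?i \<phi>) * T2 m (R ?i \<phi>))"
    proof (rule lim[OF i])
      have "continuous_on UNIV (T1 m)" "continuous_on UNIV (T2 m)" if "m < q" for m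
        using T1 T2 that linear_continuous_on by blast+
      then show "closed {x. T x = (\<Sum>m<q. T1 m x * T2 m x)}"
        by (intro closed_Collect_eq linear_continuous_on[OF T(1)] continuous_on_sum continuous_on_mult) auto
      show "T (R ?i \<psi>) = (\<Sum>m<q. T1 m (R ?i \<psi>) * T2 m (R ?i \<psi>))" if \<psi>: "\<psi> \<in> Chars" for \<psi>
        using bspec[OF T(2) Chars_Lin[OF \<psi>]] prod[OF Chars_Lin[OF \<psi>]] by (simp add: Chars_mult[OF \<psi>])
    qed
    then show "\<beta> (\<phi> (x * y)) k l = \<beta> (\<phi> x * \<phi> y) k l" using bspec[OF T(2) \<phi>] prod[OF \<phi>] by simp
  qed
qed

sublocale T: tower Idx below N R Lin fun_add fun_rscale star \<eta> Chars
proof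
  show "Idx \<noteq> {}" using coalgs_cover W.kernels_UNIV by (auto simp: Idx_def)
  fix i :: "'h set \<times> 'b set" assume i: "i \<in> Idx"
  show "below i i" by (simp add: below_def)
  show "below i k" if "below i j" "below j k" for j k using that by (auto simp: below_def)
  show "\<exists>k\<in>Idx. below i k \<and> below j k" if j: "j \<in> Idx" for j
  proof -
    obtain D where "D \<in> coalgs" "fst i \<subseteq> D" "fst j \<subseteq> D" using coalgs_directed[of "fst i" "fst j"] i j by (auto simp: Idx_def)
    moreover have "snd i \<inter> snd j \<in> W.kernels" using i j by (auto simp: Idx_def intro: W.kernels_Int)
    ultimately show ?thesis by (intro bexI[of _ "(D, snd i \<inter> snd j)"]) (auto simp: below_def Idx_def)
  qed
  obtain p a q \<beta> where pq: "matrix_coalgebra p a" "W.matrix_rep q \<beta>" "N i = p * q" "R i = rep_matrix p a q \<beta>" using Idx_cases[OF i] by metis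
  fix \<phi> assume \<phi>: "\<phi> \<in> Lin"
  show "R i (fun_rscale r \<phi>) = r *\<^sub>R R i \<phi>" for r by (simp add: pq rep_matrix_scale)
  show "R i \<phi> \<in> mat.F (N i)" by (simp only: pq rep_matrix_F)
  fix \<psi> assume \<psi>: "\<psi> \<in> Lin"
  show "R i (fun_add \<phi> \<psi>) = R i \<phi> + R i \<psi>" by (simp only: pq rep_matrix_add[OF pq(2)])
  show "R i (star \<phi> \<psi>) = R i \<phi> * R i \<psi>" by (simp only: pq rep_matrix_star[OF pq(2,1) \<phi> \<psi>])
next
  fix i :: "'h set \<times> 'b set" assume i: "i \<in> Idx"
  obtain p a q \<beta> where pq: "matrix_coalgebra p a" "W.matrix_rep q \<beta>" "N i = p * q" "R i = rep_matrix p a q \<beta>" using Idx_cases[OF i] by metis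
  show "continuous_on Lin (R i)" unfolding pq by (rule continuous_on_rep_matrix[OF pq(2)])
next
  fix \<phi> \<psi> assume \<phi>: "\<phi> \<in> Lin" and \<psi>: "\<psi> \<in> Lin"
  show "fun_add \<phi> \<psi> \<in> Lin" by (rule fun_add_Lin[OF \<phi> \<psi>])
  show "star \<phi> \<psi> \<in> Lin" by (rule star_Lin[OF \<phi> \<psi>])
  show "star \<eta> \<phi> = \<phi>" "star \<phi> \<eta> = \<phi>" by (rule star_unit[OF \<phi>])+
  show "fun_rscale r \<phi> \<in> Lin" for r by (rule fun_rscale_Lin[OF \<phi>])
  show "\<phi> = \<psi>" if e: "\<And>i. i \<in> Idx \<Longrightarrow> R i \<phi> = R i \<psi>"
  proof
    fix h
    obtain C where C: "C \<in> coalgs" "h \<in> C" using coalgs_cover by blast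
    have "\<phi> h - \<psi> h = 0"
    proof (rule W.kernels_separate)
      fix J assume "J \<in> W.kernels"
      then have i: "(C, J) \<in> Idx" using C by (simp add: Idx_def)
      show "\<phi> h - \<psi> h \<in> J" using R_eq_iff[OF i \<phi> \<psi>] e[OF i] C(2) by simp
    qed
    then show "\<phi> h = \<psi> h" by simp
  qed
  show "R i \<phi> = R i \<psi>" if i: "i \<in> Idx" "j \<in> Idx" "below i j" "R j \<phi> = R j \<psi>" for i j
    using i(3,4) R_eq_iff[OF i(1) \<phi> \<psi>] R_eq_iff[OF i(2) \<phi> \<psi>] unfolding below_def by blast
next
  fix \<phi> assume \<phi>: "\<phi> \<in> Chars"
  show "\<exists>\<psi>\<in>Chars. star \<phi> \<psi> = \<eta> \<and> star \<psi> \<phi> = \<eta>"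
    using antipode_Chars[OF \<phi>] antipode_inverse[OF \<phi>] by blast
next
  show "\<exists>\<phi>\<in>Lin. \<forall>i\<in>Idx. R i \<phi> = x i"
    if "\<And>i. i \<in> Idx \<Longrightarrow> x i \<in> R i ` Lin"
      "\<And>i j \<phi>. i \<in> Idx \<Longrightarrow> j \<in> Idx \<Longrightarrow> below i j \<Longrightarrow> \<phi> \<in> Lin \<Longrightarrow> R j \<phi> = x j \<Longrightarrow> R i \<phi> = x i" for x
    by (rule R_complete[OF that])
  show "continuous_map X euclidean g"
    if "g ` topspace X \<subseteq> Lin" "\<And>i. i \<in> Idx \<Longrightarrow> continuous_map X euclidean (\<lambda>x. R i (g x))" for X :: "('h \<Rightarrow> 'b) topology" and g
    by (rule R_continuous_into[OF that])
  show "\<phi> \<in> Chars" if "\<phi> \<in> Lin" "\<And>i. i \<in> Idx \<Longrightarrow> R i \<phi> \<in> closure (R i ` Chars)" for \<phi>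
    by (rule R_closed_Chars[OF that])
  show "\<eta> \<in> Lin" by (rule \<eta>_Lin)
  show "\<eta> \<in> Chars" by (rule \<eta>_Chars)
  show "Chars \<subseteq> Lin" by (rule subsetI) (rule Chars_Lin)
  show "star \<phi> \<psi> \<in> Chars" if "\<phi> \<in> Chars" "\<psi> \<in> Chars" for \<phi> \<psi> by (rule star_Chars[OF that])
qed

end

lemma sum_rect_delta:
  fixes f :: "nat \<Rightarrow> nat \<Rightarrow> 'b::{comm_ring,comm_monoid_mult}"
  assumes "j < p" "l < q"
  shows "(\<Sum>s<p. \<Sum>t<q. f s t * ((if s = j then g t else 0) + (if t = l then h s else 0))) =
    (\<Sum>t<q. f j t * g t) + (\<Sum>s<p. f s l * h s)"
proof -
  have "(\<Sum>s<p. \<Sum>t<q. f s t * ((if s = j then g t else 0) + (if t = l then h s else 0))) =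
      (\<Sum>s<p. \<Sum>t<q. (if s = j then f s t * g t else 0) + (if t = l then f s t * h s else 0))"
    by (intro sum.cong refl) (auto simp: distrib_left)
  also have "\<dots> = (\<Sum>s<p. if s = j then \<Sum>t<q. f s t * g t else 0) + (\<Sum>s<p. \<Sum>t<q. if t = l then f s t * h s else 0)"
    unfolding sum.distrib by (intro arg_cong2[of _ _ _ _ "(+)"] sum.cong refl) auto
  finally show ?thesis using assms by simp
qed

section \<open>Infinitesimal characters\<close>

context hopf_weakly_complete
begin

lemma InfI: "\<phi> \<in> Lin \<Longrightarrow> (\<And>x y. \<phi> (x * y) = sB (\<epsilon> x) (\<phi> y) + sB (\<epsilon> y) (\<phi> x)) \<Longrightarrow> \<phi> \<in> Inf"
  by (simp add: infinitesimal_characters_def)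

lemma Inf_Lin: "\<phi> \<in> Inf \<Longrightarrow> \<phi> \<in> Lin"
  and Inf_mult: "\<phi> \<in> Inf \<Longrightarrow> \<phi> (x * y) = sB (\<epsilon> x) (\<phi> y) + sB (\<epsilon> y) (\<phi> x)"
  by (simp_all add: infinitesimal_characters_def)

lemma Inf_one: "\<phi> \<in> Inf \<Longrightarrow> \<phi> 1 = 0"
  using Inf_mult[of \<phi> 1 1] by (simp add: counit_one)

text \<open>On a Kronecker product of matrix coalgebras an infinitesimal character takes the form of
  a Kronecker sum.\<close>

lemma Inf_matrix_coalgebra:
  assumes "\<phi> \<in> Inf" "matrix_coalgebra p a" "matrix_coalgebra q b" "i < p" "j < p" "k < q" "l < q"
  shows "\<phi> (a i j * b k l) = (if i = j then \<phi> (b k l) else 0) + (if k = l then \<phi> (a i j) else 0)"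
  using assms(2-) by (simp add: Inf_mult[OF assms(1)] matrix_coalgebra_\<epsilon>)

text \<open>The product of two Kronecker sums. Its two mixed terms are exchanged with each other
  when \<open>\<phi>\<close> and \<open>\<psi>\<close> are swapped, as \<open>B\<close> is
  commutative; they cancel in the bracket, and what is left is again a Kronecker sum.\<close>

lemma star_Inf_matrix_coalgebra:
  assumes \<phi>: "\<phi> \<in> Inf" and \<psi>: "\<psi> \<in> Inf" and a: "matrix_coalgebra p a" "matrix_coalgebra q b" "i < p" "j < p" "k < q" "l < q"
  shows "star \<phi> \<psi> (a i j * b k l) = (if i = j then star \<phi> \<psi> (b k l) else 0) + \<phi> (a i j) * \<psi> (b k l)
    + \<phi> (b k l) * \<psi> (a i j) + (if k = l then star \<phi> \<psi> (a i j) else 0)"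
proof -
  note L = Inf_Lin[OF \<phi>] Inf_Lin[OF \<psi>]
  have "star \<phi> \<psi> (a i j * b k l) = (\<Sum>s<p. \<Sum>t<q. \<phi> (a i s * b k t) * \<psi> (a s j * b t l))"
    by (rule star_mult_matrix_coalgebra[OF a L])
  also have "\<dots> = (\<Sum>s<p. \<Sum>t<q. \<phi> (a i s * b k t) * ((if s = j then \<psi> (b t l) else 0) + (if t = l then \<psi> (a s j) else 0)))"
    using a by (intro sum.cong refl arg_cong2[of _ _ _ _ "(*)"]) (simp add: Inf_matrix_coalgebra[OF \<psi> a(1,2)])
  also have "\<dots> = (\<Sum>t<q. \<phi> (a i j * b k t) * \<psi> (b t l)) + (\<Sum>s<p. \<phi> (a i s * b k l) * \<psi> (a s j))"
    by (rule sum_rect_delta[OF a(4,6)])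
  also have "(\<Sum>t<q. \<phi> (a i j * b k t) * \<psi> (b t l)) =
      (\<Sum>t<q. (if i = j then \<phi> (b k t) * \<psi> (b t l) else 0) + (if t = k then \<phi> (a i j) * \<psi> (b k l) else 0))"
    using a by (intro sum.cong refl) (auto simp: Inf_matrix_coalgebra[OF \<phi> a(1,2)] distrib_right)
  also have "\<dots> = (if i = j then star \<phi> \<psi> (b k l) else 0) + \<phi> (a i j) * \<psi> (b k l)"
    using a by (simp add: sum.distrib star_matrix_coalgebra[OF a(2) L])
  also have "(\<Sum>s<p. \<phi> (a i s * b k l) * \<psi> (a s j)) =
      (\<Sum>s<p. (if s = i then \<phi> (b k l) * \<psi> (a i j) else 0) + (if k = l then \<phi> (a i s) * \<psi> (a s j) else 0))"
    using a by (intro sum.cong refl) (auto simp: Inf_matrix_coalgebra[OF \<phi> a(1,2)] distrib_right)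
  also have "\<dots> = \<phi> (b k l) * \<psi> (a i j) + (if k = l then star \<phi> \<psi> (a i j) else 0)"
    using a by (simp add: sum.distrib star_matrix_coalgebra[OF a(1) L])
  finally show ?thesis by (simp add: add.assoc)
qed

definition bracket :: "('h \<Rightarrow> 'b) \<Rightarrow> ('h \<Rightarrow> 'b) \<Rightarrow> 'h \<Rightarrow> 'b" where "bracket \<phi> \<psi> = (\<lambda>x. star \<phi> \<psi> x - star \<psi> \<phi> x)"

lemma bracket_eq: "bracket \<phi> \<psi> = fun_add (star \<phi> \<psi>) (fun_rscale (-1) (star \<psi> \<phi>))"
  by (rule ext) (simp add: bracket_def fun_add_def fun_rscale_def)

lemma bracket_Lin: "\<phi> \<in> Lin \<Longrightarrow> \<psi> \<in> Lin \<Longrightarrow> bracket \<phi> \<psi> \<in> Lin"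
  unfolding bracket_eq by (intro fun_add_Lin fun_rscale_Lin star_Lin)

lemma sB_mult_\<eta>: "sB (\<epsilon> x) y = \<eta> x * y"
  unfolding \<eta>_def using B.smul_mult_left[of "\<epsilon> x" 1 y] by simp

lemma bracket_Inf:
  assumes \<phi>: "\<phi> \<in> Inf" and \<psi>: "\<psi> \<in> Inf"
  shows "bracket \<phi> \<psi> \<in> Inf"
proof (rule InfI)
  note L = Inf_Lin[OF \<phi>] Inf_Lin[OF \<psi>]
  show bL: "bracket \<phi> \<psi> \<in> Lin" by (rule bracket_Lin[OF L])
  note s = Lin_mult_const[OF bL] Lin_mult_const[OF \<eta>_Lin]
  have G1: "(\<lambda>x. \<eta> x * bracket \<phi> \<psi> y + \<eta> y * bracket \<phi> \<psi> x) \<in> Lin" for y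
    using fun_add_Lin[OF s(3)[of "bracket \<phi> \<psi> y"] s(2)[of "\<eta> y"]] by (simp only: fun_add_def)
  have G2: "(\<lambda>y. \<eta> x * bracket \<phi> \<psi> y + \<eta> y * bracket \<phi> \<psi> x) \<in> Lin" for x
    using fun_add_Lin[OF s(2)[of "\<eta> x"] s(3)[of "bracket \<phi> \<psi> x"]] by (simp only: fun_add_def)
  have "bracket \<phi> \<psi> (x * y) = \<eta> x * bracket \<phi> \<psi> y + \<eta> y * bracket \<phi> \<psi> x" for x y
  proof (rule bilinear_eqI[of "\<lambda>x y. bracket \<phi> \<psi> (x * y)" "\<lambda>x y. \<eta> x * bracket \<phi> \<psi> y + \<eta> y * bracket \<phi> \<psi> x"])
    fix p a q b i j k l assume a: "matrix_coalgebra p a" "matrix_coalgebra q b" "i < p" "j < p" "k < q" "l < q"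
    show "bracket \<phi> \<psi> (a i j * b k l) = \<eta> (a i j) * bracket \<phi> \<psi> (b k l) + \<eta> (b k l) * bracket \<phi> \<psi> (a i j)"
      unfolding bracket_def star_Inf_matrix_coalgebra[OF \<phi> \<psi> a] star_Inf_matrix_coalgebra[OF \<psi> \<phi> a]
      using a by (simp add: \<eta>_matrix_coalgebra mult.commute algebra_simps)
  qed (rule Lin_translate[OF bL] G1 G2)+
  then show "bracket \<phi> \<psi> (x * y) = sB (\<epsilon> x) (bracket \<phi> \<psi> y) + sB (\<epsilon> y) (bracket \<phi> \<psi> x)" for x y by (simp only: sB_mult_\<eta>)
qed

lemma fun_add_Inf: "\<phi> \<in> Inf \<Longrightarrow> \<psi> \<in> Inf \<Longrightarrow> fun_add \<phi> \<psi> \<in> Inf"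
  by (rule InfI[OF fun_add_Lin[OF Inf_Lin Inf_Lin]])
     (simp_all add: fun_add_def Inf_mult B.scale_right_distrib)

lemma fun_rscale_Inf: "\<phi> \<in> Inf \<Longrightarrow> fun_rscale r \<phi> \<in> Inf"
  by (rule InfI[OF fun_rscale_Lin[OF Inf_Lin]])
     (simp_all add: fun_rscale_def Inf_mult B.scale_right_distrib mult.commute)

lemma R_bracket: "i \<in> Idx \<Longrightarrow> \<phi> \<in> Lin \<Longrightarrow> \<psi> \<in> Lin \<Longrightarrow> R i (bracket \<phi> \<psi>) = R i \<phi> * R i \<psi> - R i \<psi> * R i \<phi>"
  unfolding bracket_eq
  by (simp only: T.R(1)[OF _ star_Lin fun_rscale_Lin[OF star_Lin]] T.R(2)[OF _ star_Lin] T.R(3)) simp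

section \<open>Curves that are exponentials at every stage\<close>

context
  fixes \<phi> and X :: "real \<Rightarrow> 'h \<Rightarrow> 'b"
  assumes \<phi>: "\<phi> \<in> Lin" and XL: "\<And>t. X t \<in> Lin" and Xexp: "\<And>i t. i \<in> Idx \<Longrightarrow> T.\<rho> i (X t) = exp (t *\<^sub>R R i \<phi>)"
begin

lemma X_0: "X 0 = \<eta>"
  by (rule T.\<rho>_inj[OF XL \<eta>_Lin]) (simp add: Xexp T.\<rho>_\<eta>)

text \<open>This is the equation \<open>X' = star X \<phi>\<close>, obtained at one stage and read
  through a single entry, since \<open>B\<close> itself carries no norm.\<close>

lemma X_derivative:
  assumes b: "W.matrix_rep q \<beta>" and kl: "k < q" "l < q"
  shows "((\<lambda>t. \<beta> (X t x) k l) has_real_derivative \<beta> (star (X t) \<phi> x) k l) (at t)"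
proof -
  obtain C where C: "C \<in> coalgs" "x \<in> C" using coalgs_cover by blast
  define i where "i = (C, W.rep_kernel q \<beta>)"
  have i: "i \<in> Idx" using C W.kernelsI[OF b] by (simp add: i_def Idx_def)
  have "x \<in> fst i" "snd i \<subseteq> W.rep_kernel q \<beta>" using C by (simp_all add: i_def)
  then obtain T where T: "bounded_linear T" "\<forall>\<phi>\<in>Lin. \<beta> (\<phi> x) k l = T (R i \<phi>)"
    using R_functional[OF i _ b _ kl] by meson
  have RX: "R i (X t) = exp (t *\<^sub>R R i \<phi>) - T.E i" for t using Xexp[OF i, of t] by (simp add: T.\<rho>_def algebra_simps)
  \<comment> \<open>The complementary idempotent disappears after multiplication with the generator,
    so the derivative comes from the linear map \<open>star (X t) \<phi>\<close>.\<close>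
  have "T.E i * R i \<phi> = 0"
    using T.R(3)[OF i \<eta>_Lin \<phi>] star_unit(1)[OF \<phi>] by (simp add: T.E_def left_diff_distrib)
  then have e: "exp (t *\<^sub>R R i \<phi>) * R i \<phi> = R i (star (X t) \<phi>)"
    by (simp add: T.R(3)[OF i XL \<phi>] RX left_diff_distrib)
  have "((\<lambda>t. exp (t *\<^sub>R R i \<phi>) - T.E i) has_vector_derivative exp (t *\<^sub>R R i \<phi>) * R i \<phi> - 0) (at t)"
    by (intro has_vector_derivative_diff exp_scaleR_has_vector_derivative_right has_vector_derivative_const)
  then have "((\<lambda>t. R i (X t)) has_vector_derivative R i (star (X t) \<phi>)) (at t)" by (simp add: RX e)
  from bounded_linear.has_vector_derivative[OF T(1) this]
  show ?thesis
    unfolding has_real_derivative_iff_has_vector_derivative bspec[OF T(2) XL] bspec[OF T(2) star_Lin[OF XL \<phi>]] .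
qed

lemma X_mult_derivative:
  assumes b: "W.matrix_rep q \<beta>" and kl: "k < q" "l < q"
  shows "((\<lambda>t. \<beta> (X t x * X t y) k l) has_real_derivative
    \<beta> (star (X t) \<phi> x * X t y + X t x * star (X t) \<phi> y) k l) (at t)"
proof -
  have "((\<lambda>t. \<Sum>m<q. \<beta> (X t x) k m * \<beta> (X t y) m l) has_real_derivative
      (\<Sum>m<q. \<beta> (X t x) k m * \<beta> (star (X t) \<phi> y) m l + \<beta> (star (X t) \<phi> x) k m * \<beta> (X t y) m l)) (at t)"
    by (intro DERIV_sum DERIV_mult' X_derivative[OF b] kl) auto
  then show ?thesis
    by (simp add: W.matrix_repD(4)[OF b kl] W.rlin_add[OF W.matrix_repD(1)[OF b kl]] sum.distrib add.commute)
qed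

text \<open>Differentiate the multiplicativity of \<open>X t\<close> at \<open>t = 0\<close>, where
  \<open>X 0 = \<eta>\<close>: the product rule becomes the defining identity.\<close>

lemma Chars_imp_Inf:
  assumes ch: "\<And>t. X t \<in> Chars"
  shows "\<phi> \<in> Inf"
proof (rule InfI[OF \<phi>])
  show "\<phi> (x * y) = sB (\<epsilon> x) (\<phi> y) + sB (\<epsilon> y) (\<phi> x)" for x y
  proof (rule matrix_rep_eqI)
    fix q \<beta> and k l :: nat assume b: "W.matrix_rep q \<beta>" and kl: "k < q" "l < q"
    have "((\<lambda>t. \<beta> (X t (x * y)) k l) has_real_derivative \<beta> (\<phi> (x * y)) k l) (at 0)"
      using X_derivative[OF b kl, of "x * y" 0] by (simp add: X_0 star_unit(1)[OF \<phi>])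
    moreover have "((\<lambda>t. \<beta> (X t (x * y)) k l) has_real_derivative \<beta> (\<phi> x * \<eta> y + \<eta> x * \<phi> y) k l) (at 0)"
      using X_mult_derivative[OF b kl, of x y 0] by (simp add: X_0 star_unit(1)[OF \<phi>] Chars_mult[OF ch])
    ultimately have "\<beta> (\<phi> (x * y)) k l = \<beta> (\<phi> x * \<eta> y + \<eta> x * \<phi> y) k l" by (rule DERIV_unique)
    then show "\<beta> (\<phi> (x * y)) k l = \<beta> (sB (\<epsilon> x) (\<phi> y) + sB (\<epsilon> y) (\<phi> x)) k l"
      by (simp only: sB_mult_\<eta> mult.commute[of "\<phi> x"] add.commute)
  qed
qed

\<comment> \<open>On a Kronecker product of matrix coalgebras both sides of the multiplicativity condition
  solve the same linear differential equation.\<close>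
lemma Inf_imp_Chars:
  assumes I: "\<phi> \<in> Inf"
  shows "X t \<in> Chars"
proof (rule CharsI[OF XL])
  show "X t 1 = 1"
  proof (rule matrix_rep_eqI)
    fix r \<beta> and k l :: nat assume b: "W.matrix_rep r \<beta>" and kl: "k < r" "l < r"
    have z: "star (X t) \<phi> 1 = 0" for t
      using lift_one[OF VB bilin_star[OF XL \<phi>]] by (simp add: star_lift Inf_one[OF I])
    have "((\<lambda>t. \<beta> (X t 1) k l) has_real_derivative 0) (at t)" for t
      using X_derivative[OF b kl, of 1 t] by (simp add: z W.rlin_0[OF W.matrix_repD(1)[OF b kl]])
    then have "\<beta> (X t 1) k l = \<beta> (X 0 1) k l" using DERIV_isconst_all by blast
    then show "\<beta> (X t 1) k l = \<beta> 1 k l" by (simp add: X_0 Chars_one[OF \<eta>_Chars])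
  qed
  show "X t (x * y) = X t x * X t y" for x y
  proof (rule bilinear_eqI[of "\<lambda>x y. X t (x * y)" "\<lambda>x y. X t x * X t y"])
    fix p a q b i j k l assume a: "matrix_coalgebra p a" and b: "matrix_coalgebra q b" and ij: "i < p" "j < p" and kl: "k < q" "l < q"
    let ?c = "kron q a b"
    have c: "matrix_coalgebra (p * q) ?c" by (rule matrix_coalgebra_kron[OF a b])
    define w where "w K L = \<phi> (?c K L)" for K L
    define u1 where "u1 t K L = X t (?c K L)" for t K L
    define u2 where "u2 t K L = X t (a (K div q) (L div q)) * X t (b (K mod q) (L mod q))" for t K L
    show "X t (a i j * b k l) = X t (a i j) * X t (b k l)"
    proof (rule matrix_rep_eqI)
      fix r \<beta> and m n :: nat assume r: "W.matrix_rep r \<beta>" and mn: "m < r" "n < r"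
      let ?M = "block_matrix (p * q) r \<beta>"
      have 1: "((\<lambda>t. ?M (u1 t)) has_vector_derivative ?M (u1 t) * ?M w) (at t)" for t
        unfolding block_matrix_mult[OF r]
      proof (rule block_matrix_has_vector_derivative)
        fix K L k' l' assume KL: "K < p * q" "L < p * q" and kl': "k' < r" "l' < r"
        show "((\<lambda>t. \<beta> (u1 t K L) k' l') has_real_derivative \<beta> (\<Sum>s<p * q. u1 t K s * w s L) k' l') (at t)"
          using X_derivative[OF r kl', of "?c K L" t] unfolding u1_def w_def star_matrix_coalgebra[OF c XL \<phi> KL] .
      qed
      have 2: "((\<lambda>t. ?M (u2 t)) has_vector_derivative ?M (u2 t) * ?M w) (at t)" for t
        unfolding block_matrix_mult[OF r]
      proof (rule block_matrix_has_vector_derivative)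
        fix K L k' l' assume KL: "K < p * q" "L < p * q" and kl': "k' < r" "l' < r"
        note bounds = div_mod_bounds(1)[OF KL(1)] div_mod_bounds(1)[OF KL(2)] div_mod_bounds(2)[OF KL(1)] div_mod_bounds(2)[OF KL(2)]
        let ?K = "K div q" and ?K' = "K mod q" and ?L = "L div q" and ?L' = "L mod q"
        have "(\<Sum>s<p * q. u2 t K s * w s L) =
            (\<Sum>s<p. \<Sum>s'<q. (X t (a ?K s) * X t (b ?K' s')) * \<phi> (a s ?L * b s' ?L'))"
          using sum_rect[of "\<lambda>s s'. (X t (a ?K s) * X t (b ?K' s')) * \<phi> (a s ?L * b s' ?L')" q p]
          by (simp add: u2_def w_def kron_def)
        \<comment> \<open>As \<open>w\<close> is a Kronecker sum, multiplication by it
          differentiates the two factors of \<open>u2\<close> one at a time, as the product rule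
          does.\<close>
        also have "\<dots> = (\<Sum>s<p. \<Sum>s'<q. (X t (a ?K s) * X t (b ?K' s')) *
            ((if s = ?L then \<phi> (b s' ?L') else 0) + (if s' = ?L' then \<phi> (a s ?L) else 0)))"
          by (intro sum.cong refl arg_cong2[of _ _ _ _ "(*)"]) (simp add: Inf_matrix_coalgebra[OF I a b] bounds)
        also have "\<dots> = (\<Sum>s'<q. (X t (a ?K ?L) * X t (b ?K' s')) * \<phi> (b s' ?L')) + (\<Sum>s<p. (X t (a ?K s) * X t (b ?K' ?L')) * \<phi> (a s ?L))"
          by (rule sum_rect_delta[OF bounds(2,4)])
        also have "\<dots> = star (X t) \<phi> (a ?K ?L) * X t (b ?K' ?L') + X t (a ?K ?L) * star (X t) \<phi> (b ?K' ?L')"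
          unfolding star_matrix_coalgebra[OF a XL \<phi> bounds(1,2)] star_matrix_coalgebra[OF b XL \<phi> bounds(3,4)]
          by (simp add: sum_distrib_left sum_distrib_right mult_ac add.commute)
        finally have e: "(\<Sum>s<p * q. u2 t K s * w s L) =
            star (X t) \<phi> (a ?K ?L) * X t (b ?K' ?L') + X t (a ?K ?L) * star (X t) \<phi> (b ?K' ?L')" .
        show "((\<lambda>t. \<beta> (u2 t K L) k' l') has_real_derivative \<beta> (\<Sum>s<p * q. u2 t K s * w s L) k' l') (at t)"
          unfolding e unfolding u2_def by (rule X_mult_derivative[OF r kl'])
      qed
      have "?M (u1 0) = ?M (u2 0)"
        by (rule block_matrix_cong) (simp add: u1_def u2_def X_0 kron_def Chars_mult[OF \<eta>_Chars])
      then have "?M (u1 t) = ?M (u2 t)"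
        using vector_derivative_right_mult_imp_exp[of "\<lambda>t. ?M (u1 t)" "?M w", OF 1, of t]
          vector_derivative_right_mult_imp_exp[of "\<lambda>t. ?M (u2 t)" "?M w", OF 2, of t] by simp
      then have "\<beta> (u1 t (i * q + k) (j * q + l)) m n = \<beta> (u2 t (i * q + k) (j * q + l)) m n"
        using entry_block_matrix[OF rect_index(1)[OF ij(1) kl(1)] rect_index(1)[OF ij(2) kl(2)] mn, of \<beta> "u1 t"]
          entry_block_matrix[OF rect_index(1)[OF ij(1) kl(1)] rect_index(1)[OF ij(2) kl(2)] mn, of \<beta> "u2 t"] by simp
      then show "\<beta> (X t (a i j * b k l)) m n = \<beta> (X t (a i j) * X t (b k l)) m n"
        unfolding u1_def u2_def kron_def rect_index[OF ij(1) kl(1)] rect_index[OF ij(2) kl(2)] .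
    qed
  qed (rule Lin_translate[OF XL] Lin_mult_const[OF XL])+
qed

end

sublocale TL: tower_lie Idx below N R Lin fun_add fun_rscale star \<eta> Chars Inf bracket
proof
  show "Inf \<subseteq> Lin" by (rule subsetI) (rule Inf_Lin)
  fix \<phi> assume \<phi>: "\<phi> \<in> Inf"
  show "fun_rscale r \<phi> \<in> Inf" for r by (rule fun_rscale_Inf[OF \<phi>])
  fix \<psi> assume \<psi>: "\<psi> \<in> Inf"
  show "fun_add \<phi> \<psi> \<in> Inf" by (rule fun_add_Inf[OF \<phi> \<psi>])
  show "bracket \<phi> \<psi> \<in> Inf" by (rule bracket_Inf[OF \<phi> \<psi>])
  show "R i (bracket \<phi> \<psi>) = R i \<phi> * R i \<psi> - R i \<psi> * R i \<phi>" if "i \<in> Idx" for i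
    by (rule R_bracket[OF that Inf_Lin[OF \<phi>] Inf_Lin[OF \<psi>]])
next
  fix \<phi> X assume a: "\<phi> \<in> Lin" "\<And>t. X t \<in> Lin" "\<And>i t. i \<in> Idx \<Longrightarrow> T.\<rho> i (X t) = exp (t *\<^sub>R R i \<phi>)"
  show "\<phi> \<in> Inf \<longleftrightarrow> (\<forall>t. X t \<in> Chars)"
  proof
    show "\<forall>t. X t \<in> Chars" if "\<phi> \<in> Inf" by (rule allI) (rule Inf_imp_Chars[OF a that])
    show "\<phi> \<in> Inf" if "\<forall>t. X t \<in> Chars" by (rule Chars_imp_Inf[OF a], assumption, rule spec[OF that])
  qed
qed

lemma top_grp_eq: "T.top_grp = character_group smul \<Delta> \<epsilon> sB"
  unfolding T.top_grp_def character_group_def by (simp add: \<eta>_def[abs_def])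

lemma lie_alg_eq: "TL.lie_alg = infinitesimal_lie_algebra smul \<Delta> \<epsilon> sB"
  unfolding TL.lie_alg_def infinitesimal_lie_algebra_def by (simp add: fun_add_def[abs_def] fun_rscale_def[abs_def] bracket_def[abs_def])

end

theorem theoremD:
  fixes scaleH :: "'k::real_or_complex \<Rightarrow> 'h::{ring,monoid_mult} \<Rightarrow> 'h"
    and \<Delta> :: "'h \<Rightarrow> ('h \<times> 'h \<Rightarrow>\<^sub>0 'k)"
    and \<epsilon> :: "'h \<Rightarrow> 'k"
    and S :: "'h \<Rightarrow> 'h"
    and scaleB :: "'k \<Rightarrow> 'b::{comm_ring,comm_monoid_mult,topological_space} \<Rightarrow> 'b"
    and I :: "'x set"
  assumes "hopf_algebra scaleH \<Delta> \<epsilon> S"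
    and "weakly_complete_algebra scaleB I"
  shows "\<exists>(L :: ('h set \<times> 'b set, nat \<Rightarrow> real) lie_system) p.
    is_pro_lie_limit L (character_group scaleH \<Delta> \<epsilon> scaleB) p \<and>
    (\<exists>\<Phi>. is_iso_onto_pro_lie_algebra (infinitesimal_lie_algebra scaleH \<Delta> \<epsilon> scaleB)
       L (character_group scaleH \<Delta> \<epsilon> scaleB) p \<Phi>)"
proof -
  interpret W: weakly_complete_algebra scaleB I by fact
  interpret H: hopf_algebra scaleH \<Delta> \<epsilon> S by fact
  interpret hopf_weakly_complete scaleH \<Delta> \<epsilon> S scaleB I ..
  show ?thesis
    using T.pro_lie_top_grp TL.iso_lie_alg unfolding top_grp_eq lie_alg_eq by blast
qed

end
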